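(* For a Lip-normed operator system $(X,L)$ the following are equivalent: (i) $X$ is $1$-exact; (ii) for every $\varepsilon>0$ there is a Lip-normed operator system $(Y,L')$ such that $Y$ is an operator subsystem of a matrix algebra and $\mathrm{dist}_{\mathrm{op}}(X,Y)\le\varepsilon$; (iii) for every $\varepsilon>0$ there is a Lip-normed matrix algebra $(M_n,L')$ such that $\mathrm{dist}_{\mathrm{op}}(X,M_n)\le\varepsilon$.
   Context: Operator systems are not assumed complete; $X_{\mathrm{sa}}$ denotes the self-adjoint part of an operator system $X$ and $S(X)$ its state space. A unital complete order embedding is a unital completely positive map that is isometric with completely positive inverse on its image (equivalently, a unital complete isometry). A Lip-norm on $X_{\mathrm{sa}}$ is a seminorm $L:X_{\mathrm{sa}}\to[0,+\infty]$ (value $+\infty$ allowed) with $L=0$ on $\mathbb R 1$ such that $\rho_L(\sigma,\omega)=\sup\{|\sigma(a)-\omega(a)|: a\in X_{\mathrm{sa}},\ L(a)\le 1\}$ is a metric on $S(X)$ inducing the weak$^*$ topology. A Lip-normed operator system is a pair $(X,L)$ with $X$ an operator system and $L$ a Lip-norm on $X_{\mathrm{sa}}$; it is a Lip-normed matrix algebra if $X=M_n$ is the algebra of complex $n\times n$ matrices for some $n$. Put $\mathcal E(X)=\{x\in X_{\mathrm{sa}}: L(x)\le 1\}$. Operator Gromov-Hausdorff distance is $\mathrm{dist}_{\mathrm{op}}(X,Y)=\inf\mathrm{dist}_{\mathrm H}(h_X(\mathcal E(X)),h_Y(\mathcal E(Y)))$, with $\mathrm{dist}_{\mathrm H}$ the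 norm Hausdorff distance and the infimum over all triples $(V,h_X,h_Y)$ with $V$ an operator system and $h_X:X\to V$, $h_Y:Y\to V$ unital complete order embeddings. An operator system (or operator space) $X$ is $1$-exact if for every finite-dimensional subspace $E\subseteq X$ and every $\lambda>1$ there is a linear isomorphism $\alpha$ from $E$ onto a subspace of a matrix algebra with $\|\alpha\|_{\mathrm{cb}}\|\alpha^{-1}\|_{\mathrm{cb}}\le\lambda$. *)

theory Defs
  imports "HOL-Analysis.Analysis" "HOL-Library.Function_Algebras"
begin

text \<open>
  Operator systems are treated abstractly (Choi--Effros): complex vector spaces with a conjugate
  linear involution, a proper cone of positive matrices at each level, compatible with compression
  by scalar matrices, and an Archimedean matrix order unit. No completeness is assumed.

  The vector space is a subspace of an ambient abelian group type. An \<open>n \<times> n\<close> matrix over a set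
  \<open>S\<close> is a function on pairs of indices that takes values in \<open>S\<close> for indices below \<open>n\<close> and is
  zero elsewhere, so that equality and addition of matrices are those of functions.
\<close>

record 'a opsys =
  carr :: "'a set"
  scl :: "complex \<Rightarrow> 'a \<Rightarrow> 'a"
  adj :: "'a \<Rightarrow> 'a"
  ounit :: 'a
  pos :: "nat \<Rightarrow> (nat \<Rightarrow> nat \<Rightarrow> 'a) set"

definition mats :: "nat \<Rightarrow> 'a::zero set \<Rightarrow> (nat \<Rightarrow> nat \<Rightarrow> 'a) set" where
  "mats n S = {x. \<forall>i j. if i < n \<and> j < n then x i j \<in> S else x i j = 0}"

definition mscl :: "'a opsys \<Rightarrow> complex \<Rightarrow> (nat \<Rightarrow> nat \<Rightarrow> 'a) \<Rightarrow> (nat \<Rightarrow> nat \<Rightarrow> 'a)" where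
  "mscl X c x = (\<lambda>i j. scl X c (x i j))"

definition madj :: "'a opsys \<Rightarrow> nat \<Rightarrow> (nat \<Rightarrow> nat \<Rightarrow> 'a::zero) \<Rightarrow> (nat \<Rightarrow> nat \<Rightarrow> 'a)" where
  "madj X n x = (\<lambda>i j. if i < n \<and> j < n then adj X (x j i) else 0)"

definition munit :: "'a opsys \<Rightarrow> nat \<Rightarrow> (nat \<Rightarrow> nat \<Rightarrow> 'a::zero)" where
  "munit X n = (\<lambda>i j. if i < n \<and> i = j then ounit X else 0)"

definition hmats :: "'a opsys \<Rightarrow> nat \<Rightarrow> (nat \<Rightarrow> nat \<Rightarrow> 'a::zero) set" where
  "hmats X n = {x \<in> mats n (carr X). madj X n x = x}"

text \<open>The \<open>m \<times> m\<close> matrix \<open>A\<^sup>* x A\<close>, for \<open>x\<close> an \<open>n \<times> n\<close> matrix over \<open>X\<close> and \<open>A\<close> a complex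
  \<open>n \<times> m\<close> matrix (only the entries of \<open>A\<close> in that range matter).\<close>

definition compress ::
    "'a opsys \<Rightarrow> nat \<Rightarrow> nat \<Rightarrow> (nat \<Rightarrow> nat \<Rightarrow> complex) \<Rightarrow> (nat \<Rightarrow> nat \<Rightarrow> 'a::comm_monoid_add) \<Rightarrow> (nat \<Rightarrow> nat \<Rightarrow> 'a)"
  where
  "compress X n m A x = (\<lambda>i j. if i < m \<and> j < m
     then \<Sum>k<n. \<Sum>l<n. scl X (cnj (A k i) * A l j) (x k l) else 0)"

locale operator_system = vector_space "scl X" for X :: "'a::ab_group_add opsys" +
  assumes subspace_carr: "subspace (carr X)"
    and adj_closed: "x \<in> carr X \<Longrightarrow> adj X x \<in> carr X"
    and adj_adj: "x \<in> carr X \<Longrightarrow> adj X (adj X x) = x"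
    and adj_add: "x \<in> carr X \<Longrightarrow> y \<in> carr X \<Longrightarrow> adj X (x + y) = adj X x + adj X y"
    and adj_scl: "x \<in> carr X \<Longrightarrow> adj X (scl X c x) = scl X (cnj c) (adj X x)"
    and ounit_closed: "ounit X \<in> carr X"
    and ounit_nonzero: "ounit X \<noteq> 0"
    and adj_ounit: "adj X (ounit X) = ounit X"
    and pos_hmats: "pos X n \<subseteq> hmats X n"
    and pos_add: "a \<in> pos X n \<Longrightarrow> b \<in> pos X n \<Longrightarrow> a + b \<in> pos X n"
    and pos_mscl: "a \<in> pos X n \<Longrightarrow> 0 \<le> r \<Longrightarrow> mscl X (complex_of_real r) a \<in> pos X n"
    and pos_proper: "a \<in> pos X n \<Longrightarrow> - a \<in> pos X n \<Longrightarrow> a = 0"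
    and pos_compress: "a \<in> pos X n \<Longrightarrow> compress X n m A a \<in> pos X m"
    and order_unit: "a \<in> hmats X n \<Longrightarrow> \<exists>r>0. mscl X (complex_of_real r) (munit X n) + a \<in> pos X n"
    and archimedean: "a \<in> hmats X n
      \<Longrightarrow> (\<And>r. r > 0 \<Longrightarrow> mscl X (complex_of_real r) (munit X n) + a \<in> pos X n) \<Longrightarrow> a \<in> pos X n"

text \<open>The block matrix with rows \<open>(r e, x)\<close> and \<open>(x\<^sup>*, r e)\<close>; its positivity means that the norm of
  \<open>x\<close> is at most \<open>r\<close>.\<close>

definition norm_block :: "'a opsys \<Rightarrow> nat \<Rightarrow> real \<Rightarrow> (nat \<Rightarrow> nat \<Rightarrow> 'a::zero) \<Rightarrow> (nat \<Rightarrow> nat \<Rightarrow> 'a)" where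
  "norm_block X n r x = (\<lambda>i j.
     if i < 2 * n \<and> i = j then scl X (complex_of_real r) (ounit X)
     else if i < n \<and> n \<le> j \<and> j < 2 * n then x i (j - n)
     else if n \<le> i \<and> i < 2 * n \<and> j < n then adj X (x j (i - n))
     else 0)"

definition mnorm :: "'a opsys \<Rightarrow> nat \<Rightarrow> (nat \<Rightarrow> nat \<Rightarrow> 'a::zero) \<Rightarrow> real" where
  "mnorm X n x = Inf {r. 0 \<le> r \<and> norm_block X n r x \<in> pos X (2 * n)}"

definition opsys_norm :: "'a opsys \<Rightarrow> 'a::zero \<Rightarrow> real" where
  "opsys_norm X x = mnorm X 1 (\<lambda>i j. if i = 0 \<and> j = 0 then x else 0)"

subsection \<open>Matrix algebras and subsystems\<close>

text \<open>A \<open>k \<times> k\<close> matrix \<open>x\<close> over the \<open>n \<times> n\<close> matrices is read as a \<open>kn \<times> kn\<close> complex matrix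
  acting on vectors \<open>\<xi>\<close> indexed by pairs \<open>(i, p)\<close>, \<open>i < k\<close>, \<open>p < n\<close>; it is positive if its quadratic
  form is nonnegative.\<close>

definition matalg :: "nat \<Rightarrow> (nat \<Rightarrow> nat \<Rightarrow> complex) opsys" where
  "matalg n = \<lparr>
     carr = mats n UNIV,
     scl = (\<lambda>c A i j. c * A i j),
     adj = (\<lambda>A i j. cnj (A j i)),
     ounit = (\<lambda>i j. if i < n \<and> i = j then 1 else 0),
     pos = (\<lambda>k. {x \<in> mats k (mats n UNIV). \<forall>\<xi> :: nat \<Rightarrow> nat \<Rightarrow> complex.
        (\<Sum>i<k. \<Sum>j<k. \<Sum>p<n. \<Sum>q<n. cnj (\<xi> i p) * x i j p q * \<xi> j q) \<in> \<real>\<^sub>\<ge>\<^sub>0}) \<rparr>"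

definition subsys :: "'a::zero opsys \<Rightarrow> 'a set \<Rightarrow> 'a opsys" where
  "subsys X S = X\<lparr>carr := S, pos := (\<lambda>n. pos X n \<inter> mats n S)\<rparr>"

definition operator_subsystem :: "'a::ab_group_add opsys \<Rightarrow> 'a opsys \<Rightarrow> bool" where
  "operator_subsystem Y X \<longleftrightarrow> (\<exists>S \<subseteq> carr X. module.subspace (scl X) S \<and> ounit X \<in> S \<and>
     (\<forall>x\<in>S. adj X x \<in> S) \<and> Y = subsys X S)"

subsection \<open>Maps\<close>

definition linear_into ::
    "(complex \<Rightarrow> 'a \<Rightarrow> 'a) \<Rightarrow> 'a set \<Rightarrow> (complex \<Rightarrow> 'b \<Rightarrow> 'b) \<Rightarrow> 'b set \<Rightarrow> ('a::plus \<Rightarrow> 'b::plus) \<Rightarrow> bool" where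
  "linear_into s E t F f \<longleftrightarrow> f ` E \<subseteq> F \<and> (\<forall>x\<in>E. \<forall>y\<in>E. f (x + y) = f x + f y) \<and>
     (\<forall>c. \<forall>x\<in>E. f (s c x) = t c (f x))"

definition amp :: "('a \<Rightarrow> 'b) \<Rightarrow> (nat \<Rightarrow> nat \<Rightarrow> 'a) \<Rightarrow> (nat \<Rightarrow> nat \<Rightarrow> 'b)" where
  "amp f x = (\<lambda>i j. f (x i j))"

definition cp_map :: "'a::ab_group_add opsys \<Rightarrow> 'b::ab_group_add opsys \<Rightarrow> ('a \<Rightarrow> 'b) \<Rightarrow> bool" where
  "cp_map X Y f \<longleftrightarrow> linear_into (scl X) (carr X) (scl Y) (carr Y) f \<and>
     (\<forall>n. \<forall>x\<in>pos X n. amp f x \<in> pos Y n)"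

definition unital_complete_order_embedding ::
    "'a::ab_group_add opsys \<Rightarrow> 'b::ab_group_add opsys \<Rightarrow> ('a \<Rightarrow> 'b) \<Rightarrow> bool" where
  "unital_complete_order_embedding X Y h \<longleftrightarrow>
     cp_map X Y h \<and> h (ounit X) = ounit Y \<and>
     inj_on h (carr X) \<and> (\<forall>x\<in>carr X. opsys_norm Y (h x) = opsys_norm X x) \<and>
     cp_map (subsys Y (h ` carr X)) X (inv_into (carr X) h)"

text \<open>The completely bounded norm of a map from a subspace \<open>E\<close> of \<open>X\<close> into \<open>Y\<close>.\<close>

definition cb_norm :: "'a::ab_group_add opsys \<Rightarrow> 'a set \<Rightarrow> 'b::ab_group_add opsys \<Rightarrow> ('a \<Rightarrow> 'b) \<Rightarrow> ennreal" where
  "cb_norm X E Y f =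
     (SUP n. SUP x \<in> {x \<in> mats n E. mnorm X n x \<le> 1}. ennreal (mnorm Y n (amp f x)))"

definition one_exact :: "'a::ab_group_add opsys \<Rightarrow> bool" where
  "one_exact X \<longleftrightarrow> (\<forall>E c. module.subspace (scl X) E \<and> E \<subseteq> carr X \<and>
       (\<exists>B. finite B \<and> module.span (scl X) B = E) \<and> (1::real) < c \<longrightarrow>
     (\<exists>n\<ge>1. \<exists>\<alpha>. linear_into (scl X) E (scl (matalg n)) (carr (matalg n)) \<alpha> \<and> inj_on \<alpha> E \<and>
        cb_norm X E (matalg n) \<alpha> * cb_norm (matalg n) (\<alpha> ` E) X (inv_into E \<alpha>) \<le> ennreal c))"

subsection \<open>States and Lip-norms\<close>

definition sa :: "'a opsys \<Rightarrow> 'a set" where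
  "sa X = {x \<in> carr X. adj X x = x}"

text \<open>Functionals are made extensional, so that they are determined by their values on \<open>X\<close>.\<close>

definition states :: "'a::ab_group_add opsys \<Rightarrow> ('a \<Rightarrow> complex) set" where
  "states X = {\<phi> \<in> extensional (carr X).
     linear_into (scl X) (carr X) (*) UNIV \<phi> \<and> \<phi> (ounit X) = 1 \<and>
     (\<forall>x\<in>pos X 1. \<phi> (x 0 0) \<in> \<real>\<^sub>\<ge>\<^sub>0)}"

definition weak_star :: "'a::ab_group_add opsys \<Rightarrow> ('a \<Rightarrow> complex) topology" where
  "weak_star X = subtopology (product_topology (\<lambda>_. euclidean) (carr X)) (states X)"

definition lip_ball :: "'a opsys \<Rightarrow> ('a \<Rightarrow> ennreal) \<Rightarrow> 'a set" where
  "lip_ball X L = {x \<in> sa X. L x \<le> 1}"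

definition lip_rho :: "'a opsys \<Rightarrow> ('a \<Rightarrow> ennreal) \<Rightarrow> ('a \<Rightarrow> complex) \<Rightarrow> ('a \<Rightarrow> complex) \<Rightarrow> ennreal" where
  "lip_rho X L \<sigma> \<omega> = (SUP a \<in> lip_ball X L. ennreal (cmod (\<sigma> a - \<omega> a)))"

definition lip_norm :: "'a::ab_group_add opsys \<Rightarrow> ('a \<Rightarrow> ennreal) \<Rightarrow> bool" where
  "lip_norm X L \<longleftrightarrow>
     (\<forall>a\<in>sa X. \<forall>b\<in>sa X. L (a + b) \<le> L a + L b) \<and>
     (\<forall>a\<in>sa X. \<forall>r::real. L (scl X (complex_of_real r) a) = ennreal \<bar>r\<bar> * L a) \<and>
     (\<forall>r::real. L (scl X (complex_of_real r) (ounit X)) = 0) \<and>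
     (\<forall>\<sigma>\<in>states X. \<forall>\<omega>\<in>states X. lip_rho X L \<sigma> \<omega> < \<infinity>) \<and>
     Metric_space (states X) (\<lambda>\<sigma> \<omega>. enn2real (lip_rho X L \<sigma> \<omega>)) \<and>
     Metric_space.mtopology (states X) (\<lambda>\<sigma> \<omega>. enn2real (lip_rho X L \<sigma> \<omega>)) = weak_star X"

definition lip_normed :: "'a::ab_group_add opsys \<Rightarrow> ('a \<Rightarrow> ennreal) \<Rightarrow> bool" where
  "lip_normed X L \<longleftrightarrow> operator_system X \<and> lip_norm X L"

subsection \<open>Operator Gromov--Hausdorff distance\<close>

definition hausdorff :: "'a::ab_group_add opsys \<Rightarrow> 'a set \<Rightarrow> 'a set \<Rightarrow> ennreal" where
  "hausdorff V A B = max
     (SUP a\<in>A. INF b\<in>B. ennreal (opsys_norm V (a - b)))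
     (SUP b\<in>B. INF a\<in>A. ennreal (opsys_norm V (a - b)))"

text \<open>HOL cannot quantify over types inside a formula, so \<open>V\<close> is taken with underlying vector
  space in the product of the ambient types of \<open>X\<close> and \<open>Y\<close>. All operator systems \<open>V\<close> over
  all types give the same infimum, see \<open>dist_op_le\<close> below.\<close>

definition dist_op ::
    "'a::ab_group_add opsys \<Rightarrow> ('a \<Rightarrow> ennreal) \<Rightarrow> 'b::ab_group_add opsys \<Rightarrow> ('b \<Rightarrow> ennreal) \<Rightarrow> ennreal" where
  "dist_op X L Y M = Inf {hausdorff V (h ` lip_ball X L) (k ` lip_ball Y M) |
     (V :: ('a \<times> 'b) opsys) h k. operator_system V \<and>
       unital_complete_order_embedding X V h \<and> unital_complete_order_embedding Y V k}"

subsection \<open>Matrix algebras and their subsystems are operator systems\<close>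

lemma sum_fun_apply2: "(\<Sum>a\<in>A. f a) p q = (\<Sum>a\<in>A. f a p q)"
  by (induction A rule: infinite_finite_induct) auto

lemma mats_mats_iff:
  "x \<in> mats k (mats n (UNIV :: 'a::zero set)) \<longleftrightarrow>
     (\<forall>i j p q. \<not> (i < k \<and> j < k \<and> p < n \<and> q < n) \<longrightarrow> x i j p q = 0)"
  by (auto simp: mats_def fun_eq_iff split: if_splits)

context
  fixes k n :: nat
begin

definition sesq :: "(nat \<Rightarrow> nat \<Rightarrow> nat \<Rightarrow> nat \<Rightarrow> complex) \<Rightarrow> (nat \<Rightarrow> nat \<Rightarrow> complex) \<Rightarrow> (nat \<Rightarrow> nat \<Rightarrow> complex) \<Rightarrow> complex" where
  "sesq x \<xi> \<eta> = (\<Sum>i<k. \<Sum>j<k. \<Sum>p<n. \<Sum>q<n. cnj (\<xi> i p) * x i j p q * \<eta> j q)"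

lemma sesq_add_mat: "sesq (x + y) \<xi> \<eta> = sesq x \<xi> \<eta> + sesq y \<xi> \<eta>"
  by (simp add: sesq_def algebra_simps sum.distrib)

lemma sesq_minus_mat: "sesq (- x) \<xi> \<eta> = - sesq x \<xi> \<eta>"
  by (simp add: sesq_def sum_negf fun_Compl_def)

lemma sesq_left: "sesq x (\<lambda>i p. a i p + c * b i p) \<eta> = sesq x a \<eta> + cnj c * sesq x b \<eta>"
  by (simp add: sesq_def algebra_simps sum.distrib sum_distrib_left)

lemma sesq_right: "sesq x \<xi> (\<lambda>i p. a i p + c * b i p) = sesq x \<xi> a + c * sesq x \<xi> b"
  by (simp add: sesq_def algebra_simps sum.distrib sum_distrib_left)

lemma sesq_scl: "sesq (\<lambda>i j p q. c * x i j p q) \<xi> \<eta> = c * sesq x \<xi> \<eta>"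
  by (simp add: sesq_def algebra_simps sum_distrib_left)

lemma sesq_adj: "sesq (\<lambda>i j p q. cnj (x j i q p)) \<xi> \<eta> = cnj (sesq x \<eta> \<xi>)"
proof -
  have "cnj (sesq x \<eta> \<xi>) = (\<Sum>i<k. \<Sum>j<k. \<Sum>p<n. \<Sum>q<n. cnj (\<xi> j q) * cnj (x i j p q) * \<eta> i p)"
    unfolding sesq_def cnj_sum complex_cnj_mult complex_cnj_cnj
    by (intro sum.cong refl) (simp add: mult_ac)
  also have "\<dots> = (\<Sum>j<k. \<Sum>i<k. \<Sum>p<n. \<Sum>q<n. cnj (\<xi> j q) * cnj (x i j p q) * \<eta> i p)"
    by (rule sum.swap)
  also have "\<dots> = (\<Sum>j<k. \<Sum>i<k. \<Sum>q<n. \<Sum>p<n. cnj (\<xi> j q) * cnj (x i j p q) * \<eta> i p)"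
    by (rule sum.cong[OF refl], rule sum.cong[OF refl], rule sum.swap)
  finally show ?thesis by (simp add: sesq_def)
qed

lemma sesq_delta:
  assumes "i0 < k" "j0 < k" "p0 < n" "q0 < n"
  shows "sesq x (\<lambda>i p. if i = i0 then if p = p0 then 1 else 0 else 0)
               (\<lambda>j q. if j = j0 then if q = q0 then 1 else 0 else 0) = x i0 j0 p0 q0"
proof -
  have "sesq x (\<lambda>i p. if i = i0 then if p = p0 then 1 else 0 else 0)
               (\<lambda>j q. if j = j0 then if q = q0 then 1 else 0 else 0)
     = (\<Sum>i<k. \<Sum>j<k. \<Sum>p<n. \<Sum>q<n. if q = q0 then (if p = p0 then if j = j0 then if i = i0 then x i j p q else 0 else 0 else 0) else 0)"
    unfolding sesq_def by (intro sum.cong refl) auto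
  also have "\<dots> = (\<Sum>i<k. \<Sum>j<k. \<Sum>p<n. if p = p0 then if j = j0 then if i = i0 then x i j p q0 else 0 else 0 else 0)"
    using assms by simp
  also have "\<dots> = (\<Sum>i<k. \<Sum>j<k. if j = j0 then if i = i0 then x i j p0 q0 else 0 else 0)"
    using assms by simp
  also have "\<dots> = (\<Sum>i<k. if i = i0 then x i j0 p0 q0 else 0)"
    using assms by simp
  finally show ?thesis using assms by simp
qed

lemma sesq_polar:
  assumes "\<And>\<xi>. sesq x \<xi> \<xi> = 0"
  shows "sesq x a b = 0"
proof -
  have *: "cnj c * sesq x b a + c * sesq x a b = 0" for c
    using assms[of "\<lambda>i p. a i p + c * b i p"] assms[of a] assms[of b]
    by (simp add: sesq_left sesq_right algebra_simps)
  show ?thesis using *[of 1] *[of \<i>] by (simp add: complex_eq_iff)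
qed

lemma sesq_zero:
  assumes "x \<in> mats k (mats n UNIV)" "\<And>\<xi>. sesq x \<xi> \<xi> = 0"
  shows "x = 0"
proof (intro ext)
  fix i j p q
  show "x i j p q = 0 i j p q"
  proof (cases "i < k \<and> j < k \<and> p < n \<and> q < n")
    case True
    then show ?thesis using sesq_delta[of i j p q x] sesq_polar[OF assms(2)] by simp
  next
    case False
    then show ?thesis using assms(1) by (simp add: mats_mats_iff)
  qed
qed

definition sqn :: "(nat \<Rightarrow> nat \<Rightarrow> complex) \<Rightarrow> real" where
  "sqn \<xi> = (\<Sum>i<k. \<Sum>p<n. (cmod (\<xi> i p))\<^sup>2)"

lemma sqn_nonneg: "0 \<le> sqn \<xi>" by (simp add: sqn_def sum_nonneg)

lemma sqn_ge: assumes "i < k" "p < n" shows "(cmod (\<xi> i p))\<^sup>2 \<le> sqn \<xi>"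
proof -
  have "(cmod (\<xi> i p))\<^sup>2 \<le> (\<Sum>p<n. (cmod (\<xi> i p))\<^sup>2)"
    using assms by (intro member_le_sum) auto
  also have "\<dots> \<le> sqn \<xi>" unfolding sqn_def
    using assms by (intro member_le_sum[of i "{..<k}" "\<lambda>i. \<Sum>p<n. (cmod (\<xi> i p))\<^sup>2"]) (auto intro: sum_nonneg)
  finally show ?thesis .
qed

lemma sesq_bound:
  "cmod (sesq x \<xi> \<xi>) \<le> (\<Sum>i<k. \<Sum>j<k. \<Sum>p<n. \<Sum>q<n. cmod (x i j p q)) * sqn \<xi>"
proof -
  have "cmod (cnj (\<xi> i p) * x i j p q * \<xi> j q) \<le> cmod (x i j p q) * sqn \<xi>"
    if "i < k" "j < k" "p < n" "q < n" for i j p q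
  proof -
    have "cmod (\<xi> i p) \<le> sqrt (sqn \<xi>)" "cmod (\<xi> j q) \<le> sqrt (sqn \<xi>)"
      using sqn_ge that by (auto intro: real_le_rsqrt)
    then have "cmod (\<xi> i p) * cmod (\<xi> j q) \<le> sqrt (sqn \<xi>) * sqrt (sqn \<xi>)"
      by (intro mult_mono) (auto simp: sqn_nonneg)
    then have "cmod (\<xi> i p) * cmod (\<xi> j q) \<le> sqn \<xi>" by (simp add: sqn_nonneg)
    then have "cmod (x i j p q) * (cmod (\<xi> i p) * cmod (\<xi> j q)) \<le> cmod (x i j p q) * sqn \<xi>"
      by (rule mult_left_mono) simp
    then show ?thesis by (simp add: norm_mult mult_ac)
  qed
  then have "cmod (sesq x \<xi> \<xi>) \<le> (\<Sum>i<k. \<Sum>j<k. \<Sum>p<n. \<Sum>q<n. cmod (x i j p q) * sqn \<xi>)"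
    unfolding sesq_def by (intro sum_norm_le) auto
  then show ?thesis by (simp add: sum_distrib_right)
qed

end

lemma matalg_pos: "pos (matalg n) k = {x \<in> mats k (mats n UNIV). \<forall>\<xi>. sesq k n x \<xi> \<xi> \<in> \<real>\<^sub>\<ge>\<^sub>0}"
  by (simp add: matalg_def sesq_def)

lemma sesq_unit: "sesq k n (munit (matalg n) k) \<xi> \<xi> = complex_of_real (sqn k n \<xi>)"
proof -
  have "sesq k n (munit (matalg n) k) \<xi> \<xi> =
     (\<Sum>i<k. \<Sum>j<k. if j = i then (\<Sum>p<n. \<Sum>q<n. if q = p then cnj (\<xi> i p) * \<xi> j q else 0) else 0)"
    unfolding sesq_def
  proof (intro sum.cong refl)
    fix i j assume "i \<in> {..<k}" "j \<in> {..<k}"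
    then have "(\<Sum>p<n. \<Sum>q<n. cnj (\<xi> i p) * munit (matalg n) k i j p q * \<xi> j q) =
      (\<Sum>p<n. \<Sum>q<n. if j = i then if q = p then cnj (\<xi> i p) * \<xi> j q else 0 else 0)"
      by (intro sum.cong refl) (auto simp: munit_def matalg_def)
    then show "(\<Sum>p<n. \<Sum>q<n. cnj (\<xi> i p) * munit (matalg n) k i j p q * \<xi> j q) =
      (if j = i then (\<Sum>p<n. \<Sum>q<n. if q = p then cnj (\<xi> i p) * \<xi> j q else 0) else 0)"
      by simp
  qed
  also have "\<dots> = (\<Sum>i<k. \<Sum>p<n. cnj (\<xi> i p) * \<xi> i p)"
    by simp
  also have "\<dots> = complex_of_real (sqn k n \<xi>)"
    unfolding sqn_def of_real_sum
    by (intro sum.cong refl) (simp only: complex_norm_square mult.commute)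
  finally show ?thesis .
qed

lemma sesq_compress:
  "sesq m n (compress (matalg n) k m A x) \<xi> \<xi> =
   sesq k n x (\<lambda>a p. \<Sum>i<m. A a i * \<xi> i p) (\<lambda>a p. \<Sum>i<m. A a i * \<xi> i p)"
proof -
  have "sesq m n (compress (matalg n) k m A x) \<xi> \<xi> =
    (\<Sum>i<m. \<Sum>j<m. \<Sum>p<n. \<Sum>q<n. \<Sum>a<k. \<Sum>b<k.
       cnj (\<xi> i p) * (cnj (A a i) * A b j * x a b p q) * \<xi> j q)"
    unfolding sesq_def
    by (intro sum.cong refl)
      (simp add: compress_def sum_fun_apply2 matalg_def sum_distrib_left sum_distrib_right)
  also have "\<dots> = (\<Sum>(i,j,p,q,a,b)\<in>{..<m}\<times>{..<m}\<times>{..<n}\<times>{..<n}\<times>{..<k}\<times>{..<k}.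
       cnj (\<xi> i p) * (cnj (A a i) * A b j * x a b p q) * \<xi> j q)"
    by (simp add: sum.cartesian_product)
  also have "\<dots> = (\<Sum>(a,b,p,q,i,j)\<in>{..<k}\<times>{..<k}\<times>{..<n}\<times>{..<n}\<times>{..<m}\<times>{..<m}.
       cnj (\<xi> i p) * (cnj (A a i) * A b j * x a b p q) * \<xi> j q)"
    by (rule sum.reindex_bij_witness[of _ "\<lambda>(a,b,p,q,i,j). (i,j,p,q,a,b)" "\<lambda>(i,j,p,q,a,b). (a,b,p,q,i,j)"]) auto
  also have "\<dots> = (\<Sum>a<k. \<Sum>b<k. \<Sum>p<n. \<Sum>q<n. \<Sum>i<m. \<Sum>j<m.
       cnj (\<xi> i p) * (cnj (A a i) * A b j * x a b p q) * \<xi> j q)"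
    by (simp add: sum.cartesian_product)
  also have "\<dots> = sesq k n x (\<lambda>a p. \<Sum>i<m. A a i * \<xi> i p) (\<lambda>a p. \<Sum>i<m. A a i * \<xi> i p)"
    unfolding sesq_def
    by (intro sum.cong refl) (simp add: sum_distrib_left sum_distrib_right mult_ac)
  finally show ?thesis .
qed

lemma operator_system_matalg:
  assumes "1 \<le> n"
  shows "operator_system (matalg n)"
proof -
  interpret vector_space "scl (matalg n)"
    by unfold_locales (auto simp: matalg_def fun_eq_iff algebra_simps)
  have hm: "hmats (matalg n) k = {x \<in> mats k (mats n UNIV). (\<lambda>i j p q. cnj (x j i q p)) = x}" for k
  proof -
    have "madj (matalg n) k x = (\<lambda>i j p q. cnj (x j i q p))" if "x \<in> mats k (mats n UNIV)" for x
      using that by (auto simp: madj_def matalg_def mats_mats_iff fun_eq_iff)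
    then show ?thesis by (auto simp: hmats_def matalg_def)
  qed
  have real_form: "sesq k n x \<xi> \<xi> \<in> \<real>" if "x \<in> hmats (matalg n) k" for k x \<xi>
    using that sesq_adj[of k n x \<xi> \<xi>] by (simp add: hm Reals_cnj_iff)
  have mscl: "mscl (matalg n) c x = (\<lambda>i j p q. c * x i j p q)" for c x
    by (simp add: mscl_def matalg_def)
  have mscl_closed: "mscl (matalg n) c x \<in> mats k (mats n UNIV)" if "x \<in> mats k (mats n UNIV)" for c x k
    using that by (simp add: mscl mats_mats_iff)
  have add_closed: "x + y \<in> mats k (mats n UNIV)"
    if "x \<in> mats k (mats n UNIV)" "y \<in> mats k (mats n UNIV)" for x y :: "nat \<Rightarrow> nat \<Rightarrow> nat \<Rightarrow> nat \<Rightarrow> complex" and k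
    using that by (simp add: mats_mats_iff)
  have unit_closed: "munit (matalg n) k \<in> mats k (mats n UNIV)" for k
    by (auto simp: munit_def matalg_def mats_mats_iff)
  have form: "sesq k n (mscl (matalg n) (complex_of_real r) (munit (matalg n) k) + x) \<xi> \<xi>
      = complex_of_real (r * sqn k n \<xi>) + sesq k n x \<xi> \<xi>" for k r x \<xi>
    by (simp add: sesq_add_mat mscl sesq_scl sesq_unit)
  show ?thesis
  proof
    show "subspace (carr (matalg n))"
      by (rule subspaceI) (auto simp: matalg_def mats_def)
    show "ounit (matalg n) \<noteq> 0"
      using assms by (auto simp: matalg_def fun_eq_iff intro!: exI[of _ 0])
    show "pos (matalg n) k \<subseteq> hmats (matalg n) k" for k
    proof
      fix x assume x: "x \<in> pos (matalg n) k"
      let ?y = "\<lambda>i j p q. cnj (x j i q p)"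
      have "sesq k n (?y + - x) \<xi> \<xi> = 0" for \<xi>
        using x unfolding sesq_add_mat sesq_minus_mat sesq_adj
        by (auto simp: matalg_pos complex_nonneg_Reals_iff complex_eq_iff)
      moreover have "?y + - x \<in> mats k (mats n UNIV)"
        using x by (auto simp: matalg_pos mats_mats_iff fun_Compl_def)
      ultimately have "?y + - x = 0" by (rule sesq_zero[rotated])
      then show "x \<in> hmats (matalg n) k" using x by (simp add: hm matalg_pos)
    qed
    show "a + b \<in> pos (matalg n) k" if "a \<in> pos (matalg n) k" "b \<in> pos (matalg n) k" for a b k
      using that by (auto simp: matalg_pos add_closed sesq_add_mat)
    show "mscl (matalg n) (complex_of_real r) a \<in> pos (matalg n) k"
      if "a \<in> pos (matalg n) k" "0 \<le> r" for a k r
      using that mscl_closed by (auto simp: matalg_pos mscl sesq_scl complex_nonneg_Reals_iff)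
    show "a = 0" if "a \<in> pos (matalg n) k" "- a \<in> pos (matalg n) k" for a k
      using that by (intro sesq_zero[of a k n])
        (auto simp: matalg_pos sesq_minus_mat complex_nonneg_Reals_iff complex_eq_iff intro: antisym)
    show "compress (matalg n) k m A a \<in> pos (matalg n) m" if "a \<in> pos (matalg n) k" for a k m A
    proof -
      have "compress (matalg n) k m A a \<in> mats m (mats n UNIV)"
        using that by (auto simp: matalg_pos compress_def mats_mats_iff sum_fun_apply2)
          (auto simp: matalg_def intro!: sum.neutral)
      then show ?thesis using that by (auto simp: matalg_pos sesq_compress)
    qed
    show "\<exists>r>0. mscl (matalg n) (complex_of_real r) (munit (matalg n) k) + a \<in> pos (matalg n) k"
      if a: "a \<in> hmats (matalg n) k" for a k
    proof -
      define C where "C = (\<Sum>i<k. \<Sum>j<k. \<Sum>p<n. \<Sum>q<n. cmod (a i j p q))"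
      have C: "0 \<le> C" unfolding C_def by (intro sum_nonneg) auto
      have "complex_of_real ((C + 1) * sqn k n \<xi>) + sesq k n a \<xi> \<xi> \<in> \<real>\<^sub>\<ge>\<^sub>0" for \<xi>
      proof -
        have "cmod (sesq k n a \<xi> \<xi>) \<le> C * sqn k n \<xi>" unfolding C_def by (rule sesq_bound)
        then have "- Re (sesq k n a \<xi> \<xi>) \<le> C * sqn k n \<xi>"
          using abs_Re_le_cmod[of "sesq k n a \<xi> \<xi>"] by linarith
        then show ?thesis using real_form[OF a, of \<xi>] sqn_nonneg[of k n \<xi>]
          by (auto simp: complex_nonneg_Reals_iff complex_is_Real_iff algebra_simps)
      qed
      then have "mscl (matalg n) (complex_of_real (C + 1)) (munit (matalg n) k) + a \<in> pos (matalg n) k"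
        unfolding matalg_pos mem_Collect_eq form
        using a by (intro conjI allI add_closed mscl_closed unit_closed) (simp_all add: hm)
      then show ?thesis using C by (intro exI[of _ "C + 1"]) auto
    qed
    show "a \<in> pos (matalg n) k" if a: "a \<in> hmats (matalg n) k"
      and *: "\<And>r. r > 0 \<Longrightarrow> mscl (matalg n) (complex_of_real r) (munit (matalg n) k) + a \<in> pos (matalg n) k" for a k
    proof -
      have "sesq k n a \<xi> \<xi> \<in> \<real>\<^sub>\<ge>\<^sub>0" for \<xi>
      proof -
        have "0 \<le> Re (sesq k n a \<xi> \<xi>) + r * sqn k n \<xi>" if "r > 0" for r
          using *[OF that] by (simp add: matalg_pos form complex_nonneg_Reals_iff) (simp add: add.commute)
        moreover have "((\<lambda>r. Re (sesq k n a \<xi> \<xi>) + r * sqn k n \<xi>) \<longlongrightarrow> Re (sesq k n a \<xi> \<xi>) + 0 * sqn k n \<xi>) (at_right 0)"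
          by (intro tendsto_intros)
        ultimately have "0 \<le> Re (sesq k n a \<xi> \<xi>)"
          using tendsto_lowerbound[of "\<lambda>r. Re (sesq k n a \<xi> \<xi>) + r * sqn k n \<xi>" _ "at_right 0" 0]
          by (auto simp: eventually_at_right_less eventually_at_filter)
        then show ?thesis using real_form[OF a, of \<xi>]
          by (auto simp: complex_nonneg_Reals_iff complex_is_Real_iff)
      qed
      then show ?thesis using a by (simp add: matalg_pos hm)
    qed
  qed (auto simp: matalg_def mats_def fun_eq_iff algebra_simps)
qed

lemma (in operator_system) pos_mats: "x \<in> pos X n \<Longrightarrow> x \<in> mats n (carr X)"
  using pos_hmats by (auto simp: hmats_def)

lemma operator_system_subsystem:
  assumes "operator_system X" "operator_subsystem Y X"
  shows "operator_system Y"
proof -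
  interpret operator_system X by fact
  obtain S where S: "S \<subseteq> carr X" "subspace S" "ounit X \<in> S" "\<And>x. x \<in> S \<Longrightarrow> adj X x \<in> S"
    and Y: "Y = subsys X S"
    using assms(2) by (auto simp: operator_subsystem_def)
  have [simp]: "scl Y = scl X" "adj Y = adj X" "ounit Y = ounit X" "carr Y = S"
    "\<And>n. pos Y n = pos X n \<inter> mats n S" by (simp_all add: Y subsys_def)
  have [simp]: "mscl Y = mscl X" "madj Y = madj X" "munit Y = munit X" "compress Y = compress X"
    by (simp_all add: fun_eq_iff mscl_def madj_def munit_def compress_def)
  have hm: "hmats Y n = hmats X n \<inter> mats n S" for n
    using S(1) by (auto simp: hmats_def mats_def subset_eq)
  have 0: "0 \<in> S" by (rule subspace_0[OF S(2)])
  have ms: "mscl X c x \<in> mats n S" if "x \<in> mats n S" for c x n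
    using that by (auto simp: mscl_def mats_def intro: subspace_scale[OF S(2)])
  have ma: "x + y \<in> mats n S" if "x \<in> mats n S" "y \<in> mats n S" for x y n
    using that by (auto simp: mats_def intro: subspace_add[OF S(2)])
  have mu: "munit X n \<in> mats n S" for n
    using S 0 by (auto simp: mats_def munit_def)
  show ?thesis
  proof (intro operator_system.intro operator_system_axioms.intro, goal_cases)
    case 1 then show ?case by (simp add: vector_space_axioms)
  next
    case (14 a n m A)
    then have "compress X n m A a \<in> mats m S"
      by (auto simp: mats_def compress_def intro!: subspace_sum[OF S(2)] subspace_scale[OF S(2)])
    then show ?case using 14 pos_compress by auto
  next
    case (15 a n)
    then obtain r where "r > 0" "mscl X (complex_of_real r) (munit X n) + a \<in> pos X n"
      using order_unit[of a n] by (auto simp: hm)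
    moreover have "mscl X (complex_of_real r) (munit X n) + a \<in> mats n S"
      using 15 by (intro ma ms mu) (simp add: hm)
    ultimately show ?case by auto
  next
    case (16 a n)
    then show ?case using archimedean[of a n] by (auto simp: hm)
  qed (use S pos_hmats ounit_closed ounit_nonzero adj_ounit pos_proper in
      \<open>auto simp: hm adj_adj adj_add adj_scl subset_eq intro!: pos_add ma pos_mscl ms\<close>)
qed

subsection \<open>Independence of the ambient type in the distance\<close>

lemma linear_into_0:
  assumes "linear_into s E t F f" "0 \<in> E"
  shows "f (0::'a::ab_group_add) = (0::'b::ab_group_add)"
proof -
  have "f (0 + 0) = f 0 + f 0" using assms unfolding linear_into_def by blast
  then show ?thesis by simp
qed

lemma amp_mats:
  assumes "x \<in> mats n E" "f ` E \<subseteq> F" "f 0 = 0"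
  shows "amp f x \<in> mats n F"
  using assms by (auto simp: amp_def mats_def)

lemma amp_cancel:
  assumes "x \<in> mats n E" "\<And>v. v \<in> E \<Longrightarrow> U (T v) = v" "0 \<in> E"
  shows "amp U (amp T x) = x"
proof (intro ext)
  fix i j
  have "x i j \<in> E" using assms by (cases "i < n \<and> j < n") (auto simp: mats_def)
  then show "amp U (amp T x) i j = x i j" using assms by (simp add: amp_def)
qed

text \<open>Transport of the structure of \<open>V\<close> along a linear injection \<open>T\<close> with left inverse \<open>U\<close>.\<close>

locale transport = operator_system V + W: vector_space t
  for V :: "'v::ab_group_add opsys" and t :: "complex \<Rightarrow> 'w::ab_group_add \<Rightarrow> 'w" +
  fixes T :: "'v \<Rightarrow> 'w" and U :: "'w \<Rightarrow> 'v"
  assumes lin: "linear_into (scl V) (carr V) t UNIV T"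
    and UT: "\<And>v. v \<in> carr V \<Longrightarrow> U (T v) = v"
begin

definition "V' = \<lparr>carr = T ` carr V, scl = t, adj = (\<lambda>w. T (adj V (U w))),
  ounit = T (ounit V), pos = (\<lambda>n. amp T ` pos V n)\<rparr>"

lemma sel [simp]: "carr V' = T ` carr V" "scl V' = t" "adj V' w = T (adj V (U w))"
  "ounit V' = T (ounit V)" "pos V' n = amp T ` pos V n"
  by (simp_all add: V'_def)

lemma zero_in: "0 \<in> carr V" by (rule subspace_0[OF subspace_carr])
lemma T0: "T 0 = 0" by (rule linear_into_0[OF lin zero_in])
lemma Tadd: "v \<in> carr V \<Longrightarrow> w \<in> carr V \<Longrightarrow> T (v + w) = T v + T w"
  using lin by (simp add: linear_into_def)
lemma Tscl: "v \<in> carr V \<Longrightarrow> T (scl V c v) = t c (T v)"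
  using lin by (simp add: linear_into_def)
lemma U0: "U 0 = 0" using UT[OF zero_in] T0 by simp
lemma Tminus: "v \<in> carr V \<Longrightarrow> T (- v) = - T v"
  using Tscl[of v "- 1"] by simp
lemma Tsum: "(\<And>a. a \<in> A \<Longrightarrow> f a \<in> carr V) \<Longrightarrow> T (sum f A) = (\<Sum>a\<in>A. T (f a))"
proof (induction A rule: infinite_finite_induct)
  case (insert a A)
  then show ?case using Tadd[of "f a" "sum f A"] subspace_sum[OF subspace_carr, of A f] by simp
qed (auto simp: T0)

lemma entry: "x \<in> mats n (carr V) \<Longrightarrow> x i j \<in> carr V"
  using zero_in by (cases "i < n \<and> j < n") (auto simp: mats_def)

lemma mats_T: "y \<in> mats n (T ` carr V) \<Longrightarrow> \<exists>x \<in> mats n (carr V). y = amp T x"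
proof (intro bexI[of _ "amp U y"])
  assume y: "y \<in> mats n (T ` carr V)"
  show "y = amp T (amp U y)"
    by (rule amp_cancel[OF y, symmetric]) (use UT zero_in T0 in \<open>auto intro: image_eqI[of _ T 0]\<close>)
  show "amp U y \<in> mats n (carr V)"
    by (rule amp_mats[OF y]) (use UT U0 in auto)
qed

lemma amp_T_inj: "x \<in> mats n (carr V) \<Longrightarrow> y \<in> mats n (carr V) \<Longrightarrow> amp T x = amp T y \<Longrightarrow> x = y"
  using amp_cancel[of x n "carr V" U T] amp_cancel[of y n "carr V" U T] UT zero_in by metis

lemma amp_mscl: "x \<in> mats n (carr V) \<Longrightarrow> amp T (mscl V c x) = mscl V' c (amp T x)"
  by (simp add: amp_def mscl_def fun_eq_iff Tscl entry)

lemma amp_add: "x \<in> mats n (carr V) \<Longrightarrow> y \<in> mats n (carr V) \<Longrightarrow> amp T (x + y) = amp T x + amp T y"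
  by (simp add: amp_def fun_eq_iff Tadd entry)

lemma amp_madj: "x \<in> mats n (carr V) \<Longrightarrow> amp T (madj V n x) = madj V' n (amp T x)"
  by (simp add: amp_def fun_eq_iff madj_def entry T0 UT)

lemma amp_munit: "amp T (munit V n) = munit V' n"
  by (simp add: amp_def fun_eq_iff munit_def T0)

lemma amp_compress: "x \<in> mats n (carr V) \<Longrightarrow> amp T (compress V n m A x) = compress V' n m A (amp T x)"
  by (auto simp: amp_def fun_eq_iff compress_def T0 Tsum Tscl entry
      subspace_sum[OF subspace_carr] subspace_scale[OF subspace_carr])

lemma mscl_mats: "x \<in> mats n (carr V) \<Longrightarrow> mscl V c x \<in> mats n (carr V)"
  by (auto simp: mscl_def mats_def intro: subspace_scale[OF subspace_carr])
lemma madj_mats: "x \<in> mats n (carr V) \<Longrightarrow> madj V n x \<in> mats n (carr V)"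
  by (auto simp: madj_def mats_def intro: adj_closed)
lemma add_mats: "x \<in> mats n (carr V) \<Longrightarrow> y \<in> mats n (carr V) \<Longrightarrow> x + y \<in> mats n (carr V)"
  by (auto simp: mats_def intro: subspace_add[OF subspace_carr])
lemma minus_mats: "x \<in> mats n (carr V) \<Longrightarrow> - x \<in> mats n (carr V)"
  by (auto simp: mats_def intro: subspace_neg[OF subspace_carr])
lemma munit_mats: "munit V n \<in> mats n (carr V)"
  by (auto simp: munit_def mats_def intro: ounit_closed zero_in)

lemma hmats_V': "hmats V' n = amp T ` hmats V n"
proof
  show "hmats V' n \<subseteq> amp T ` hmats V n"
  proof
    fix y assume y: "y \<in> hmats V' n"
    then obtain x where x: "x \<in> mats n (carr V)" "y = amp T x"
      using mats_T by (auto simp: hmats_def)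
    then have "amp T (madj V n x) = amp T x" using y by (simp add: hmats_def amp_madj)
    then have "madj V n x = x" using amp_T_inj madj_mats x by blast
    then show "y \<in> amp T ` hmats V n" using x by (auto simp: hmats_def)
  qed
  show "amp T ` hmats V n \<subseteq> hmats V' n"
    by (auto simp: hmats_def amp_madj[symmetric] T0 intro!: amp_mats)
qed

lemma operator_system_V': "operator_system V'"
proof (intro operator_system.intro operator_system_axioms.intro, goal_cases)
  case 1 then show ?case using W.vector_space_axioms by simp
next
  case 2
  show ?case
  unfolding sel
  proof (rule W.subspaceI, goal_cases)
    case 1 then show ?case using T0 zero_in by force
  next
    case (2 x y) then show ?case
      by (auto simp: Tadd[symmetric] intro!: imageI subspace_add[OF subspace_carr])
  next
    case (3 c x) then show ?case
      by (auto simp: Tscl[symmetric] intro!: imageI subspace_scale[OF subspace_carr])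
  qed
next
  case (3 x) then show ?case by (auto simp: UT adj_closed)
next
  case (4 x) then show ?case by (auto simp: UT adj_closed adj_adj)
next
  case (5 x y)
  then obtain v w where vw: "v \<in> carr V" "w \<in> carr V" "x = T v" "y = T w" by auto
  have "adj V' (T (v + w)) = adj V' (T v) + adj V' (T w)"
    using vw by (simp add: UT adj_closed adj_add Tadd[of "adj V v"] subspace_add[OF subspace_carr] del: sel(2))
  then show ?case using vw by (simp only: Tadd)
next
  case (6 x c)
  then obtain v where v: "v \<in> carr V" "x = T v" by auto
  have "adj V' (T (scl V c v)) = t (cnj c) (adj V' (T v))"
    using v by (simp add: UT adj_closed adj_scl Tscl[of "adj V v"] subspace_scale[OF subspace_carr])
  then show ?case using v by (simp only: Tscl sel)
next
  case 7 then show ?case by (auto simp: ounit_closed)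
next
  case 8 then show ?case using UT[OF ounit_closed] U0 ounit_nonzero by auto
next
  case 9 then show ?case by (auto simp: UT ounit_closed adj_ounit)
next
  case (10 n) then show ?case using pos_hmats by (auto simp: hmats_V')
next
  case (11 a n b) then show ?case
    by (auto simp: amp_add[symmetric, OF pos_mats pos_mats] intro!: imageI pos_add)
next
  case (12 a n r) then show ?case
    by (auto simp: amp_mscl[symmetric, OF pos_mats] intro!: imageI pos_mscl)
next
  case (13 a n)
  then obtain x y where x: "x \<in> pos V n" "a = amp T x" and y: "y \<in> pos V n" "- a = amp T y" by auto
  have "amp T (- x) = - amp T x"
    using pos_mats[OF x(1)] by (simp add: amp_def fun_eq_iff Tminus entry fun_Compl_def)
  then have "amp T (- x) = amp T y" using x y by simp
  then have "- x = y" using amp_T_inj minus_mats pos_mats x y by blast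
  then have "x = 0" using pos_proper x y by blast
  then show ?case using x by (simp add: amp_def T0 fun_eq_iff)
next
  case (14 a n m A) then show ?case
    by (auto simp: amp_compress[symmetric, OF pos_mats] intro!: imageI pos_compress)
next
  case (15 a n)
  then obtain x where x: "x \<in> hmats V n" "a = amp T x" by (auto simp: hmats_V')
  obtain r where r: "r > 0" "mscl V (complex_of_real r) (munit V n) + x \<in> pos V n"
    using order_unit[OF x(1)] by blast
  have "amp T (mscl V (complex_of_real r) (munit V n) + x) = mscl V' (complex_of_real r) (munit V' n) + a"
    using x by (simp add: amp_add[of _ n] amp_mscl[of _ n] amp_munit munit_mats mscl_mats hmats_def)
  then show ?case using r by (auto intro!: exI[of _ r] image_eqI)
next
  case (16 a n)
  then obtain x where x: "x \<in> hmats V n" "a = amp T x" by (auto simp: hmats_V')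
  have "mscl V (complex_of_real r) (munit V n) + x \<in> pos V n" if r: "r > 0" for r
  proof -
    have m: "mscl V (complex_of_real r) (munit V n) + x \<in> mats n (carr V)"
      using x by (intro add_mats mscl_mats munit_mats) (simp add: hmats_def)
    have "amp T (mscl V (complex_of_real r) (munit V n) + x) = mscl V' (complex_of_real r) (munit V' n) + a"
      using x by (simp add: amp_add[of _ n] amp_mscl[of _ n] amp_munit munit_mats mscl_mats hmats_def)
    then have "amp T (mscl V (complex_of_real r) (munit V n) + x) \<in> amp T ` pos V n"
      using 16(2)[OF r] by simp
    then obtain y where "y \<in> pos V n" "amp T (mscl V (complex_of_real r) (munit V n) + x) = amp T y" by auto
    then show ?thesis using amp_T_inj[OF m pos_mats] by auto
  qed
  then show ?case using archimedean[OF x(1)] x by auto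
qed

lemma mnorm_V': assumes x: "x \<in> mats n (carr V)" shows "mnorm V' n (amp T x) = mnorm V n x"
proof -
  have nb: "norm_block V n r x \<in> mats (2 * n) (carr V)" for r
    using entry[OF x] zero_in ounit_closed
    by (auto simp: norm_block_def mats_def intro: subspace_scale[OF subspace_carr] adj_closed)
  have "norm_block V' n r (amp T x) = amp T (norm_block V n r x)" for r
    by (auto simp: norm_block_def amp_def fun_eq_iff Tscl ounit_closed T0 UT entry[OF x])
  moreover have "amp T (norm_block V n r x) \<in> amp T ` pos V (2 * n) \<longleftrightarrow> norm_block V n r x \<in> pos V (2 * n)" for r
    using amp_T_inj[OF nb pos_mats] by auto
  ultimately show ?thesis by (simp add: mnorm_def)
qed

lemma opsys_norm_V': assumes x: "x \<in> carr V" shows "opsys_norm V' (T x) = opsys_norm V x"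
proof -
  let ?x = "\<lambda>(i::nat) (j::nat). if i = 0 \<and> j = 0 then x else 0"
  have "amp T ?x = (\<lambda>i j. if i = 0 \<and> j = 0 then T x else 0)"
    by (auto simp: amp_def fun_eq_iff T0)
  moreover have "?x \<in> mats 1 (carr V)"
    using x by (simp add: mats_def)
  ultimately show ?thesis unfolding opsys_norm_def using mnorm_V'[of ?x 1] by simp
qed

lemma embedding_V':
  assumes h: "unital_complete_order_embedding Z V h" and Z: "operator_system Z"
  shows "unital_complete_order_embedding Z V' (T \<circ> h)"
proof -
  interpret Z: operator_system Z by fact
  have hZ: "h z \<in> carr V" if "z \<in> carr Z" for z
    using h that by (auto simp: unital_complete_order_embedding_def cp_map_def linear_into_def)
  have hlin: "h (x + y) = h x + h y" "h (scl Z c x) = scl V c (h x)" if "x \<in> carr Z" "y \<in> carr Z" for x y c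
    using h that by (auto simp: unital_complete_order_embedding_def cp_map_def linear_into_def)
  have inj: "inj_on h (carr Z)" using h by (simp add: unital_complete_order_embedding_def)
  have "inj_on T (carr V)" using UT by (metis inj_on_inverseI)
  then have inj': "inj_on (T \<circ> h) (carr Z)"
    using inj hZ by (intro comp_inj_on) (auto elim: inj_on_subset)
  have inv: "inv_into (carr Z) (T \<circ> h) (T w) = inv_into (carr Z) h w" if "w \<in> h ` carr Z" for w
    using that inj inj' by (auto simp: inv_into_f_f) (metis comp_apply inv_into_f_f)
  have amp2: "amp (T \<circ> h) x = amp T (amp h x)" for x
    by (simp add: amp_def)
  have Zzero: "0 \<in> carr Z" by (rule Z.subspace_0[OF Z.subspace_carr])
  have h0: "h 0 = 0" using hlin(1)[OF Zzero Zzero] by simp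
  have cpinv: "amp (inv_into (carr Z) h) y \<in> pos Z n" if "y \<in> pos V n" "y \<in> mats n (h ` carr Z)" for y n
    using h that by (auto simp: unital_complete_order_embedding_def cp_map_def subsys_def)
  show ?thesis unfolding unital_complete_order_embedding_def
  proof (intro conjI)
    show "cp_map Z V' (T \<circ> h)"
      unfolding cp_map_def
    proof (intro conjI ballI allI)
      show "linear_into (scl Z) (carr Z) (scl V') (carr V') (T \<circ> h)"
        by (auto simp: linear_into_def hZ hlin Tadd Tscl)
      fix n x assume "x \<in> pos Z n"
      then have "amp h x \<in> pos V n"
        using h by (auto simp: unital_complete_order_embedding_def cp_map_def)
      then show "amp (T \<circ> h) x \<in> pos V' n" unfolding amp2 by simp
    qed
    show "(T \<circ> h) (ounit Z) = ounit V'"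
      using h by (simp add: unital_complete_order_embedding_def)
    show "inj_on (T \<circ> h) (carr Z)" by fact
    show "\<forall>x\<in>carr Z. opsys_norm V' ((T \<circ> h) x) = opsys_norm Z x"
      using h hZ by (auto simp: unital_complete_order_embedding_def opsys_norm_V')
    show "cp_map (subsys V' ((T \<circ> h) ` carr Z)) Z (inv_into (carr Z) (T \<circ> h))"
      unfolding cp_map_def
    proof (intro conjI ballI allI)
      have *: "inv_into (carr Z) (T \<circ> h) (T (h x)) = x" if "x \<in> carr Z" for x
        using inv_into_f_f[OF inj' that] by simp
      have 1: "inv_into (carr Z) (T \<circ> h) (T (h x) + T (h y)) = x + y" if "x \<in> carr Z" "y \<in> carr Z" for x y
        using that *[of "x + y"] Z.subspace_add[OF Z.subspace_carr] by (simp add: hlin Tadd hZ)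
      have 2: "inv_into (carr Z) (T \<circ> h) (t c (T (h x))) = scl Z c x" if "x \<in> carr Z" for x c
        using that *[of "scl Z c x"] Z.subspace_scale[OF Z.subspace_carr] by (simp add: hlin Tscl hZ)
      show "linear_into (scl (subsys V' ((T \<circ> h) ` carr Z))) (carr (subsys V' ((T \<circ> h) ` carr Z)))
          (scl Z) (carr Z) (inv_into (carr Z) (T \<circ> h))"
        by (auto simp: linear_into_def subsys_def * 1 2)
      fix n y assume "y \<in> pos (subsys V' ((T \<circ> h) ` carr Z)) n"
      then have y: "y \<in> amp T ` pos V n" "y \<in> mats n ((T \<circ> h) ` carr Z)"
        by (auto simp: subsys_def)
      then obtain x where x: "x \<in> pos V n" "y = amp T x" by auto
      have ent: "x i j \<in> h ` carr Z" if "i < n" "j < n" for i j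
      proof -
        have "T (x i j) \<in> T ` h ` carr Z" using y(2) that x(2) by (auto simp: mats_def amp_def image_comp)
        then obtain z where z: "z \<in> carr Z" "T (x i j) = T (h z)" by auto
        have "x i j = U (T (x i j))" by (rule UT[OF entry[OF pos_mats[OF x(1)]], symmetric])
        also have "\<dots> = h z" unfolding z(2) by (rule UT[OF hZ[OF z(1)]])
        finally show ?thesis using z(1) by blast
      qed
      have xm: "x \<in> mats n (h ` carr Z)"
        using ent pos_mats[OF x(1)] by (auto simp: mats_def)
      have "x i j \<in> h ` carr Z" for i j
        using ent xm h0 Zzero by (cases "i < n \<and> j < n") (auto simp: mats_def intro: image_eqI[of _ h 0])
      then have "amp (inv_into (carr Z) (T \<circ> h)) y = amp (inv_into (carr Z) h) x"
        by (simp add: amp_def x(2) inv fun_eq_iff)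
      then show "amp (inv_into (carr Z) (T \<circ> h)) y \<in> pos Z n" using cpinv[OF x(1) xm] by simp
    qed
  qed
qed

lemma hausdorff_V':
  assumes "A \<subseteq> carr V" "B \<subseteq> carr V"
  shows "hausdorff V' (T ` A) (T ` B) = hausdorff V A B"
proof -
  have "opsys_norm V' (T a - T b) = opsys_norm V (a - b)" if "a \<in> A" "b \<in> B" for a b
  proof -
    have ab: "a \<in> carr V" "- b \<in> carr V" "b \<in> carr V"
      using that assms subspace_neg[OF subspace_carr] by auto
    then have "T a - T b = T (a - b)" using Tadd[of a "- b"] Tminus[of b] by simp
    moreover have "a - b \<in> carr V" using ab subspace_diff[OF subspace_carr] by blast
    ultimately show ?thesis by (simp add: opsys_norm_V')
  qed
  then show ?thesis unfolding hausdorff_def image_image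
    by (simp cong: SUP_cong INF_cong)
qed

end

lemma subsys_subsys: "S \<subseteq> R \<Longrightarrow> subsys (subsys V R) S = subsys V S"
  by (auto simp: subsys_def fun_eq_iff mats_def subset_eq intro!: arg_cong[of _ _ "\<lambda>p. pos_update p _"])

lemma opsys_norm_subsys:
  assumes V: "operator_system V" "operator_subsystem (subsys V S) V" and x: "x \<in> S"
  shows "opsys_norm (subsys V S) x = opsys_norm V x"
proof -
  interpret Y: operator_system "subsys V S" by (rule operator_system_subsystem[OF V])
  have S: "carr (subsys V S) = S" "adj (subsys V S) = adj V" "ounit (subsys V S) = ounit V" "scl (subsys V S) = scl V"
    by (simp_all add: subsys_def)
  have "norm_block (subsys V S) 1 r (\<lambda>i j. if i = 0 \<and> j = 0 then x else 0) = norm_block V 1 r (\<lambda>i j. if i = 0 \<and> j = 0 then x else 0)" for r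
    by (simp add: norm_block_def S fun_eq_iff)
  moreover have "norm_block V 1 r (\<lambda>i j. if i = 0 \<and> j = 0 then x else 0) \<in> mats 2 S" for r
    using Y.ounit_closed x Y.adj_closed[of x] Y.subspace_0[OF Y.subspace_carr]
      Y.subspace_scale[OF Y.subspace_carr]
    by (auto simp: norm_block_def S mats_def)
  ultimately show ?thesis unfolding opsys_norm_def mnorm_def by (simp add: subsys_def numeral_2_eq_2)
qed

lemma embedding_subsys:
  assumes h: "unital_complete_order_embedding Z V h" and Z: "operator_system Z"
    and V: "operator_system V" "operator_subsystem (subsys V S) V" and S: "h ` carr Z \<subseteq> S"
  shows "unital_complete_order_embedding Z (subsys V S) h"
proof -
  interpret Z: operator_system Z by fact
  have 0: "0 \<in> carr Z" by (rule Z.subspace_0[OF Z.subspace_carr])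
  have lin: "linear_into (scl Z) (carr Z) (scl V) (carr V) h"
    using h by (simp add: unital_complete_order_embedding_def cp_map_def)
  have "amp h x \<in> mats n S" if "x \<in> pos Z n" for x n
    by (rule amp_mats[OF Z.pos_mats[OF that] S linear_into_0[OF lin 0]])
  then show ?thesis
    using h S unfolding unital_complete_order_embedding_def cp_map_def subsys_subsys[OF S]
    by (auto simp: linear_into_def subsys_def opsys_norm_subsys[OF V, unfolded subsys_def] subset_eq)
qed

text \<open>\<open>h(X) + k(Y)\<close> is a subsystem of \<open>V\<close> that is linearly isomorphic to a subspace of \<open>X \<times> Y\<close>, so
  operator systems \<open>V\<close> over other types do not lower the infimum.\<close>

theorem dist_op_le:
  fixes X :: "'a::ab_group_add opsys" and Y :: "'b::ab_group_add opsys"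
    and V :: "'v::ab_group_add opsys"
  assumes X: "operator_system X" and Y: "operator_system Y" and V: "operator_system V"
    and h: "unital_complete_order_embedding X V h" and k: "unital_complete_order_embedding Y V k"
  shows "dist_op X L Y M \<le> hausdorff V (h ` lip_ball X L) (k ` lip_ball Y M)"
proof -
  interpret X: operator_system X by fact
  interpret Y: operator_system Y by fact
  interpret V: operator_system V by fact
  define t where "t = (\<lambda>c (p :: 'a \<times> 'b). (scl X c (fst p), scl Y c (snd p)))"
  interpret P: vector_space t
    by unfold_locales (auto simp: t_def X.scale_right_distrib X.scale_left_distrib
        Y.scale_right_distrib Y.scale_left_distrib)
  interpret vector_space_pair "scl V" t ..
  have hlin: "h x \<in> carr V" "h (x + y) = h x + h y" "h (scl X c x) = scl V c (h x)" "h (ounit X) = ounit V"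
    if "x \<in> carr X" "y \<in> carr X" for x y c
    using h that by (auto simp: unital_complete_order_embedding_def cp_map_def linear_into_def)
  have klin: "k x \<in> carr V" "k (x + y) = k x + k y" "k (scl Y c x) = scl V c (k x)"
    if "x \<in> carr Y" "y \<in> carr Y" for x y c
    using k that by (auto simp: unital_complete_order_embedding_def cp_map_def linear_into_def)
  have X0: "0 \<in> carr X" by (rule X.subspace_0[OF X.subspace_carr])
  have Y0: "0 \<in> carr Y" by (rule Y.subspace_0[OF Y.subspace_carr])
  have h0: "h 0 = 0" using hlin(2)[OF X0 X0] by simp
  have k0: "k 0 = 0" using klin(2)[OF Y0 Y0] by simp
  define W where "W = (\<lambda>(x, y). h x + k y) ` (carr X \<times> carr Y)"
  have Wsub: "V.subspace W"
  proof (rule V.subspaceI)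
    show "0 \<in> W" unfolding W_def by (rule image_eqI[of _ _ "(0, 0)"]) (auto simp: h0 k0 X0 Y0)
    show "u + v \<in> W" if uv: "u \<in> W" "v \<in> W" for u v
    proof -
      obtain a b c d where "u = h a + k b" "v = h c + k d" "a \<in> carr X" "c \<in> carr X" "b \<in> carr Y" "d \<in> carr Y"
        using uv by (auto simp: W_def)
      then show ?thesis unfolding W_def
        by (intro image_eqI[of _ _ "(a + c, b + d)"])
          (auto simp: hlin klin X.subspace_add[OF X.subspace_carr] Y.subspace_add[OF Y.subspace_carr])
    qed
    show "scl V c u \<in> W" if u: "u \<in> W" for u c
    proof -
      obtain a b where "u = h a + k b" "a \<in> carr X" "b \<in> carr Y"
        using u by (auto simp: W_def)
      then show ?thesis unfolding W_def
        by (intro image_eqI[of _ _ "(scl X c a, scl Y c b)"])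
          (auto simp: hlin klin V.scale_right_distrib X.subspace_scale[OF X.subspace_carr] Y.subspace_scale[OF Y.subspace_carr])
    qed
  qed
  have Wcarr: "W \<subseteq> carr V"
    by (auto simp: W_def hlin klin V.subspace_add[OF V.subspace_carr])
  have hW: "h ` carr X \<subseteq> W"
  proof
    fix w assume "w \<in> h ` carr X"
    then obtain x where "x \<in> carr X" "w = h x" by auto
    then show "w \<in> W" unfolding W_def by (intro image_eqI[of _ _ "(x, 0)"]) (auto simp: k0 Y0)
  qed
  have kW: "k ` carr Y \<subseteq> W"
  proof
    fix w assume "w \<in> k ` carr Y"
    then obtain x where "x \<in> carr Y" "w = k x" by auto
    then show "w \<in> W" unfolding W_def by (intro image_eqI[of _ _ "(0, x)"]) (auto simp: h0 X0)
  qed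
  have hadj: "adj V (f z) = f (adj Z z)"
    if f: "unital_complete_order_embedding Z V f" and Z: "operator_system Z" and z: "z \<in> carr Z"
    for Z :: "'z::ab_group_add opsys" and f z
  proof -
    interpret Z: operator_system Z by fact
    have fl: "f x \<in> carr V" "f (x + y) = f x + f y" "f (scl Z c x) = scl V c (f x)" "f (ounit Z) = ounit V"
      if "x \<in> carr Z" "y \<in> carr Z" for x y c
      using f that by (auto simp: unital_complete_order_embedding_def cp_map_def linear_into_def)
    have sa: "adj V (f a) = f a" if a: "a \<in> carr Z" "adj Z a = a" for a
    proof -
      let ?a = "\<lambda>i j. if i = 0 \<and> j = 0 then a else (0::'z)"
      have "?a \<in> hmats Z 1" using a by (auto simp: hmats_def mats_def madj_def fun_eq_iff)
      then obtain r where r: "mscl Z (complex_of_real r) (munit Z 1) + ?a \<in> pos Z 1"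
        using Z.order_unit by blast
      then have "amp f (mscl Z (complex_of_real r) (munit Z 1) + ?a) \<in> hmats V 1"
        using f V.pos_hmats unfolding unital_complete_order_embedding_def cp_map_def by blast
      then have "madj V 1 (amp f (mscl Z (complex_of_real r) (munit Z 1) + ?a)) 0 0 = amp f (mscl Z (complex_of_real r) (munit Z 1) + ?a) 0 0"
        by (simp add: hmats_def)
      then have "adj V (f (scl Z r (ounit Z) + a)) = f (scl Z r (ounit Z) + a)"
        by (simp add: madj_def amp_def mscl_def munit_def)
      then have "adj V (scl V r (ounit V)) + adj V (f a) = scl V r (ounit V) + f a"
        using a by (simp add: fl Z.ounit_closed Z.subspace_scale[OF Z.subspace_carr] V.adj_add
            V.ounit_closed V.subspace_scale[OF V.subspace_carr])
      then show ?thesis by (simp add: V.adj_scl V.ounit_closed V.adj_ounit)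
    qed
    note zs = z Z.adj_closed[OF z] Z.subspace_scale[OF Z.subspace_carr] Z.subspace_add[OF Z.subspace_carr]
    note vs = V.adj_closed fl(1) V.subspace_scale[OF V.subspace_carr] V.subspace_add[OF V.subspace_carr]
    let ?b = "adj Z z"
    have 1: "adj V (f (z + ?b)) = f (z + ?b)"
      by (rule sa) (auto simp: zs Z.adj_add Z.adj_adj add.commute)
    have 2: "adj V (f (scl Z \<i> z + scl Z (- \<i>) ?b)) = f (scl Z \<i> z + scl Z (- \<i>) ?b)"
      by (rule sa) (auto simp: zs Z.adj_add Z.adj_adj Z.adj_scl add.commute simp del: Z.scale_minus_left)
    have e1: "adj V (f z) + adj V (f ?b) = f z + f ?b"
      using 1 fl(1)[OF zs(1) zs(1)] fl(1)[OF zs(2) zs(2)] fl(2)[OF zs(1,2)] V.adj_add[of "f z" "f ?b"] by simp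
    have e2: "scl V (- \<i>) (adj V (f z)) + scl V \<i> (adj V (f ?b)) = scl V \<i> (f z) + scl V (- \<i>) (f ?b)"
    proof -
      have m: "scl Z \<i> z \<in> carr Z" "scl Z (- \<i>) ?b \<in> carr Z" using zs by blast+
      have n: "f z \<in> carr V" "f ?b \<in> carr V" using fl(1) zs by blast+
      have "f (scl Z \<i> z + scl Z (- \<i>) ?b) = scl V \<i> (f z) + scl V (- \<i>) (f ?b)"
        using fl(2)[OF m] fl(3)[OF zs(1) zs(1), of \<i>] fl(3)[OF zs(2) zs(2), of "- \<i>"] by argo
      moreover have "adj V (scl V \<i> (f z) + scl V (- \<i>) (f ?b)) = scl V (- \<i>) (adj V (f z)) + scl V \<i> (adj V (f ?b))"
        using V.adj_add[OF V.subspace_scale[OF V.subspace_carr n(1)] V.subspace_scale[OF V.subspace_carr n(2)], of \<i> "- \<i>"]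
          V.adj_scl[OF n(1), of \<i>] V.adj_scl[OF n(2), of "- \<i>"] by simp
      ultimately show ?thesis using 2 by simp
    qed
    have "scl V \<i> (scl V (- \<i>) (adj V (f z)) + scl V \<i> (adj V (f ?b))) = scl V \<i> (scl V \<i> (f z) + scl V (- \<i>) (f ?b))"
      by (simp only: e2)
    then have 3: "adj V (f z) + - adj V (f ?b) = - f z + f ?b"
      by (simp add: V.scale_right_distrib V.scale_right_diff_distrib)
    have "adj V (f z) + adj V (f z) = (adj V (f z) + adj V (f ?b)) + (adj V (f z) + - adj V (f ?b))"
      by simp
    also have "\<dots> = f ?b + f ?b" unfolding e1 3 by simp
    finally have "scl V (1 + 1) (adj V (f z)) = scl V (1 + 1) (f ?b)"
      by (simp only: V.scale_left_distrib V.scale_one)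
    then have "scl V (1/2) (scl V 2 (adj V (f z))) = scl V (1/2) (scl V 2 (f ?b))" by simp
    then show ?thesis by (simp only: V.scale_scale) simp
  qed
  have sub: "operator_subsystem (subsys V W) V"
    unfolding operator_subsystem_def
  proof (intro exI[of _ W] conjI refl ballI)
    show "W \<subseteq> carr V" "V.subspace W" by fact+
    show "ounit V \<in> W" using hW hlin(4)[OF X0 X0] X.ounit_closed by force
    fix w assume "w \<in> W"
    then obtain a b where ab: "w = h a + k b" "a \<in> carr X" "b \<in> carr Y" by (auto simp: W_def)
    then have "adj V w = h (adj X a) + k (adj Y b)"
      by (simp add: V.adj_add hlin klin hadj[OF h X] hadj[OF k Y])
    then show "adj V w \<in> W" unfolding W_def using ab X.adj_closed Y.adj_closed
      by (intro image_eqI[of _ _ "(adj X a, adj Y b)"]) auto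
  qed
  obtain B where B: "B \<subseteq> W" "V.independent B" "V.span B = W"
    using V.basis_exists[of W] V.span_minimal[OF _ Wsub] by (metis subset_antisym)
  define \<Phi> where "\<Phi> = (\<lambda>(x, y). h x + k y)"
  have "\<forall>b\<in>B. \<exists>p. p \<in> carr X \<times> carr Y \<and> \<Phi> p = b"
    using B(1) unfolding W_def \<Phi>_def by (force simp: subset_eq)
  then obtain g where g: "\<And>b. b \<in> B \<Longrightarrow> g b \<in> carr X \<times> carr Y \<and> \<Phi> (g b) = b"
    using bchoice[of B "\<lambda>b p. p \<in> carr X \<times> carr Y \<and> \<Phi> p = b"] by blast
  define T where "T = construct B g"
  have Tlin: "Vector_Spaces.linear (scl V) t T" unfolding T_def by (rule linear_construct[OF B(2)])
  interpret T: Vector_Spaces.linear "scl V" t T by (rule Tlin)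
  have "T w \<in> carr X \<times> carr Y \<and> \<Phi> (T w) = w" if "w \<in> V.span B" for w
    using that
  proof (induction rule: V.span_induct_alt)
    case base
    then show ?case by (simp add: T.zero \<Phi>_def h0 k0 zero_prod_def X0 Y0)
  next
    case (step c b w)
    have Tb: "T b = g b" unfolding T_def by (rule construct_basis[OF B(2) step(1)])
    obtain x y where xy: "g b = (x, y)" by fastforce
    obtain x' y' where xy': "T w = (x', y')" by fastforce
    have T': "T (scl V c b + w) = (scl X c x + x', scl Y c y + y')"
      by (simp add: T.add T.scale Tb xy xy' t_def)
    have m: "x \<in> carr X" "y \<in> carr Y" "h x + k y = b" "x' \<in> carr X" "y' \<in> carr Y" "h x' + k y' = w"
      using g[OF step(1)] step(2) by (auto simp: xy xy' \<Phi>_def)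
    have "h (scl X c x + x') + k (scl Y c y + y') = scl V c (h x + k y) + (h x' + k y')"
      using m(1,2,4,5) by (simp add: hlin klin X.subspace_scale[OF X.subspace_carr] Y.subspace_scale[OF Y.subspace_carr]
          V.scale_right_distrib)
    then show ?case using m unfolding T' \<Phi>_def
      by (simp add: X.subspace_scale[OF X.subspace_carr] Y.subspace_scale[OF Y.subspace_carr]
          X.subspace_add[OF X.subspace_carr] Y.subspace_add[OF Y.subspace_carr])
  qed
  then have \<Phi>T: "\<Phi> (T w) = w" if "w \<in> W" for w using that B by auto
  define V1 where "V1 = subsys V W"
  have V1: "operator_system V1" unfolding V1_def by (rule operator_system_subsystem[OF V sub])
  interpret V1: operator_system V1 by (rule V1)
  have V1c: "carr V1 = W" "scl V1 = scl V" by (simp_all add: V1_def subsys_def)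
  interpret tr: transport V1 t T \<Phi>
  proof unfold_locales
    show "linear_into (scl V1) (carr V1) t UNIV T"
      by (auto simp: linear_into_def V1c T.add T.scale)
    show "\<Phi> (T v) = v" if "v \<in> carr V1" for v using \<Phi>T that by (simp add: V1c)
  qed
  have h1: "unital_complete_order_embedding X V1 h" and k1: "unital_complete_order_embedding Y V1 k"
    unfolding V1_def using embedding_subsys[OF h X V sub hW] embedding_subsys[OF k Y V sub kW] by blast+
  have lb: "h ` lip_ball X L \<subseteq> W" "k ` lip_ball Y M \<subseteq> W"
    using hW kW by (auto simp: lip_ball_def sa_def)
  have "dist_op X L Y M \<le> hausdorff tr.V' ((T \<circ> h) ` lip_ball X L) ((T \<circ> k) ` lip_ball Y M)"
    unfolding dist_op_def
    using tr.operator_system_V' tr.embedding_V'[OF h1 X] tr.embedding_V'[OF k1 Y]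
    by (intro Inf_lower) blast
  also have "\<dots> = hausdorff V1 (h ` lip_ball X L) (k ` lip_ball Y M)"
    unfolding image_comp[symmetric] by (rule tr.hausdorff_V') (use lb in \<open>auto simp: V1c\<close>)
  also have "\<dots> = hausdorff V (h ` lip_ball X L) (k ` lip_ball Y M)"
  proof -
    have "opsys_norm V1 (a - b) = opsys_norm V (a - b)" if "a \<in> h ` lip_ball X L" "b \<in> k ` lip_ball Y M" for a b
      unfolding V1_def using that lb V.subspace_diff[OF Wsub] by (intro opsys_norm_subsys[OF V sub]) auto
    then show ?thesis unfolding hausdorff_def by (simp cong: SUP_cong INF_cong)
  qed
  finally show ?thesis .
qed

end

theory Submission
  imports Defs
begin

text \<open>
  For (i) to (iii), take a finite-dimensional \<open>E\<close> containing the unit that, up to small errors,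
  meets every element of the Lip-ball (total boundedness of the state space). By exactness there is a
  unital completely positive \<open>\<phi> : X \<rightarrow> M\<^sub>m\<close> almost completely isometric on \<open>E\<close>. A Hahn--Banach
  argument on pairs of \<open>k \<times> k\<close> matrices shows that each unital completely positive \<open>f : X \<rightarrow> M\<^sub>k\<close>
  agrees on \<open>E\<close>, up to a small error, with some \<open>g \<circ> \<phi>\<close>. All such pairs \<open>(f, g)\<close> together embed \<open>X\<close>
  and \<open>M\<^sub>m\<close> completely order isomorphically into a product of matrix algebras, in which \<open>x\<close> and \<open>\<phi> x\<close>
  are close for \<open>x\<close> in the Lip-ball. The Lip-norm on \<open>M\<^sub>m\<close> is the infimal convolution
  \<open>L' y = inf\<^sub>x (L x + \<parallel>y - \<phi> x\<parallel> / \<epsilon>)\<close>.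

  For (ii) to (i), elements of finite Lip-norm are dense, so a basis of a finite-dimensional subspace of
  \<open>X\<close> can be moved by a small amount into a subsystem of a matrix algebra inside a common operator
  system; the linear extension is a small perturbation of the identity.
\<close>


text \<open>No Hilbert space occurs: positivity and norms are tested by unital completely positive
  maps into matrix algebras, and \<open>separating_ucp\<close> shows that there are enough of them.
  The isomorphism \<alpha> that exactness supplies is neither unital nor positive and is defined on
  \<open>E\<close> only. It is neither repaired nor extended: its one task is to bound all matrix
  levels by level \<open>N\<close>, the size of its target. A map \<phi> on all of \<open>X\<close>
  that is nearly isometric at level \<open>N\<close> over \<open>E\<close> comes from a finite net,
  and \<alpha> makes it nearly isometric at every level. The inverse of \<phi> on its image is only
  almost positive, so f composed with it need not extend to a unital completely positive g. A second
  map h absorbs the defect: f = (1 + \<delta>) g \<phi> - \<delta> h \<phi> on self-adjoint elements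
  of \<open>E\<close>, and one functional on pairs yields g and h together. Off \<open>E\<close> the
  map \<phi> may be far from isometric. In the product over all admissible pairs the embeddings are
  nevertheless exact, and only the distance of x and \<phi> x is approximate; the pair of \<phi> and
  the identity ensures that the matrix algebra embeds.\<close>

section \<open>Sublinear functionals and the Hahn-Banach theorem\<close>

text \<open>Read \<open>G x t\<close> as: t is an admissible upper bound at x. Admissible pairs form
  a convex cone, and the only issue is that the infimum be finite: admissible bounds at x and at
  \<open>- x\<close> add up to an admissible bound at 0, which is nonnegative.\<close>

lemma Inf_cone:
  fixes sc :: "real \<Rightarrow> 'w::ab_group_add \<Rightarrow> 'w"
  assumes V: "vector_space sc" and W: "module.subspace sc W"
    and dom: "\<And>x. x \<in> W \<Longrightarrow> \<exists>t. G x t"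
    and add: "\<And>x y s t. x \<in> W \<Longrightarrow> y \<in> W \<Longrightarrow> G x s \<Longrightarrow> G y t \<Longrightarrow> G (x + y) (s + t)"
    and scale: "\<And>x c t. x \<in> W \<Longrightarrow> 0 < c \<Longrightarrow> G x t \<Longrightarrow> G (sc c x) (c * t)"
    and zero: "\<And>t. G 0 t \<Longrightarrow> 0 \<le> (t::real)"
  defines "q \<equiv> \<lambda>x. Inf {t. G x t}"
  shows "\<And>x t. x \<in> W \<Longrightarrow> G x t \<Longrightarrow> q x \<le> t"
    and "\<And>x t. x \<in> W \<Longrightarrow> (\<And>s. G x s \<Longrightarrow> t \<le> s) \<Longrightarrow> t \<le> q x"
    and "\<And>x y. x \<in> W \<Longrightarrow> y \<in> W \<Longrightarrow> q (x + y) \<le> q x + q y"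
    and "\<And>x c. x \<in> W \<Longrightarrow> 0 < c \<Longrightarrow> q (sc c x) \<le> c * q x"
proof -
  interpret vector_space sc by fact
  have bdd: "bdd_below {t. G x t}" if x: "x \<in> W" for x
  proof -
    have "- x \<in> W" using W x subspace_neg by blast
    then obtain s where s: "G (- x) s" using dom by blast
    have "- s \<le> t" if "G x t" for t
      using add[OF x \<open>- x \<in> W\<close> that s] zero[of "t + s"] by simp
    then show ?thesis unfolding bdd_below_def by auto
  qed
  show 1: "q x \<le> t" if "x \<in> W" "G x t" for x t
    unfolding q_def using that bdd by (auto intro: cInf_lower)
  show 2: "t \<le> q x" if "x \<in> W" "\<And>s. G x s \<Longrightarrow> t \<le> s" for x t
    unfolding q_def using that dom by (auto intro!: cInf_greatest)
  show "q (x + y) \<le> q x + q y" if x: "x \<in> W" and y: "y \<in> W" for x y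
  proof -
    have xy: "x + y \<in> W" using W x y subspace_add by blast
    have "q (x + y) - s \<le> q y" if s: "G x s" for s
      using 1[OF xy] add[OF x y s] by (intro 2[OF y]) (simp add: algebra_simps)
    then have "q (x + y) - q y \<le> q x"
      by (intro 2[OF x]) (simp add: algebra_simps)
    then show ?thesis by simp
  qed
  show "q (sc c x) \<le> c * q x" if x: "x \<in> W" and c: "0 < c" for x c
  proof -
    have cx: "sc c x \<in> W" using W x subspace_scale by blast
    have "q (sc c x) / c \<le> q x"
      using 1[OF cx scale[OF x c]] c by (intro 2[OF x]) (simp add: field_simps)
    then show ?thesis using c by (simp add: field_simps)
  qed
qed

definition sublinear_on :: "(real \<Rightarrow> 'w \<Rightarrow> 'w) \<Rightarrow> 'w set \<Rightarrow> ('w::ab_group_add \<Rightarrow> real) \<Rightarrow> bool" where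
  "sublinear_on sc W p \<longleftrightarrow> (\<forall>x\<in>W. \<forall>y\<in>W. p (x + y) \<le> p x + p y) \<and>
     (\<forall>c>0. \<forall>x\<in>W. p (sc c x) \<le> c * p x)"

text \<open>The inequality for c and the one for 1 / c give equality; scaling 0 by 2 then forces the
  value 0 at 0.\<close>

lemma sublinear_on_scale:
  assumes V: "vector_space sc" and W: "module.subspace sc W" and p: "sublinear_on sc W p"
    and x: "x \<in> W" and c: "0 \<le> c"
  shows "p (sc c x) = c * p x"
proof -
  interpret vector_space sc by fact
  have pos: "p (sc c x) = c * p x" if x: "x \<in> W" and c: "0 < c" for c x
  proof -
    have "sc c x \<in> W" using W x subspace_scale by blast
    then have "p (sc (1 / c) (sc c x)) \<le> (1 / c) * p (sc c x)"
      using p c unfolding sublinear_on_def by (metis zero_less_divide_1_iff)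
    then have "c * p x \<le> p (sc c x)" using c by (simp add: field_simps)
    then show ?thesis using p x c by (auto simp: sublinear_on_def intro: antisym)
  qed
  have "p 0 = 0" using pos[of 0 2] subspace_0[OF W] by simp
  then show ?thesis using pos[OF x, of c] c by (cases "c = 0") auto
qed

text \<open>The infimum of \<open>p (x + t y) - t p y\<close> over t \<ge> 0 is again sublinear. At
  \<open>- y\<close> the choice t = 1 cancels the argument and leaves \<open>- p y\<close>, so the
  new functional is odd in the direction y.\<close>

lemma sublinear_on_tilt:
  assumes V: "vector_space sc" and W: "module.subspace sc W" and p: "sublinear_on sc W p"
    and y: "y \<in> W"
  obtains p' where "sublinear_on sc W p'" "\<And>x. x \<in> W \<Longrightarrow> p' x \<le> p x" "p' (- y) \<le> - p y"
proof -
  interpret vector_space sc by fact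
  have padd: "p (u + v) \<le> p u + p v" if "u \<in> W" "v \<in> W" for u v
    using p that by (auto simp: sublinear_on_def)
  note psc = sublinear_on_scale[OF V W p]
  have ty: "sc t y \<in> W" for t using W y subspace_scale by blast
  define G where "G = (\<lambda>x s. \<exists>t\<ge>0. p (x + sc t y) - t * p y \<le> s)"
  have G0: "G x (p x)" for x unfolding G_def by (rule exI[of _ 0]) simp
  have add: "G (u + v) (a + b)" if uv: "u \<in> W" "v \<in> W" and ab: "G u a" "G v b" for u v a b
  proof -
    obtain s t where st: "s \<ge> 0" "p (u + sc s y) - s * p y \<le> a" "t \<ge> 0" "p (v + sc t y) - t * p y \<le> b"
      using ab by (auto simp: G_def)
    have "p ((u + sc s y) + (v + sc t y)) \<le> p (u + sc s y) + p (v + sc t y)"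
      using uv ty by (intro padd subspace_add[OF W])
    moreover have "(u + sc s y) + (v + sc t y) = (u + v) + sc (s + t) y"
      by (simp add: scale_left_distrib algebra_simps)
    ultimately show ?thesis unfolding G_def using st
      by (intro exI[of _ "s + t"]) (simp add: algebra_simps)
  qed
  have scale: "G (sc c x) (c * a)" if x: "x \<in> W" and c: "0 < c" and a: "G x a" for x c a
  proof -
    obtain s where s: "s \<ge> 0" "p (x + sc s y) - s * p y \<le> a" using a by (auto simp: G_def)
    have "p (sc c (x + sc s y)) = c * p (x + sc s y)"
      using c x ty by (intro psc subspace_add[OF W]) auto
    then have "p (sc c x + sc (c * s) y) - c * s * p y = c * (p (x + sc s y) - s * p y)"
      by (simp add: scale_right_distrib algebra_simps)
    also have "\<dots> \<le> c * a" using s c by simp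
    finally show ?thesis unfolding G_def using s c by (intro exI[of _ "c * s"]) simp
  qed
  have zero: "0 \<le> t" if "G 0 t" for t
    using that psc[OF y] by (auto simp: G_def)
  have dom: "\<exists>t. G x t" for x using G0 by blast
  have I: "Inf {t. G x t} \<le> s" if "x \<in> W" "G x s" for x s
    by (rule Inf_cone(1)[OF V W]) (use that dom add scale zero in auto)
  show ?thesis
  proof (rule that[of "\<lambda>x. Inf {t. G x t}"])
    show "sublinear_on sc W (\<lambda>x. Inf {t. G x t})"
      unfolding sublinear_on_def
    proof (intro conjI ballI allI impI)
      show "Inf {t. G (x + y) t} \<le> Inf {t. G x t} + Inf {t. G y t}" if "x \<in> W" "y \<in> W" for x y
        by (rule Inf_cone(3)[OF V W]) (use that dom add scale zero in auto)
      show "Inf {t. G (sc c x) t} \<le> c * Inf {t. G x t}" if "x \<in> W" "0 < c" for x c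
        by (rule Inf_cone(4)[OF V W]) (use that dom add scale zero in auto)
    qed
    show "Inf {t. G x t} \<le> p x" if "x \<in> W" for x
      by (rule I[OF that G0])
    have "G (- y) (- p y)" unfolding G_def
      using psc[OF y, of 0] by (intro exI[of _ 1]) auto
    then show "Inf {t. G (- y) t} \<le> - p y"
      using I[OF subspace_neg[OF W y]] by blast
  qed
qed

text \<open>A minimal sublinear functional below q is linear: tilting it at y gives a smaller one,
  so by minimality it is already odd at y, and an odd subadditive functional is additive.\<close>

lemma sublinear_on_dominates_linear:
  assumes V: "vector_space sc" and W: "module.subspace sc W" and q: "sublinear_on sc W q"
  obtains S where "\<And>x y. x \<in> W \<Longrightarrow> y \<in> W \<Longrightarrow> S (x + y) = S x + S y"
    "\<And>c x. x \<in> W \<Longrightarrow> S (sc c x) = c * S x" "\<And>x. x \<in> W \<Longrightarrow> S x \<le> q x"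
proof -
  interpret vector_space sc by fact
  \<comment> \<open>Values off \<open>W\<close> are fixed to 0: minimality compares functions on the
    whole type, while the other conditions only constrain them on \<open>W\<close>.\<close>
  define A where "A = {p. sublinear_on sc W p \<and> (\<forall>x\<in>W. p x \<le> q x) \<and> (\<forall>x. x \<notin> W \<longrightarrow> p x = 0)}"
  \<comment> \<open>A lower bound that is uniform over \<open>A\<close>; it makes the pointwise
    infimum along a chain finite.\<close>
  have lower: "- q (- x) \<le> p x" if "p \<in> A" "x \<in> W" for p x
  proof -
    have p: "sublinear_on sc W p" "\<And>x. x \<in> W \<Longrightarrow> p x \<le> q x" using that by (auto simp: A_def)
    have "- x \<in> W" using subspace_neg[OF W] that by blast
    moreover have "p 0 = 0" using sublinear_on_scale[OF V W p(1) subspace_0[OF W], of 0] by simp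
    ultimately have "0 \<le> p x + p (- x)" using p(1) that unfolding sublinear_on_def
      by (metis add.right_inverse)
    then show ?thesis using p(2)[OF \<open>- x \<in> W\<close>] by linarith
  qed
  have "\<exists>m\<in>A. \<forall>a\<in>A. a \<le> m \<longrightarrow> a = m"
  proof (rule predicate_Zorn[where P = "\<lambda>p p'. p' \<le> p"])
    show "partial_order_on A (relation_of (\<lambda>p p'. p' \<le> p) A)"
      by (rule partial_order_on_relation_ofI) auto
    fix C assume C: "C \<in> Chains (relation_of (\<lambda>p p'. p' \<le> p) A)"
    have CA: "C \<subseteq> A" using C by (auto simp: Chains_def relation_of_def)
    have tot: "p \<le> p' \<or> p' \<le> p" if "p \<in> C" "p' \<in> C" for p p'
      using C that by (auto simp: Chains_def relation_of_def)
    show "\<exists>u\<in>A. \<forall>a\<in>C. u \<le> a"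
    proof (cases "C = {}")
      case True
      have "(\<lambda>x. if x \<in> W then q x else 0) \<in> A"
        using q W by (auto simp: A_def sublinear_on_def subspace_add subspace_scale)
      then show ?thesis using True by blast
    next
      case False
      define u where "u = (\<lambda>x. if x \<in> W then INF p\<in>C. p x else 0)"
      have bdd: "bdd_below ((\<lambda>p. p x) ` C)" if "x \<in> W" for x
        using lower[OF _ that] CA by (auto intro!: bdd_belowI[of _ "- q (- x)"])
      have ule: "u x \<le> p x" if "p \<in> C" "x \<in> W" for p x
        using bdd that by (auto simp: u_def intro: cINF_lower)
      have uge: "t \<le> u x" if "x \<in> W" "\<And>p. p \<in> C \<Longrightarrow> t \<le> p x" for x t
        using that False by (auto simp: u_def intro: cINF_greatest)
      have "u (x + y) \<le> u x + u y" if x: "x \<in> W" and y: "y \<in> W" for x y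
      proof -
        have xy: "x + y \<in> W" using subspace_add[OF W x y] .
        \<comment> \<open>In a chain one of two functionals lies below both, and its subadditivity
          passes to the infimum.\<close>
        have "u (x + y) \<le> p x + p' y" if p: "p \<in> C" "p' \<in> C" for p p'
        proof -
          obtain r where r: "r \<in> C" "r \<le> p" "r \<le> p'" using tot[OF p] p order_refl by metis
          have "u (x + y) \<le> r (x + y)" by (rule ule[OF r(1) xy])
          also have "\<dots> \<le> r x + r y" using r(1) CA x y by (auto simp: A_def sublinear_on_def)
          also have "\<dots> \<le> p x + p' y" using r by (intro add_mono) (auto simp: le_fun_def)
          finally show ?thesis .
        qed
        then have "u (x + y) - p x \<le> u y" if "p \<in> C" for p
          using that by (intro uge[OF y]) (simp add: algebra_simps, metis add.commute)
        then have "u (x + y) - u y \<le> u x"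
          by (intro uge[OF x]) (simp add: algebra_simps)
        then show ?thesis by simp
      qed
      moreover have "u (sc c x) \<le> c * u x" if x: "x \<in> W" and c: "0 < c" for x c
      proof -
        have cx: "sc c x \<in> W" using subspace_scale[OF W x] .
        have "u (sc c x) / c \<le> u x"
        proof (rule uge[OF x])
          fix p assume p: "p \<in> C"
          then have "p (sc c x) \<le> c * p x" using CA x c by (auto simp: A_def sublinear_on_def)
          then show "u (sc c x) / c \<le> p x" using ule[OF p cx] c by (simp add: field_simps)
        qed
        then show ?thesis using c by (simp add: field_simps)
      qed
      ultimately have "sublinear_on sc W u" by (auto simp: sublinear_on_def)
      moreover have "\<forall>x\<in>W. u x \<le> q x"
      proof
        fix x assume x: "x \<in> W"
        obtain p where "p \<in> C" using False by blast
        then show "u x \<le> q x" using ule[of p x] CA x by (force simp: A_def)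
      qed
      ultimately have "u \<in> A" by (simp add: A_def u_def)
      moreover have "\<forall>a\<in>C. u \<le> a"
        using ule CA by (auto simp: le_fun_def A_def u_def)
      ultimately show ?thesis by blast
    qed
  qed
  then obtain m where m: "m \<in> A" and min: "\<And>a. a \<in> A \<Longrightarrow> a \<le> m \<Longrightarrow> a = m" by blast
  have ms: "sublinear_on sc W m" and mq: "\<And>x. x \<in> W \<Longrightarrow> m x \<le> q x" using m by (auto simp: A_def)
  have m0: "m 0 = 0" using sublinear_on_scale[OF V W ms subspace_0[OF W], of 0] by simp
  have madd: "m (x + y) \<le> m x + m y" if "x \<in> W" "y \<in> W" for x y
    using ms that by (auto simp: sublinear_on_def)
  have odd: "m (- y) = - m y" if y: "y \<in> W" for y
  proof -
    obtain p where p: "sublinear_on sc W p" "\<And>x. x \<in> W \<Longrightarrow> p x \<le> m x" "p (- y) \<le> - m y"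
      using sublinear_on_tilt[OF V W ms y] by blast
    define p' where "p' = (\<lambda>x. if x \<in> W then p x else 0)"
    have "sublinear_on sc W p'"
      using p(1) W by (auto simp: p'_def sublinear_on_def subspace_add subspace_scale)
    moreover have "p' x \<le> q x" if "x \<in> W" for x
      using p(2)[OF that] mq[OF that] that by (simp add: p'_def)
    ultimately have "p' \<in> A" by (auto simp: A_def p'_def)
    moreover have "p' \<le> m" using p(2) m by (auto simp: le_fun_def p'_def A_def)
    ultimately have "p' = m" using min by blast
    then have "m (- y) \<le> - m y" using p(3) subspace_neg[OF W y] by (auto simp: p'_def)
    moreover have "0 \<le> m y + m (- y)" using madd[OF y subspace_neg[OF W y]] m0 by simp
    ultimately show ?thesis by linarith
  qed
  show ?thesis
  proof (rule that[of m])
    show "m (x + y) = m x + m y" if x: "x \<in> W" and y: "y \<in> W" for x y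
    proof -
      have "m ((x + y) + - y) \<le> m (x + y) + m (- y)"
        using x y W by (intro madd subspace_add subspace_neg)
      then have "m x + m y \<le> m (x + y)" using odd[OF y] by simp
      then show ?thesis using madd[OF x y] by simp
    qed
    show "m (sc c x) = c * m x" if x: "x \<in> W" for c x
    proof (cases "0 \<le> c")
      case True then show ?thesis by (rule sublinear_on_scale[OF V W ms x])
    next
      case False
      have "m (- sc (- c) x) = - m (sc (- c) x)" by (rule odd[OF subspace_scale[OF W x]])
      then show ?thesis using False sublinear_on_scale[OF V W ms x, of "- c"] by simp
    qed
  qed (fact mq)
qed

text \<open>Tilting the infimum functional at \<open>x0\<close> before a linear minorant is chosen
  forces \<open>S (- x0) \<le> - q x0\<close>, so S attains the infimum at \<open>x0\<close>. The
  last clause expresses this without the infimum: every lower bound of the admissible values at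
  \<open>x0\<close> is at most \<open>S x0\<close>.\<close>

theorem hahn_banach_cone:
  fixes sc :: "real \<Rightarrow> 'w::ab_group_add \<Rightarrow> 'w"
  assumes V: "vector_space sc" and W: "module.subspace sc W"
    and dom: "\<And>x. x \<in> W \<Longrightarrow> \<exists>t. G x t"
    and add: "\<And>x y s t. x \<in> W \<Longrightarrow> y \<in> W \<Longrightarrow> G x s \<Longrightarrow> G y t \<Longrightarrow> G (x + y) (s + t)"
    and scale: "\<And>x c t. x \<in> W \<Longrightarrow> 0 < c \<Longrightarrow> G x t \<Longrightarrow> G (sc c x) (c * t)"
    and zero: "\<And>t. G 0 t \<Longrightarrow> 0 \<le> (t::real)"
    and x0: "x0 \<in> W"
  shows "\<exists>S. (\<forall>x\<in>W. \<forall>y\<in>W. S (x + y) = S x + S y) \<and> (\<forall>c. \<forall>x\<in>W. S (sc c x) = c * S x) \<and>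
    (\<forall>x\<in>W. \<forall>t. G x t \<longrightarrow> S x \<le> t) \<and> (\<forall>t. (\<forall>s. G x0 s \<longrightarrow> t \<le> s) \<longrightarrow> t \<le> S x0)"
proof -
  interpret vector_space sc by fact
  define q where "q = (\<lambda>x. Inf {t. G x t})"
  have I1: "q x \<le> t" if "x \<in> W" "G x t" for x t
    unfolding q_def by (rule Inf_cone(1)[OF V W]) (use that dom add scale zero in auto)
  have I2: "t \<le> q x0" if "\<And>s. G x0 s \<Longrightarrow> t \<le> s" for t
    unfolding q_def by (rule Inf_cone(2)[OF V W]) (use that x0 dom add scale zero in auto)
  have "q (x + y) \<le> q x + q y" if "x \<in> W" "y \<in> W" for x y
    unfolding q_def by (rule Inf_cone(3)[OF V W]) (use that dom add scale zero in auto)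
  moreover have "q (sc c x) \<le> c * q x" if "x \<in> W" "0 < c" for x c
    unfolding q_def by (rule Inf_cone(4)[OF V W]) (use that dom add scale zero in auto)
  ultimately have "sublinear_on sc W q" unfolding sublinear_on_def by blast
  from sublinear_on_tilt[OF V W this x0] obtain p where
    p: "sublinear_on sc W p" "\<And>x. x \<in> W \<Longrightarrow> p x \<le> q x" "p (- x0) \<le> - q x0" by blast
  from sublinear_on_dominates_linear[OF V W p(1)] obtain S where
    S: "\<And>x y. x \<in> W \<Longrightarrow> y \<in> W \<Longrightarrow> S (x + y) = S x + S y"
    "\<And>c x. x \<in> W \<Longrightarrow> S (sc c x) = c * S x" "\<And>x. x \<in> W \<Longrightarrow> S x \<le> p x" by blast
  show ?thesis
  proof (intro exI[of _ S] conjI ballI allI impI)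
    show "S (x + y) = S x + S y" if "x \<in> W" "y \<in> W" for x y by (rule S(1)[OF that])
    show "S (sc c x) = c * S x" if "x \<in> W" for c x by (rule S(2)[OF that])
    show "S x \<le> t" if "x \<in> W" "G x t" for x t
      using S(3) p(2) I1 that by (meson order_trans)
    show "t \<le> S x0" if "\<forall>s. G x0 s \<longrightarrow> t \<le> s" for t
    proof -
      have "S (- x0) = - S x0" using S(2)[OF x0, of "- 1"] by simp
      then have "q x0 \<le> S x0" using S(3)[OF subspace_neg[OF W x0]] p(3) by linarith
      then show ?thesis using I2[of t] that by force
    qed
  qed
qed

section \<open>Completely positive maps into matrix algebras\<close>

lemma sum_swap22:
  "(\<Sum>a\<in>A. \<Sum>b\<in>B. \<Sum>c\<in>C. \<Sum>d\<in>D. f a b c d) = (\<Sum>c\<in>C. \<Sum>d\<in>D. \<Sum>a\<in>A. \<Sum>b\<in>B. f a b c d)"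
proof -
  have "(\<Sum>a\<in>A. \<Sum>b\<in>B. \<Sum>c\<in>C. \<Sum>d\<in>D. f a b c d) = (\<Sum>a\<in>A. \<Sum>c\<in>C. \<Sum>d\<in>D. \<Sum>b\<in>B. f a b c d)"
    by (intro sum.cong refl) (subst sum.swap, intro sum.cong refl, rule sum.swap)
  also have "\<dots> = (\<Sum>c\<in>C. \<Sum>d\<in>D. \<Sum>a\<in>A. \<Sum>b\<in>B. f a b c d)"
    by (subst sum.swap, intro sum.cong refl, rule sum.swap)
  finally show ?thesis .
qed

definition elt :: "nat \<Rightarrow> nat \<Rightarrow> 'a::zero \<Rightarrow> nat \<Rightarrow> nat \<Rightarrow> 'a" where
  "elt i j a = (\<lambda>k l. if k = i \<and> l = j then a else 0)"

text \<open>Matrices whose real part is positive: a cone that contains the skew-adjoint matrices, so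
  real functionals that are nonnegative on it are determined by their values on hermitian
  matrices.\<close>

definition rpos :: "'a::ab_group_add opsys \<Rightarrow> nat \<Rightarrow> (nat \<Rightarrow> nat \<Rightarrow> 'a) set" where
  "rpos X n = {z \<in> mats n (carr X). z + madj X n z \<in> pos X n}"

context operator_system
begin

lemma carr_0: "0 \<in> carr X" by (rule subspace_0[OF subspace_carr])
lemma carr_add: "x \<in> carr X \<Longrightarrow> y \<in> carr X \<Longrightarrow> x + y \<in> carr X" by (rule subspace_add[OF subspace_carr])
lemma carr_diff: "x \<in> carr X \<Longrightarrow> y \<in> carr X \<Longrightarrow> x - y \<in> carr X" by (rule subspace_diff[OF subspace_carr])
lemma carr_neg: "x \<in> carr X \<Longrightarrow> - x \<in> carr X" by (rule subspace_neg[OF subspace_carr])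
lemma carr_scl: "x \<in> carr X \<Longrightarrow> scl X c x \<in> carr X" by (rule subspace_scale[OF subspace_carr])
lemma carr_sum: "(\<And>a. a \<in> A \<Longrightarrow> f a \<in> carr X) \<Longrightarrow> sum f A \<in> carr X" by (rule subspace_sum[OF subspace_carr])
lemmas carr_intros = carr_0 carr_add carr_diff carr_neg carr_scl carr_sum ounit_closed adj_closed

lemma adj_0: "adj X 0 = 0"
  using adj_add[OF carr_0 carr_0] by simp

lemma adj_neg: "x \<in> carr X \<Longrightarrow> adj X (- x) = - adj X x"
  using adj_scl[of x "- 1"] by simp

lemma adj_diff: "x \<in> carr X \<Longrightarrow> y \<in> carr X \<Longrightarrow> adj X (x - y) = adj X x - adj X y"
  using adj_add[of x "- y"] adj_neg[of y] carr_neg[of y] by simp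

lemma adj_sum: "(\<And>a. a \<in> A \<Longrightarrow> f a \<in> carr X) \<Longrightarrow> adj X (sum f A) = (\<Sum>a\<in>A. adj X (f a))"
  by (induction A rule: infinite_finite_induct) (auto simp: adj_0 adj_add carr_sum)

lemma mats_entry: "x \<in> mats n (carr X) \<Longrightarrow> x i j \<in> carr X"
  using carr_0 by (cases "i < n \<and> j < n") (auto simp: mats_def)

lemma mats_0: "0 \<in> mats n (carr X)" by (auto simp: mats_def carr_intros)
lemma mats_add: "x \<in> mats n (carr X) \<Longrightarrow> y \<in> mats n (carr X) \<Longrightarrow> x + y \<in> mats n (carr X)"
  by (auto simp: mats_def carr_intros)
lemma mats_diff: "x \<in> mats n (carr X) \<Longrightarrow> y \<in> mats n (carr X) \<Longrightarrow> x - y \<in> mats n (carr X)"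
  by (auto simp: mats_def carr_intros)
lemma mats_neg: "x \<in> mats n (carr X) \<Longrightarrow> - x \<in> mats n (carr X)"
  by (auto simp: mats_def carr_intros)
lemma mats_mscl: "x \<in> mats n (carr X) \<Longrightarrow> mscl X c x \<in> mats n (carr X)"
  by (auto simp: mats_def mscl_def carr_intros)
lemma mats_madj: "x \<in> mats n (carr X) \<Longrightarrow> madj X n x \<in> mats n (carr X)"
  by (auto simp: mats_def madj_def carr_intros)
lemma mats_munit: "munit X n \<in> mats n (carr X)"
  by (auto simp: mats_def munit_def carr_intros)
lemma mats_sum: "(\<And>a. a \<in> A \<Longrightarrow> f a \<in> mats n (carr X)) \<Longrightarrow> sum f A \<in> mats n (carr X)"
  by (induction A rule: infinite_finite_induct) (auto simp: mats_0 mats_add)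
lemma mats_elt: "i < n \<Longrightarrow> j < n \<Longrightarrow> a \<in> carr X \<Longrightarrow> elt i j a \<in> mats n (carr X)"
  by (auto simp: mats_def elt_def carr_intros)
lemmas mats_intros = mats_0 mats_add mats_diff mats_neg mats_mscl mats_madj mats_munit mats_sum

lemma madj_add: "x \<in> mats n (carr X) \<Longrightarrow> y \<in> mats n (carr X) \<Longrightarrow> madj X n (x + y) = madj X n x + madj X n y"
  by (auto simp: madj_def fun_eq_iff adj_add mats_entry)
lemma madj_diff: "x \<in> mats n (carr X) \<Longrightarrow> y \<in> mats n (carr X) \<Longrightarrow> madj X n (x - y) = madj X n x - madj X n y"
  by (auto simp: madj_def fun_eq_iff adj_diff mats_entry)
lemma madj_mscl: "x \<in> mats n (carr X) \<Longrightarrow> madj X n (mscl X c x) = mscl X (cnj c) (madj X n x)"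
  by (auto simp: madj_def mscl_def fun_eq_iff adj_scl mats_entry)
lemma madj_madj: "x \<in> mats n (carr X) \<Longrightarrow> madj X n (madj X n x) = x"
  by (auto simp: madj_def fun_eq_iff adj_adj mats_entry) (auto simp: mats_def)
lemma madj_munit: "madj X n (munit X n) = munit X n"
  by (auto simp: madj_def munit_def fun_eq_iff adj_ounit adj_0)

lemma mscl_simps: "mscl X (c + d) x = mscl X c x + mscl X d x" "mscl X c (x + y) = mscl X c x + mscl X c y"
  "mscl X c (x - y) = mscl X c x - mscl X c y" "mscl X (c - d) x = mscl X c x - mscl X d x"
  "mscl X c (mscl X d x) = mscl X (c * d) x" "mscl X 1 x = x" "mscl X 0 x = 0" "mscl X c 0 = 0"
  "mscl X (- c) x = - mscl X c x" "mscl X c (- x) = - mscl X c x"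
  by (auto simp: mscl_def fun_eq_iff scale_left_distrib scale_right_distrib scale_right_diff_distrib
      scale_left_diff_distrib)

lemma vector_space_mscl: "vector_space (\<lambda>r::real. mscl X (complex_of_real r))"
  by unfold_locales (auto simp: mscl_simps)

lemma subspace_mats: "module.subspace (\<lambda>r::real. mscl X (complex_of_real r)) (mats n (carr X))"
proof -
  interpret R: vector_space "\<lambda>r::real. mscl X (complex_of_real r)" by (rule vector_space_mscl)
  show ?thesis by (rule R.subspaceI) (auto simp: mats_intros)
qed

lemma hmats_mats: "x \<in> hmats X n \<Longrightarrow> x \<in> mats n (carr X)" by (simp add: hmats_def)
lemma hmats_add: "x \<in> hmats X n \<Longrightarrow> y \<in> hmats X n \<Longrightarrow> x + y \<in> hmats X n"
  by (simp add: hmats_def madj_add mats_add)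
lemma hmats_diff: "x \<in> hmats X n \<Longrightarrow> y \<in> hmats X n \<Longrightarrow> x - y \<in> hmats X n"
  by (simp add: hmats_def madj_diff mats_diff)
lemma hmats_mscl: "x \<in> hmats X n \<Longrightarrow> mscl X (complex_of_real r) x \<in> hmats X n"
  by (simp add: hmats_def madj_mscl mats_mscl)
lemma hmats_munit: "munit X n \<in> hmats X n"
  by (simp add: hmats_def madj_munit mats_munit)
lemma hmats_0: "0 \<in> hmats X n"
  using hmats_mscl[OF hmats_munit, of 0 n] by (simp add: mscl_simps)
lemma hmats_neg: "x \<in> hmats X n \<Longrightarrow> - x \<in> hmats X n"
  using hmats_diff[OF hmats_0] by fastforce
lemmas hmats_intros = hmats_add hmats_diff hmats_mscl hmats_munit hmats_0 hmats_neg

lemma pos_0: "0 \<in> pos X n"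
proof -
  obtain r where "mscl X (complex_of_real r) (munit X n) + 0 \<in> pos X n" using order_unit[OF hmats_0] by blast
  from pos_mscl[OF this, of 0] show ?thesis by (simp add: mscl_simps)
qed

lemma pos_munit: "0 \<le> r \<Longrightarrow> mscl X (complex_of_real r) (munit X n) \<in> pos X n"
proof -
  assume r: "0 \<le> r"
  obtain s where s: "s > 0" "mscl X (complex_of_real s) (munit X n) + 0 \<in> pos X n" using order_unit[OF hmats_0] by blast
  from pos_mscl[OF this(2), of "r / s"] r s show ?thesis by (simp add: mscl_simps)
qed

lemma munit_nonzero: "1 \<le> n \<Longrightarrow> munit X n \<noteq> 0"
  using ounit_nonzero by (auto simp: munit_def fun_eq_iff intro!: exI[of _ 0])

lemma munit_pos_iff:
  assumes "1 \<le> n" "mscl X (complex_of_real r) (munit X n) \<in> pos X n" shows "0 \<le> r"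
proof (rule ccontr)
  assume r: "\<not> 0 \<le> r"
  have "- mscl X (complex_of_real r) (munit X n) = mscl X (complex_of_real (- r)) (munit X n)"
    by (simp add: mscl_simps)
  then have "- mscl X (complex_of_real r) (munit X n) \<in> pos X n" using r pos_munit[of "- r"] by simp
  then have "mscl X (complex_of_real r) (munit X n) = 0" using pos_proper assms by blast
  then have "mscl X (complex_of_real (1 / r)) (mscl X (complex_of_real r) (munit X n)) = 0" by (simp add: mscl_simps)
  then show False using r munit_nonzero[OF assms(1)] by (simp add: mscl_simps)
qed

lemma rpos_mats: "z \<in> rpos X n \<Longrightarrow> z \<in> mats n (carr X)" by (simp add: rpos_def)
lemma rpos_add: "x \<in> rpos X n \<Longrightarrow> y \<in> rpos X n \<Longrightarrow> x + y \<in> rpos X n"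
  using pos_add[of "x + madj X n x" n "y + madj X n y"]
  by (simp add: rpos_def mats_add madj_add algebra_simps)
lemma rpos_mscl: "x \<in> rpos X n \<Longrightarrow> 0 \<le> r \<Longrightarrow> mscl X (complex_of_real r) x \<in> rpos X n"
  using pos_mscl[of "x + madj X n x" n r]
  by (simp add: rpos_def mats_mscl madj_mscl mscl_simps)
lemma rpos_hmats: "x \<in> hmats X n \<Longrightarrow> x \<in> rpos X n \<longleftrightarrow> x \<in> pos X n"
proof -
  assume x: "x \<in> hmats X n"
  have "x + x = mscl X (complex_of_real 2) x" using mscl_simps(1)[of 1 1 x] by (simp add: mscl_simps)
  moreover have "mscl X (complex_of_real (1/2)) (mscl X (complex_of_real 2) x) = x" by (simp add: mscl_simps)
  ultimately have "x + x \<in> pos X n \<longleftrightarrow> x \<in> pos X n"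
    using pos_mscl[of "mscl X (complex_of_real 2) x" n "1/2"] pos_mscl[of x n 2] by auto
  then show ?thesis using x by (simp add: rpos_def hmats_def)
qed
lemma rpos_skew: "x \<in> mats n (carr X) \<Longrightarrow> madj X n x = - x \<Longrightarrow> x \<in> rpos X n"
  by (simp add: rpos_def pos_0)
lemma pos_rpos: "x \<in> pos X n \<Longrightarrow> x \<in> rpos X n"
  using rpos_hmats pos_hmats by blast

lemma rpos_munit: "0 \<le> r \<Longrightarrow> mscl X (complex_of_real r) (munit X n) \<in> rpos X n"
  by (intro pos_rpos pos_munit)

lemma rpos_munit_iff: "1 \<le> n \<Longrightarrow> mscl X (complex_of_real r) (munit X n) \<in> rpos X n \<Longrightarrow> 0 \<le> r"
  using rpos_hmats[OF hmats_mscl[OF hmats_munit]] munit_pos_iff by blast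

text \<open>The order unit dominates the hermitian matrix formed by x plus its adjoint. Half of that
  constant suffices for x, since the unit is counted twice when the real part is formed.\<close>

lemma rpos_order_unit:
  assumes x: "x \<in> mats n (carr X)"
  shows "\<exists>t. mscl X (complex_of_real t) (munit X n) - x \<in> rpos X n"
proof -
  have m: "x + madj X n x \<in> hmats X n"
    using x by (simp add: hmats_def mats_intros madj_add madj_madj add.commute)
  then obtain t where "mscl X (complex_of_real t) (munit X n) + - (x + madj X n x) \<in> pos X n"
    using order_unit[OF hmats_neg[OF m]] by blast
  moreover have "mscl X (complex_of_real t) (munit X n) =
      mscl X (complex_of_real (t/2)) (munit X n) + mscl X (complex_of_real (t/2)) (munit X n)"
    by (simp add: mscl_simps(1)[symmetric] del: of_real_divide flip: of_real_add)
  ultimately have "mscl X (complex_of_real (t/2)) (munit X n) - x \<in> rpos X n"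
    using x by (simp add: rpos_def mats_intros madj_diff madj_mscl madj_munit algebra_simps)
  then show ?thesis by blast
qed

end

text \<open>The complex functional with a given real part. For hermitian x both
  \<open>\<i> x\<close> and its negative are skew-adjoint, hence in \<open>rpos\<close>, so the
  imaginary part vanishes there and positivity carries over.\<close>

lemma (in operator_system) complexify:
  assumes add: "\<And>x y. x \<in> mats n (carr X) \<Longrightarrow> y \<in> mats n (carr X) \<Longrightarrow> S (x + y) = S x + (S y :: real)"
    and scale: "\<And>r x. x \<in> mats n (carr X) \<Longrightarrow> S (mscl X (complex_of_real r) x) = r * S x"
    and S: "\<And>x. x \<in> rpos X n \<Longrightarrow> 0 \<le> S x"
  defines "T \<equiv> \<lambda>z. complex_of_real (S z) - \<i> * complex_of_real (S (mscl X \<i> z))"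
  shows "\<And>x y. x \<in> mats n (carr X) \<Longrightarrow> y \<in> mats n (carr X) \<Longrightarrow> T (x + y) = T x + T y"
    "\<And>c x. x \<in> mats n (carr X) \<Longrightarrow> T (mscl X c x) = c * T x"
    "\<And>x. x \<in> hmats X n \<Longrightarrow> T x = complex_of_real (S x)"
    "\<And>x. x \<in> pos X n \<Longrightarrow> T x \<in> \<real>\<^sub>\<ge>\<^sub>0"
proof -
  show Tadd: "T (x + y) = T x + T y" if "x \<in> mats n (carr X)" "y \<in> mats n (carr X)" for x y
    using that by (simp add: T_def mscl_simps add mats_mscl algebra_simps)
  have neg: "S (- x) = - S x" if "x \<in> mats n (carr X)" for x
    using scale[OF that, of "- 1"] by (simp add: mscl_simps)
  show "T (mscl X c x) = c * T x" if x: "x \<in> mats n (carr X)" for c x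
  proof -
    have c: "mscl X c x = mscl X (complex_of_real (Re c)) x + mscl X (complex_of_real (Im c)) (mscl X \<i> x)"
      by (simp add: mscl_simps flip: mscl_simps(1)) (simp add: complex_eq[symmetric] mult.commute)
    have "mscl X \<i> (mscl X \<i> x) = - x" by (simp add: mscl_simps)
    then have ci: "mscl X \<i> (mscl X c x) = mscl X (complex_of_real (Re c)) (mscl X \<i> x) - mscl X (complex_of_real (Im c)) x"
      unfolding c by (simp add: mscl_simps mult.commute)
    have 1: "S (mscl X c x) = Re c * S x + Im c * S (mscl X \<i> x)"
      unfolding c using x by (simp add: add scale mats_mscl)
    have "S (mscl X \<i> (mscl X c x)) = S (mscl X (complex_of_real (Re c)) (mscl X \<i> x) + - mscl X (complex_of_real (Im c)) x)"
      unfolding ci by simp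
    also have "\<dots> = Re c * S (mscl X \<i> x) - Im c * S x"
      using x by (subst add) (simp_all add: mats_mscl mats_neg neg scale)
    finally show ?thesis unfolding T_def 1
      by (simp add: complex_eq_iff algebra_simps)
  qed
  show herm: "T x = complex_of_real (S x)" if x: "x \<in> hmats X n" for x
  proof -
    have m: "x \<in> mats n (carr X)" "madj X n x = x" using x by (auto simp: hmats_def)
    have "mscl X \<i> x \<in> rpos X n" "mscl X (- \<i>) x \<in> rpos X n"
      using m by (auto intro!: rpos_skew mats_mscl simp: madj_mscl[OF m(1)] simp del: mscl_simps(9))
        (simp_all add: mscl_simps)
    then have "0 \<le> S (mscl X \<i> x)" "0 \<le> S (- mscl X \<i> x)" using S by (auto simp: mscl_simps)
    then have "S (mscl X \<i> x) = 0" using neg[OF mats_mscl[OF m(1)]] by fastforce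
    then show ?thesis by (simp add: T_def)
  qed
  show "T x \<in> \<real>\<^sub>\<ge>\<^sub>0" if "x \<in> pos X n" for x
    using herm S pos_hmats pos_rpos that by (auto simp: subset_eq)
qed

lemma (in operator_system) additive_sum:
  assumes add: "\<And>x y. x \<in> mats n (carr X) \<Longrightarrow> y \<in> mats n (carr X) \<Longrightarrow> T (x + y) = T x + T y"
    and f: "\<And>a. a \<in> A \<Longrightarrow> f a \<in> mats n (carr X)"
  shows "T (sum f A) = (\<Sum>a\<in>A. T (f a) :: 'b::ab_group_add)"
proof -
  have "T 0 = 0" using add[OF mats_0 mats_0] by simp
  then show ?thesis using f
    by (induction A rule: infinite_finite_induct) (auto simp: add mats_sum)
qed

section \<open>Functionals on matrices as maps into matrix algebras\<close>

lemma mats_elt_sum: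
  assumes "x \<in> mats n S" shows "x = (\<Sum>i<n. \<Sum>j<n. elt i j (x i j :: 'a::comm_monoid_add))"
proof (intro ext)
  fix k l
  have "(\<Sum>i<n. \<Sum>j<n. elt i j (x i j)) k l = (\<Sum>i<n. \<Sum>j<n. if l = j then if k = i then x i j else 0 else 0)"
    unfolding sum_fun_apply2 by (intro sum.cong refl) (simp add: elt_def)
  also have "\<dots> = (if k < n \<and> l < n then x k l else 0)" by (cases "l < n") simp_all
  also have "\<dots> = x k l" using assms by (auto simp: mats_def)
  finally show "x k l = (\<Sum>i<n. \<Sum>j<n. elt i j (x i j)) k l" by simp
qed

lemma elt_simps: "elt i j (a + b) = elt i j a + elt i j (b::'a::ab_group_add)" "elt i j (0::'a) = 0"
  by (auto simp: elt_def fun_eq_iff)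

lemma matalg_sel [simp]: "carr (matalg n) = mats n UNIV" "scl (matalg n) = (\<lambda>c A i j. c * A i j)"
  "adj (matalg n) = (\<lambda>A i j. cnj (A j i))" "ounit (matalg n) = (\<lambda>i j. if i < n \<and> i = j then 1 else 0)"
  by (simp_all add: matalg_def)

text \<open>The usual correspondence between functionals on n x n matrices over an operator system
  and linear maps from the system into the n x n matrices, without the factor 1 / n: the functional
  is recovered as the plain sum in \<open>choi_trace\<close>.\<close>

definition choi :: "nat \<Rightarrow> ((nat \<Rightarrow> nat \<Rightarrow> 'a::zero) \<Rightarrow> complex) \<Rightarrow> 'a \<Rightarrow> nat \<Rightarrow> nat \<Rightarrow> complex" where
  "choi n T a = (\<lambda>i j. if i < n \<and> j < n then T (elt i j a) else 0)"

context operator_system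
begin

lemma choi_linear:
  assumes add: "\<And>x y. x \<in> mats n (carr X) \<Longrightarrow> y \<in> mats n (carr X) \<Longrightarrow> T (x + y) = T x + T y"
    and scale: "\<And>c x. x \<in> mats n (carr X) \<Longrightarrow> T (mscl X c x) = c * T x"
  shows "linear_into (scl X) (carr X) (scl (matalg n)) (carr (matalg n)) (choi n T)"
proof -
  have e: "elt i j (scl X c a) = mscl X c (elt i j a)" for i j c a
    by (auto simp: elt_def mscl_def fun_eq_iff)
  show ?thesis unfolding linear_into_def matalg_sel
  proof (intro conjI ballI allI)
    show "choi n T ` carr X \<subseteq> mats n UNIV" by (auto simp: choi_def mats_def)
    show "choi n T (x + y) = choi n T x + choi n T y" if "x \<in> carr X" "y \<in> carr X" for x y
      using that by (intro ext) (simp add: choi_def elt_simps add mats_elt)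
    show "choi n T (scl X c x) = (\<lambda>i j. c * choi n T x i j)" if "x \<in> carr X" for c x
      using that by (intro ext) (simp add: choi_def e scale mats_elt)
  qed
qed

lemma choi_trace:
  assumes add: "\<And>x y. x \<in> mats n (carr X) \<Longrightarrow> y \<in> mats n (carr X) \<Longrightarrow> T (x + y) = T x + T y"
    and x: "x \<in> mats n (carr X)"
  shows "(\<Sum>i<n. \<Sum>j<n. choi n T (x i j) i j) = T x"
proof -
  have "T x = T (\<Sum>i<n. \<Sum>j<n. elt i j (x i j))" using mats_elt_sum[OF x] by simp
  also have "\<dots> = (\<Sum>i<n. T (\<Sum>j<n. elt i j (x i j)))"
    by (rule additive_sum[of n T]) (auto intro!: add mats_sum mats_elt mats_entry[OF x])
  also have "\<dots> = (\<Sum>i<n. \<Sum>j<n. T (elt i j (x i j)))"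
    by (intro sum.cong refl additive_sum[of n T]) (auto intro!: add mats_sum mats_elt mats_entry[OF x])
  finally show ?thesis by (simp add: choi_def)
qed

text \<open>A vector \<xi> at amplification level m, read as an m x n scalar matrix, compresses an m
  x m matrix z over \<open>X\<close> to an n x n matrix, and the quadratic form at \<xi> is the
  value of T on this compression. So positivity of T at the single level n gives positivity of the
  map at all levels.\<close>

lemma choi_cp:
  assumes add: "\<And>x y. x \<in> mats n (carr X) \<Longrightarrow> y \<in> mats n (carr X) \<Longrightarrow> T (x + y) = T x + T y"
    and scale: "\<And>c x. x \<in> mats n (carr X) \<Longrightarrow> T (mscl X c x) = c * T x"
    and T: "\<And>x. x \<in> pos X n \<Longrightarrow> T x \<in> \<real>\<^sub>\<ge>\<^sub>0"
  shows "cp_map X (matalg n) (choi n T)"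
  unfolding cp_map_def
proof (intro conjI ballI allI)
  show lin: "linear_into (scl X) (carr X) (scl (matalg n)) (carr (matalg n)) (choi n T)"
    by (rule choi_linear[OF add scale])
  fix m z assume z: "z \<in> pos X m"
  have zm: "z \<in> mats m (carr X)" by (rule pos_mats[OF z])
  note lin' = lin[unfolded linear_into_def]
  have sum: "choi n T (sum f A) i j = (\<Sum>a\<in>A. choi n T (f a) i j)" if "\<And>a. a \<in> A \<Longrightarrow> f a \<in> carr X"
    for f :: "nat \<Rightarrow> 'a" and A i j
    using that
  proof (induction A rule: infinite_finite_induct)
    case (insert a A)
    then have "choi n T (f a + sum f A) = choi n T (f a) + choi n T (sum f A)"
      using lin' carr_sum[of A f] by blast
    then show ?case using insert by simp
  qed (use linear_into_0[OF lin carr_0] in auto)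
  show "amp (choi n T) z \<in> pos (matalg n) m"
    unfolding matalg_pos mem_Collect_eq
  proof (intro conjI allI)
    show "amp (choi n T) z \<in> mats m (mats n UNIV)"
      by (rule amp_mats[OF zm]) (use lin' linear_into_0[OF lin carr_0] in auto)
    fix \<xi>
    let ?c = "compress X m n \<xi> z"
    have c: "?c \<in> pos X n" by (rule pos_compress[OF z])
    have "sesq m n (amp (choi n T) z) \<xi> \<xi> =
       (\<Sum>i<n. \<Sum>j<n. \<Sum>k<m. \<Sum>l<m. cnj (\<xi> k i) * choi n T (z k l) i j * \<xi> l j)"
      unfolding sesq_def amp_def by (rule sum_swap22)
    also have "\<dots> = (\<Sum>i<n. \<Sum>j<n. choi n T (?c i j) i j)"
    proof (intro sum.cong refl)
      fix i j assume "i \<in> {..<n}" "j \<in> {..<n}"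
      have s: "choi n T (scl X c (z k l)) i j = c * choi n T (z k l) i j" for c k l
        using lin' mats_entry[OF zm, of k l] by auto
      show "(\<Sum>k<m. \<Sum>l<m. cnj (\<xi> k i) * choi n T (z k l) i j * \<xi> l j) = choi n T (?c i j) i j"
        using \<open>i \<in> {..<n}\<close> \<open>j \<in> {..<n}\<close>
        by (simp add: compress_def sum carr_intros mats_entry[OF zm] s algebra_simps)
    qed
    also have "\<dots> = T ?c" by (rule choi_trace[OF add pos_mats[OF c]])
    finally show "sesq m n (amp (choi n T) z) \<xi> \<xi> \<in> \<real>\<^sub>\<ge>\<^sub>0" using T[OF c] by simp
  qed
qed

end

lemma sum_lessThan_add: "(\<Sum>p<a + b. f p) = (\<Sum>p<a. f p) + (\<Sum>p<b. f (a + p) :: 'a::comm_monoid_add)"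
  for a b :: nat
  by (induction b) (auto simp: add.assoc)

lemma sum_rotate: "(\<Sum>a\<in>A. \<Sum>b\<in>B. \<Sum>c\<in>C. f a b c) = (\<Sum>c\<in>C. \<Sum>a\<in>A. \<Sum>b\<in>B. f a b c)"
proof -
  have "(\<Sum>a\<in>A. \<Sum>b\<in>B. \<Sum>c\<in>C. f a b c) = (\<Sum>a\<in>A. \<Sum>c\<in>C. \<Sum>b\<in>B. f a b c)"
    by (rule sum.cong[OF refl], rule sum.swap)
  also have "\<dots> = (\<Sum>c\<in>C. \<Sum>a\<in>A. \<Sum>b\<in>B. f a b c)" by (rule sum.swap)
  finally show ?thesis .
qed

section \<open>Cholesky factorization\<close>

text \<open>Induction on the size by Schur complements. The inverse D of the triangular factor is
  carried along as a witness, because every application conjugates by the inverse or divides by the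
  factor; this is why the form has to be strictly positive.\<close>

lemma cholesky:
  fixes P :: "nat \<Rightarrow> nat \<Rightarrow> complex"
  assumes "\<And>i j. i < n \<Longrightarrow> j < n \<Longrightarrow> P j i = cnj (P i j)"
    and "\<And>x. \<exists>i<n. x i \<noteq> 0 \<Longrightarrow> 0 < Re (\<Sum>i<n. \<Sum>j<n. cnj (x i) * P i j * x j)"
  shows "\<exists>T D. (\<forall>i<n. \<forall>j<n. P i j = (\<Sum>k<n. cnj (T k i) * T k j)) \<and>
    (\<forall>i<n. \<forall>j<n. (\<Sum>k<n. D i k * T k j) = (if i = j then 1 else 0)) \<and>
    (\<forall>i<n. \<forall>j<n. (\<Sum>k<n. T i k * D k j) = (if i = j then 1 else 0))"
  using assms
proof (induction n)
  case 0
  then show ?case by simp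
next
  case (Suc n)
  have "0 < Re (\<Sum>i<n. \<Sum>j<n. cnj (x i) * P i j * x j)" if "\<exists>i<n. x i \<noteq> 0" for x
  proof -
    have "\<exists>i<Suc n. (if i < n then x i else 0) \<noteq> 0" using that less_SucI by auto
    from Suc.prems(2)[OF this] show ?thesis by simp
  qed
  then have "\<exists>T D. (\<forall>i<n. \<forall>j<n. P i j = (\<Sum>k<n. cnj (T k i) * T k j)) \<and>
    (\<forall>i<n. \<forall>j<n. (\<Sum>k<n. D i k * T k j) = (if i = j then 1 else 0)) \<and>
    (\<forall>i<n. \<forall>j<n. (\<Sum>k<n. T i k * D k j) = (if i = j then 1 else 0))"
    by (intro Suc.IH) (auto intro: Suc.prems(1))
  then obtain T D where *: "\<forall>i<n. \<forall>j<n. P i j = (\<Sum>k<n. cnj (T k i) * T k j)"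
    "\<forall>i<n. \<forall>j<n. (\<Sum>k<n. D i k * T k j) = (if i = j then 1 else 0)"
    "\<forall>i<n. \<forall>j<n. (\<Sum>k<n. T i k * D k j) = (if i = j then 1 else 0)"
    by (elim exE conjE)
  have T: "P i j = (\<Sum>k<n. cnj (T k i) * T k j)" if "i < n" "j < n" for i j
    using *(1) that by simp
  have DT: "(\<Sum>k<n. D i k * T k j) = (if i = j then 1 else 0)" if "i < n" "j < n" for i j
    using *(2) that by simp
  have TD: "(\<Sum>k<n. T i k * D k j) = (if i = j then 1 else 0)" if "i < n" "j < n" for i j
    using *(3) that by simp
  \<comment> \<open>With p the new column of P, w solves the equation (adjoint of T) w = p, and u =
    D w then solves P u = p.\<close>
  define w where "w k = (\<Sum>i<n. cnj (D i k) * P i n)" for k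
  define u where "u i = (\<Sum>k<n. D i k * w k)" for i
  have Tw: "(\<Sum>k<n. cnj (T k i) * w k) = P i n" if "i < n" for i
  proof -
    have "(\<Sum>k<n. cnj (T k i) * w k) = (\<Sum>k<n. \<Sum>m<n. cnj (D m k * T k i) * P m n)"
      by (simp add: w_def sum_distrib_left mult_ac)
    also have "\<dots> = (\<Sum>m<n. cnj (\<Sum>k<n. D m k * T k i) * P m n)"
      by (subst sum.swap) (simp add: sum_distrib_right)
    also have "\<dots> = (\<Sum>m<n. if m = i then P m n else 0)"
      by (intro sum.cong refl) (use DT that in auto)
    finally show ?thesis using that by simp
  qed
  have Tu: "(\<Sum>i<n. T k i * u i) = w k" if "k < n" for k
  proof -
    have "(\<Sum>i<n. T k i * u i) = (\<Sum>m<n. (\<Sum>i<n. T k i * D i m) * w m)"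
      unfolding u_def sum_distrib_left sum_distrib_right by (subst sum.swap) (simp add: mult_ac)
    also have "\<dots> = (\<Sum>m<n. if m = k then w m else 0)"
      by (intro sum.cong refl) (use TD that in auto)
    finally show ?thesis using that by simp
  qed
  define \<nu> where "\<nu> = (\<Sum>k<n. (cmod (w k))\<^sup>2)"
  have \<nu>: "complex_of_real \<nu> = (\<Sum>k<n. cnj (w k) * w k)"
    unfolding \<nu>_def of_real_sum by (intro sum.cong refl) (simp only: complex_norm_square mult.commute)
  have up: "(\<Sum>i<n. cnj (u i) * P i n) = complex_of_real \<nu>"
  proof -
    have "(\<Sum>i<n. cnj (u i) * P i n) = (\<Sum>i<n. \<Sum>k<n. cnj (T k i * u i) * w k)"
      by (intro sum.cong refl) (simp add: Tw[symmetric] sum_distrib_left mult_ac)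
    also have "\<dots> = (\<Sum>k<n. cnj (\<Sum>i<n. T k i * u i) * w k)"
      by (subst sum.swap) (simp add: sum_distrib_right)
    also have "\<dots> = complex_of_real \<nu>"
      unfolding \<nu> by (intro sum.cong refl) (simp add: Tu)
    finally show ?thesis .
  qed
  have uPu: "(\<Sum>i<n. \<Sum>j<n. cnj (u i) * P i j * u j) = complex_of_real \<nu>"
  proof -
    have "(\<Sum>i<n. \<Sum>j<n. cnj (u i) * P i j * u j) = (\<Sum>i<n. \<Sum>k<n. \<Sum>j<n. cnj (u i) * cnj (T k i) * (T k j * u j))"
    proof (rule sum.cong[OF refl])
      fix i assume i: "i \<in> {..<n}"
      have "(\<Sum>j<n. cnj (u i) * P i j * u j) = (\<Sum>j<n. \<Sum>k<n. cnj (u i) * cnj (T k i) * (T k j * u j))"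
        using i by (intro sum.cong refl) (simp add: T sum_distrib_left sum_distrib_right mult_ac)
      then show "(\<Sum>j<n. cnj (u i) * P i j * u j) = (\<Sum>k<n. \<Sum>j<n. cnj (u i) * cnj (T k i) * (T k j * u j))"
        using sum.swap by simp
    qed
    also have "\<dots> = (\<Sum>i<n. cnj (u i) * (\<Sum>k<n. cnj (T k i) * w k))"
    proof (rule sum.cong[OF refl])
      fix i
      have "(\<Sum>j<n. cnj (u i) * cnj (T k i) * (T k j * u j)) = cnj (u i) * (cnj (T k i) * w k)" if "k < n" for k
        unfolding sum_distrib_left[symmetric] Tu[OF that] by (simp add: mult.assoc)
      then show "(\<Sum>k<n. \<Sum>j<n. cnj (u i) * cnj (T k i) * (T k j * u j)) = cnj (u i) * (\<Sum>k<n. cnj (T k i) * w k)"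
        by (simp add: sum_distrib_left)
    qed
    also have "\<dots> = (\<Sum>i<n. cnj (u i) * P i n)" by (simp add: Tw)
    finally show ?thesis using up by simp
  qed
  have Pn: "P n i = cnj (P i n)" if "i < Suc n" for i using Suc.prems(1)[of i n] that by simp
  have pu: "(\<Sum>i<n. P n i * u i) = complex_of_real \<nu>"
  proof -
    have "(\<Sum>i<n. P n i * u i) = cnj (\<Sum>i<n. cnj (u i) * P i n)"
      by (simp add: Pn mult.commute)
    then show ?thesis by (simp add: up)
  qed
  \<comment> \<open>At the vector (-u, 1) the form takes the value of the Schur complement
    \<open>P n n - \<nu>\<close>, which is therefore positive and has a square root \<tau>.\<close>
  let ?x = "\<lambda>i. if i = n then 1 else - u i"
  have "(\<Sum>i<Suc n. \<Sum>j<Suc n. cnj (?x i) * P i j * ?x j) = (\<Sum>i<n. \<Sum>j<n. cnj (u i) * P i j * u j)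
     - (\<Sum>i<n. cnj (u i) * P i n) - (\<Sum>i<n. P n i * u i) + P n n"
    by (simp add: sum.distrib sum_negf sum_subtractf)
  then have "(\<Sum>i<Suc n. \<Sum>j<Suc n. cnj (?x i) * P i j * ?x j) = P n n - complex_of_real \<nu>"
    by (simp add: up pu uPu)
  moreover have "0 < Re (\<Sum>i<Suc n. \<Sum>j<Suc n. cnj (?x i) * P i j * ?x j)"
    by (rule Suc.prems(2)) (auto intro!: exI[of _ n])
  ultimately have "0 < Re (P n n - complex_of_real \<nu>)" by (simp only:)
  then have \<tau>pos: "0 < Re (P n n) - \<nu>" by simp
  define \<tau> where "\<tau> = sqrt (Re (P n n) - \<nu>)"
  have \<tau>: "\<tau> \<noteq> 0" "\<tau> * \<tau> = Re (P n n) - \<nu>" using \<tau>pos by (auto simp: \<tau>_def)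
  have Pnn: "P n n = complex_of_real \<nu> + complex_of_real \<tau> * complex_of_real \<tau>"
    using arg_cong[OF Pn[of n], of Im] unfolding of_real_mult[symmetric] \<tau>(2) by (simp add: complex_eq_iff)
  \<comment> \<open>Block form: T bordered by the column w, a zero row and the corner \<tau>. D' is
    the block inverse, with border column - u / \<tau> and corner 1 / \<tau>.\<close>
  define T' where "T' k i = (if k < n \<and> i < n then T k i else if k < n then w k else if i < n then 0 else complex_of_real \<tau>)" for k i
  define D' where "D' i k = (if k < n \<and> i < n then D i k else if i < n then - u i / complex_of_real \<tau> else if k < n then 0 else 1 / complex_of_real \<tau>)" for k i
  have ww: "(\<Sum>k<n. cnj (T k i) * w k) = P i n" "(\<Sum>k<n. cnj (w k) * T k i) = P n i" if "i < n" for i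
  proof -
    show "(\<Sum>k<n. cnj (T k i) * w k) = P i n" by (rule Tw[OF that])
    then have "P n i = cnj (\<Sum>k<n. cnj (T k i) * w k)" using Pn that by simp
    then show "(\<Sum>k<n. cnj (w k) * T k i) = P n i" by (simp add: mult.commute)
  qed
  have "\<forall>i<Suc n. \<forall>j<Suc n. P i j = (\<Sum>k<Suc n. cnj (T' k i) * T' k j)"
    by (auto simp: less_Suc_eq T'_def T ww Pnn \<nu>)
  moreover have "(\<Sum>k<Suc n. D' i k * T' k j) = (if i = j then 1 else 0)" if "i < Suc n" "j < Suc n" for i j
    using that \<tau>(1) by (auto simp: less_Suc_eq T'_def D'_def DT u_def)
  moreover have "(\<Sum>k<Suc n. T' i k * D' k j) = (if i = j then 1 else 0)" if "i < Suc n" "j < Suc n" for i j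
  proof -
    have "(\<Sum>k<n. T i k * (- u k / complex_of_real \<tau>)) = - w i / complex_of_real \<tau>" if "i < n"
      using Tu[OF that] by (simp add: sum_negf sum_divide_distrib[symmetric])
    then show ?thesis
      using that \<tau>(1) by (auto simp: less_Suc_eq T'_def D'_def TD)
  qed
  ultimately show ?case by blast
qed

lemma sum_nonneg_Reals: "(\<And>a. a \<in> A \<Longrightarrow> f a \<in> \<real>\<^sub>\<ge>\<^sub>0) \<Longrightarrow> sum f A \<in> (\<real>\<^sub>\<ge>\<^sub>0 :: complex set)"
  by (induction A rule: infinite_finite_induct) auto

section \<open>Unital completely positive maps into matrix algebras\<close>

definition ucp :: "'a::ab_group_add opsys \<Rightarrow> nat \<Rightarrow> ('a \<Rightarrow> nat \<Rightarrow> nat \<Rightarrow> complex) \<Rightarrow> bool" where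
  "ucp X k f \<longleftrightarrow> 1 \<le> k \<and> cp_map X (matalg k) f \<and> f (ounit X) = ounit (matalg k)"

lemma cp_map_linear:
  assumes "cp_map X Y f"
  shows "x \<in> carr X \<Longrightarrow> f x \<in> carr Y"
    "x \<in> carr X \<Longrightarrow> y \<in> carr X \<Longrightarrow> f (x + y) = f x + f y"
    "x \<in> carr X \<Longrightarrow> f (scl X c x) = scl Y c (f x)"
    "z \<in> pos X n \<Longrightarrow> amp f z \<in> pos Y n"
  using assms by (auto simp: cp_map_def linear_into_def)

lemma cp_map_0:
  assumes "operator_system X" "cp_map X Y f" shows "f 0 = (0::'b::ab_group_add)"
  using linear_into_0[of "scl X" "carr X" "scl Y" "carr Y" f] assms operator_system.carr_0[OF assms(1)]
  by (auto simp: cp_map_def)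

lemma cp_map_mats:
  assumes "operator_system X" "cp_map X Y f" "x \<in> mats n (carr X)" shows "amp f x \<in> mats n (carr Y)"
  by (rule amp_mats[OF assms(3)]) (use cp_map_linear(1)[OF assms(2)] cp_map_0[OF assms(1,2)] in auto)

text \<open>Positive matrices are hermitian, and the order unit shifts every self-adjoint element
  into the cone, so images of self-adjoint elements are self-adjoint. With y the adjoint of x, the
  self-adjoint elements x + y and i x - i y determine the images of both.\<close>

lemma cp_map_adj:
  assumes X: "operator_system X" and Y: "operator_system Y" and f: "cp_map X Y f" and x: "x \<in> carr X"
  shows "f (adj X x) = adj Y (f x)"
proof -
  interpret X: operator_system X by fact
  interpret Y: operator_system Y by fact
  note lin = cp_map_linear[OF f] and f0 = cp_map_0[OF X f]
  have herm: "adj Y (f a) = f a" if "elt 0 0 a \<in> pos X 1" for a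
  proof -
    have "amp f (elt 0 0 a) \<in> hmats Y 1" using lin(4)[OF that] Y.pos_hmats by blast
    then have "madj Y 1 (amp f (elt 0 0 a)) 0 0 = amp f (elt 0 0 a) 0 0" by (simp add: hmats_def)
    then show ?thesis by (simp add: madj_def amp_def elt_def)
  qed
  have sa: "adj Y (f a) = f a" if a: "a \<in> carr X" "adj X a = a" for a
  proof -
    have e: "elt 0 0 a \<in> hmats X 1" using a by (auto simp: hmats_def mats_def madj_def fun_eq_iff elt_def)
    obtain r where r: "r > 0" "mscl X (complex_of_real r) (munit X 1) + elt 0 0 a \<in> pos X 1"
      using X.order_unit[OF e] by blast
    let ?u = "scl X (complex_of_real r) (ounit X)"
    have u: "?u \<in> carr X" by (intro X.carr_intros)
    have 1: "mscl X (complex_of_real r) (munit X 1) = elt 0 0 ?u"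
      by (auto simp: mscl_def munit_def elt_def fun_eq_iff)
    have "adj Y (f ?u) = f ?u" using X.pos_munit[of r 1] r(1) herm unfolding 1 by simp
    moreover have "adj Y (f (?u + a)) = f (?u + a)" using r(2) herm unfolding 1 elt_simps(1)[symmetric] by simp
    ultimately show ?thesis using a u by (simp add: lin Y.adj_add)
  qed
  let ?b = "adj X x"
  have b: "?b \<in> carr X" by (intro X.carr_intros x)
  have fx: "f x \<in> carr Y" "f ?b \<in> carr Y" using lin(1) x b by auto
  have 1: "adj Y (f (x + ?b)) = f (x + ?b)"
    by (rule sa) (auto simp: x b X.carr_intros X.adj_add X.adj_adj add.commute)
  have 2: "adj Y (f (scl X \<i> x + scl X (- \<i>) ?b)) = f (scl X \<i> x + scl X (- \<i>) ?b)"
    by (rule sa) (auto simp: x b X.carr_intros X.adj_add X.adj_adj X.adj_scl add.commute simp del: X.scale_minus_left)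
  have e1: "adj Y (f x) + adj Y (f ?b) = f x + f ?b"
    using 1 x b fx by (simp add: lin Y.adj_add)
  have e2: "scl Y (- \<i>) (adj Y (f x)) + scl Y \<i> (adj Y (f ?b)) = scl Y \<i> (f x) + scl Y (- \<i>) (f ?b)"
    using 2 x b fx
    by (simp add: lin Y.adj_add Y.adj_scl X.carr_scl Y.carr_scl del: X.scale_minus_left Y.scale_minus_left)
  have "scl Y \<i> (scl Y (- \<i>) (adj Y (f x)) + scl Y \<i> (adj Y (f ?b))) = scl Y \<i> (scl Y \<i> (f x) + scl Y (- \<i>) (f ?b))"
    by (simp only: e2)
  then have 3: "adj Y (f x) - adj Y (f ?b) = - f x + f ?b"
    by (simp add: Y.scale_right_distrib Y.scale_right_diff_distrib)
  have "adj Y (f x) + adj Y (f x) = (adj Y (f x) + adj Y (f ?b)) + (adj Y (f x) - adj Y (f ?b))"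
    by simp
  also have "\<dots> = f ?b + f ?b" unfolding e1 3 by simp
  finally have "scl Y (1 + 1) (adj Y (f x)) = scl Y (1 + 1) (f ?b)"
    by (simp only: Y.scale_left_distrib Y.scale_one)
  then have "scl Y (1/2) (scl Y 2 (adj Y (f x))) = scl Y (1/2) (scl Y 2 (f ?b))" by simp
  then show ?thesis by (simp only: Y.scale_scale) simp
qed

definition conj_mat :: "nat \<Rightarrow> nat \<Rightarrow> (nat \<Rightarrow> nat \<Rightarrow> complex) \<Rightarrow> (nat \<Rightarrow> nat \<Rightarrow> complex) \<Rightarrow> nat \<Rightarrow> nat \<Rightarrow> complex" where
  "conj_mat n m D B = (\<lambda>i j. if i < m \<and> j < m then \<Sum>k<n. \<Sum>l<n. cnj (D k i) * B k l * D l j else 0)"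

text \<open>The scalar matrix D moves from the matrix to the vectors, so positivity after
  conjugation follows from positivity before it.\<close>

lemma sesq_conj_mat:
  "sesq a m (amp (\<lambda>x. conj_mat n m D (\<Phi> x)) z) \<xi> \<eta> =
   sesq a n (amp \<Phi> z) (\<lambda>b k. \<Sum>i<m. D k i * \<xi> b i) (\<lambda>b k. \<Sum>i<m. D k i * \<eta> b i)"
proof -
  have *: "(\<Sum>p<m. \<Sum>q<m. cnj (\<xi> b p) * amp (\<lambda>x. conj_mat n m D (\<Phi> x)) z b c p q * \<eta> c q) =
    (\<Sum>k<n. \<Sum>l<n. cnj (\<Sum>i<m. D k i * \<xi> b i) * amp \<Phi> z b c k l * (\<Sum>i<m. D l i * \<eta> c i))" for b c
  proof -
  have "(\<Sum>p<m. \<Sum>q<m. cnj (\<xi> b p) * amp (\<lambda>x. conj_mat n m D (\<Phi> x)) z b c p q * \<eta> c q) =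
    (\<Sum>p<m. \<Sum>q<m. \<Sum>k<n. \<Sum>l<n. cnj (\<xi> b p) * (cnj (D k p) * \<Phi> (z b c) k l * D l q) * \<eta> c q)"
    by (intro sum.cong refl) (simp add: amp_def conj_mat_def sum_distrib_left sum_distrib_right)
  also have "\<dots> = (\<Sum>k<n. \<Sum>l<n. \<Sum>p<m. \<Sum>q<m. cnj (\<xi> b p) * (cnj (D k p) * \<Phi> (z b c) k l * D l q) * \<eta> c q)"
    by (rule sum_swap22)
  also have "\<dots> = (\<Sum>k<n. \<Sum>l<n. cnj (\<Sum>i<m. D k i * \<xi> b i) * amp \<Phi> z b c k l * (\<Sum>i<m. D l i * \<eta> c i))"
    by (intro sum.cong refl) (simp add: amp_def sum_distrib_left sum_distrib_right mult_ac)
  finally show ?thesis .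
  qed
  show ?thesis unfolding sesq_def * ..
qed

lemma cp_map_matalgI:
  assumes X: "operator_system X" and lin: "linear_into (scl X) (carr X) (scl (matalg k)) (carr (matalg k)) f"
    and pos: "\<And>n z \<xi>. z \<in> pos X n \<Longrightarrow> sesq n k (amp f z) \<xi> \<xi> \<in> \<real>\<^sub>\<ge>\<^sub>0"
  shows "cp_map X (matalg k) f"
proof -
  have "amp f z \<in> mats n (mats k UNIV)" if "z \<in> pos X n" for z n
    by (rule amp_mats[OF operator_system.pos_mats[OF X that]])
      (use lin linear_into_0[OF lin] operator_system.carr_0[OF X] in \<open>auto simp: linear_into_def\<close>)
  then show ?thesis using lin pos by (auto simp: cp_map_def matalg_pos)
qed

lemma cp_map_sesq:
  assumes "cp_map X (matalg k) f" "z \<in> pos X n"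
  shows "sesq n k (amp f z) \<xi> \<xi> \<in> \<real>\<^sub>\<ge>\<^sub>0"
  using cp_map_linear(4)[OF assms] by (simp add: matalg_pos)

lemma cp_map_conj_mat:
  assumes X: "operator_system X" and f: "cp_map X (matalg n) f"
  shows "cp_map X (matalg m) (\<lambda>x. conj_mat n m D (f x))"
proof (rule cp_map_matalgI[OF X])
  note lin = cp_map_linear[OF f]
  show "linear_into (scl X) (carr X) (scl (matalg m)) (carr (matalg m)) (\<lambda>x. conj_mat n m D (f x))"
    unfolding linear_into_def matalg_sel
  proof (intro conjI ballI allI)
    show "(\<lambda>x. conj_mat n m D (f x)) ` carr X \<subseteq> mats m UNIV" by (auto simp: conj_mat_def mats_def)
    show "conj_mat n m D (f (x + y)) = conj_mat n m D (f x) + conj_mat n m D (f y)" if "x \<in> carr X" "y \<in> carr X" for x y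
      unfolding lin(2)[OF that]
      by (intro ext) (simp add: conj_mat_def algebra_simps sum.distrib)
    show "conj_mat n m D (f (scl X c x)) = (\<lambda>i j. c * conj_mat n m D (f x) i j)" if "x \<in> carr X" for x c
      unfolding lin(3)[OF that]
      by (intro ext) (simp add: conj_mat_def sum_distrib_left mult_ac)
  qed
qed (simp add: sesq_conj_mat cp_map_sesq[OF f])

text \<open>At this maximally entangled vector the form becomes the pairing that recovers a
  functional from its Choi map.\<close>

lemma sesq_unit_vectors:
  "sesq n n x (\<lambda>i p. if i = p then 1 else 0) (\<lambda>i p. if i = p then 1 else 0) = (\<Sum>i<n. \<Sum>j<n. x i j i j)"
proof -
  have "sesq n n x (\<lambda>i p. if i = p then 1 else 0) (\<lambda>i p. if i = p then 1 else 0) =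
    (\<Sum>i<n. \<Sum>j<n. \<Sum>p<n. if p = i then \<Sum>q<n. if q = j then x i j p q else 0 else 0)"
    unfolding sesq_def
  proof (rule sum.cong[OF refl], rule sum.cong[OF refl], rule sum.cong[OF refl])
    fix i j p
    show "(\<Sum>q<n. cnj (if i = p then 1 else 0) * x i j p q * (if j = q then 1 else 0)) =
      (if p = i then \<Sum>q<n. if q = j then x i j p q else 0 else 0)"
    proof -
      have "(\<Sum>q<n. cnj (if i = p then 1 else 0) * x i j p q * (if j = q then 1 else 0)) =
        (\<Sum>q<n. if q = j then if p = i then x i j p q else 0 else 0)"
        by (rule sum.cong[OF refl]) auto
      then show ?thesis by auto
    qed
  qed
  then show ?thesis by simp
qed

section \<open>Separation of non-positive matrices\<close>

text \<open>A functional that separates x from the cone at level n becomes a completely positive map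
  into n x n matrices by the Choi correspondence. That map need not be unital, and its value at the
  unit may be singular; so the functional is perturbed first, and the map is then normalized by a
  Cholesky factor.\<close>

theorem separating_ucp:
  assumes X: "operator_system X" and x: "x \<in> hmats X n" and npos: "x \<notin> pos X n"
  shows "\<exists>f. ucp X n f \<and> amp f x \<notin> pos (matalg n) n"
proof -
  interpret operator_system X by fact
  let ?r = "\<lambda>r::real. mscl X (complex_of_real r)"
  have n: "1 \<le> n"
  proof (rule ccontr)
    assume "\<not> 1 \<le> n"
    then have "x = 0" using x by (auto simp: hmats_def mats_def fun_eq_iff)
    then show False using npos pos_0 by simp
  qed
  have xm: "x \<in> mats n (carr X)" using x by (rule hmats_mats)
  \<comment> \<open>The Archimedean property leaves a gap r0 between x and the cone. This gap makes
    the separating functional strictly negative at x, which leaves room for the later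
    perturbation.\<close>
  obtain r0 where r0: "r0 > 0" "?r r0 (munit X n) + x \<notin> pos X n"
    using archimedean[OF x] npos by blast
  define G where "G = (\<lambda>w t. ?r t (munit X n) - w \<in> rpos X n)"
  have "\<exists>t. G w t" if "w \<in> mats n (carr X)" for w
    unfolding G_def using rpos_order_unit[OF that] .
  moreover have "G (v + w) (s + t)" if "G v s" "G w t" for v w s t
    using rpos_add[OF that[unfolded G_def]] by (simp add: G_def mscl_simps algebra_simps)
  moreover have "G (?r c w) (c * t)" if "G w t" "0 < c" for w c t
    using rpos_mscl[OF that(1)[unfolded G_def], of c] that(2) by (simp add: G_def mscl_simps)
  moreover have "0 \<le> t" if "G 0 t" for t
    using that rpos_munit_iff[OF n] by (simp add: G_def)
  ultimately have "\<exists>S. (\<forall>x\<in>mats n (carr X). \<forall>y\<in>mats n (carr X). S (x + y) = S x + S y) \<and>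
    (\<forall>c. \<forall>x\<in>mats n (carr X). S (?r c x) = c * S x) \<and>
    (\<forall>x\<in>mats n (carr X). \<forall>t. G x t \<longrightarrow> S x \<le> t) \<and> (\<forall>t. (\<forall>s. G (- x) s \<longrightarrow> t \<le> s) \<longrightarrow> t \<le> S (- x))"
    by (intro hahn_banach_cone[OF vector_space_mscl subspace_mats] mats_neg[OF xm]) auto
  then obtain S where S: "\<forall>x\<in>mats n (carr X). \<forall>y\<in>mats n (carr X). S (x + y) = S x + (S y::real)"
    "\<forall>c. \<forall>x\<in>mats n (carr X). S (?r c x) = c * S x"
    "\<forall>x\<in>mats n (carr X). \<forall>t. G x t \<longrightarrow> S x \<le> t" "\<forall>t. (\<forall>s. G (- x) s \<longrightarrow> t \<le> s) \<longrightarrow> t \<le> S (- x)"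
    by (elim exE conjE)
  have Sadd: "S (x + y) = S x + S y" if "x \<in> mats n (carr X)" "y \<in> mats n (carr X)" for x y
    using S(1) that by simp
  have Sscale: "S (?r c x) = c * S x" if "x \<in> mats n (carr X)" for c x
    using S(2) that by simp
  have SG: "S x \<le> t" if "x \<in> mats n (carr X)" "G x t" for x t
    using S(3) that by simp
  have Sx: "t \<le> S (- x)" if "\<And>s. G (- x) s \<Longrightarrow> t \<le> s" for t
    using S(4) that by simp
  have Sneg: "S (- z) = - S z" if "z \<in> mats n (carr X)" for z
    using Sscale[OF that, of "- 1"] by (simp add: mscl_simps)
  have Spos: "0 \<le> S z" if "z \<in> rpos X n" for z
    using SG[of "- z" 0] rpos_mats[OF that] that by (simp add: G_def mats_neg mscl_simps Sneg)
  have S1: "S (munit X n) = 1"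
    using SG[OF mats_munit, of 1] SG[OF mats_neg[OF mats_munit], of "-1"] rpos_munit[of 0 n]
    by (simp add: G_def mscl_simps Sneg mats_munit)
  have "r0 \<le> S (- x)"
  proof (rule Sx)
    fix s assume "G (- x) s"
    then have "?r s (munit X n) + x \<in> pos X n"
      using rpos_hmats hmats_intros x by (simp add: G_def)
    then have "?r (r0 - s) (munit X n) + (?r s (munit X n) + x) \<in> pos X n" if "s \<le> r0"
      using that \<open>?r s (munit X n) + x \<in> pos X n\<close> pos_munit[of "r0 - s" n] by (rule_tac pos_add) (simp_all del: of_real_diff)
    then have "?r r0 (munit X n) + x \<in> pos X n" if "s \<le> r0"
      using that by (simp add: mscl_simps)
    then show "r0 \<le> s" using r0(2) linear[of s r0] by blast
  qed
  then have Sx: "S x < 0" using r0(1) Sneg[OF xm] by simp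
  define T where "T = (\<lambda>z. complex_of_real (S z) - \<i> * complex_of_real (S (mscl X \<i> z)))"
  have Tadd: "T (x + y) = T x + T y" if "x \<in> mats n (carr X)" "y \<in> mats n (carr X)" for x y
    unfolding T_def by (rule complexify(1)[of n S]) (fact Sadd Sscale Spos that)+
  have Tscale: "T (mscl X c x) = c * T x" if "x \<in> mats n (carr X)" for x c
    unfolding T_def by (rule complexify(2)[of n S]) (fact Sadd Sscale Spos that)+
  have Therm: "T x = complex_of_real (S x)" if "x \<in> hmats X n" for x
    unfolding T_def by (rule complexify(3)[of n S]) (fact Sadd Sscale Spos that)+
  have Tpos: "T x \<in> \<real>\<^sub>\<ge>\<^sub>0" if "x \<in> pos X n" for x
    unfolding T_def by (rule complexify(4)[of n S]) (fact Sadd Sscale Spos that)+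
  \<comment> \<open>Moving the entry at (i, i) to the position (j, j) is a compression by a matrix
    unit and so preserves positivity.\<close>
  have cmp: "elt j j (w i i) \<in> mats n (carr X)" "w \<in> pos X n \<Longrightarrow> elt j j (w i i) \<in> pos X n"
    if "i < n" "j < n" "w \<in> mats n (carr X)" for i j w
  proof -
    show "elt j j (w i i) \<in> mats n (carr X)" using that by (intro mats_elt mats_entry)
    assume w: "w \<in> pos X n"
    let ?A = "\<lambda>k l. if k = i \<and> l = j then 1 else (0::complex)"
    have "compress X n n ?A w a b = elt j j (w i i) a b" for a b
    proof -
      have "(\<Sum>l<n. scl X (cnj (?A k a) * ?A l b) (w k l)) = (if k = i then if a = j \<and> b = j then w k i else 0 else 0)" for k
      proof -
        have "(\<Sum>l<n. scl X (cnj (?A k a) * ?A l b) (w k l)) =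
          (\<Sum>l<n. if l = i then if k = i \<and> a = j \<and> b = j then w k l else 0 else 0)"
          by (rule sum.cong[OF refl]) auto
        then show ?thesis using that by simp
      qed
      then show ?thesis using that by (auto simp: compress_def elt_def)
    qed
    then have "compress X n n ?A w = elt j j (w i i)" by blast
    then show "elt j j (w i i) \<in> pos X n" using pos_compress[OF w, of n ?A] by simp
  qed
  \<comment> \<open>The Choi map of \<open>T2\<close> sends a to a multiple of the identity matrix,
    the scalar being the sum of the diagonal values of T at a. At the unit this scalar is 1, so
    adding \<tau> times \<open>T2\<close> adds \<tau> to the value at the unit and makes it positive
    definite.\<close>
  define T2 where "T2 = (\<lambda>w. \<Sum>i<n. \<Sum>j<n. T (elt j j (w i i)))"
  \<comment> \<open>Chosen so that the perturbation uses up at most half of the negative value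
    \<open>S x\<close>; the summand 1 keeps the denominator positive.\<close>
  define \<tau> where "\<tau> = - S x / (2 * (1 + \<bar>Re (T2 x)\<bar>))"
  have \<tau>: "\<tau> > 0" unfolding \<tau>_def by (rule divide_pos_pos) (use Sx in auto)
  define T' where "T' = (\<lambda>w. T w + complex_of_real \<tau> * T2 w)"
  have eadd: "elt j j ((x + y) i i) = elt j j (x i i) + elt j j (y i i)" for x y :: "nat \<Rightarrow> nat \<Rightarrow> 'a" and i j
    by (simp add: elt_simps)
  have escl: "elt j j (mscl X c x i i) = mscl X c (elt j j (x i i))" for x i j c
    by (auto simp: elt_def mscl_def fun_eq_iff)
  have T'add: "T' (x + y) = T' x + T' y" if "x \<in> mats n (carr X)" "y \<in> mats n (carr X)" for x y
  proof -
    have "T2 (x + y) = T2 x + T2 y"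
    proof -
      have *: "T (elt j j ((x + y) i i)) = T (elt j j (x i i)) + T (elt j j (y i i))" if "i < n" "j < n" for i j
        unfolding eadd by (rule Tadd) (use cmp(1) that \<open>x \<in> _\<close> \<open>y \<in> _\<close> in auto)
      show ?thesis unfolding T2_def sum.distrib[symmetric]
        by (intro sum.cong refl *) auto
    qed
    then show ?thesis using that by (simp add: T'_def Tadd algebra_simps)
  qed
  have T'scale: "T' (mscl X c x) = c * T' x" if "x \<in> mats n (carr X)" for x c
  proof -
    have "T2 (mscl X c x) = c * T2 x"
    proof -
      have *: "T (elt j j (mscl X c x i i)) = c * T (elt j j (x i i))" if "i < n" "j < n" for i j
        unfolding escl by (rule Tscale) (use cmp(1) that \<open>x \<in> _\<close> in auto)
      show ?thesis unfolding T2_def sum_distrib_left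
        by (intro sum.cong refl *) auto
    qed
    then show ?thesis using that by (simp add: T'_def Tscale algebra_simps)
  qed
  have nnI: "a + complex_of_real \<tau> * b \<in> \<real>\<^sub>\<ge>\<^sub>0" if "a \<in> \<real>\<^sub>\<ge>\<^sub>0" "b \<in> \<real>\<^sub>\<ge>\<^sub>0" for a b
    using that \<tau> by (intro nonneg_Reals_add_I nonneg_Reals_mult_I) auto
  have T2pos: "T2 w \<in> \<real>\<^sub>\<ge>\<^sub>0" if "w \<in> pos X n" for w
    unfolding T2_def using cmp(2)[OF _ _ pos_mats[OF that] that] Tpos
    by (intro sum_nonneg_Reals) auto
  have T'pos: "T' w \<in> \<real>\<^sub>\<ge>\<^sub>0" if "w \<in> pos X n" for w
    unfolding T'_def using nnI[OF Tpos[OF that] T2pos[OF that]] .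
  let ?\<Phi> = "choi n T'"
  have \<Phi>: "cp_map X (matalg n) ?\<Phi>" by (rule choi_cp[OF T'add T'scale T'pos])
  have \<Phi>0: "cp_map X (matalg n) (choi n T)" by (rule choi_cp[OF Tadd Tscale Tpos])
  have T'x: "Re (T' x) < 0"
  proof -
    have "\<tau> * Re (T2 x) \<le> \<tau> * \<bar>Re (T2 x)\<bar>" using \<tau> by (intro mult_left_mono) auto
    also have "\<dots> \<le> - S x / 2"
    proof -
      have "\<bar>Re (T2 x)\<bar> / (1 + \<bar>Re (T2 x)\<bar>) \<le> 1" by (simp add: field_simps)
      then have "(- S x / 2) * (\<bar>Re (T2 x)\<bar> / (1 + \<bar>Re (T2 x)\<bar>)) \<le> (- S x / 2) * 1"
        using Sx by (intro mult_left_mono) auto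
      moreover have "\<tau> * \<bar>Re (T2 x)\<bar> = (- S x / 2) * (\<bar>Re (T2 x)\<bar> / (1 + \<bar>Re (T2 x)\<bar>))"
        by (simp add: \<tau>_def divide_simps)
      ultimately show ?thesis by simp
    qed
    finally show ?thesis using Sx by (simp add: T'_def Therm[OF x])
  qed
  define A where "A = ?\<Phi> (ounit X)"
  have u1: "munit X 1 \<in> pos X 1" using pos_munit[of 1 1] by (simp add: mscl_simps)
  have form1: "sesq 1 n (amp f (munit X 1)) \<xi> \<xi> = (\<Sum>p<n. \<Sum>q<n. cnj (\<xi> 0 p) * f (ounit X) p q * \<xi> 0 q)" for f \<xi>
    by (simp add: sesq_def amp_def munit_def)
  have "adj (matalg n) A = A"
    using cp_map_adj[OF X operator_system_matalg[OF n] \<Phi> ounit_closed] by (simp add: A_def adj_ounit)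
  then have Aherm: "A j i = cnj (A i j)" for i j
    using fun_cong[OF fun_cong[of "adj (matalg n) A" A, of j], of i] unfolding matalg_sel by simp
  have Aentry: "A i j = choi n T (ounit X) i j + (if i = j then complex_of_real \<tau> else 0)" if ij: "i < n" "j < n" for i j
  proof -
    have "T2 (elt i j (ounit X)) = (if i = j then (\<Sum>a<n. \<Sum>b<n. choi n T (munit X n a b) a b) else 0)"
    proof -
      have "T2 (elt i j (ounit X)) = (\<Sum>a<n. if a = i then \<Sum>b<n. T (elt b b (elt i j (ounit X) a a)) else 0)"
        unfolding T2_def
      proof (intro sum.cong refl)
        have "T 0 = 0" using Tadd[OF mats_0 mats_0] by simp
        then show "(\<Sum>b<n. T (elt b b (elt i j (ounit X) a a))) =
            (if a = i then \<Sum>b<n. T (elt b b (elt i j (ounit X) a a)) else 0)" for a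
          by (auto simp: elt_def zero_fun_def[symmetric])
      qed
      also have "\<dots> = (\<Sum>b<n. T (elt b b (if i = j then ounit X else 0)))" using ij by (simp add: elt_def)
      finally have 1: "T2 (elt i j (ounit X)) = (\<Sum>b<n. T (elt b b (if i = j then ounit X else 0)))" .
      have T0: "T 0 = 0" using Tadd[OF mats_0 mats_0] by simp
      have 2: "(\<Sum>b<n. choi n T (munit X n a b) a b) = T (elt a a (ounit X))" if "a < n" for a
      proof -
        have "(\<Sum>b<n. choi n T (munit X n a b) a b) = (\<Sum>b<n. if b = a then T (elt a a (ounit X)) else 0)"
          using that by (intro sum.cong refl) (auto simp: munit_def choi_def elt_simps T0)
        then show ?thesis using that by simp
      qed
      show ?thesis unfolding 1 by (auto simp: 2 elt_simps T0)
    qed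
    also have "(\<Sum>a<n. \<Sum>b<n. choi n T (munit X n a b) a b) = 1"
      using choi_trace[of n T, OF Tadd mats_munit] Therm[OF hmats_munit] S1 by simp
    finally show ?thesis using ij by (simp add: A_def choi_def T'_def)
  qed
  have Apd: "0 < Re (\<Sum>i<n. \<Sum>j<n. cnj (\<xi> i) * A i j * \<xi> j)" if \<xi>: "\<exists>i<n. \<xi> i \<noteq> 0" for \<xi>
  proof -
    have "(\<Sum>i<n. \<Sum>j<n. cnj (\<xi> i) * A i j * \<xi> j) =
      (\<Sum>i<n. \<Sum>j<n. cnj (\<xi> i) * choi n T (ounit X) i j * \<xi> j) +
      (\<Sum>i<n. \<Sum>j<n. if j = i then complex_of_real \<tau> * (cnj (\<xi> i) * \<xi> j) else 0)"
      unfolding sum.distrib[symmetric] by (intro sum.cong refl) (simp add: Aentry algebra_simps)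
    also have "(\<Sum>i<n. \<Sum>j<n. if j = i then complex_of_real \<tau> * (cnj (\<xi> i) * \<xi> j) else 0) =
       (\<Sum>i<n. complex_of_real (\<tau> * (cmod (\<xi> i))\<^sup>2))"
    proof (intro sum.cong refl)
      fix i assume "i \<in> {..<n}"
      then have "(\<Sum>j<n. if j = i then complex_of_real \<tau> * (cnj (\<xi> i) * \<xi> j) else 0) = complex_of_real \<tau> * (cnj (\<xi> i) * \<xi> i)"
        by simp
      also have "\<dots> = complex_of_real (\<tau> * (cmod (\<xi> i))\<^sup>2)"
        by (simp only: of_real_mult complex_norm_square mult.commute[of "cnj (\<xi> i)"])
      finally show "(\<Sum>j<n. if j = i then complex_of_real \<tau> * (cnj (\<xi> i) * \<xi> j) else 0) = complex_of_real (\<tau> * (cmod (\<xi> i))\<^sup>2)" .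
    qed
    finally have "Re (\<Sum>i<n. \<Sum>j<n. cnj (\<xi> i) * A i j * \<xi> j) =
      Re (\<Sum>i<n. \<Sum>j<n. cnj (\<xi> i) * choi n T (ounit X) i j * \<xi> j) + (\<Sum>i<n. \<tau> * (cmod (\<xi> i))\<^sup>2)"
      by simp
    moreover have "0 \<le> Re (\<Sum>i<n. \<Sum>j<n. cnj (\<xi> i) * choi n T (ounit X) i j * \<xi> j)"
      using cp_map_sesq[OF \<Phi>0 u1, of "\<lambda>_. \<xi>"] unfolding form1 by (simp add: complex_nonneg_Reals_iff)
    moreover have "0 < (\<Sum>i<n. \<tau> * (cmod (\<xi> i))\<^sup>2)"
      using \<xi> \<tau> by (auto intro!: sum_pos2)
    ultimately show ?thesis by linarith
  qed
  have "\<exists>R D. (\<forall>i<n. \<forall>j<n. A i j = (\<Sum>k<n. cnj (R k i) * R k j)) \<and>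
    (\<forall>i<n. \<forall>j<n. (\<Sum>k<n. D i k * R k j) = (if i = j then 1 else 0)) \<and>
    (\<forall>i<n. \<forall>j<n. (\<Sum>k<n. R i k * D k j) = (if i = j then 1 else 0))"
    by (rule cholesky, rule Aherm, rule Apd)
  then obtain R D where R: "\<forall>i<n. \<forall>j<n. A i j = (\<Sum>k<n. cnj (R k i) * R k j)"
    and DR: "\<forall>i<n. \<forall>j<n. (\<Sum>k<n. D i k * R k j) = (if i = j then 1 else 0)"
    and RD: "\<forall>i<n. \<forall>j<n. (\<Sum>k<n. R i k * D k j) = (if i = j then 1 else 0)"
    by (elim exE conjE)
  \<comment> \<open>A is the adjoint of R times R, and D is the inverse of R, so conjugation by D
    turns the value A at the unit into the identity.\<close>
  let ?f = "\<lambda>a. conj_mat n n D (?\<Phi> a)"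
  have f: "cp_map X (matalg n) ?f" by (rule cp_map_conj_mat[OF X \<Phi>])
  have "?f (ounit X) = ounit (matalg n)"
  proof (intro ext)
    fix i j
    have "(\<Sum>k<n. \<Sum>l<n. cnj (D k i) * A k l * D l j) = (if i = j then 1 else 0)" if ij: "i < n" "j < n"
    proof -
      have "(\<Sum>k<n. \<Sum>l<n. cnj (D k i) * A k l * D l j) =
        (\<Sum>k<n. \<Sum>l<n. \<Sum>m<n. cnj (R m k * D k i) * (R m l * D l j))"
        by (intro sum.cong refl) (simp add: R sum_distrib_left sum_distrib_right mult_ac)
      also have "\<dots> = (\<Sum>m<n. (\<Sum>k<n. cnj (R m k * D k i)) * (\<Sum>l<n. R m l * D l j))"
        unfolding sum_product by (rule sum_rotate)
      also have "\<dots> = (\<Sum>m<n. cnj (\<Sum>k<n. R m k * D k i) * (\<Sum>l<n. R m l * D l j))" by simp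
      also have "\<dots> = (\<Sum>m<n. if m = i then if m = j then 1 else 0 else 0)"
        by (intro sum.cong refl) (use RD ij in auto)
      finally show ?thesis using ij by simp
    qed
    then show "?f (ounit X) i j = ounit (matalg n) i j"
      by (auto simp: conj_mat_def A_def[symmetric])
  qed
  then have "ucp X n ?f" using n f by (simp add: ucp_def)
  \<comment> \<open>The vector with the coordinates of R undoes the conjugation by D. The form there
    is the trace pairing, that is, \<open>T' x\<close>, whose real part is negative.\<close>
  moreover have "amp ?f x \<notin> pos (matalg n) n"
  proof
    assume "amp ?f x \<in> pos (matalg n) n"
    then have "sesq n n (amp ?f x) (\<lambda>i a. R a i) (\<lambda>i a. R a i) \<in> \<real>\<^sub>\<ge>\<^sub>0" by (simp add: matalg_pos)
    also have "sesq n n (amp ?f x) (\<lambda>i a. R a i) (\<lambda>i a. R a i) =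
        sesq n n (amp ?\<Phi> x) (\<lambda>i p. if i = p then 1 else 0) (\<lambda>i p. if i = p then 1 else 0)"
      unfolding sesq_conj_mat unfolding sesq_def using DR by (intro sum.cong refl) auto
    also have "\<dots> = T' x" using choi_trace[of n T', OF T'add xm] unfolding sesq_unit_vectors by (simp add: amp_def)
    finally show False using T'x by (simp add: complex_nonneg_Reals_iff)
  qed
  ultimately show ?thesis by blast
qed

section \<open>Matrix norms\<close>

lemma ucpD:
  assumes "ucp X k f"
  shows "1 \<le> k" "cp_map X (matalg k) f" "f (ounit X) = ounit (matalg k)" "operator_system (matalg k)"
  using assms operator_system_matalg by (auto simp: ucp_def)

lemma sesq_scale_left: "sesq n k x (\<lambda>i p. c * \<xi> i p) \<eta> = cnj c * sesq n k x \<xi> \<eta>"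
  by (simp add: sesq_def sum_distrib_left mult_ac)

lemma sqn_scale: "sqn n k (\<lambda>i p. c * \<xi> i p) = (cmod c)\<^sup>2 * sqn n k \<xi>"
  by (simp add: sqn_def sum_distrib_left norm_mult power_mult_distrib)

text \<open>For r \<ge> 0 this says that y has operator norm at most r. The sum of squares in place
  of a product of norms makes the condition linear in r and matches what positivity of the norm
  block states.\<close>

definition bnd :: "nat \<Rightarrow> nat \<Rightarrow> (nat \<Rightarrow> nat \<Rightarrow> nat \<Rightarrow> nat \<Rightarrow> complex) \<Rightarrow> real \<Rightarrow> bool" where
  "bnd n k y r \<longleftrightarrow> (\<forall>\<xi> \<eta>. 2 * cmod (sesq n k y \<xi> \<eta>) \<le> r * (sqn n k \<xi> + sqn n k \<eta>))"

text \<open>Multiplying \<xi> by a phase turns the real part of the form into minus its modulus and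
  leaves the square norm of \<xi> unchanged.\<close>

lemma bnd_iff_Re: "bnd n k y r \<longleftrightarrow> (\<forall>\<xi> \<eta>. - 2 * Re (sesq n k y \<xi> \<eta>) \<le> r * (sqn n k \<xi> + sqn n k \<eta>))"
proof
  assume "bnd n k y r"
  then show "\<forall>\<xi> \<eta>. - 2 * Re (sesq n k y \<xi> \<eta>) \<le> r * (sqn n k \<xi> + sqn n k \<eta>)"
    unfolding bnd_def using abs_Re_le_cmod by (smt (verit))
next
  assume R: "\<forall>\<xi> \<eta>. - 2 * Re (sesq n k y \<xi> \<eta>) \<le> r * (sqn n k \<xi> + sqn n k \<eta>)"
  show "bnd n k y r" unfolding bnd_def
  proof (intro allI)
    fix \<xi> \<eta>
    let ?s = "sesq n k y \<xi> \<eta>"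
    show "2 * cmod ?s \<le> r * (sqn n k \<xi> + sqn n k \<eta>)"
    proof (cases "?s = 0")
      case True
      then show ?thesis using R[rule_format, of \<xi> \<eta>] by simp
    next
      case False
      define c where "c = - ?s / complex_of_real (cmod ?s)"
      have c: "cmod c = 1" using False by (simp add: c_def norm_divide)
      have "cnj c * ?s = - complex_of_real (cmod ?s)"
        using False complex_norm_square[of ?s] by (simp add: c_def field_simps power2_eq_square)
      then show ?thesis using R[rule_format, of "\<lambda>i p. c * \<xi> i p" \<eta>]
        by (simp add: sesq_scale_left sqn_scale c)
    qed
  qed
qed

lemma sesq_cong:
  assumes "\<And>i j p q. i < n \<Longrightarrow> j < n \<Longrightarrow> p < k \<Longrightarrow> q < k \<Longrightarrow> cnj (\<xi> i p) * x i j p q * \<eta> j q = cnj (\<xi>' i p) * x' i j p q * \<eta>' j q"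
  shows "sesq n k x \<xi> \<eta> = sesq n k x' \<xi>' \<eta>'"
  unfolding sesq_def by (intro sum.cong refl assms) auto

lemma sesq_norm_block:
  "sesq (2 * n) k (norm_block (matalg k) n r y) \<zeta> \<zeta> =
   complex_of_real (r * (sqn n k \<zeta> + sqn n k (\<lambda>i. \<zeta> (n + i)))) +
   (sesq n k y \<zeta> (\<lambda>i. \<zeta> (n + i)) + cnj (sesq n k y \<zeta> (\<lambda>i. \<zeta> (n + i))))"
proof -
  let ?\<eta> = "\<lambda>i. \<zeta> (n + i)" and ?N = "norm_block (matalg k) n r y"
  let ?f = "\<lambda>i j. \<Sum>p<k. \<Sum>q<k. cnj (\<zeta> i p) * ?N i j p q * \<zeta> j q"
  have "sesq (2 * n) k ?N \<zeta> \<zeta> = (\<Sum>i<n. \<Sum>j<n. ?f i j) + (\<Sum>i<n. \<Sum>j<n. ?f i (n + j)) +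
    ((\<Sum>i<n. \<Sum>j<n. ?f (n + i) j) + (\<Sum>i<n. \<Sum>j<n. ?f (n + i) (n + j)))"
    unfolding sesq_def mult_2 sum_lessThan_add sum.distrib[symmetric] by (simp add: sum.distrib)
  also have "(\<Sum>i<n. \<Sum>j<n. ?f i j) = sesq n k (mscl (matalg k) (complex_of_real r) (munit (matalg k) n)) \<zeta> \<zeta>"
    unfolding sesq_def by (intro sum.cong refl) (auto simp: norm_block_def mscl_def munit_def)
  also have "(\<Sum>i<n. \<Sum>j<n. ?f (n + i) (n + j)) = sesq n k (mscl (matalg k) (complex_of_real r) (munit (matalg k) n)) ?\<eta> ?\<eta>"
    unfolding sesq_def by (intro sum.cong refl) (auto simp: norm_block_def mscl_def munit_def)
  also have "(\<Sum>i<n. \<Sum>j<n. ?f i (n + j)) = sesq n k y \<zeta> ?\<eta>"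
    unfolding sesq_def by (intro sum.cong refl) (auto simp: norm_block_def)
  also have "(\<Sum>i<n. \<Sum>j<n. ?f (n + i) j) = sesq n k (\<lambda>i j p q. cnj (y j i q p)) ?\<eta> \<zeta>"
    unfolding sesq_def by (intro sum.cong refl) (auto simp: norm_block_def)
  finally show ?thesis
    by (simp add: mscl_def sesq_scl sesq_unit sesq_adj algebra_simps)
qed

lemma norm_block_mats:
  assumes "operator_system X" "x \<in> mats n (carr X)"
  shows "norm_block X n r x \<in> mats (2 * n) (carr X)"
proof -
  interpret operator_system X by fact
  show ?thesis using mats_entry[OF assms(2)] unfolding norm_block_def
    by (auto simp: mats_def intro!: carr_intros)
qed

lemma norm_block_hmats:
  assumes "operator_system X" "x \<in> mats n (carr X)"
  shows "norm_block X n r x \<in> hmats X (2 * n)"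
proof -
  interpret operator_system X by fact
  show ?thesis using mats_entry[OF assms(2)] norm_block_mats[OF assms]
    by (auto simp: hmats_def norm_block_def madj_def fun_eq_iff adj_0 adj_scl adj_ounit adj_adj ounit_closed)
qed

lemma matalg_norm_block_pos:
  assumes "1 \<le> k" "y \<in> mats n (mats k UNIV)"
  shows "norm_block (matalg k) n r y \<in> pos (matalg k) (2 * n) \<longleftrightarrow> bnd n k y r"
proof -
  have m: "norm_block (matalg k) n r y \<in> mats (2 * n) (mats k UNIV)"
    using norm_block_mats[OF operator_system_matalg[OF assms(1)], of y n] assms by simp
  have form: "sesq (2 * n) k (norm_block (matalg k) n r y) \<zeta> \<zeta> \<in> \<real>\<^sub>\<ge>\<^sub>0 \<longleftrightarrow>
    - 2 * Re (sesq n k y \<zeta> (\<lambda>i. \<zeta> (n + i))) \<le> r * (sqn n k \<zeta> + sqn n k (\<lambda>i. \<zeta> (n + i)))" for \<zeta>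
    unfolding sesq_norm_block by (auto simp: complex_nonneg_Reals_iff)
  show ?thesis unfolding matalg_pos mem_Collect_eq form bnd_iff_Re
  proof (intro iffI conjI allI)
    assume "norm_block (matalg k) n r y \<in> mats (2 * n) (mats k UNIV) \<and>
      (\<forall>\<zeta>. - 2 * Re (sesq n k y \<zeta> (\<lambda>i. \<zeta> (n + i))) \<le> r * (sqn n k \<zeta> + sqn n k (\<lambda>i. \<zeta> (n + i))))"
    then have R: "- 2 * Re (sesq n k y \<zeta> (\<lambda>i. \<zeta> (n + i))) \<le> r * (sqn n k \<zeta> + sqn n k (\<lambda>i. \<zeta> (n + i)))" for \<zeta>
      by blast
    fix \<xi> \<eta> :: "nat \<Rightarrow> nat \<Rightarrow> complex"
    let ?\<zeta> = "\<lambda>i. if i < n then \<xi> i else \<eta> (i - n)"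
    have "sesq n k y ?\<zeta> (\<lambda>i. ?\<zeta> (n + i)) = sesq n k y \<xi> \<eta>"
      by (rule sesq_cong) simp
    moreover have "sqn n k ?\<zeta> = sqn n k \<xi>" "sqn n k (\<lambda>i. ?\<zeta> (n + i)) = sqn n k \<eta>"
      by (simp_all add: sqn_def)
    ultimately show "- 2 * Re (sesq n k y \<xi> \<eta>) \<le> r * (sqn n k \<xi> + sqn n k \<eta>)"
      using R[of ?\<zeta>] by simp
  qed (use m in auto)
qed

lemma amp_norm_block:
  assumes X: "operator_system X" and Y: "operator_system Y" and f: "cp_map X Y f" "f (ounit X) = ounit Y"
    and x: "x \<in> mats n (carr X)"
  shows "amp f (norm_block X n r x) = norm_block Y n r (amp f x)"
proof -
  interpret X: operator_system X by fact
  show ?thesis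
    unfolding amp_def norm_block_def
    by (intro ext) (auto simp: f(2) cp_map_linear(3)[OF f(1)] X.ounit_closed cp_map_0[OF X f(1)]
        cp_map_adj[OF X Y f(1)] X.mats_entry[OF x])
qed

section \<open>Matrix norms tested by unital completely positive maps\<close>

text \<open>Inequalities with nonnegative slope in r cut out a closed set of radii that is closed
  upwards, so its infimum is attained. This is what allows a norm bound to be exchanged for
  positivity of one block.\<close>

lemma Inf_tests:
  fixes c d :: "'t \<Rightarrow> real"
  assumes B: "\<And>r. 0 \<le> r \<Longrightarrow> B r \<longleftrightarrow> (\<forall>t\<in>I. c t \<le> r * d t)" and d: "\<And>t. t \<in> I \<Longrightarrow> 0 \<le> d t"
    and ne: "0 \<le> r0" "B r0"
  shows "0 \<le> Inf {r. 0 \<le> r \<and> B r}" and "0 \<le> r \<Longrightarrow> Inf {r. 0 \<le> r \<and> B r} \<le> r \<longleftrightarrow> B r"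
proof -
  let ?A = "{r. 0 \<le> r \<and> B r}"
  have bdd: "bdd_below ?A" by (auto intro: bdd_belowI[of _ 0])
  have ne': "?A \<noteq> {}" using ne by auto
  show 0: "0 \<le> Inf ?A" using ne' by (intro cInf_greatest) auto
  assume r: "0 \<le> r"
  show "Inf ?A \<le> r \<longleftrightarrow> B r"
  proof
    assume I: "Inf ?A \<le> r"
    have "c t \<le> r * d t" if t: "t \<in> I" for t
    proof (rule field_le_epsilon)
      fix e :: real assume e: "0 < e"
      define e' where "e' = e / (d t + 1)"
      have e': "0 < e'" "e' * d t \<le> e" using e d[OF t] by (auto simp: e'_def field_simps)
      have "Inf ?A < r + e'" using I e' by linarith
      then obtain s where s: "0 \<le> s" "B s" "s < r + e'" using cInf_lessD[OF ne'] by blast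
      have "c t \<le> s * d t" using B s t by blast
      also have "\<dots> \<le> (r + e') * d t" using s d[OF t] by (intro mult_right_mono) auto
      also have "\<dots> \<le> r * d t + e" using e' by (simp add: algebra_simps)
      finally show "c t \<le> r * d t + e" .
    qed
    then show "B r" using B r by blast
  next
    assume "B r"
    then show "Inf ?A \<le> r" using r bdd by (intro cInf_lower) auto
  qed
qed

lemma sqn_pos: "0 \<le> sqn n k \<xi> + sqn n k \<eta>"
  using sqn_nonneg[of n k \<xi>] sqn_nonneg[of n k \<eta>] by simp

context operator_system
begin

text \<open>Positivity of the hermitian norm block is detected by separating maps. Together with
  attainment of the infimum, this makes \<open>mnorm\<close> a supremum over all unital completely
  positive maps into matrix algebras, so that norm inequalities reduce to estimates of scalar
  sesquilinear forms.\<close>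

lemma norm_block_pos_iff:
  assumes x: "x \<in> mats n (carr X)"
  shows "norm_block X n r x \<in> pos X (2 * n) \<longleftrightarrow> (\<forall>k f. ucp X k f \<longrightarrow> bnd n k (amp f x) r)"
proof -
  have *: "amp f (norm_block X n r x) \<in> pos (matalg k) (2 * n) \<longleftrightarrow> bnd n k (amp f x) r" if f: "ucp X k f" for k f
  proof -
    have "amp f x \<in> mats n (mats k UNIV)"
      using cp_map_mats[OF operator_system_axioms ucpD(2)[OF f] x] by simp
    then show ?thesis
      unfolding amp_norm_block[OF operator_system_axioms ucpD(4)[OF f] ucpD(2,3)[OF f] x]
      by (intro matalg_norm_block_pos ucpD(1)[OF f])
  qed
  show ?thesis
  proof
    assume "norm_block X n r x \<in> pos X (2 * n)"
    then show "\<forall>k f. ucp X k f \<longrightarrow> bnd n k (amp f x) r"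
      using * cp_map_linear(4)[OF ucpD(2)] by blast
  next
    assume R: "\<forall>k f. ucp X k f \<longrightarrow> bnd n k (amp f x) r"
    show "norm_block X n r x \<in> pos X (2 * n)"
    proof (rule ccontr)
      assume "norm_block X n r x \<notin> pos X (2 * n)"
      then obtain f where "ucp X (2 * n) f" "amp f (norm_block X n r x) \<notin> pos (matalg (2 * n)) (2 * n)"
        using separating_ucp[OF operator_system_axioms norm_block_hmats[OF operator_system_axioms x]] by blast
      then show False using R * by blast
    qed
  qed
qed

lemma mnorm_norm_block:
  assumes x: "x \<in> mats n (carr X)"
  shows "0 \<le> mnorm X n x" and "0 \<le> r \<Longrightarrow> mnorm X n x \<le> r \<longleftrightarrow> norm_block X n r x \<in> pos X (2 * n)"
proof -
  let ?B = "\<lambda>r. norm_block X n r x \<in> pos X (2 * n)"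
  have nb: "norm_block X n 0 x \<in> hmats X (2 * n)" by (rule norm_block_hmats[OF operator_system_axioms x])
  \<comment> \<open>An order unit multiple that dominates the block with zero diagonal fills in that
    diagonal; it provides one admissible radius.\<close>
  obtain s where s: "0 < s" "mscl X (complex_of_real s) (munit X (2 * n)) + norm_block X n 0 x \<in> pos X (2 * n)"
    using order_unit[OF nb] by blast
  have "mscl X (complex_of_real s) (munit X (2 * n)) + norm_block X n 0 x = norm_block X n s x"
    by (auto simp: mscl_def munit_def norm_block_def fun_eq_iff)
  then have ne: "0 \<le> s" "?B s" using s by auto
  let ?I = "{(k, f, \<xi>, \<eta>). ucp X k f}"
  let ?c = "\<lambda>(k, f, \<xi>, \<eta>). 2 * cmod (sesq n k (amp f x) \<xi> \<eta>)"
  let ?d = "\<lambda>(k, f :: 'a \<Rightarrow> nat \<Rightarrow> nat \<Rightarrow> complex, \<xi>, \<eta>). sqn n k \<xi> + sqn n k \<eta>"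
  have "?B r \<longleftrightarrow> (\<forall>t\<in>?I. ?c t \<le> r * ?d t)" for r
    unfolding norm_block_pos_iff[OF x] bnd_def by auto
  note I = Inf_tests[of ?B ?I ?c ?d, OF this _ ne]
  show "0 \<le> mnorm X n x" unfolding mnorm_def by (rule I(1)) (auto simp: sqn_pos)
  assume "0 \<le> r"
  then show "mnorm X n x \<le> r \<longleftrightarrow> norm_block X n r x \<in> pos X (2 * n)"
    unfolding mnorm_def by (intro I(2)) (auto simp: sqn_pos)
qed

lemmas mnorm_nonneg = mnorm_norm_block(1)

lemma mnorm_le_iff:
  assumes "x \<in> mats n (carr X)" "0 \<le> r"
  shows "mnorm X n x \<le> r \<longleftrightarrow> (\<forall>k f. ucp X k f \<longrightarrow> bnd n k (amp f x) r)"
  using mnorm_norm_block(2)[OF assms] norm_block_pos_iff[OF assms(1)] by simp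

lemma mnorm_leI:
  assumes "x \<in> mats n (carr X)" "0 \<le> r" "\<And>k f \<xi> \<eta>. ucp X k f \<Longrightarrow> 2 * cmod (sesq n k (amp f x) \<xi> \<eta>) \<le> r * (sqn n k \<xi> + sqn n k \<eta>)"
  shows "mnorm X n x \<le> r"
  using assms by (simp add: mnorm_le_iff bnd_def)

lemma mnormD:
  assumes "x \<in> mats n (carr X)" "ucp X k f" "mnorm X n x \<le> r"
  shows "2 * cmod (sesq n k (amp f x) \<xi> \<eta>) \<le> r * (sqn n k \<xi> + sqn n k \<eta>)"
proof -
  have "0 \<le> r" using mnorm_nonneg[OF assms(1)] assms(3) by linarith
  then show ?thesis using assms by (simp add: mnorm_le_iff bnd_def)
qed

lemma ucp_amp_add:
  assumes "ucp X k f" "x \<in> mats n (carr X)" "y \<in> mats n (carr X)"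
  shows "amp f (x + y) = amp f x + amp f y"
  using mats_entry[OF assms(2)] mats_entry[OF assms(3)] cp_map_linear(2)[OF ucpD(2)[OF assms(1)]]
  by (simp add: amp_def fun_eq_iff)

lemma ucp_amp_mscl:
  assumes "ucp X k f" "x \<in> mats n (carr X)"
  shows "amp f (mscl X c x) = (\<lambda>i j p q. c * amp f x i j p q)"
  using mats_entry[OF assms(2)] cp_map_linear(3)[OF ucpD(2)[OF assms(1)]]
  by (simp add: amp_def mscl_def fun_eq_iff)

lemma ucp_amp_munit:
  assumes "ucp X k f" shows "amp f (munit X n) = munit (matalg k) n"
  using ucpD(3)[OF assms] cp_map_0[OF operator_system_axioms ucpD(2)[OF assms]]
  by (auto simp: amp_def munit_def fun_eq_iff)

lemma mnorm_triangle:
  assumes x: "x \<in> mats n (carr X)" and y: "y \<in> mats n (carr X)"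
  shows "mnorm X n (x + y) \<le> mnorm X n x + mnorm X n y"
proof (rule mnorm_leI)
  fix k f \<xi> \<eta> assume f: "ucp X k f"
  have "cmod (sesq n k (amp f (x + y)) \<xi> \<eta>) \<le> cmod (sesq n k (amp f x) \<xi> \<eta>) + cmod (sesq n k (amp f y) \<xi> \<eta>)"
    unfolding ucp_amp_add[OF f x y] sesq_add_mat by (rule norm_triangle_ineq)
  then show "2 * cmod (sesq n k (amp f (x + y)) \<xi> \<eta>) \<le> (mnorm X n x + mnorm X n y) * (sqn n k \<xi> + sqn n k \<eta>)"
    using mnormD[OF x f order_refl, of \<xi> \<eta>] mnormD[OF y f order_refl, of \<xi> \<eta>]
    by (simp add: distrib_right)
qed (use x y mnorm_nonneg mats_add in auto)

lemma mnorm_mscl_le: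
  assumes x: "x \<in> mats n (carr X)"
  shows "mnorm X n (mscl X c x) \<le> cmod c * mnorm X n x"
proof (rule mnorm_leI)
  fix k f \<xi> \<eta> assume f: "ucp X k f"
  show "2 * cmod (sesq n k (amp f (mscl X c x)) \<xi> \<eta>) \<le> cmod c * mnorm X n x * (sqn n k \<xi> + sqn n k \<eta>)"
    unfolding ucp_amp_mscl[OF f x] sesq_scl norm_mult
    using mult_left_mono[OF mnormD[OF x f order_refl, of \<xi> \<eta>], of "cmod c"] by (simp add: mult_ac)
qed (use x mnorm_nonneg mats_mscl in auto)

lemma mnorm_mscl:
  assumes x: "x \<in> mats n (carr X)"
  shows "mnorm X n (mscl X c x) = cmod c * mnorm X n x"
proof (cases "c = 0")
  case True
  have "mnorm X n (mscl X c x) \<le> 0" using mnorm_mscl_le[OF x, of c] True by simp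
  then show ?thesis using mnorm_nonneg[OF mats_mscl[OF x], of c] True by simp
next
  case False
  have "mnorm X n (mscl X (1 / c) (mscl X c x)) \<le> cmod (1 / c) * mnorm X n (mscl X c x)"
    by (rule mnorm_mscl_le[OF mats_mscl[OF x]])
  then have "cmod c * mnorm X n x \<le> mnorm X n (mscl X c x)"
    using False by (simp add: mscl_simps norm_divide field_simps)
  then show ?thesis using mnorm_mscl_le[OF x, of c] by simp
qed

lemma mnorm_0 [simp]: "mnorm X n 0 = 0"
  using mnorm_mscl[OF mats_0, of n 0] by (simp add: mscl_simps)

lemma mnorm_neg: "x \<in> mats n (carr X) \<Longrightarrow> mnorm X n (- x) = mnorm X n x"
  using mnorm_mscl[of x n "- 1"] by (simp add: mscl_simps)

lemma mnorm_diff: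
  assumes "x \<in> mats n (carr X)" "y \<in> mats n (carr X)"
  shows "mnorm X n (x - y) \<le> mnorm X n x + mnorm X n y"
  using mnorm_triangle[OF assms(1) mats_neg[OF assms(2)]] mnorm_neg[OF assms(2)] by simp

lemma mnorm_minus_commute:
  assumes "x \<in> mats n (carr X)" "y \<in> mats n (carr X)"
  shows "mnorm X n (x - y) = mnorm X n (y - x)"
  using mnorm_neg[OF mats_diff[OF assms]] by simp

lemma ucp_amp_hermitian:
  assumes f: "ucp X k f" and x: "x \<in> hmats X n"
  shows "sesq n k (amp f x) \<xi> \<eta> = cnj (sesq n k (amp f x) \<eta> \<xi>)"
proof -
  have xm: "x \<in> mats n (carr X)" "madj X n x = x" using x by (auto simp: hmats_def)
  have "amp f x i j p q = cnj (amp f x j i q p)" if "i < n" "j < n" for i j p q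
  proof -
    have "x i j = adj X (x j i)" using fun_cong[OF fun_cong[OF xm(2), of i], of j] that by (simp add: madj_def)
    then show ?thesis
      using cp_map_adj[OF operator_system_axioms ucpD(4)[OF f] ucpD(2)[OF f] mats_entry[OF xm(1)], of j i]
      by (simp add: amp_def)
  qed
  then have "sesq n k (amp f x) \<xi> \<eta> = sesq n k (\<lambda>i j p q. cnj (amp f x j i q p)) \<xi> \<eta>"
    by (intro sesq_cong) metis
  then show ?thesis by (simp add: sesq_adj)
qed

lemma pos_iff:
  assumes x: "x \<in> hmats X n"
  shows "x \<in> pos X n \<longleftrightarrow> (\<forall>k f \<xi>. ucp X k f \<longrightarrow> 0 \<le> Re (sesq n k (amp f x) \<xi> \<xi>))"
proof
  assume "x \<in> pos X n"
  then show "\<forall>k f \<xi>. ucp X k f \<longrightarrow> 0 \<le> Re (sesq n k (amp f x) \<xi> \<xi>)"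
    using cp_map_sesq[OF ucpD(2)] complex_nonneg_Reals_iff by metis
next
  assume R: "\<forall>k f \<xi>. ucp X k f \<longrightarrow> 0 \<le> Re (sesq n k (amp f x) \<xi> \<xi>)"
  show "x \<in> pos X n"
  proof (rule ccontr)
    assume "x \<notin> pos X n"
    then obtain f where f: "ucp X n f" "amp f x \<notin> pos (matalg n) n"
      using separating_ucp[OF operator_system_axioms x] by blast
    have "amp f x \<in> mats n (mats n UNIV)"
      using cp_map_mats[OF operator_system_axioms ucpD(2)[OF f(1)] hmats_mats[OF x]] by simp
    moreover have "Im (sesq n n (amp f x) \<xi> \<xi>) = 0" for \<xi>
      using arg_cong[OF ucp_amp_hermitian[OF f(1) x, of \<xi> \<xi>], of Im] by simp
    ultimately show False using f R by (auto simp: matalg_pos complex_nonneg_Reals_iff)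
  qed
qed

text \<open>A hermitian form is recovered from its diagonal values by polarization. For the real
  part only \<xi> + \<eta> and \<xi> - \<eta> are needed, and the parallelogram law returns their
  square norms to those of \<xi> and \<eta>, so no constant is lost.\<close>

lemma hermitian_mnorm_le_iff:
  assumes x: "x \<in> hmats X n" and r: "0 \<le> r"
  shows "mnorm X n x \<le> r \<longleftrightarrow> mscl X (complex_of_real r) (munit X n) + x \<in> pos X n \<and>
    mscl X (complex_of_real r) (munit X n) - x \<in> pos X n"
proof -
  have xm: "x \<in> mats n (carr X)" using x by (rule hmats_mats)
  have m: "mscl X (complex_of_real r) (munit X n) \<in> mats n (carr X)" by (intro mats_intros)
  have 1: "sesq n k (amp f (mscl X (complex_of_real r) (munit X n) + x)) \<xi> \<xi> =
     complex_of_real (r * sqn n k \<xi>) + sesq n k (amp f x) \<xi> \<xi>" if f: "ucp X k f" for f k \<xi>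
    unfolding ucp_amp_add[OF f m xm] ucp_amp_mscl[OF f mats_munit] ucp_amp_munit[OF f] sesq_add_mat sesq_scl sesq_unit
    by simp
  have "amp f (- x) = - amp f x" if f: "ucp X k f" for f k
    using ucp_amp_mscl[OF f xm, of "- 1"] by (simp add: mscl_simps fun_eq_iff)
  then have 2: "sesq n k (amp f (mscl X (complex_of_real r) (munit X n) - x)) \<xi> \<xi> =
     complex_of_real (r * sqn n k \<xi>) - sesq n k (amp f x) \<xi> \<xi>" if f: "ucp X k f" for f k \<xi>
  proof -
    have "amp f (mscl X (complex_of_real r) (munit X n) + - x) =
       (\<lambda>i j p q. complex_of_real r * munit (matalg k) n i j p q) + - amp f x"
      unfolding ucp_amp_add[OF that m mats_neg[OF xm]] ucp_amp_mscl[OF that mats_munit] ucp_amp_munit[OF that]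
      using \<open>\<And>k f. ucp X k f \<Longrightarrow> amp f (- x) = - amp f x\<close> that by simp
    then show ?thesis unfolding diff_conv_add_uminus[of "mscl X (complex_of_real r) (munit X n)"]
      by (simp only: sesq_add_mat sesq_scl sesq_unit sesq_minus_mat of_real_mult diff_conv_add_uminus)
  qed
  have h: "mscl X (complex_of_real r) (munit X n) + x \<in> hmats X n" "mscl X (complex_of_real r) (munit X n) - x \<in> hmats X n"
    using x by (auto intro!: hmats_intros)
  show ?thesis unfolding mnorm_le_iff[OF xm r] pos_iff[OF h(1)] pos_iff[OF h(2)]
  proof (intro iffI conjI allI impI)
    assume R: "\<forall>k f. ucp X k f \<longrightarrow> bnd n k (amp f x) r"
    fix k f \<xi> assume f: "ucp X k f"
    have "cmod (sesq n k (amp f x) \<xi> \<xi>) \<le> r * sqn n k \<xi>"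
      using R f unfolding bnd_def by (auto dest!: spec[of _ \<xi>] simp: distrib_left) (smt (verit))
    then have "\<bar>Re (sesq n k (amp f x) \<xi> \<xi>)\<bar> \<le> r * sqn n k \<xi>"
      using abs_Re_le_cmod order_trans by blast
    then show "0 \<le> Re (sesq n k (amp f (mscl X (complex_of_real r) (munit X n) + x)) \<xi> \<xi>)"
      "0 \<le> Re (sesq n k (amp f (mscl X (complex_of_real r) (munit X n) - x)) \<xi> \<xi>)"
      unfolding 1[OF f] 2[OF f] by auto
  next
    assume R: "(\<forall>k f \<xi>. ucp X k f \<longrightarrow> 0 \<le> Re (sesq n k (amp f (mscl X (complex_of_real r) (munit X n) + x)) \<xi> \<xi>)) \<and>
      (\<forall>k f \<xi>. ucp X k f \<longrightarrow> 0 \<le> Re (sesq n k (amp f (mscl X (complex_of_real r) (munit X n) - x)) \<xi> \<xi>))"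
    fix k f assume f: "ucp X k f"
    let ?s = "sesq n k (amp f x)"
    have R: "\<bar>Re (?s \<xi> \<xi>)\<bar> \<le> r * sqn n k \<xi>" for \<xi>
      using R[THEN conjunct1, rule_format, OF f, of \<xi>] R[THEN conjunct2, rule_format, OF f, of \<xi>]
      unfolding 1[OF f] 2[OF f] by auto
    show "bnd n k (amp f x) r" unfolding bnd_iff_Re
    proof (intro allI)
      fix \<xi> \<eta>
      have p: "?s (\<lambda>i p. \<xi> i p + c * \<eta> i p) (\<lambda>i p. \<xi> i p + c * \<eta> i p) =
        ?s \<xi> \<xi> + cnj c * ?s \<eta> \<xi> + c * ?s \<xi> \<eta> + cnj c * c * ?s \<eta> \<eta>" for c
        by (simp add: sesq_left sesq_right algebra_simps)
      have h: "Re (?s \<eta> \<xi>) = Re (?s \<xi> \<eta>)" using ucp_amp_hermitian[OF f x, of \<eta> \<xi>] by simp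
      have "(cmod (a + b))\<^sup>2 + (cmod (a - b))\<^sup>2 = 2 * (cmod a)\<^sup>2 + 2 * (cmod b)\<^sup>2" for a b
        unfolding cmod_power2 by (simp add: power2_eq_square algebra_simps)
      then have q: "sqn n k (\<lambda>i p. \<xi> i p + \<eta> i p) + sqn n k (\<lambda>i p. \<xi> i p - \<eta> i p) = 2 * sqn n k \<xi> + 2 * sqn n k \<eta>"
        unfolding sqn_def sum.distrib[symmetric] sum_distrib_left by (simp flip: sum.distrib)
      have "- 4 * Re (?s \<xi> \<eta>) = Re (?s (\<lambda>i p. \<xi> i p - \<eta> i p) (\<lambda>i p. \<xi> i p - \<eta> i p)) -
         Re (?s (\<lambda>i p. \<xi> i p + \<eta> i p) (\<lambda>i p. \<xi> i p + \<eta> i p))"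
        using p[of 1] p[of "- 1"] h by simp
      also have "\<dots> \<le> r * (2 * sqn n k \<xi> + 2 * sqn n k \<eta>)"
        using R[of "\<lambda>i p. \<xi> i p - \<eta> i p"] R[of "\<lambda>i p. \<xi> i p + \<eta> i p"]
        unfolding q[symmetric] by (simp add: distrib_left)
      finally show "- 2 * Re (?s \<xi> \<eta>) \<le> r * (sqn n k \<xi> + sqn n k \<eta>)" by (simp add: algebra_simps)
    qed
  qed
qed

text \<open>Conjugation by the signature matrix diag(1, -1) maps the norm block of radius 0 to its
  negative. The cone is proper, so the block vanishes, and x is its corner.\<close>

lemma mnorm_eq_0D:
  assumes x: "x \<in> mats n (carr X)" and 0: "mnorm X n x = 0"
  shows "x = 0"
proof -
  let ?N = "norm_block X n 0 x"
  have N: "?N \<in> pos X (2 * n)" using mnorm_norm_block(2)[OF x, of 0] 0 by simp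
  let ?A = "\<lambda>k l. if k = l then if k < n then 1 else - 1 else (0::complex)"
  have "compress X (2 * n) (2 * n) ?A ?N = - ?N"
  proof (intro ext)
    fix i j
    show "compress X (2 * n) (2 * n) ?A ?N i j = (- ?N) i j"
    proof (cases "i < 2 * n \<and> j < 2 * n")
      case True
      have 1: "(\<Sum>l<2*n. scl X (cnj (?A k i) * ?A l j) (?N k l)) = (if k = i then scl X (cnj (?A i i) * ?A j j) (?N i j) else 0)" for k
      proof -
        have "(\<Sum>l<2*n. scl X (cnj (?A k i) * ?A l j) (?N k l)) =
          (\<Sum>l<2*n. if l = j then if k = i then scl X (cnj (?A i i) * ?A j j) (?N i j) else 0 else 0)"
          by (rule sum.cong[OF refl]) auto
        then show ?thesis using True by simp
      qed
      have "compress X (2 * n) (2 * n) ?A ?N i j = scl X (cnj (?A i i) * ?A j j) (?N i j)"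
        using True unfolding compress_def 1 by simp
      also have "\<dots> = - ?N i j" by (auto simp: norm_block_def)
      finally show ?thesis by simp
    next
      case False
      then show ?thesis by (auto simp: compress_def norm_block_def)
    qed
  qed
  then have "- ?N \<in> pos X (2 * n)" using pos_compress[OF N, of "2 * n" ?A] by simp
  then have "?N = 0" using pos_proper N by blast
  show ?thesis
  proof (intro ext)
    fix i j
    show "x i j = 0 i j"
    proof (cases "i < n \<and> j < n")
      case True
      then have "?N i (n + j) = x i j" by (simp add: norm_block_def)
      then show ?thesis using \<open>?N = 0\<close> by simp
    next
      case False
      then show ?thesis using x by (auto simp: mats_def)
    qed
  qed
qed

end

lemma mnorm_matalg_le_iff:
  assumes "1 \<le> k" "y \<in> mats n (mats k UNIV)" "0 \<le> r"
  shows "mnorm (matalg k) n y \<le> r \<longleftrightarrow> bnd n k y r"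
  using operator_system.mnorm_norm_block(2)[OF operator_system_matalg[OF assms(1)], of y n r] assms
    matalg_norm_block_pos[OF assms(1,2)] by simp

lemma ucp_mnorm_le:
  assumes X: "operator_system X" and f: "ucp X k f" and x: "x \<in> mats n (carr X)"
  shows "mnorm (matalg k) n (amp f x) \<le> mnorm X n x"
proof -
  interpret operator_system X by fact
  have "amp f x \<in> mats n (mats k UNIV)" using cp_map_mats[OF X ucpD(2)[OF f] x] by simp
  then show ?thesis using mnorm_le_iff[OF x mnorm_nonneg[OF x]] f
      mnorm_matalg_le_iff[OF ucpD(1)[OF f] _ mnorm_nonneg[OF x], of "amp f x" n] by blast
qed

lemma amp_elt: "f 0 = 0 \<Longrightarrow> amp f (elt i j x) = elt i j (f x)"
  by (auto simp: amp_def elt_def fun_eq_iff)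

lemma opsys_norm_elt: "opsys_norm X x = mnorm X 1 (elt 0 0 x)"
  by (simp add: opsys_norm_def elt_def)

section \<open>Unital complete order embeddings\<close>

lemma embedding_linear:
  assumes "unital_complete_order_embedding X V h"
  shows "cp_map X V h" "h (ounit X) = ounit V" "inj_on h (carr X)"
  using assms by (auto simp: unital_complete_order_embedding_def)

lemma embedding_pos_iff:
  assumes X: "operator_system X" and h: "unital_complete_order_embedding X V h"
    and x: "x \<in> mats n (carr X)"
  shows "amp h x \<in> pos V n \<longleftrightarrow> x \<in> pos X n"
proof
  interpret X: operator_system X by fact
  assume p: "amp h x \<in> pos V n"
  have h0: "h 0 = 0" by (rule cp_map_0[OF X embedding_linear(1)[OF h]])
  have "amp h x \<in> mats n (h ` carr X)" by (rule amp_mats[where f = h, OF x subset_refl h0])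
  then have "amp h x \<in> pos (subsys V (h ` carr X)) n" using p by (simp add: subsys_def)
  then have "amp (inv_into (carr X) h) (amp h x) \<in> pos X n"
    using h unfolding unital_complete_order_embedding_def cp_map_def by blast
  moreover have "amp (inv_into (carr X) h) (amp h x) = x"
    by (rule amp_cancel[OF x _ X.carr_0]) (rule inv_into_f_f[OF embedding_linear(3)[OF h]])
  ultimately show "x \<in> pos X n" by simp
qed (use cp_map_linear(4)[OF embedding_linear(1)[OF h]] in auto)

lemma embedding_mnorm:
  assumes X: "operator_system X" and V: "operator_system V" and h: "unital_complete_order_embedding X V h"
    and x: "x \<in> mats n (carr X)"
  shows "mnorm V n (amp h x) = mnorm X n x"
  unfolding mnorm_def amp_norm_block[OF X V embedding_linear(1,2)[OF h] x, symmetric]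
    embedding_pos_iff[OF X h norm_block_mats[OF X x]] ..

text \<open>It is enough to reflect positivity on hermitian matrices. Norm blocks are hermitian, so
  all matrix norms are preserved, which gives injectivity; injectivity makes the preimage of a
  hermitian matrix hermitian, which gives complete positivity of the inverse.\<close>

lemma embeddingI:
  assumes X: "operator_system X" and V: "operator_system V" and h: "cp_map X V h" "h (ounit X) = ounit V"
    and pos: "\<And>n x. x \<in> hmats X n \<Longrightarrow> amp h x \<in> pos V n \<Longrightarrow> x \<in> pos X n"
  shows "unital_complete_order_embedding X V h"
proof -
  interpret X: operator_system X by fact
  interpret V: operator_system V by fact
  note lin = cp_map_linear[OF h(1)] and h0 = cp_map_0[OF X h(1)]
  have pos': "amp h x \<in> pos V n \<longleftrightarrow> x \<in> pos X n" if "x \<in> hmats X n" for x n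
    using pos[OF that] lin(4) by blast
  have norm: "mnorm V n (amp h x) = mnorm X n x" if x: "x \<in> mats n (carr X)" for x n
    unfolding mnorm_def amp_norm_block[OF X V h x, symmetric] pos'[OF norm_block_hmats[OF X x]] ..
  have inj: "inj_on h (carr X)"
  proof (rule inj_onI)
    fix x y assume xy: "x \<in> carr X" "y \<in> carr X" "h x = h y"
    have d: "x - y \<in> carr X" using xy X.carr_diff by blast
    have "h (x - y) = h x - h y" using lin(2)[OF d xy(2)] by (simp add: algebra_simps)
    then have "amp h (elt 0 0 (x - y)) = 0" using xy(3) by (simp add: amp_elt h0 elt_simps)
    then have "mnorm X 1 (elt 0 0 (x - y)) = 0" using norm[of "elt 0 0 (x - y)" 1] d X.mats_elt[of 0 1 0 "x - y"] by simp
    then have "elt 0 0 (x - y) = 0" using X.mnorm_eq_0D[of "elt 0 0 (x - y)" 1] d X.mats_elt[of 0 1 0 "x - y"] by simp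
    then have "elt 0 0 (x - y) 0 0 = 0" by simp
    then show "x = y" by (simp add: elt_def)
  qed
  have inv: "inv_into (carr X) h (h x) = x" if "x \<in> carr X" for x
    by (rule inv_into_f_f[OF inj that])
  have "cp_map (subsys V (h ` carr X)) X (inv_into (carr X) h)"
    unfolding cp_map_def
  proof (intro conjI ballI allI)
    have "inv_into (carr X) h (h x + h y) = x + y" if "x \<in> carr X" "y \<in> carr X" for x y
      using inv[OF X.carr_add[OF that]] lin(2)[OF that] by simp
    moreover have "inv_into (carr X) h (scl V c (h x)) = scl X c x" if "x \<in> carr X" for x c
      using inv[OF X.carr_scl[OF that]] lin(3)[OF that] by simp
    ultimately show "linear_into (scl (subsys V (h ` carr X))) (carr (subsys V (h ` carr X))) (scl X) (carr X) (inv_into (carr X) h)"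
      by (auto simp: linear_into_def subsys_def inv)
    fix n y assume "y \<in> pos (subsys V (h ` carr X)) n"
    then have y: "y \<in> pos V n" "y \<in> mats n (h ` carr X)" by (auto simp: subsys_def)
    let ?x = "amp (inv_into (carr X) h) y"
    have 0: "inv_into (carr X) h 0 = 0" using inv[OF X.carr_0] h0 by simp
    have x: "?x \<in> mats n (carr X)" by (rule amp_mats[where f = "inv_into (carr X) h", OF y(2) _ 0]) (auto simp: inv)
    have xy: "amp h ?x = y"
      by (rule amp_cancel[OF y(2)]) (auto simp: inv h0 intro!: image_eqI[of _ h 0] X.carr_0)
    have "amp h (madj X n ?x) = madj V n (amp h ?x)"
      by (auto simp: amp_def madj_def fun_eq_iff h0 cp_map_adj[OF X V h(1)] X.mats_entry[OF x, unfolded amp_def])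
    also have "\<dots> = amp h ?x" using y(1) V.pos_hmats xy by (auto simp: hmats_def)
    finally have e: "h (madj X n ?x i j) = h (?x i j)" for i j by (simp add: amp_def fun_eq_iff)
    have "madj X n ?x = ?x"
      by (intro ext) (rule inj_onD[OF inj e], auto intro: X.mats_entry[OF X.mats_madj[OF x]] X.mats_entry[OF x])
    then have "?x \<in> hmats X n" using x by (simp add: hmats_def)
    then show "?x \<in> pos X n" using pos xy y(1) by simp
  qed
  moreover have "opsys_norm V (h x) = opsys_norm X x" if "x \<in> carr X" for x
    using norm[OF X.mats_elt[of 0 1 0 x]] that by (simp add: opsys_norm_elt amp_elt h0)
  ultimately show ?thesis using h inj by (auto simp: unital_complete_order_embedding_def)
qed

context operator_system
begin

lemma opsys_norm_nonneg: "x \<in> carr X \<Longrightarrow> 0 \<le> opsys_norm X x"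
  unfolding opsys_norm_elt by (intro mnorm_nonneg mats_elt) auto

lemma opsys_norm_triangle: "x \<in> carr X \<Longrightarrow> y \<in> carr X \<Longrightarrow> opsys_norm X (x + y) \<le> opsys_norm X x + opsys_norm X y"
  unfolding opsys_norm_elt elt_simps by (intro mnorm_triangle mats_elt) auto

lemma opsys_norm_scl: "x \<in> carr X \<Longrightarrow> opsys_norm X (scl X c x) = cmod c * opsys_norm X x"
proof -
  assume x: "x \<in> carr X"
  have "elt 0 0 (scl X c x) = mscl X c (elt 0 0 x)" by (auto simp: elt_def mscl_def fun_eq_iff)
  then show ?thesis unfolding opsys_norm_elt using x mnorm_mscl[of "elt 0 0 x" 1 c] by (simp add: mats_elt)
qed

lemma opsys_norm_0 [simp]: "opsys_norm X 0 = 0"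
  unfolding opsys_norm_elt elt_simps by simp

lemma opsys_norm_neg: "x \<in> carr X \<Longrightarrow> opsys_norm X (- x) = opsys_norm X x"
  using opsys_norm_scl[of x "- 1"] by simp

lemma opsys_norm_diff: "x \<in> carr X \<Longrightarrow> y \<in> carr X \<Longrightarrow> opsys_norm X (x - y) \<le> opsys_norm X x + opsys_norm X y"
  using opsys_norm_triangle[of x "- y"] opsys_norm_neg[of y] carr_neg by simp

lemma opsys_norm_eq_0D: "x \<in> carr X \<Longrightarrow> opsys_norm X x = 0 \<Longrightarrow> x = 0"
proof -
  assume "x \<in> carr X" "opsys_norm X x = 0"
  then have "elt 0 0 x = 0" unfolding opsys_norm_elt by (intro mnorm_eq_0D mats_elt) auto
  then have "elt 0 0 x 0 0 = 0" by simp
  then show ?thesis by (simp add: elt_def)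
qed

lemma opsys_norm_sum: "(\<And>a. a \<in> A \<Longrightarrow> f a \<in> carr X) \<Longrightarrow> opsys_norm X (sum f A) \<le> (\<Sum>a\<in>A. opsys_norm X (f a))"
proof (induction A rule: infinite_finite_induct)
  case (insert a A)
  then show ?case using opsys_norm_triangle[of "f a" "sum f A"] carr_sum[of A f] by fastforce
qed auto

end

section \<open>Two-sided compression by contractions\<close>

text \<open>Rescaling \<xi> by t and \<eta> by 1 / t leaves the form unchanged. With t the square
  root of the quotient of the two norms, both square norms become the product of the norms.\<close>

lemma bnd_product:
  assumes b: "bnd n k y r" and r: "0 \<le> r"
  shows "cmod (sesq n k y \<xi> \<eta>) \<le> r * (sqrt (sqn n k \<xi>) * sqrt (sqn n k \<eta>))"
proof -
  define a where "a = sqrt (sqn n k \<xi>)"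
  define c where "c = sqrt (sqn n k \<eta>)"
  have ac: "0 \<le> a" "0 \<le> c" "sqn n k \<xi> = a\<^sup>2" "sqn n k \<eta> = c\<^sup>2" by (auto simp: a_def c_def sqn_nonneg)
  have zero: "\<zeta> i p = 0" if "sqn n k \<zeta> = 0" "i < n" "p < k" for \<zeta> i p
    using sqn_ge[OF that(2,3), of \<zeta>] that(1) by simp
  show ?thesis
  proof (cases "a = 0 \<or> c = 0")
    case True
    then have "sesq n k y \<xi> \<eta> = 0" unfolding sesq_def using zero ac by (auto intro!: sum.neutral)
    then show ?thesis using r ac by (simp add: sqn_nonneg)
  next
    case False
    then have p: "0 < a" "0 < c" using ac by auto
    define t where "t = sqrt (c / a)"
    have t: "0 < t" "t\<^sup>2 = c / a" using p by (auto simp: t_def)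
    have "sesq n k y (\<lambda>i p. complex_of_real t * \<xi> i p) (\<lambda>i p. 0 + complex_of_real (1 / t) * \<eta> i p)
      = complex_of_real t * (sesq n k y \<xi> (\<lambda>i p. 0) + complex_of_real (1 / t) * sesq n k y \<xi> \<eta>)"
      unfolding sesq_scale_left sesq_right by simp
    also have "sesq n k y \<xi> (\<lambda>i p. 0) = 0" by (simp add: sesq_def)
    finally have "sesq n k y (\<lambda>i p. complex_of_real t * \<xi> i p) (\<lambda>i p. complex_of_real (1 / t) * \<eta> i p) = sesq n k y \<xi> \<eta>"
      using t by simp
    then have "2 * cmod (sesq n k y \<xi> \<eta>) \<le> r * (t\<^sup>2 * a\<^sup>2 + (1 / t)\<^sup>2 * c\<^sup>2)"
      using b[unfolded bnd_def, rule_format, of "\<lambda>i p. complex_of_real t * \<xi> i p" "\<lambda>i p. complex_of_real (1 / t) * \<eta> i p"]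
      by (simp add: sqn_scale ac abs_of_pos[OF t(1)] del: of_real_divide)
    also have "t\<^sup>2 * a\<^sup>2 + (1 / t)\<^sup>2 * c\<^sup>2 = 2 * (a * c)"
      using p by (simp add: power_divide t(2)) (simp add: power2_eq_square field_simps)
    finally show ?thesis by (simp add: a_def c_def)
  qed
qed

text \<open>The matrix product of the adjoint of A, of x and of B. Norm estimates of bilinear forms
  need two different factors, while \<open>compress\<close> has the same one on both sides.\<close>

definition bicomp ::
    "'a opsys \<Rightarrow> nat \<Rightarrow> nat \<Rightarrow> (nat \<Rightarrow> nat \<Rightarrow> complex) \<Rightarrow> (nat \<Rightarrow> nat \<Rightarrow> complex) \<Rightarrow> (nat \<Rightarrow> nat \<Rightarrow> 'a::comm_monoid_add) \<Rightarrow> nat \<Rightarrow> nat \<Rightarrow> 'a"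
  where "bicomp X n m A B x = (\<lambda>a b. if a < m \<and> b < m
     then \<Sum>k<n. \<Sum>l<n. scl X (cnj (A k a) * B l b) (x k l) else 0)"

lemma linear_into_sum:
  assumes lin: "linear_into s E t F f" and V: "vector_space s" and E: "module.subspace s E"
    and g: "\<And>a. a \<in> A \<Longrightarrow> g a \<in> E"
  shows "f (sum g A) = (\<Sum>a\<in>A. f (g a) :: 'b::ab_group_add)"
proof -
  interpret vector_space s by fact
  show ?thesis using g
  proof (induction A rule: infinite_finite_induct)
    case (insert a A)
    then have "f (g a + sum g A) = f (g a) + f (sum g A)"
      using lin subspace_sum[OF E, of A g] unfolding linear_into_def by blast
    then show ?case using insert by simp
  qed (use linear_into_0[OF lin subspace_0[OF E]] in auto)
qed

text \<open>Stated for a linear map on a subspace, since \<open>smith\<close> applies it to an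
  isomorphism that is defined on \<open>E\<close> only.\<close>

lemma sesq_bicomp:
  assumes X: "operator_system X" and lin: "linear_into (scl X) E (scl (matalg k)) F f"
    and E: "module.subspace (scl X) E" and x: "x \<in> mats n E"
  shows "sesq m k (amp f (bicomp X n m A B x)) \<xi> \<eta> =
    sesq n k (amp f x) (\<lambda>i p. \<Sum>a<m. A i a * \<xi> a p) (\<lambda>i p. \<Sum>a<m. B i a * \<eta> a p)"
proof -
  interpret operator_system X by fact
  have xE: "x i j \<in> E" for i j using x subspace_0[OF E] by (cases "i < n \<and> j < n") (auto simp: mats_def)
  have V: "vector_space (scl X)" by unfold_locales
  have f: "f (bicomp X n m A B x a b) p q = (\<Sum>i<n. \<Sum>j<n. cnj (A i a) * B j b * f (x i j) p q)"
    if "a < m" "b < m" for a b p q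
  proof -
    have "f (bicomp X n m A B x a b) = (\<Sum>i<n. f (\<Sum>j<n. scl X (cnj (A i a) * B j b) (x i j)))"
      using that by (simp add: bicomp_def linear_into_sum[OF lin V E] subspace_sum[OF E] subspace_scale[OF E] xE)
    also have "\<dots> = (\<Sum>i<n. \<Sum>j<n. f (scl X (cnj (A i a) * B j b) (x i j)))"
      by (simp add: linear_into_sum[OF lin V E] subspace_scale[OF E] xE)
    also have "\<dots> = (\<Sum>i<n. \<Sum>j<n. (\<lambda>p q. cnj (A i a) * B j b * f (x i j) p q))"
      using lin xE by (simp add: linear_into_def)
    finally show ?thesis by (simp add: sum_fun_apply2)
  qed
  have "sesq m k (amp f (bicomp X n m A B x)) \<xi> \<eta> =
    (\<Sum>a<m. \<Sum>b<m. \<Sum>p<k. \<Sum>q<k. \<Sum>i<n. \<Sum>j<n. cnj (\<xi> a p) * (cnj (A i a) * B j b * f (x i j) p q) * \<eta> b q)"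
    unfolding sesq_def by (intro sum.cong refl) (simp add: amp_def f sum_distrib_left sum_distrib_right)
  also have "\<dots> = (\<Sum>a<m. \<Sum>b<m. \<Sum>i<n. \<Sum>j<n. \<Sum>p<k. \<Sum>q<k. cnj (\<xi> a p) * (cnj (A i a) * B j b * f (x i j) p q) * \<eta> b q)"
    by (rule sum.cong[OF refl], rule sum.cong[OF refl], rule sum_swap22)
  also have "\<dots> = (\<Sum>i<n. \<Sum>j<n. \<Sum>a<m. \<Sum>b<m. \<Sum>p<k. \<Sum>q<k. cnj (\<xi> a p) * (cnj (A i a) * B j b * f (x i j) p q) * \<eta> b q)"
    by (rule sum_swap22)
  also have "\<dots> = (\<Sum>i<n. \<Sum>j<n. \<Sum>p<k. \<Sum>q<k. \<Sum>a<m. \<Sum>b<m. cnj (\<xi> a p) * (cnj (A i a) * B j b * f (x i j) p q) * \<eta> b q)"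
    by (rule sum.cong[OF refl], rule sum.cong[OF refl], rule sum_swap22)
  also have "\<dots> = sesq n k (amp f x) (\<lambda>i p. \<Sum>a<m. A i a * \<xi> a p) (\<lambda>i p. \<Sum>a<m. B i a * \<eta> a p)"
    unfolding sesq_def by (intro sum.cong refl) (simp add: amp_def sum_distrib_left sum_distrib_right mult_ac)
  finally show ?thesis .
qed

definition contr :: "nat \<Rightarrow> nat \<Rightarrow> (nat \<Rightarrow> nat \<Rightarrow> complex) \<Rightarrow> bool" where
  "contr n m A \<longleftrightarrow> (\<forall>z. (\<Sum>i<n. (cmod (\<Sum>a<m. A i a * z a))\<^sup>2) \<le> (\<Sum>a<m. (cmod (z a))\<^sup>2))"

lemma contr_sqn:
  assumes "contr n m A"
  shows "sqn n k (\<lambda>i p. \<Sum>a<m. A i a * \<xi> a p) \<le> sqn m k \<xi>"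
proof -
  have "sqn n k (\<lambda>i p. \<Sum>a<m. A i a * \<xi> a p) = (\<Sum>p<k. \<Sum>i<n. (cmod (\<Sum>a<m. A i a * \<xi> a p))\<^sup>2)"
    unfolding sqn_def by (rule sum.swap)
  also have "\<dots> \<le> (\<Sum>p<k. \<Sum>a<m. (cmod (\<xi> a p))\<^sup>2)"
    by (intro sum_mono) (rule assms[unfolded contr_def, rule_format])
  also have "\<dots> = sqn m k \<xi>" unfolding sqn_def by (rule sum.swap)
  finally show ?thesis .
qed

lemma mats_bicomp:
  assumes X: "operator_system X" and E: "module.subspace (scl X) E" and x: "x \<in> mats n E"
  shows "bicomp X n m A B x \<in> mats m E"
proof -
  interpret operator_system X by fact
  have xE: "x i j \<in> E" for i j using x subspace_0[OF E] by (cases "i < n \<and> j < n") (auto simp: mats_def)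
  show ?thesis by (auto simp: mats_def bicomp_def intro!: subspace_sum[OF E] subspace_scale[OF E] xE)
qed

lemma mnorm_bicomp:
  assumes X: "operator_system X" and x: "x \<in> mats n (carr X)" and A: "contr n m A" and B: "contr n m B"
  shows "mnorm X m (bicomp X n m A B x) \<le> mnorm X n x"
proof -
  interpret operator_system X by fact
  show ?thesis
  proof (rule mnorm_leI)
    show "bicomp X n m A B x \<in> mats m (carr X)" by (rule mats_bicomp[OF X subspace_carr x])
    show "0 \<le> mnorm X n x" by (rule mnorm_nonneg[OF x])
    fix k f \<xi> \<eta> assume f: "ucp X k f"
    have lin: "linear_into (scl X) (carr X) (scl (matalg k)) (carr (matalg k)) f"
      using ucpD(2)[OF f] by (simp add: cp_map_def)
    have "2 * cmod (sesq m k (amp f (bicomp X n m A B x)) \<xi> \<eta>) \<le> mnorm X n x *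
       (sqn n k (\<lambda>i p. \<Sum>a<m. A i a * \<xi> a p) + sqn n k (\<lambda>i p. \<Sum>a<m. B i a * \<eta> a p))"
      unfolding sesq_bicomp[OF X lin subspace_carr x] by (rule mnormD[OF x f order_refl])
    also have "\<dots> \<le> mnorm X n x * (sqn m k \<xi> + sqn m k \<eta>)"
      by (intro mult_left_mono add_mono contr_sqn A B mnorm_nonneg[OF x])
    finally show "2 * cmod (sesq m k (amp f (bicomp X n m A B x)) \<xi> \<eta>) \<le> mnorm X n x * (sqn m k \<xi> + sqn m k \<eta>)" .
  qed
qed

text \<open>A regularized polar decomposition: T is a Cholesky factor of the Gram matrix of u plus
  \<epsilon>, and A is u times the inverse of T. The regularization makes T invertible whatever the
  rank of u, at the price of the extra \<epsilon> N in the square norm.\<close>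

lemma contr_factor:
  assumes \<epsilon>: "0 < \<epsilon>"
  shows "\<exists>A T. contr n N A \<and> (\<forall>i<n. \<forall>b<N. u i b = (\<Sum>a<N. A i a * T a b)) \<and>
    sqn N N T = sqn n N u + \<epsilon> * real N"
proof -
  define P where "P a b = (\<Sum>i<n. cnj (u i a) * u i b) + (if a = b then complex_of_real \<epsilon> else 0)" for a b
  have cs: "cnj z * z = complex_of_real ((cmod z)\<^sup>2)" for z by (simp only: complex_norm_square mult.commute)
  have form: "(\<Sum>a<N. \<Sum>b<N. cnj (z a) * P a b * z b) =
    complex_of_real ((\<Sum>i<n. (cmod (\<Sum>b<N. u i b * z b))\<^sup>2) + \<epsilon> * (\<Sum>a<N. (cmod (z a))\<^sup>2))" for z
  proof -
    have "(\<Sum>a<N. \<Sum>b<N. cnj (z a) * P a b * z b) =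
      (\<Sum>a<N. \<Sum>b<N. \<Sum>i<n. cnj (u i a * z a) * (u i b * z b)) +
      (\<Sum>a<N. \<Sum>b<N. if b = a then complex_of_real \<epsilon> * (cnj (z a) * z b) else 0)"
      unfolding sum.distrib[symmetric]
      by (intro sum.cong refl) (simp add: P_def distrib_left distrib_right sum_distrib_left sum_distrib_right mult_ac)
    also have "(\<Sum>a<N. \<Sum>b<N. \<Sum>i<n. cnj (u i a * z a) * (u i b * z b)) =
      (\<Sum>i<n. cnj (\<Sum>a<N. u i a * z a) * (\<Sum>b<N. u i b * z b))"
      unfolding cnj_sum sum_product by (rule sum_rotate)
    also have "\<dots> = (\<Sum>i<n. complex_of_real ((cmod (\<Sum>b<N. u i b * z b))\<^sup>2))"
      by (rule sum.cong[OF refl], rule cs)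
    also have "(\<Sum>a<N. \<Sum>b<N. if b = a then complex_of_real \<epsilon> * (cnj (z a) * z b) else 0) =
      (\<Sum>a<N. complex_of_real (\<epsilon> * (cmod (z a))\<^sup>2))"
      by (rule sum.cong[OF refl]) (simp add: cs del: of_real_power)
    finally show ?thesis by (simp add: sum_distrib_left)
  qed
  have "\<exists>T D. (\<forall>i<N. \<forall>j<N. P i j = (\<Sum>k<N. cnj (T k i) * T k j)) \<and>
    (\<forall>i<N. \<forall>j<N. (\<Sum>k<N. D i k * T k j) = (if i = j then 1 else 0)) \<and>
    (\<forall>i<N. \<forall>j<N. (\<Sum>k<N. T i k * D k j) = (if i = j then 1 else 0))"
  proof (rule cholesky)
    show "P j i = cnj (P i j)" for i j by (simp add: P_def mult.commute)
    show "0 < Re (\<Sum>i<N. \<Sum>j<N. cnj (z i) * P i j * z j)" if z: "\<exists>i<N. z i \<noteq> 0" for z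
    proof -
      have "0 < (\<Sum>a<N. (cmod (z a))\<^sup>2)" using z by (auto intro!: sum_pos2)
      then show ?thesis unfolding form using \<epsilon> by (simp add: add_nonneg_pos sum_nonneg)
    qed
  qed
  then obtain T D where T: "\<forall>i<N. \<forall>j<N. P i j = (\<Sum>k<N. cnj (T k i) * T k j)"
    and DT: "\<forall>i<N. \<forall>j<N. (\<Sum>k<N. D i k * T k j) = (if i = j then 1 else 0)"
    and TD: "\<forall>i<N. \<forall>j<N. (\<Sum>k<N. T i k * D k j) = (if i = j then 1 else 0)"
    by (elim exE conjE)
  define A where "A i a = (\<Sum>b<N. u i b * D b a)" for i a
  show ?thesis
  proof (rule exI[of _ A], rule exI[of _ T], intro conjI allI impI)
    \<comment> \<open>With w the preimage of z under T, the square norm of A z is that of z minus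
      \<epsilon> times that of w.\<close>
    show "contr n N A" unfolding contr_def
    proof
      fix z
      define w where "w b = (\<Sum>a<N. D b a * z a)" for b
      have "(\<Sum>a<N. A i a * z a) = (\<Sum>b<N. u i b * w b)" for i
        unfolding A_def w_def sum_distrib_left sum_distrib_right by (subst sum.swap) (simp add: mult_ac)
      then have "complex_of_real (\<Sum>i<n. (cmod (\<Sum>a<N. A i a * z a))\<^sup>2) =
        (\<Sum>a<N. \<Sum>b<N. cnj (w a) * P a b * w b) - complex_of_real (\<epsilon> * (\<Sum>a<N. (cmod (w a))\<^sup>2))"
        unfolding form by simp
      also have "(\<Sum>a<N. \<Sum>b<N. cnj (w a) * P a b * w b) = (\<Sum>a<N. \<Sum>b<N. \<Sum>k<N. cnj (T k a * w a) * (T k b * w b))"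
        by (intro sum.cong refl) (simp add: T sum_distrib_left sum_distrib_right mult_ac)
      also have "\<dots> = (\<Sum>k<N. cnj (\<Sum>a<N. T k a * w a) * (\<Sum>b<N. T k b * w b))"
        unfolding cnj_sum sum_product by (rule sum_rotate)
      also have "\<dots> = (\<Sum>k<N. cnj (z k) * z k)"
      proof (intro sum.cong refl)
        fix k assume k: "k \<in> {..<N}"
        have "(\<Sum>a<N. T k a * w a) = (\<Sum>c<N. (\<Sum>a<N. T k a * D a c) * z c)"
          unfolding w_def sum_distrib_left sum_distrib_right by (subst sum.swap) (simp add: mult_ac)
        also have "\<dots> = (\<Sum>c<N. if c = k then z c else 0)"
          by (intro sum.cong refl) (use TD k in auto)
        finally have "(\<Sum>a<N. T k a * w a) = z k" using k by simp
        then show "cnj (\<Sum>a<N. T k a * w a) * (\<Sum>b<N. T k b * w b) = cnj (z k) * z k" by simp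
      qed
      also have "\<dots> = complex_of_real (\<Sum>k<N. (cmod (z k))\<^sup>2)" by (simp add: cs)
      finally have "(\<Sum>i<n. (cmod (\<Sum>a<N. A i a * z a))\<^sup>2) = (\<Sum>k<N. (cmod (z k))\<^sup>2) - \<epsilon> * (\<Sum>a<N. (cmod (w a))\<^sup>2)"
        unfolding of_real_diff[symmetric] of_real_eq_iff .
      moreover have "0 \<le> \<epsilon> * (\<Sum>a<N. (cmod (w a))\<^sup>2)" using \<epsilon> by (intro mult_nonneg_nonneg sum_nonneg) auto
      ultimately show "(\<Sum>i<n. (cmod (\<Sum>a<N. A i a * z a))\<^sup>2) \<le> (\<Sum>a<N. (cmod (z a))\<^sup>2)" by linarith
    qed
    show "u i b = (\<Sum>a<N. A i a * T a b)" if "i < n" "b < N" for i b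
    proof -
      have "(\<Sum>a<N. A i a * T a b) = (\<Sum>c<N. u i c * (\<Sum>a<N. D c a * T a b))"
        unfolding A_def sum_distrib_left sum_distrib_right by (subst sum.swap) (simp add: mult_ac)
      also have "\<dots> = (\<Sum>c<N. if c = b then u i c else 0)"
        by (intro sum.cong refl) (use DT that in auto)
      finally show ?thesis using that by simp
    qed
    have "complex_of_real (sqn N N T) = (\<Sum>b<N. \<Sum>a<N. cnj (T a b) * T a b)"
      unfolding sqn_def by (subst sum.swap) (simp add: cs)
    also have "\<dots> = (\<Sum>b<N. P b b)" using T by simp
    also have "\<dots> = complex_of_real (sqn n N u + \<epsilon> * real N)"
      unfolding sqn_def P_def by (subst sum.swap) (simp add: cs sum.distrib)
    finally show "sqn N N T = sqn n N u + \<epsilon> * real N" unfolding of_real_eq_iff .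
  qed
qed

section \<open>Exactness\<close>

text \<open>Rounding real and imaginary parts to a grid of width \<gamma> / 2 leaves finitely many
  patterns. One point of T is kept for each pattern that occurs, so the net consists of points of T
  itself; the two parts contribute at most \<gamma> / 2 each.\<close>

lemma finite_net:
  fixes c :: "'x \<Rightarrow> 'i \<Rightarrow> complex"
  assumes I: "finite I" and M: "\<And>x i. x \<in> T \<Longrightarrow> i \<in> I \<Longrightarrow> cmod (c x i) \<le> M" and \<gamma>: "0 < \<gamma>"
  shows "\<exists>F. finite F \<and> F \<subseteq> T \<and> (\<forall>x\<in>T. \<exists>y\<in>F. \<forall>i\<in>I. cmod (c x i - c y i) \<le> \<gamma>)"
proof -
  define fl where "fl r = \<lfloor>2 * r / \<gamma>\<rfloor>" for r :: real
  define g where "g x = (\<lambda>i\<in>I. (fl (Re (c x i)), fl (Im (c x i))))" for x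
  define L where "L = \<lceil>2 * \<bar>M\<bar> / \<gamma>\<rceil> + 1"
  have fl: "fl r \<in> {- L..L}" if "\<bar>r\<bar> \<le> M" for r
  proof -
    have "2 * r / \<gamma> \<le> 2 * \<bar>M\<bar> / \<gamma>" "2 * (- r) / \<gamma> \<le> 2 * \<bar>M\<bar> / \<gamma>"
      using that \<gamma> by (intro divide_right_mono; linarith)+
    then show ?thesis unfolding fl_def L_def atLeastAtMost_iff by (simp add: floor_le_iff le_floor_iff) linarith
  qed
  have "g x \<in> I \<rightarrow>\<^sub>E {- L..L} \<times> {- L..L}" if x: "x \<in> T" for x
  proof (rule PiE_I)
    fix i assume i: "i \<in> I"
    have "\<bar>Re (c x i)\<bar> \<le> M" "\<bar>Im (c x i)\<bar> \<le> M"
      using M[OF x i] abs_Re_le_cmod[of "c x i"] abs_Im_le_cmod[of "c x i"] by linarith+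
    then show "g x i \<in> {- L..L} \<times> {- L..L}" using i fl by (auto simp: g_def)
  qed (auto simp: g_def)
  then have "g ` T \<subseteq> I \<rightarrow>\<^sub>E {- L..L} \<times> {- L..L}" by blast
  then have fin: "finite (g ` T)" by (rule finite_subset) (intro finite_PiE I, auto)
  have close: "\<bar>r - s\<bar> \<le> \<gamma> / 2" if "fl r = fl s" for r s
  proof -
    have "\<bar>2 * r / \<gamma> - 2 * s / \<gamma>\<bar> \<le> 1" using that unfolding fl_def by linarith
    then have "\<bar>2 * (r - s)\<bar> / \<gamma> \<le> 1" using \<gamma> by (simp add: diff_divide_distrib[symmetric] algebra_simps abs_divide)
    then have "\<bar>2 * (r - s)\<bar> \<le> \<gamma>" using \<gamma> by (simp add: divide_le_eq)
    then show ?thesis by (simp only: abs_mult) simp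
  qed
  show ?thesis
  proof (intro exI[of _ "(\<lambda>v. SOME x. x \<in> T \<and> g x = v) ` g ` T"] conjI ballI)
    have sel: "(SOME y. y \<in> T \<and> g y = g x) \<in> T \<and> g (SOME y. y \<in> T \<and> g y = g x) = g x" if "x \<in> T" for x
      by (rule someI[of _ x]) (simp add: that)
    show "finite ((\<lambda>v. SOME x. x \<in> T \<and> g x = v) ` g ` T)" using fin by simp
    show "(\<lambda>v. SOME x. x \<in> T \<and> g x = v) ` g ` T \<subseteq> T" using sel by auto
    fix x assume x: "x \<in> T"
    define y where "y = (SOME y. y \<in> T \<and> g y = g x)"
    have y: "g y = g x" using sel[OF x] by (simp add: y_def)
    have "cmod (c x i - c y i) \<le> \<gamma>" if i: "i \<in> I" for i
    proof -
      have "g y i = g x i" using y by simp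
      then have "\<bar>Re (c x i) - Re (c y i)\<bar> \<le> \<gamma> / 2" "\<bar>Im (c x i) - Im (c y i)\<bar> \<le> \<gamma> / 2"
        using i close by (auto simp: g_def)
      then show ?thesis using cmod_le[of "c x i - c y i"] by simp
    qed
    then show "\<exists>y\<in>(\<lambda>v. SOME x. x \<in> T \<and> g x = v) ` g ` T. \<forall>i\<in>I. cmod (c x i - c y i) \<le> \<gamma>"
      using x by (intro bexI[of _ y]) (auto simp: y_def)
  qed
qed

text \<open>Coordinates in finite dimension are continuous, here for a norm given on a subset with
  its own scalar multiplication. In the inductive step, if combinations of the earlier vectors came
  arbitrarily close to the new one, their coefficients would be Cauchy by the bound already known,
  and the limit would be a linear relation.\<close>

lemma coord_bounded:
  fixes s :: "complex \<Rightarrow> 'a::ab_group_add \<Rightarrow> 'a" and d :: nat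
  assumes V: "vector_space s" and S: "module.subspace s S"
    and tri: "\<And>x y. x \<in> S \<Longrightarrow> y \<in> S \<Longrightarrow> nrm (x + y) \<le> nrm x + (nrm y :: real)"
    and hom: "\<And>c x. x \<in> S \<Longrightarrow> nrm (s c x) = cmod c * nrm x"
    and def: "\<And>x. x \<in> S \<Longrightarrow> nrm x = 0 \<Longrightarrow> x = 0"
    and nn: "\<And>x. x \<in> S \<Longrightarrow> 0 \<le> nrm x"
    and b: "\<And>i. i < d \<Longrightarrow> b i \<in> S"
    and ind: "\<And>a i. (\<Sum>i<d. s (a i) (b i)) = 0 \<Longrightarrow> i < d \<Longrightarrow> a i = 0"
  shows "\<exists>K>0. \<forall>a. \<forall>i<d. cmod (a i) \<le> K * nrm (\<Sum>i<d. s (a i) (b i))"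
  using b ind
proof (induction d)
  case 0
  then show ?case by (auto intro: exI[of _ 1])
next
  case (Suc d)
  interpret vector_space s by fact
  let ?L = "\<lambda>a. \<Sum>i<d. s (a i) (b i)"
  have LS: "?L a \<in> S" for a using Suc.prems(1) by (intro subspace_sum[OF S] subspace_scale[OF S]) auto
  have bd: "b d \<in> S" using Suc.prems(1) by simp
  have ind': "a i = 0" if "?L a = 0" "i < d" for a i
    using Suc.prems(2)[of "\<lambda>i. if i < d then a i else 0" i] that by simp
  have "\<exists>K>0. \<forall>a. \<forall>i<d. cmod (a i) \<le> K * nrm (?L a)"
    by (rule Suc.IH) (use Suc.prems(1) ind' in auto)
  then obtain K where K: "0 < K" "\<And>a i. i < d \<Longrightarrow> cmod (a i) \<le> K * nrm (?L a)"
    by blast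
  have Ldiff: "?L (\<lambda>i. a i - a' i) = ?L a - ?L a'" for a a'
    by (simp add: scale_left_diff_distrib sum_subtractf)
  have nneg: "nrm (- x) = nrm x" if "x \<in> S" for x using hom[OF that, of "- 1"] by simp
  have tri': "nrm (x - y) \<le> nrm x + nrm y" if "x \<in> S" "y \<in> S" for x y
    using tri[OF that(1) subspace_neg[OF S that(2)]] nneg[OF that(2)] by simp
  have "\<exists>\<delta>>0. \<forall>a. \<delta> \<le> nrm (b d - ?L a)"
  proof (rule ccontr)
    assume "\<not> ?thesis"
    then have "\<exists>a. nrm (b d - ?L a) < inverse (real (Suc m))" for m
      by (meson inverse_positive_iff_positive not_less of_nat_0_less_iff zero_less_Suc)
    then obtain a where a: "\<And>m. nrm (b d - ?L (a m)) < inverse (real (Suc m))" by metis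
    have cau: "cmod (a m i - a l i) \<le> K * (inverse (real (Suc m)) + inverse (real (Suc l)))" if i: "i < d" for m l i
    proof -
      have "cmod (a m i - a l i) \<le> K * nrm (?L (\<lambda>i. a m i - a l i))"
        by (rule K(2)[OF i, of "\<lambda>i. a m i - a l i"])
      also have "?L (\<lambda>i. a m i - a l i) = (b d - ?L (a l)) - (b d - ?L (a m))" by (simp add: Ldiff)
      also have "nrm \<dots> \<le> nrm (b d - ?L (a l)) + nrm (b d - ?L (a m))"
        by (intro tri' subspace_diff[OF S] bd LS)
      finally show ?thesis using K(1) a[of m] a[of l]
        by (smt (verit, ccfv_SIG) mult_left_mono)
    qed
    have "\<exists>z. (\<lambda>m. a m i) \<longlonglongrightarrow> z" if i: "i < d" for i
    proof -
      have "Cauchy (\<lambda>m. a m i)"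
      proof (rule CauchyI)
        fix e :: real assume e: "0 < e"
        obtain M where M: "inverse (real (Suc M)) < e / (2 * K)"
          using reals_Archimedean[of "e / (2 * K)"] e K(1) by auto
        have "norm (a m i - a n i) < e" if "M \<le> m" "M \<le> n" for m n
        proof -
          have "inverse (real (Suc m)) \<le> inverse (real (Suc M))" "inverse (real (Suc n)) \<le> inverse (real (Suc M))"
            using that by (auto intro!: le_imp_inverse_le)
          then have "inverse (real (Suc m)) + inverse (real (Suc n)) < e / (2 * K) + e / (2 * K)" using M by linarith
          then have "inverse (real (Suc m)) + inverse (real (Suc n)) < e / K" by (simp add: field_simps)
          then have "K * (inverse (real (Suc m)) + inverse (real (Suc n))) < e" using K(1) by (simp add: field_simps)
          then show ?thesis using cau[OF i, of m n] by simp
        qed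
        then show "\<exists>M. \<forall>m\<ge>M. \<forall>n\<ge>M. norm (a m i - a n i) < e" by blast
      qed
      then show ?thesis using Cauchy_convergent convergent_def by blast
    qed
    then obtain z where z: "\<And>i. i < d \<Longrightarrow> (\<lambda>m. a m i) \<longlonglongrightarrow> z i" by metis
    have "nrm (b d - ?L z) \<le> inverse (real (Suc m)) + (\<Sum>i<d. cmod (a m i - z i) * nrm (b i))" for m
    proof -
      have 1: "nrm (\<Sum>i\<in>I. s (w i) (b i)) \<le> (\<Sum>i\<in>I. cmod (w i) * nrm (b i))" if "I \<subseteq> {..<d}" for I w
      proof -
        have "finite I" using that finite_subset by blast
        then show ?thesis using that
        proof induction
          case empty
          have "nrm 0 = 0" using hom[OF subspace_0[OF S], of 0] by simp
          then show ?case by simp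
        next
          case (insert i I)
          have "s (w i) (b i) \<in> S" "(\<Sum>i\<in>I. s (w i) (b i)) \<in> S"
            using insert Suc.prems(1) by (auto intro!: subspace_sum[OF S] subspace_scale[OF S])
          then have "nrm (s (w i) (b i) + (\<Sum>i\<in>I. s (w i) (b i))) \<le> nrm (s (w i) (b i)) + nrm (\<Sum>i\<in>I. s (w i) (b i))"
            by (rule tri)
          then show ?case using insert hom[of "b i" "w i"] Suc.prems(1)[of i] by auto
        qed
      qed
      have "b d - ?L z = (b d - ?L (a m)) + ?L (\<lambda>i. a m i - z i)" by (simp add: Ldiff)
      then have "nrm (b d - ?L z) \<le> nrm (b d - ?L (a m)) + nrm (?L (\<lambda>i. a m i - z i))"
        using tri[OF subspace_diff[OF S bd LS] LS, of "a m" "\<lambda>i. a m i - z i"] by (simp only:)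
      then show ?thesis using a[of m] 1[of "{..<d}" "\<lambda>i. a m i - z i"] by simp
    qed
    moreover have "(\<lambda>m. inverse (real (Suc m)) + (\<Sum>i<d. cmod (a m i - z i) * nrm (b i))) \<longlonglongrightarrow> 0 + (\<Sum>i<d. 0 * nrm (b i))"
      by (intro tendsto_intros LIMSEQ_inverse_real_of_nat)
        (use z in \<open>auto simp: tendsto_norm_zero_iff intro: LIM_zero\<close>)
    ultimately have "nrm (b d - ?L z) \<le> 0"
      by (intro LIMSEQ_le_const) auto
    then have "b d - ?L z = 0" using def[OF subspace_diff[OF S bd LS]] nn[OF subspace_diff[OF S bd LS]] by (meson order_antisym)
    then have "(\<Sum>i<Suc d. s (if i = d then - 1 else z i) (b i)) = 0" by simp
    then have "(if d = d then - 1 else z d) = (0::complex)" using Suc.prems(2)[of "\<lambda>i. if i = d then - 1 else z i" d] by blast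
    then show False by simp
  qed
  then obtain \<delta> where \<delta>: "0 < \<delta>" "\<And>a. \<delta> \<le> nrm (b d - ?L a)" by blast
  \<comment> \<open>The last coordinate is bounded by the distance \<delta> of its vector from the
    span of the others, the remaining ones by K after the last term has been subtracted; K' is the
    sum of both bounds.\<close>
  define K' where "K' = K * (1 + nrm (b d) / \<delta>) + 1 / \<delta>"
  have K': "0 < K'" "1 / \<delta> \<le> K'" "K * (1 + nrm (b d) / \<delta>) \<le> K'"
    using K(1) \<delta>(1) nn[OF bd] by (auto simp: K'_def intro!: add_nonneg_pos mult_nonneg_nonneg)
  show ?case
  proof (intro exI[of _ K'] conjI K' allI impI)
    fix a i assume i: "i < Suc d"
    let ?x = "\<Sum>i<Suc d. s (a i) (b i)"
    have xS: "?x \<in> S" using Suc.prems(1) by (intro subspace_sum[OF S] subspace_scale[OF S]) auto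
    have ad: "cmod (a d) * \<delta> \<le> nrm ?x"
    proof (cases "a d = 0")
      case True then show ?thesis using nn[OF xS] by simp
    next
      case False
      have "?x = s (a d) (b d - ?L (\<lambda>i. - a i / a d))"
        using False by (simp add: scale_right_distrib scale_right_diff_distrib scale_sum_right sum_negf add.commute)
      then have "nrm ?x = cmod (a d) * nrm (b d - ?L (\<lambda>i. - a i / a d))"
        using hom[OF subspace_diff[OF S bd LS], of "a d" "\<lambda>i. - a i / a d"] by (simp only:)
      then show ?thesis using mult_left_mono[OF \<delta>(2), of "cmod (a d)" "\<lambda>i. - a i / a d"] by simp
    qed
    then have ad: "cmod (a d) \<le> nrm ?x / \<delta>" using \<delta>(1) by (simp add: field_simps)
    show "cmod (a i) \<le> K' * nrm ?x"
    proof (cases "i = d")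
      case True
      then show ?thesis using ad mult_right_mono[OF K'(2) nn[OF xS]] by simp
    next
      case False
      then have i: "i < d" using i by simp
      have "?L a = ?x - s (a d) (b d)" by simp
      then have "nrm (?L a) \<le> nrm ?x + cmod (a d) * nrm (b d)"
        using tri'[OF xS subspace_scale[OF S bd, of "a d"]] hom[OF bd] by simp
      also have "\<dots> \<le> nrm ?x + nrm ?x / \<delta> * nrm (b d)"
        using mult_right_mono[OF ad nn[OF bd]] by linarith
      finally have "nrm (?L a) \<le> (1 + nrm (b d) / \<delta>) * nrm ?x" by (simp add: algebra_simps)
      then have "K * nrm (?L a) \<le> K * (1 + nrm (b d) / \<delta>) * nrm ?x" using K(1) by (simp add: mult.assoc)
      also have "\<dots> \<le> K' * nrm ?x" by (rule mult_right_mono[OF K'(3) nn[OF xS]])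
      finally show ?thesis using K(2)[OF i, of a] by linarith
    qed
  qed
qed

lemma (in operator_system) fd_coords:
  assumes B: "finite B" and E: "span B \<subseteq> carr X"
  shows "\<exists>K d b c. 0 < K \<and> (\<forall>i<d. b i \<in> span B) \<and>
    (\<forall>e\<in>span B. e = (\<Sum>i<d. scl X (c e i) (b i))) \<and>
    (\<forall>e\<in>span B. \<forall>i<d. cmod (c e i) \<le> K * opsys_norm X e) \<and>
    (\<forall>e\<in>span B. \<forall>e'\<in>span B. \<forall>i<d. c (e + e') i = c e i + c e' i) \<and>
    (\<forall>t. \<forall>e\<in>span B. \<forall>i<d. c (scl X t e) i = t * c e (i::nat))"
proof -
  obtain B' where B': "B' \<subseteq> B" "independent B'" "B \<subseteq> span B'"
    using maximal_independent_subset[of B] by blast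
  have sp: "span B' = span B" using B' by (metis span_eq span_superset subset_trans)
  have fin: "finite B'" using B' B finite_subset by blast
  obtain b where b: "bij_betw b {..<card B'} B'" using ex_bij_betw_nat_finite[OF fin] by (auto simp: lessThan_atLeast0)
  define d where "d = card B'"
  define c where "c e i = representation B' e (b i)" for e i
  have bB: "b i \<in> B'" if "i < d" for i using b that by (auto simp: bij_betw_def d_def)
  have rep: "e = (\<Sum>i<d. scl X (c e i) (b i))" if "e \<in> span B" for e
  proof -
    have "e = (\<Sum>v\<in>B'. scl X (representation B' e v) v)"
      using sum_representation_eq[OF B'(2) _ fin] that sp by simp
    also have "\<dots> = (\<Sum>i<d. scl X (c e i) (b i))"
      unfolding c_def d_def by (rule sum.reindex_bij_betw[OF b, symmetric])
    finally show ?thesis .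
  qed
  have bE: "b i \<in> span B" if "i < d" for i using bB[OF that] sp span_base by blast
  have "\<exists>K>0. \<forall>a. \<forall>i<d. cmod (a i) \<le> K * opsys_norm X (\<Sum>i<d. scl X (a i) (b i))"
  proof (rule coord_bounded[of "scl X" "carr X"])
    show "vector_space (scl X)" by unfold_locales
    show "subspace (carr X)" by (rule subspace_carr)
    show "b i \<in> carr X" if "i < d" for i using bE[OF that] E by blast
    show "a i = 0" if z: "(\<Sum>i<d. scl X (a i) (b i)) = 0" and i: "i < d" for a i
    proof -
      let ?u = "\<lambda>v. a (inv_into {..<d} b v)"
      have inj: "inj_on b {..<d}" using b by (simp add: bij_betw_def d_def)
      have "(\<Sum>v\<in>B'. scl X (?u v) v) = (\<Sum>i<d. scl X (?u (b i)) (b i))"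
        unfolding d_def by (rule sum.reindex_bij_betw[OF b, symmetric])
      also have "\<dots> = 0" using z inj by (simp add: inv_into_f_f)
      finally have "?u (b i) = 0" by (rule independentD[OF B'(2) fin subset_refl _ bB[OF i]])
      then show ?thesis using inj i by (simp add: inv_into_f_f)
    qed
  qed (auto intro: opsys_norm_triangle opsys_norm_scl opsys_norm_eq_0D opsys_norm_nonneg)
  then obtain K where K: "0 < K" "\<And>a i. i < d \<Longrightarrow> cmod (a i) \<le> K * opsys_norm X (\<Sum>i<d. scl X (a i) (b i))" by blast
  show ?thesis
  proof (intro exI conjI allI impI ballI)
    show "0 < K" by (rule K(1))
    show "b i \<in> span B" if "i < d" for i by (rule bE[OF that])
    show "e = (\<Sum>i<d. scl X (c e i) (b i))" if "e \<in> span B" for e by (rule rep[OF that])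
    show "cmod (c e i) \<le> K * opsys_norm X e" if "e \<in> span B" "i < d" for e i
      using K(2)[OF that(2), of "c e"] rep[OF that(1)] by simp
    show "c (e + e') i = c e i + c e' i" if "e \<in> span B" "e' \<in> span B" for e e' i
      using that sp by (simp add: c_def representation_add[OF B'(2)])
    show "c (scl X t e) i = t * c e i" if "e \<in> span B" for t e i
      using that sp by (simp add: c_def representation_scale[OF B'(2)])
  qed
qed

section \<open>Norms of matrices and of their entries\<close>

lemma contr_delta:
  assumes "i < n" shows "contr n 1 (\<lambda>k a. if k = i then 1 else 0)" "contr 1 n (\<lambda>a k. if k = i then 1 else 0)"
proof -
  show "contr n 1 (\<lambda>k a. if k = i then 1 else 0)" unfolding contr_def
  proof
    fix z :: "nat \<Rightarrow> complex"
    have "(\<Sum>k<n. (cmod (\<Sum>a<1. (if k = i then 1 else 0) * z a))\<^sup>2) = (\<Sum>k<n. if k = i then (cmod (z 0))\<^sup>2 else 0)"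
      by (rule sum.cong[OF refl]) simp
    also have "\<dots> = (cmod (z 0))\<^sup>2" using assms by simp
    also have "\<dots> = (\<Sum>a<1. (cmod (z a))\<^sup>2)" by simp
    finally show "(\<Sum>k<n. (cmod (\<Sum>a<1. (if k = i then 1 else 0) * z a))\<^sup>2) \<le> (\<Sum>a<1. (cmod (z a))\<^sup>2)"
      by (rule eq_refl)
  qed
  show "contr 1 n (\<lambda>a k. if k = i then 1 else 0)" unfolding contr_def
  proof
    fix z :: "nat \<Rightarrow> complex"
    have "(\<Sum>a<n. (if a = i then 1 else 0) * z a) = (\<Sum>a<n. if a = i then z a else 0)"
      by (rule sum.cong[OF refl]) simp
    also have "\<dots> = z i" using assms by simp
    finally have "(\<Sum>k<(1::nat). (cmod (\<Sum>a<n. (if a = i then 1 else 0) * z a))\<^sup>2) = (cmod (z i))\<^sup>2" by simp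
    also have "(cmod (z i))\<^sup>2 \<le> (\<Sum>a<n. (cmod (z a))\<^sup>2)"
      using assms by (intro member_le_sum) auto
    finally show "(\<Sum>k<(1::nat). (cmod (\<Sum>a<n. (if a = i then 1 else 0) * z a))\<^sup>2) \<le> (\<Sum>a<n. (cmod (z a))\<^sup>2)" .
  qed
qed

context operator_system
begin

lemma entry_norm_le:
  assumes x: "x \<in> mats n (carr X)" and ij: "i < n" "j < n"
  shows "opsys_norm X (x i j) \<le> mnorm X n x"
proof -
  have "bicomp X n 1 (\<lambda>k a. if k = i then 1 else 0) (\<lambda>k a. if k = j then 1 else 0) x = elt 0 0 (x i j)"
  proof (intro ext)
    fix a b
    have "(\<Sum>l<n. scl X (cnj (if k = i then 1 else 0) * (if l = j then 1 else 0)) (x k l)) = (if k = i then x k j else 0)" for k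
    proof -
      have "(\<Sum>l<n. scl X (cnj (if k = i then 1 else 0) * (if l = j then 1 else 0)) (x k l)) =
        (\<Sum>l<n. if l = j then if k = i then x k l else 0 else 0)"
        by (rule sum.cong[OF refl]) auto
      then show ?thesis using ij by simp
    qed
    then show "bicomp X n 1 (\<lambda>k a. if k = i then 1 else 0) (\<lambda>k a. if k = j then 1 else 0) x a b = elt 0 0 (x i j) a b"
      using ij by (simp add: bicomp_def elt_def)
  qed
  then show ?thesis
    using mnorm_bicomp[OF operator_system_axioms x contr_delta(1)[OF ij(1)] contr_delta(1)[OF ij(2)]]
    by (simp add: opsys_norm_elt)
qed

lemma mnorm_elt_le:
  assumes a: "a \<in> carr X" and ij: "i < n" "j < n"
  shows "mnorm X n (elt i j a) \<le> opsys_norm X a"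
proof -
  have "bicomp X 1 n (\<lambda>a k. if k = i then 1 else 0) (\<lambda>a k. if k = j then 1 else 0) (elt 0 0 a) = elt i j a"
    using ij by (auto simp: bicomp_def elt_def fun_eq_iff)
  then show ?thesis
    using mnorm_bicomp[OF operator_system_axioms mats_elt[of 0 1 0 a] contr_delta(2)[OF ij(1)] contr_delta(2)[OF ij(2)]] a
    by (simp add: opsys_norm_elt)
qed

lemma mnorm_sum_le:
  assumes "\<And>a. a \<in> A \<Longrightarrow> f a \<in> mats n (carr X)"
  shows "mnorm X n (sum f A) \<le> (\<Sum>a\<in>A. mnorm X n (f a))"
  using assms
proof (induction A rule: infinite_finite_induct)
  case (insert a A)
  have "mnorm X n (f a + sum f A) \<le> mnorm X n (f a) + mnorm X n (sum f A)"
    by (intro mnorm_triangle mats_sum insert.prems) auto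
  moreover have "mnorm X n (sum f A) \<le> (\<Sum>a\<in>A. mnorm X n (f a))"
    by (rule insert.IH) (rule insert.prems, simp)
  ultimately show ?case unfolding sum.insert[OF insert.hyps] by linarith
qed auto

lemma mnorm_le_sum_entries:
  assumes x: "x \<in> mats n (carr X)"
  shows "mnorm X n x \<le> (\<Sum>i<n. \<Sum>j<n. opsys_norm X (x i j))"
proof -
  have e: "elt i j (x i j) \<in> mats n (carr X)" if "i < n" "j < n" for i j
    by (intro mats_elt that mats_entry[OF x])
  have "mnorm X n x = mnorm X n (\<Sum>i<n. \<Sum>j<n. elt i j (x i j))" by (rule arg_cong[OF mats_elt_sum[OF x]])
  also have "\<dots> \<le> (\<Sum>i<n. mnorm X n (\<Sum>j<n. elt i j (x i j)))"
    by (intro mnorm_sum_le mats_sum e) auto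
  also have "\<dots> \<le> (\<Sum>i<n. \<Sum>j<n. mnorm X n (elt i j (x i j)))"
    by (intro sum_mono mnorm_sum_le e) auto
  also have "\<dots> \<le> (\<Sum>i<n. \<Sum>j<n. opsys_norm X (x i j))"
    by (intro sum_mono mnorm_elt_le mats_entry[OF x]) auto
  finally show ?thesis .
qed

end

section \<open>Complete bounds for functionals and rank-one maps\<close>

lemma sum_mult_le_squares:
  fixes s :: real assumes "0 < s"
  shows "2 * (a * b) \<le> s * a\<^sup>2 + b\<^sup>2 / s"
proof -
  have "0 \<le> (s * a - b)\<^sup>2 / s" using assms by simp
  also have "\<dots> = s * a\<^sup>2 + b\<^sup>2 / s - 2 * (a * b)" using assms by (simp add: power2_eq_square field_simps)
  finally show ?thesis by simp
qed

lemma sqn_prod: "sqn n k (\<lambda>i p. u i * w p) = (\<Sum>i<n. (cmod (u i))\<^sup>2) * (\<Sum>p<k. (cmod (w p))\<^sup>2)"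
  unfolding sqn_def norm_mult power_mult_distrib sum_product ..

lemma sqn_1: "sqn 1 k \<xi> = (\<Sum>p<k. (cmod (\<xi> 0 p))\<^sup>2)"
  by (simp add: sqn_def)

text \<open>A bounded functional is completely bounded with the same constant: the scalar vectors u
  and v are pulled inside, where they compress x to a single element y, and only then is the bound
  for the functional applied.\<close>

lemma functional_amp_bound:
  assumes X: "operator_system X" and E: "module.subspace (scl X) E" "E \<subseteq> carr X"
    and lin: "\<And>x y. x \<in> E \<Longrightarrow> y \<in> E \<Longrightarrow> \<phi> (x + y) = \<phi> x + \<phi> y" "\<And>c x. x \<in> E \<Longrightarrow> \<phi> (scl X c x) = c * \<phi> x"
    and K: "0 \<le> K" "\<And>x. x \<in> E \<Longrightarrow> cmod (\<phi> x) \<le> K * opsys_norm X x"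
    and x: "x \<in> mats n E"
  shows "cmod (\<Sum>i<n. \<Sum>j<n. cnj (u i) * \<phi> (x i j) * v j) \<le>
    K * mnorm X n x * (sqrt (\<Sum>i<n. (cmod (u i))\<^sup>2) * sqrt (\<Sum>i<n. (cmod (v i))\<^sup>2))"
proof -
  interpret operator_system X by fact
  have xE: "x i j \<in> E" for i j using x subspace_0[OF E(1)] by (cases "i < n \<and> j < n") (auto simp: mats_def)
  have xm: "x \<in> mats n (carr X)" using x E(2) by (auto simp: mats_def)
  define y where "y = (\<Sum>i<n. \<Sum>j<n. scl X (cnj (u i) * v j) (x i j))"
  let ?r = "mnorm X n x * (sqrt (\<Sum>i<n. (cmod (u i))\<^sup>2) * sqrt (\<Sum>i<n. (cmod (v i))\<^sup>2))"
  have yE: "y \<in> E" unfolding y_def by (intro subspace_sum[OF E(1)] subspace_scale[OF E(1)] xE)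
  have sumE: "\<phi> (sum f A) = (\<Sum>a\<in>A. \<phi> (f a))" if "\<And>a. a \<in> A \<Longrightarrow> f a \<in> E" for f and A :: "nat set"
  proof (rule linear_into_sum[OF _ _ E(1) that])
    show "linear_into (scl X) E (*) UNIV \<phi>" unfolding linear_into_def by (intro conjI ballI allI lin subset_UNIV)
    show "vector_space (scl X)" by unfold_locales
  qed
  have "\<phi> y = (\<Sum>i<n. \<Sum>j<n. cnj (u i) * \<phi> (x i j) * v j)"
  proof -
    have "\<phi> y = (\<Sum>i<n. \<phi> (\<Sum>j<n. scl X (cnj (u i) * v j) (x i j)))"
      unfolding y_def by (rule sumE) (intro subspace_sum[OF E(1)] subspace_scale[OF E(1)] xE)
    also have "\<dots> = (\<Sum>i<n. \<Sum>j<n. \<phi> (scl X (cnj (u i) * v j) (x i j)))"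
      by (rule sum.cong[OF refl], rule sumE) (intro subspace_scale[OF E(1)] xE)
    also have "\<dots> = (\<Sum>i<n. \<Sum>j<n. cnj (u i) * \<phi> (x i j) * v j)"
      unfolding lin(2)[OF xE] by (simp only: mult_ac)
    finally show ?thesis .
  qed
  \<comment> \<open>The columns u and v need not be contractions, so their lengths are kept by means
    of the product form of the norm bound.\<close>
  moreover have "opsys_norm X y \<le> ?r"
    unfolding opsys_norm_elt
  proof (rule mnorm_leI)
    show "elt 0 0 y \<in> mats 1 (carr X)" using yE E(2) by (intro mats_elt) auto
    show r: "0 \<le> ?r" by (intro mult_nonneg_nonneg mnorm_nonneg[OF xm]) (auto intro: sum_nonneg)
    fix k f and \<xi> \<eta> :: "nat \<Rightarrow> nat \<Rightarrow> complex" assume f: "ucp X k f"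
    have flin: "linear_into (scl X) (carr X) (scl (matalg k)) (carr (matalg k)) f"
      using ucpD(2)[OF f] by (simp add: cp_map_def)
    have b: "bnd n k (amp f x) (mnorm X n x)"
      using mnorm_le_iff[OF xm mnorm_nonneg[OF xm]] f by blast
    have e: "elt 0 0 y = bicomp X n 1 (\<lambda>i a. u i) (\<lambda>i a. v i) x"
      by (auto simp: elt_def bicomp_def y_def fun_eq_iff)
    let ?\<xi> = "\<lambda>i p. u i * \<xi> 0 p" and ?\<eta> = "\<lambda>i p. v i * \<eta> 0 p"
    have 1: "sesq 1 k (amp f (elt 0 0 y)) \<xi> \<eta> = sesq n k (amp f x) ?\<xi> ?\<eta>"
      unfolding e sesq_bicomp[OF X flin subspace_carr xm] by simp
    have "cmod (sesq 1 k (amp f (elt 0 0 y)) \<xi> \<eta>) \<le> mnorm X n x * (sqrt (sqn n k ?\<xi>) * sqrt (sqn n k ?\<eta>))"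
      unfolding 1 by (rule bnd_product[OF b mnorm_nonneg[OF xm]])
    also have "\<dots> = ?r * (sqrt (sqn 1 k \<xi>) * sqrt (sqn 1 k \<eta>))"
      by (simp only: sqn_prod sqn_1 real_sqrt_mult mult_ac)
    also have "\<dots> \<le> ?r * ((sqn 1 k \<xi> + sqn 1 k \<eta>) / 2)"
      using sum_mult_le_squares[of 1 "sqrt (sqn 1 k \<xi>)" "sqrt (sqn 1 k \<eta>)"]
      by (intro mult_left_mono r) (simp add: sqn_nonneg)
    finally show "2 * cmod (sesq 1 k (amp f (elt 0 0 y)) \<xi> \<eta>) \<le> ?r * (sqn 1 k \<xi> + sqn 1 k \<eta>)" by simp
  qed
  ultimately have "cmod (\<Sum>i<n. \<Sum>j<n. cnj (u i) * \<phi> (x i j) * v j) \<le> K * opsys_norm X y"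
    using K(2)[OF yE] by simp
  also have "\<dots> \<le> K * ?r" by (rule mult_left_mono[OF \<open>opsys_norm X y \<le> ?r\<close> K(1)])
  finally show ?thesis by (simp add: mult_ac)
qed

text \<open>The action of f(v) on \<eta> is absorbed into \<zeta> with factor M, row by row; then
  the functional bound applies for each index p. The weight M in the inequality of arithmetic and
  geometric means balances M times the square norm of \<xi> against that of \<zeta> divided by M, so
  exactly the constant K M results.\<close>

lemma rank_one_bound:
  assumes X: "operator_system X" and E: "module.subspace (scl X) E" "E \<subseteq> carr X"
    and lin: "\<And>x y. x \<in> E \<Longrightarrow> y \<in> E \<Longrightarrow> \<phi> (x + y) = \<phi> x + \<phi> y" "\<And>c x. x \<in> E \<Longrightarrow> \<phi> (scl X c x) = c * \<phi> x"
    and K: "0 \<le> K" "\<And>x. x \<in> E \<Longrightarrow> cmod (\<phi> x) \<le> K * opsys_norm X x"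
    and x: "x \<in> mats n E"
    and V: "operator_system V" and v: "v \<in> carr V" and M: "0 < M" "opsys_norm V v \<le> M"
  shows "mnorm V n (amp (\<lambda>e. scl V (\<phi> e) v) x) \<le> K * M * mnorm X n x"
proof -
  interpret X: operator_system X by fact
  interpret V: operator_system V by fact
  have xm: "x \<in> mats n (carr X)" using x E(2) by (auto simp: mats_def)
  let ?y = "amp (\<lambda>e. scl V (\<phi> e) v) x"
  have \<phi>0: "\<phi> 0 = 0" using lin(2)[of 0 0] X.subspace_0[OF E(1)] by simp
  show ?thesis
  proof (rule V.mnorm_leI)
    show "?y \<in> mats n (carr V)" using x by (auto simp: mats_def amp_def \<phi>0 intro: V.carr_scl v)
    show "0 \<le> K * M * mnorm X n x" using K M X.mnorm_nonneg[OF xm] by simp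
    fix k f and \<xi> \<eta> :: "nat \<Rightarrow> nat \<Rightarrow> complex" assume f: "ucp V k f"
    define \<zeta> where "\<zeta> j p = (\<Sum>q<k. f v p q * \<eta> j q)" for j p
    \<comment> \<open>The form of v is tested at \<zeta> itself. With a and c the lengths of the
      rows of \<zeta> and \<eta>, the square of a is at most M a c, hence a \<le> M c.\<close>
    have row: "(\<Sum>p<k. (cmod (\<zeta> j p))\<^sup>2) \<le> M\<^sup>2 * (\<Sum>q<k. (cmod (\<eta> j q))\<^sup>2)" for j
    proof -
      let ?e = "elt 0 0 v"
      have em: "?e \<in> mats 1 (carr V)" using v by (intro V.mats_elt) auto
      have b: "bnd 1 k (amp f ?e) M"
        using V.mnorm_le_iff[OF em, of M] M f by (simp add: opsys_norm_elt)
      have f0: "f 0 = 0" by (rule cp_map_0[OF V ucpD(2)[OF f]])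
      have s: "sesq 1 k (amp f ?e) (\<lambda>_. \<zeta> j) (\<lambda>_. \<eta> j) = (\<Sum>p<k. cnj (\<zeta> j p) * \<zeta> j p)"
        unfolding \<zeta>_def by (simp add: sesq_def amp_def elt_def sum_distrib_left mult.assoc)
      have "(\<Sum>p<k. cnj (\<zeta> j p) * \<zeta> j p) = complex_of_real (\<Sum>p<k. (cmod (\<zeta> j p))\<^sup>2)"
        unfolding of_real_sum by (intro sum.cong refl) (simp only: complex_norm_square mult.commute)
      then have "cmod (sesq 1 k (amp f ?e) (\<lambda>_. \<zeta> j) (\<lambda>_. \<eta> j)) = (\<Sum>p<k. (cmod (\<zeta> j p))\<^sup>2)"
        unfolding s by (simp add: sum_nonneg del: of_real_sum)
      moreover define a where "a = sqrt (\<Sum>p<k. (cmod (\<zeta> j p))\<^sup>2)"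
      moreover define c where "c = sqrt (\<Sum>p<k. (cmod (\<eta> j p))\<^sup>2)"
      ultimately have "a\<^sup>2 \<le> M * (a * c)"
        using bnd_product[OF b, of "\<lambda>_. \<zeta> j" "\<lambda>_. \<eta> j"] M(1) by (simp add: sqn_def sum_nonneg)
      moreover have ac: "0 \<le> a" "0 \<le> c" by (auto simp: a_def c_def sum_nonneg)
      ultimately have "a \<le> M * c" using M(1)
        by (cases "a = 0") (auto simp: power2_eq_square)
      then have "a\<^sup>2 \<le> (M * c)\<^sup>2" using ac by (intro power_mono) auto
      then show ?thesis by (simp add: a_def c_def power_mult_distrib sum_nonneg)
    qed
    have fscl: "f (scl V c v) p q = c * f v p q" for c p q
      using cp_map_linear(3)[OF ucpD(2)[OF f] v] by simp
    have "sesq n k (amp f ?y) \<xi> \<eta> = (\<Sum>i<n. \<Sum>j<n. \<Sum>p<k. cnj (\<xi> i p) * \<phi> (x i j) * \<zeta> j p)"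
      unfolding sesq_def \<zeta>_def by (simp add: amp_def fscl sum_distrib_left mult_ac)
    also have "\<dots> = (\<Sum>p<k. \<Sum>i<n. \<Sum>j<n. cnj (\<xi> i p) * \<phi> (x i j) * \<zeta> j p)"
      by (rule sum_rotate)
    finally have "2 * cmod (sesq n k (amp f ?y) \<xi> \<eta>) \<le>
      2 * (\<Sum>p<k. cmod (\<Sum>i<n. \<Sum>j<n. cnj (\<xi> i p) * \<phi> (x i j) * \<zeta> j p))"
      by (simp add: norm_sum)
    also have "\<dots> \<le> 2 * (\<Sum>p<k. K * mnorm X n x * (sqrt (\<Sum>i<n. (cmod (\<xi> i p))\<^sup>2) * sqrt (\<Sum>j<n. (cmod (\<zeta> j p))\<^sup>2)))"
      by (intro mult_left_mono sum_mono functional_amp_bound[OF X E lin K x]) auto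
    also have "\<dots> = (\<Sum>p<k. K * mnorm X n x * (2 * (sqrt (\<Sum>i<n. (cmod (\<xi> i p))\<^sup>2) * sqrt (\<Sum>j<n. (cmod (\<zeta> j p))\<^sup>2))))"
      by (simp add: sum_distrib_left mult_ac)
    also have "\<dots> \<le> (\<Sum>p<k. K * mnorm X n x * (M * (\<Sum>i<n. (cmod (\<xi> i p))\<^sup>2) + (\<Sum>j<n. (cmod (\<zeta> j p))\<^sup>2) / M))"
    proof (intro sum_mono mult_left_mono)
      fix p
      show "2 * (sqrt (\<Sum>i<n. (cmod (\<xi> i p))\<^sup>2) * sqrt (\<Sum>j<n. (cmod (\<zeta> j p))\<^sup>2)) \<le>
        M * (\<Sum>i<n. (cmod (\<xi> i p))\<^sup>2) + (\<Sum>j<n. (cmod (\<zeta> j p))\<^sup>2) / M"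
        using sum_mult_le_squares[OF M(1), of "sqrt (\<Sum>i<n. (cmod (\<xi> i p))\<^sup>2)" "sqrt (\<Sum>j<n. (cmod (\<zeta> j p))\<^sup>2)"]
        by (simp add: sum_nonneg)
    qed (use K X.mnorm_nonneg[OF xm] in auto)
    also have "\<dots> = K * mnorm X n x * (M * sqn n k \<xi> + (\<Sum>j<n. \<Sum>p<k. (cmod (\<zeta> j p))\<^sup>2) / M)"
    proof -
      have 1: "sqn n k \<xi> = (\<Sum>p<k. \<Sum>i<n. (cmod (\<xi> i p))\<^sup>2)" unfolding sqn_def by (rule sum.swap)
      have 2: "(\<Sum>j<n. \<Sum>p<k. (cmod (\<zeta> j p))\<^sup>2) = (\<Sum>p<k. \<Sum>j<n. (cmod (\<zeta> j p))\<^sup>2)" by (rule sum.swap)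
      show ?thesis unfolding 1 2 sum_distrib_left[symmetric] sum.distrib sum_divide_distrib[symmetric] ..
    qed
    also have "\<dots> \<le> K * mnorm X n x * (M * sqn n k \<xi> + (\<Sum>j<n. M\<^sup>2 * (\<Sum>q<k. (cmod (\<eta> j q))\<^sup>2)) / M)"
      using row K X.mnorm_nonneg[OF xm] M(1)
      by (intro mult_left_mono add_left_mono divide_right_mono sum_mono) auto
    also have "(\<Sum>j<n. M\<^sup>2 * (\<Sum>q<k. (cmod (\<eta> j q))\<^sup>2)) / M = M * sqn n k \<eta>"
      unfolding sqn_def sum_distrib_left[symmetric] using M(1) by (simp add: power2_eq_square)
    finally show "2 * cmod (sesq n k (amp f ?y) \<xi> \<eta>) \<le> K * M * mnorm X n x * (sqn n k \<xi> + sqn n k \<eta>)"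
      by (simp add: algebra_simps)
  qed
qed

section \<open>Direct sums of maps and simultaneous separation\<close>

definition dsum :: "nat \<Rightarrow> nat \<Rightarrow> ('a \<Rightarrow> nat \<Rightarrow> nat \<Rightarrow> complex) \<Rightarrow> ('a \<Rightarrow> nat \<Rightarrow> nat \<Rightarrow> complex) \<Rightarrow> 'a \<Rightarrow> nat \<Rightarrow> nat \<Rightarrow> complex" where
  "dsum k l f g a = (\<lambda>i j. if i < k \<and> j < k then f a i j
     else if k \<le> i \<and> k \<le> j \<and> i < k + l \<and> j < k + l then g a (i - k) (j - k) else 0)"

lemma sesq_dsum:
  "sesq n (k + l) (amp (dsum k l f g) z) \<xi> \<eta> =
   sesq n k (amp f z) \<xi> \<eta> + sesq n l (amp g z) (\<lambda>i p. \<xi> i (k + p)) (\<lambda>i p. \<eta> i (k + p))"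
  unfolding sesq_def sum_lessThan_add sum.distrib[symmetric]
  by (intro sum.cong refl) (simp add: amp_def dsum_def sum.distrib)

lemma ucp_dsum:
  assumes X: "operator_system X" and f: "ucp X k f" and g: "ucp X l g"
  shows "ucp X (k + l) (dsum k l f g)"
proof -
  note fl = cp_map_linear[OF ucpD(2)[OF f]] and gl = cp_map_linear[OF ucpD(2)[OF g]]
  have "cp_map X (matalg (k + l)) (dsum k l f g)"
  proof (rule cp_map_matalgI[OF X])
    show "linear_into (scl X) (carr X) (scl (matalg (k + l))) (carr (matalg (k + l))) (dsum k l f g)"
      unfolding linear_into_def matalg_sel
    proof (intro conjI ballI allI)
      show "dsum k l f g ` carr X \<subseteq> mats (k + l) UNIV" by (auto simp: dsum_def mats_def)
      show "dsum k l f g (x + y) = dsum k l f g x + dsum k l f g y" if "x \<in> carr X" "y \<in> carr X" for x y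
        by (intro ext) (simp add: dsum_def fl(2)[OF that] gl(2)[OF that])
      show "dsum k l f g (scl X c x) = (\<lambda>i j. c * dsum k l f g x i j)" if "x \<in> carr X" for x c
        by (intro ext) (simp add: dsum_def fl(3)[OF that] gl(3)[OF that])
    qed
    show "sesq n (k + l) (amp (dsum k l f g) z) \<xi> \<xi> \<in> \<real>\<^sub>\<ge>\<^sub>0" if "z \<in> pos X n" for n z \<xi>
      unfolding sesq_dsum by (intro nonneg_Reals_add_I cp_map_sesq[OF ucpD(2)[OF f] that] cp_map_sesq[OF ucpD(2)[OF g] that])
  qed
  moreover have "dsum k l f g (ounit X) = ounit (matalg (k + l))"
    by (auto simp: dsum_def ucpD(3)[OF f] ucpD(3)[OF g] fun_eq_iff)
  ultimately show ?thesis using ucpD(1)[OF f] by (simp add: ucp_def)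
qed

lemma dsum_pos:
  assumes X: "operator_system X" and f: "ucp X k f" and g: "ucp X l g" and z: "z \<in> mats n (carr X)"
    and p: "amp (dsum k l f g) z \<in> pos (matalg (k + l)) n"
  shows "amp f z \<in> pos (matalg k) n" "amp g z \<in> pos (matalg l) n"
proof -
  have P: "sesq n (k + l) (amp (dsum k l f g) z) \<xi> \<xi> \<in> \<real>\<^sub>\<ge>\<^sub>0" for \<xi> using p by (simp add: matalg_pos)
  have m: "amp f z \<in> mats n (mats k UNIV)" "amp g z \<in> mats n (mats l UNIV)"
    using cp_map_mats[OF X ucpD(2)[OF f] z] cp_map_mats[OF X ucpD(2)[OF g] z] by auto
  have "sesq n k (amp f z) \<xi> \<xi> \<in> \<real>\<^sub>\<ge>\<^sub>0" for \<xi>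
  proof -
    let ?\<xi> = "\<lambda>i p. if p < k then \<xi> i p else 0"
    have "sesq n k (amp f z) ?\<xi> ?\<xi> = sesq n k (amp f z) \<xi> \<xi>" by (rule sesq_cong) auto
    moreover have "sesq n l (amp g z) (\<lambda>i p. ?\<xi> i (k + p)) (\<lambda>i p. ?\<xi> i (k + p)) = 0" by (simp add: sesq_def)
    ultimately show ?thesis using P[of ?\<xi>] unfolding sesq_dsum by simp
  qed
  then show "amp f z \<in> pos (matalg k) n" using m by (simp add: matalg_pos)
  have "sesq n l (amp g z) \<xi> \<xi> \<in> \<real>\<^sub>\<ge>\<^sub>0" for \<xi>
  proof -
    let ?\<xi> = "\<lambda>i p. if p < k then 0 else \<xi> i (p - k)"
    have "sesq n k (amp f z) ?\<xi> ?\<xi> = 0" by (simp add: sesq_def)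
    moreover have "sesq n l (amp g z) (\<lambda>i p. ?\<xi> i (k + p)) (\<lambda>i p. ?\<xi> i (k + p)) = sesq n l (amp g z) \<xi> \<xi>" by simp
    ultimately show ?thesis using P[of ?\<xi>] unfolding sesq_dsum by simp
  qed
  then show "amp g z \<in> pos (matalg l) n" using m by (simp add: matalg_pos)
qed

text \<open>The direct sum of maps that separate single matrices separates all of them, because
  positivity of a block diagonal image passes to its blocks.\<close>

lemma separating_ucp_finite:
  assumes X: "operator_system X" and Z: "finite Z" "\<And>z. z \<in> Z \<Longrightarrow> z \<in> hmats X n \<and> z \<notin> pos X n"
  shows "\<exists>k f. ucp X k f \<and> (\<forall>z\<in>Z. amp f z \<notin> pos (matalg k) n)"
  using Z
proof (induction Z)
  case empty
  interpret operator_system X by fact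
  \<comment> \<open>Even the empty family needs some unital completely positive map; one arises by
    separating the negative of the unit from the cone.\<close>
  have "mscl X (complex_of_real (- 1)) (munit X 1) \<notin> pos X 1" using munit_pos_iff[of 1 "- 1"] by auto
  then have "\<exists>f. ucp X 1 f" using separating_ucp[OF X hmats_mscl[OF hmats_munit]] by blast
  then show ?case by auto
next
  case (insert z Z)
  have "\<exists>k f. ucp X k f \<and> (\<forall>z\<in>Z. amp f z \<notin> pos (matalg k) n)"
    by (rule insert.IH) (rule insert.prems, rule insertI2)
  then obtain k f where f: "ucp X k f" "\<forall>z\<in>Z. amp f z \<notin> pos (matalg k) n" by (elim exE conjE)
  have z: "z \<in> hmats X n" "z \<notin> pos X n" using insert.prems[of z] by auto
  obtain g where g: "ucp X n g" "amp g z \<notin> pos (matalg n) n"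
    using separating_ucp[OF X z] by (elim exE conjE)
  have m: "w \<in> mats n (carr X)" if "w \<in> insert z Z" for w using insert.prems[OF that] by (simp add: hmats_def)
  show ?case
  proof (intro exI[of _ "k + n"] exI[of _ "dsum k n f g"] conjI ballI notI ucp_dsum[OF X f(1) g(1)])
    fix w assume w: "w \<in> insert z Z" "amp (dsum k n f g) w \<in> pos (matalg (k + n)) n"
    show False using dsum_pos[OF X f(1) g(1) m[OF w(1)] w(2)] f(2) g(2) w(1) by auto
  qed
qed

section \<open>Completely bounded maps and almost isometries on subspaces\<close>

lemma amp_bicomp:
  fixes Z :: "'b::ab_group_add opsys"
  assumes X: "operator_system X" and lin: "linear_into (scl X) (carr X) (scl Z) F f"
    and x: "x \<in> mats n (carr X)"
  shows "amp f (bicomp X n m A B x) = bicomp Z n m A B (amp f x)"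
proof -
  interpret operator_system X by fact
  have V: "vector_space (scl X)" by unfold_locales
  note lsum = linear_into_sum[OF lin V subspace_carr]
  have f0: "f 0 = 0" by (rule linear_into_0[OF lin carr_0])
  have xc: "x i j \<in> carr X" for i j by (rule mats_entry[OF x])
  have "f (\<Sum>k<n. \<Sum>l<n. scl X (c k l) (x k l)) = (\<Sum>k<n. \<Sum>l<n. scl Z (c k l) (f (x k l)))" for c
  proof -
    have "f (\<Sum>k<n. \<Sum>l<n. scl X (c k l) (x k l)) = (\<Sum>k<n. f (\<Sum>l<n. scl X (c k l) (x k l)))"
      by (rule lsum) (intro carr_sum carr_scl xc)
    also have "\<dots> = (\<Sum>k<n. \<Sum>l<n. f (scl X (c k l) (x k l)))"
      by (rule sum.cong[OF refl], rule lsum) (intro carr_scl xc)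
    also have "\<dots> = (\<Sum>k<n. \<Sum>l<n. scl Z (c k l) (f (x k l)))"
      using lin xc by (simp add: linear_into_def)
    finally show ?thesis .
  qed
  then show ?thesis by (simp add: amp_def bicomp_def f0 fun_eq_iff)
qed

text \<open>Smith's lemma: into \<open>N \<times> N\<close> matrices, the norm on the \<open>N\<close>-th matrix level controls all
  levels, since an \<open>n \<times> N\<close> matrix factors through an \<open>n \<times> N\<close> contraction.\<close>

lemma smith:
  assumes X: "operator_system X" and E: "module.subspace (scl X) E" "E \<subseteq> carr X"
    and \<alpha>: "linear_into (scl X) E (scl (matalg N)) (carr (matalg N)) \<alpha>" and \<phi>: "ucp X m \<phi>" and N: "1 \<le> N"
    and a: "0 \<le> a" and b: "0 \<le> b"
    and h1: "\<And>x. x \<in> mats N E \<Longrightarrow> mnorm X N x \<le> b * mnorm (matalg m) N (amp \<phi> x)"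
    and h2: "\<And>x. x \<in> mats N E \<Longrightarrow> mnorm (matalg N) N (amp \<alpha> x) \<le> a * mnorm X N x"
    and x: "x \<in> mats n E"
  shows "mnorm (matalg N) n (amp \<alpha> x) \<le> a * b * mnorm (matalg m) n (amp \<phi> x)"
proof -
  interpret X: operator_system X by fact
  interpret M: operator_system "matalg m" by (rule ucpD(4)[OF \<phi>])
  interpret N: operator_system "matalg N" by (rule operator_system_matalg[OF N])
  have xm: "x \<in> mats n (carr X)" using x E(2) by (auto simp: mats_def)
  have \<alpha>0: "\<alpha> 0 = 0" by (rule linear_into_0[OF \<alpha> X.subspace_0[OF E(1)]])
  have \<phi>x: "amp \<phi> x \<in> mats n (carr (matalg m))" by (rule cp_map_mats[OF X ucpD(2)[OF \<phi>] xm])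
  have \<alpha>x: "amp \<alpha> z \<in> mats j (carr (matalg N))" if "z \<in> mats j E" for z j
    by (rule amp_mats[where f = \<alpha>, OF that _ \<alpha>0]) (use \<alpha> in \<open>simp add: linear_into_def\<close>)
  define r where "r = mnorm (matalg m) n (amp \<phi> x)"
  have r: "0 \<le> r" unfolding r_def by (rule M.mnorm_nonneg[OF \<phi>x])
  have "bnd n N (amp \<alpha> x) (a * b * r)" unfolding bnd_def
  proof (intro allI, rule field_le_epsilon)
    fix u v :: "nat \<Rightarrow> nat \<Rightarrow> complex" and e :: real assume e: "0 < e"
    \<comment> \<open>The two regularized factorizations add \<epsilon> N each to the square norms.
      This \<epsilon> keeps their total contribution below e; the + 1 guards against a zero
      denominator.\<close>
    define \<epsilon> where "\<epsilon> = e / (a * b * r * (2 * real N) + 1)"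
    have den: "0 < a * b * r * (2 * real N) + 1" using a b r by (intro add_nonneg_pos mult_nonneg_nonneg) auto
    have \<epsilon>: "0 < \<epsilon>" using e den by (simp add: \<epsilon>_def)
    have \<epsilon>e: "a * b * r * (2 * (\<epsilon> * real N)) \<le> e"
    proof -
      have "a * b * r * (2 * (\<epsilon> * real N)) = \<epsilon> * (a * b * r * (2 * real N))" by simp
      also have "\<dots> \<le> \<epsilon> * (a * b * r * (2 * real N) + 1)" using \<epsilon> by (intro mult_left_mono) auto
      also have "\<dots> = e" using den by (simp add: \<epsilon>_def)
      finally show ?thesis .
    qed
    obtain A T where A: "contr n N A" "\<forall>i<n. \<forall>b<N. u i b = (\<Sum>a<N. A i a * T a b)"
      "sqn N N T = sqn n N u + \<epsilon> * real N" using contr_factor[OF \<epsilon>, of n N u] by (elim exE conjE)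
    obtain B R where B: "contr n N B" "\<forall>i<n. \<forall>b<N. v i b = (\<Sum>a<N. B i a * R a b)"
      "sqn N N R = sqn n N v + \<epsilon> * real N" using contr_factor[OF \<epsilon>, of n N v] by (elim exE conjE)
    \<comment> \<open>u and v have n rows but only N columns, so the contractions of their
      factorizations bring x down to level N, where both norm comparisons are available.\<close>
    let ?y = "bicomp X n N A B x"
    have y: "?y \<in> mats N E" by (rule mats_bicomp[OF X E(1) x])
    have "sesq n N (amp \<alpha> x) u v = sesq n N (amp \<alpha> x) (\<lambda>i p. \<Sum>a<N. A i a * T a p) (\<lambda>i p. \<Sum>a<N. B i a * R a p)"
      by (rule sesq_cong) (simp add: A(2) B(2))
    also have "\<dots> = sesq N N (amp \<alpha> ?y) T R" by (rule sesq_bicomp[OF X \<alpha> E(1) x, symmetric])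
    finally have s: "sesq n N (amp \<alpha> x) u v = sesq N N (amp \<alpha> ?y) T R" .
    have TR: "0 \<le> sqn N N T + sqn N N R" by (rule sqn_pos)
    have flin: "linear_into (scl X) (carr X) (scl (matalg m)) (carr (matalg m)) \<phi>"
      using ucpD(2)[OF \<phi>] by (simp add: cp_map_def)
    have "mnorm (matalg m) N (amp \<phi> ?y) \<le> r"
      unfolding amp_bicomp[OF X flin xm] r_def by (rule mnorm_bicomp[OF M.operator_system_axioms \<phi>x A(1) B(1)])
    then have "a * (b * mnorm (matalg m) N (amp \<phi> ?y)) \<le> a * (b * r)" using a b by (intro mult_left_mono)
    moreover have "a * mnorm X N ?y \<le> a * (b * mnorm (matalg m) N (amp \<phi> ?y))"
      by (rule mult_left_mono[OF h1[OF y] a])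
    ultimately have n: "mnorm (matalg N) N (amp \<alpha> ?y) \<le> a * b * r" using h2[OF y] by (simp add: mult.assoc)
    have "2 * cmod (sesq N N (amp \<alpha> ?y) T R) \<le> mnorm (matalg N) N (amp \<alpha> ?y) * (sqn N N T + sqn N N R)"
      using mnorm_matalg_le_iff[OF N _ N.mnorm_nonneg[OF \<alpha>x[OF y]], of "amp \<alpha> ?y" N] \<alpha>x[OF y] by (simp add: bnd_def)
    also have "\<dots> \<le> a * b * r * (sqn N N T + sqn N N R)" by (rule mult_right_mono[OF n TR])
    also have "\<dots> = a * b * r * (sqn n N u + sqn n N v) + a * b * r * (2 * (\<epsilon> * real N))"
      unfolding A(3) B(3) by (simp add: algebra_simps)
    also have "\<dots> \<le> a * b * r * (sqn n N u + sqn n N v) + e" using \<epsilon>e by simp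
    finally show "2 * cmod (sesq n N (amp \<alpha> x) u v) \<le> a * b * r * (sqn n N u + sqn n N v) + e" unfolding s .
  qed
  moreover have "0 \<le> a * b * r" using a b r by simp
  ultimately show ?thesis unfolding r_def[symmetric]
    using mnorm_matalg_le_iff[OF N _ \<open>0 \<le> a * b * r\<close>, of "amp \<alpha> x" n] \<alpha>x[OF x] by simp
qed

lemma amp_mscl_linear:
  assumes lin: "linear_into (scl X) E (scl Y) F f" and x: "x \<in> mats n E" and 0: "0 \<in> E"
  shows "amp f (mscl X c x) = mscl Y c (amp f x)"
proof -
  have "x i j \<in> E" for i j using x 0 by (cases "i < n \<and> j < n") (auto simp: mats_def)
  then show ?thesis using lin by (simp add: amp_def mscl_def linear_into_def)
qed

lemma cb_normD:
  assumes X: "operator_system X" and Y: "operator_system Y" and E: "module.subspace (scl X) E" "E \<subseteq> carr X"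
    and lin: "linear_into (scl X) E (scl Y) (carr Y) f" and cb: "cb_norm X E Y f \<le> ennreal a" and a: "0 \<le> a"
    and x: "x \<in> mats n E"
  shows "mnorm Y n (amp f x) \<le> a * mnorm X n x"
proof -
  interpret X: operator_system X by fact
  interpret Y: operator_system Y by fact
  have xm: "x \<in> mats n (carr X)" using x E(2) by (auto simp: mats_def)
  have E0: "0 \<in> E" by (rule X.subspace_0[OF E(1)])
  have f0: "f 0 = 0" by (rule linear_into_0[OF lin E0])
  have fx: "amp f x \<in> mats n (carr Y)"
    by (rule amp_mats[where f = f, OF x _ f0]) (use lin in \<open>simp add: linear_into_def\<close>)
  define t where "t = mnorm X n x"
  have t: "0 \<le> t" unfolding t_def by (rule X.mnorm_nonneg[OF xm])
  show ?thesis
  proof (cases "t = 0")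
    case True
    then have "x = 0" using X.mnorm_eq_0D[OF xm] by (simp add: t_def)
    then have "amp f x = 0" by (simp add: amp_def f0 fun_eq_iff)
    then show ?thesis using True a by (simp add: t_def)
  next
    case False
    let ?x = "mscl X (complex_of_real (1 / t)) x"
    have x': "?x \<in> mats n E" using x X.subspace_scale[OF E(1)] by (auto simp: mats_def mscl_def)
    have "mnorm X n ?x = 1" using False t X.mnorm_mscl[OF xm, of "complex_of_real (1 / t)"] by (simp add: t_def norm_divide)
    then have "ennreal (mnorm Y n (amp f ?x)) \<le> cb_norm X E Y f"
      unfolding cb_norm_def using x' by (intro SUP_upper2[of n] SUP_upper) auto
    then have "ennreal (mnorm Y n (amp f ?x)) \<le> ennreal a" using cb by (rule order_trans)
    then have "mnorm Y n (amp f ?x) \<le> a" using a by simp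
    moreover have "mnorm Y n (amp f ?x) = 1 / t * mnorm Y n (amp f x)"
      unfolding amp_mscl_linear[OF lin x E0] using t Y.mnorm_mscl[OF fx, of "complex_of_real (1 / t)"] by (simp add: norm_divide)
    ultimately have "1 / t * mnorm Y n (amp f x) \<le> a" by (simp only:)
    then show ?thesis using False t by (simp add: t_def[symmetric] field_simps)
  qed
qed

lemma cb_normI:
  assumes a: "0 \<le> a" and b: "\<And>n x. x \<in> mats n E \<Longrightarrow> mnorm Y n (amp f x) \<le> a * mnorm X n x"
  shows "cb_norm X E Y f \<le> ennreal a"
  unfolding cb_norm_def
proof (intro SUP_least ennreal_leI)
  fix n x assume x: "x \<in> {x \<in> mats n E. mnorm X n x \<le> 1}"
  then have "a * mnorm X n x \<le> a * 1" using a by (intro mult_left_mono) auto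
  then show "mnorm Y n (amp f x) \<le> a" using b[of x n] x by simp
qed

lemma cb_norm_eq_0D:
  assumes X: "operator_system X" and Y: "operator_system Y" and E: "module.subspace (scl X) E" "E \<subseteq> carr X"
    and lin: "linear_into (scl X) E (scl Y) (carr Y) f" and cb: "cb_norm X E Y f = 0" and x: "x \<in> E"
  shows "f x = 0"
proof -
  interpret X: operator_system X by fact
  interpret Y: operator_system Y by fact
  have f0: "f 0 = 0" by (rule linear_into_0[OF lin X.subspace_0[OF E(1)]])
  have fx: "f x \<in> carr Y" using lin x by (auto simp: linear_into_def)
  have "elt 0 0 x \<in> mats 1 E" using x X.subspace_0[OF E(1)] by (auto simp: elt_def mats_def)
  from cb_normD[OF X Y E lin _ _ this, of 0] cb have "opsys_norm Y (f x) \<le> 0"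
    by (simp add: amp_elt f0 opsys_norm_elt)
  then show ?thesis using Y.opsys_norm_nonneg[OF fx] Y.opsys_norm_eq_0D[OF fx] by simp
qed

text \<open>At one fixed level N the unit sphere of the matrices over the span has a finite net. For
  y in the net the norm block of radius 1 - \<epsilon> is not positive, and a single map that keeps
  these finitely many blocks non-positive almost preserves the norm on the whole sphere.\<close>

lemma near_isometry:
  assumes X: "operator_system X" and B: "finite B" "module.span (scl X) B \<subseteq> carr X" and \<delta>: "0 < \<delta>"
  shows "\<exists>m \<phi>. ucp X m \<phi> \<and> (\<forall>x\<in>mats N (module.span (scl X) B).
    mnorm X N x \<le> (1 + \<delta>) * mnorm (matalg m) N (amp \<phi> x))"
proof -
  interpret X: operator_system X by fact
  let ?E = "X.span B"
  have E: "X.subspace ?E" by (rule X.subspace_span)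
  have V: "vector_space (scl X)" by unfold_locales
  obtain K d b c where K: "0 < K" and b': "\<forall>i<d. b i \<in> ?E"
    and rep': "\<forall>e\<in>?E. e = (\<Sum>i<d. scl X (c e i) (b i))"
    and cK': "\<forall>e\<in>?E. \<forall>i<d. cmod (c e (i::nat)) \<le> K * opsys_norm X e"
    using X.fd_coords[OF B] by (elim exE conjE)
  have b: "b i \<in> ?E" if "i < d" for i using b' that by simp
  have rep: "e = (\<Sum>i<d. scl X (c e i) (b i))" if "e \<in> ?E" for e using rep' that by (rule bspec)
  have cK: "cmod (c e i) \<le> K * opsys_norm X e" if "e \<in> ?E" "i < d" for e i using cK' that by simp
  have mE: "x \<in> mats N (carr X)" if "x \<in> mats N ?E" for x using that B(2) by (auto simp: mats_def)
  have entE: "x i j \<in> ?E" if "x \<in> mats N ?E" for x i j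
    using that X.subspace_0[OF E] by (cases "i < N \<and> j < N") (auto simp: mats_def)
  \<comment> \<open>One \<epsilon> is lost at the net points and one in passing to them; this choice
    gives \<open>(1 + \<delta>) (1 - 2 \<epsilon>) = 1 + \<delta> / 2\<close>.\<close>
  define \<epsilon> where "\<epsilon> = \<delta> / (4 * (1 + \<delta>))"
  have \<epsilon>: "0 < \<epsilon>" "(1 + \<delta>) * (1 - 2 * \<epsilon>) \<ge> 1" "\<epsilon> < 1"
    using \<delta> by (auto simp: \<epsilon>_def field_simps)
  \<comment> \<open>C - 1 bounds the norm of an N x N matrix whose entries have coordinates of
    modulus at most 1, so matrices with coordinates within \<epsilon> / C are within \<epsilon> of
    each other. The + 1 keeps C positive.\<close>
  define C where "C = real N * (real N * (\<Sum>i<d. opsys_norm X (b i))) + 1"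
  have bn: "0 \<le> opsys_norm X (b i)" if "i < d" for i using b[OF that] B(2) by (intro X.opsys_norm_nonneg) auto
  have C: "0 < C" unfolding C_def using bn by (intro add_nonneg_pos mult_nonneg_nonneg sum_nonneg) auto
  define \<gamma> where "\<gamma> = \<epsilon> / C"
  have \<gamma>: "0 < \<gamma>" using \<epsilon> C by (simp add: \<gamma>_def)
  define T where "T = {x \<in> mats N ?E. mnorm X N x = 1}"
  let ?c = "\<lambda>x (k, l, i). c (x k l) i"
  let ?I = "{..<N} \<times> {..<N} \<times> {..<d}"
  have fin: "finite ?I" by simp
  have bd: "cmod (?c x t) \<le> K" if x: "x \<in> T" and t: "t \<in> ?I" for x t
  proof -
    obtain k l i where t: "t = (k, l, i)" "k < N" "l < N" "i < d" using t by auto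
    have "cmod (c (x k l) i) \<le> K * opsys_norm X (x k l)"
      using x t by (intro cK entE) (auto simp: T_def)
    also have "\<dots> \<le> K * mnorm X N x"
      using x t K by (intro mult_left_mono X.entry_norm_le mE) (auto simp: T_def)
    finally show ?thesis using x t by (simp add: T_def)
  qed
  have "\<exists>F. finite F \<and> F \<subseteq> T \<and> (\<forall>x\<in>T. \<exists>y\<in>F. \<forall>t\<in>?I. cmod (?c x t - ?c y t) \<le> \<gamma>)"
    by (rule finite_net[of ?I T ?c K, OF fin bd \<gamma>])
  then obtain F where F: "finite F" "F \<subseteq> T" "\<forall>x\<in>T. \<exists>y\<in>F. \<forall>t\<in>?I. cmod (?c x t - ?c y t) \<le> \<gamma>"
    by (elim exE conjE)
  have close: "\<exists>y\<in>F. mnorm X N (x - y) \<le> \<epsilon>" if x: "x \<in> T" for x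
  proof -
    obtain y where y: "y \<in> F" "\<forall>t\<in>?I. cmod (?c x t - ?c y t) \<le> \<gamma>" using F(3) x by blast
    have xE: "x \<in> mats N ?E" and yE: "y \<in> mats N ?E" using x y(1) F(2) by (auto simp: T_def)
    have ent: "opsys_norm X ((x - y) k l) \<le> \<gamma> * (\<Sum>i<d. opsys_norm X (b i))" if kl: "k < N" "l < N" for k l
    proof -
      have "(x - y) k l = (\<Sum>i<d. scl X (c (x k l) i) (b i)) - (\<Sum>i<d. scl X (c (y k l) i) (b i))"
        using rep[OF entE[OF xE], of k l] rep[OF entE[OF yE], of k l] by simp
      also have "\<dots> = (\<Sum>i<d. scl X (c (x k l) i - c (y k l) i) (b i))"
        by (simp add: sum_subtractf X.scale_left_diff_distrib)
      finally have "opsys_norm X ((x - y) k l) \<le> (\<Sum>i<d. opsys_norm X (scl X (c (x k l) i - c (y k l) i) (b i)))"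
        using b B(2) by (simp only:) (intro X.opsys_norm_sum X.carr_scl, auto)
      also have "\<dots> = (\<Sum>i<d. cmod (c (x k l) i - c (y k l) i) * opsys_norm X (b i))"
        using b B(2) by (intro sum.cong refl X.opsys_norm_scl) auto
      also have "\<dots> \<le> (\<Sum>i<d. \<gamma> * opsys_norm X (b i))"
        using y(2) kl bn by (intro sum_mono mult_right_mono) auto
      finally show ?thesis by (simp add: sum_distrib_left)
    qed
    have "mnorm X N (x - y) \<le> (\<Sum>k<N. \<Sum>l<N. opsys_norm X ((x - y) k l))"
      by (intro X.mnorm_le_sum_entries X.mats_diff mE xE yE)
    also have "\<dots> \<le> (\<Sum>k<N. \<Sum>l<N. \<gamma> * (\<Sum>i<d. opsys_norm X (b i)))"
      by (intro sum_mono ent) auto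
    also have "\<dots> = \<gamma> * (C - 1)" by (simp add: C_def)
    also have "\<dots> \<le> \<epsilon>" using C \<epsilon>(1) by (simp add: \<gamma>_def field_simps)
    finally show ?thesis using y(1) by blast
  qed
  let ?Z = "norm_block X N (1 - \<epsilon>) ` F"
  have "\<exists>k f. ucp X k f \<and> (\<forall>z\<in>?Z. amp f z \<notin> pos (matalg k) (2 * N))"
  proof (rule separating_ucp_finite[OF X])
    show "finite ?Z" using F(1) by simp
    fix z assume "z \<in> ?Z"
    then obtain y where y: "y \<in> F" "z = norm_block X N (1 - \<epsilon>) y" by auto
    then have ym: "y \<in> mats N (carr X)" "mnorm X N y = 1" using F(2) mE by (auto simp: T_def)
    show "z \<in> hmats X (2 * N) \<and> z \<notin> pos X (2 * N)"
      using norm_block_hmats[OF X ym(1)] X.mnorm_norm_block(2)[OF ym(1), of "1 - \<epsilon>"] ym(2) \<epsilon> by (simp add: y(2))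
  qed
  then obtain m \<phi> where \<phi>: "ucp X m \<phi>" "\<forall>z\<in>?Z. amp \<phi> z \<notin> pos (matalg m) (2 * N)" by (elim exE conjE)
  interpret M: operator_system "matalg m" by (rule ucpD(4)[OF \<phi>(1)])
  have \<phi>m: "amp \<phi> x \<in> mats N (carr (matalg m))" if "x \<in> mats N ?E" for x
    by (rule cp_map_mats[OF X ucpD(2)[OF \<phi>(1)] mE[OF that]])
  have \<phi>F: "1 - \<epsilon> < mnorm (matalg m) N (amp \<phi> y)" if y: "y \<in> F" for y
  proof -
    have yE: "y \<in> mats N ?E" using y F(2) by (auto simp: T_def)
    have "amp \<phi> (norm_block X N (1 - \<epsilon>) y) \<notin> pos (matalg m) (2 * N)" using \<phi>(2) y by blast
    then show ?thesis
      unfolding amp_norm_block[OF X ucpD(4,2,3)[OF \<phi>(1)] mE[OF yE]]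
      using M.mnorm_norm_block(2)[OF \<phi>m[OF yE], of "1 - \<epsilon>"] \<epsilon>(3) by simp
  qed
  have \<phi>T: "1 - 2 * \<epsilon> \<le> mnorm (matalg m) N (amp \<phi> x)" if x: "x \<in> T" for x
  proof -
    obtain y where y: "y \<in> F" "mnorm X N (x - y) \<le> \<epsilon>" using close[OF x] by blast
    have xE: "x \<in> mats N ?E" and yE: "y \<in> mats N ?E" using x y(1) F(2) by (auto simp: T_def)
    have xy: "y - x \<in> mats N (carr X)" by (intro X.mats_diff mE xE yE)
    have "amp \<phi> y = amp \<phi> x + amp \<phi> (y - x)"
      using X.ucp_amp_add[OF \<phi>(1) mE[OF xE] xy] by simp
    then have "mnorm (matalg m) N (amp \<phi> y) \<le> mnorm (matalg m) N (amp \<phi> x) + mnorm (matalg m) N (amp \<phi> (y - x))"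
      using M.mnorm_triangle[OF \<phi>m[OF xE] cp_map_mats[OF X ucpD(2)[OF \<phi>(1)] xy]] by simp
    also have "mnorm (matalg m) N (amp \<phi> (y - x)) \<le> mnorm X N (y - x)" by (rule ucp_mnorm_le[OF X \<phi>(1) xy])
    also have "\<dots> \<le> \<epsilon>" using y(2) X.mnorm_minus_commute[OF mE[OF xE] mE[OF yE]] by simp
    finally show ?thesis using \<phi>F[OF y(1)] by simp
  qed
  show ?thesis
  proof (intro exI[of _ m] exI[of _ \<phi>] conjI allI ballI \<phi>(1))
    fix x assume x: "x \<in> mats N ?E"
    define t where "t = mnorm X N x"
    have t: "0 \<le> t" unfolding t_def by (rule X.mnorm_nonneg[OF mE[OF x]])
    show "mnorm X N x \<le> (1 + \<delta>) * mnorm (matalg m) N (amp \<phi> x)"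
    proof (cases "t = 0")
      case True
      then show ?thesis using M.mnorm_nonneg[OF \<phi>m[OF x]] \<delta> by (simp add: t_def)
    next
      case False
      let ?x = "mscl X (complex_of_real (1 / t)) x"
      have x': "?x \<in> mats N ?E" using x X.subspace_scale[OF E] by (auto simp: mats_def mscl_def)
      have "?x \<in> T" using x' False t X.mnorm_mscl[OF mE[OF x], of "complex_of_real (1 / t)"] by (simp add: T_def t_def norm_divide)
      then have "1 - 2 * \<epsilon> \<le> mnorm (matalg m) N (amp \<phi> ?x)" by (rule \<phi>T)
      also have "amp \<phi> ?x = mscl (matalg m) (complex_of_real (1 / t)) (amp \<phi> x)"
        unfolding X.ucp_amp_mscl[OF \<phi>(1) mE[OF x]] by (simp add: mscl_def)
      also have "mnorm (matalg m) N \<dots> = 1 / t * mnorm (matalg m) N (amp \<phi> x)"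
        using M.mnorm_mscl[OF \<phi>m[OF x], of "complex_of_real (1 / t)"] t by (simp add: norm_divide)
      finally have "t * (1 - 2 * \<epsilon>) \<le> mnorm (matalg m) N (amp \<phi> x)" using False t by (simp add: field_simps)
      then have "(1 + \<delta>) * (t * (1 - 2 * \<epsilon>)) \<le> (1 + \<delta>) * mnorm (matalg m) N (amp \<phi> x)" using \<delta> by (intro mult_left_mono) auto
      moreover have "t * 1 \<le> t * ((1 + \<delta>) * (1 - 2 * \<epsilon>))" by (rule mult_left_mono[OF \<epsilon>(2) t])
      ultimately show ?thesis by (simp add: t_def mult_ac)
    qed
  qed
qed

text \<open>With N the size of the matrix algebra that receives \<alpha>, a map \<phi> nearly
  isometric at level N dominates \<alpha> at every level by \<open>smith\<close>, and the inverse of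
  \<alpha> carries this domination back to \<open>X\<close>. The distortion of \<alpha> enters only
  through the product of the two completely bounded norms.\<close>

theorem one_exact_ucp:
  assumes X: "operator_system X" and ex: "one_exact X"
    and B: "finite B" "module.span (scl X) B \<subseteq> carr X" "ounit X \<in> module.span (scl X) B" and \<delta>: "0 < \<delta>"
  shows "\<exists>m \<phi>. ucp X m \<phi> \<and> (\<forall>n. \<forall>x\<in>mats n (module.span (scl X) B).
    mnorm X n x \<le> (1 + \<delta>) * mnorm (matalg m) n (amp \<phi> x))"
proof -
  interpret X: operator_system X by fact
  let ?E = "X.span B"
  have E: "X.subspace ?E" by (rule X.subspace_span)
  \<comment> \<open>The factor 1 + \<gamma> occurs twice, once for the distortion of \<alpha> and
    once for \<phi>; since \<gamma> \<le> 1 its square is at most 1 + 3 \<gamma>.\<close>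
  define \<gamma> where "\<gamma> = min 1 \<delta> / 3"
  have \<gamma>: "0 < \<gamma>" "\<gamma> \<le> 1" "3 * \<gamma> \<le> \<delta>" using \<delta> by (auto simp: \<gamma>_def)
  have g2: "(1 + \<gamma>) * (1 + \<gamma>) \<le> 1 + \<delta>"
  proof -
    have "\<gamma> * \<gamma> \<le> \<gamma> * 1" using \<gamma> by (intro mult_left_mono) auto
    moreover have "(1 + \<gamma>) * (1 + \<gamma>) = 1 + 2 * \<gamma> + \<gamma> * \<gamma>" by (simp add: algebra_simps)
    ultimately show ?thesis using \<gamma> by linarith
  qed
  obtain N \<alpha> where N: "1 \<le> N" and \<alpha>: "linear_into (scl X) ?E (scl (matalg N)) (carr (matalg N)) \<alpha>" "inj_on \<alpha> ?E"
    and cb: "cb_norm X ?E (matalg N) \<alpha> * cb_norm (matalg N) (\<alpha> ` ?E) X (inv_into ?E \<alpha>) \<le> ennreal (1 + \<gamma>)"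
    using ex[unfolded one_exact_def, rule_format, of ?E "1 + \<gamma>"] E B \<gamma> by auto
  interpret N: operator_system "matalg N" by (rule operator_system_matalg[OF N])
  let ?\<beta> = "inv_into ?E \<alpha>"
  have inv: "?\<beta> (\<alpha> e) = e" if "e \<in> ?E" for e by (rule inv_into_f_f[OF \<alpha>(2) that])
  have \<alpha>add: "\<alpha> (x + y) = \<alpha> x + \<alpha> y" and \<alpha>scl: "\<alpha> (scl X t x) = scl (matalg N) t (\<alpha> x)"
    and \<alpha>c: "\<alpha> x \<in> carr (matalg N)" if "x \<in> ?E" "y \<in> ?E" for x y t
    using \<alpha>(1) that by (auto simp: linear_into_def)
  have \<alpha>0: "\<alpha> 0 = 0" by (rule linear_into_0[OF \<alpha>(1) X.subspace_0[OF E]])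
  have \<beta>: "linear_into (scl (matalg N)) (\<alpha> ` ?E) (scl X) (carr X) ?\<beta>"
    unfolding linear_into_def
  proof (intro conjI ballI allI)
    show "?\<beta> ` \<alpha> ` ?E \<subseteq> carr X" using inv B(2) by auto
    fix u v assume "u \<in> \<alpha> ` ?E" "v \<in> \<alpha> ` ?E"
    then obtain x y where xy: "x \<in> ?E" "y \<in> ?E" "u = \<alpha> x" "v = \<alpha> y" by blast
    show "?\<beta> (u + v) = ?\<beta> u + ?\<beta> v"
      unfolding xy(3,4) \<alpha>add[OF xy(1,2), symmetric] inv[OF xy(1)] inv[OF xy(2)] by (rule inv[OF X.subspace_add[OF E xy(1,2)]])
  next
    fix t u assume "u \<in> \<alpha> ` ?E"
    then obtain x where xy: "x \<in> ?E" "u = \<alpha> x" by blast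
    show "?\<beta> (scl (matalg N) t u) = scl X t (?\<beta> u)"
      unfolding xy(2) \<alpha>scl[OF xy(1,1), symmetric] inv[OF xy(1)] by (rule inv[OF X.subspace_scale[OF E xy(1)]])
  qed
  have \<alpha>E: "N.subspace (\<alpha> ` ?E)"
  proof (rule N.subspaceI)
    show "0 \<in> \<alpha> ` ?E" using \<alpha>0 X.subspace_0[OF E] by force
    show "u + v \<in> \<alpha> ` ?E" if uv: "u \<in> \<alpha> ` ?E" "v \<in> \<alpha> ` ?E" for u v
    proof -
      obtain x y where xy: "x \<in> ?E" "y \<in> ?E" "u = \<alpha> x" "v = \<alpha> y" using uv by blast
      show ?thesis unfolding xy(3,4) \<alpha>add[OF xy(1,2), symmetric] by (intro imageI X.subspace_add[OF E] xy(1,2))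
    qed
    show "scl (matalg N) t u \<in> \<alpha> ` ?E" if uv: "u \<in> \<alpha> ` ?E" for t u
    proof -
      obtain x where xy: "x \<in> ?E" "u = \<alpha> x" using uv by blast
      show ?thesis unfolding xy(2) \<alpha>scl[OF xy(1,1), symmetric] by (intro imageI X.subspace_scale[OF E] xy(1))
    qed
  qed
  have \<alpha>Ec: "\<alpha> ` ?E \<subseteq> carr (matalg N)" using \<alpha>(1) by (simp add: linear_into_def)
  let ?A = "cb_norm X ?E (matalg N) \<alpha>" and ?B = "cb_norm (matalg N) (\<alpha> ` ?E) X ?\<beta>"
  \<comment> \<open>In \<open>ennreal\<close> a finite product does not make both factors finite
    when one of them is 0. The unit lies in the span and is not sent to 0, so neither norm vanishes
    and both are real numbers.\<close>
  have \<alpha>1: "\<alpha> (ounit X) \<noteq> 0" using inj_onD[OF \<alpha>(2), of "ounit X" 0] B(3) X.subspace_0[OF E] X.ounit_nonzero \<alpha>0 by auto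
  then have "?A \<noteq> 0" using cb_norm_eq_0D[OF X N.operator_system_axioms E B(2) \<alpha>(1) _ B(3)] by blast
  moreover have "?B \<noteq> 0"
    using cb_norm_eq_0D[OF N.operator_system_axioms X \<alpha>E \<alpha>Ec \<beta> _ imageI[OF B(3)]] inv[OF B(3)] X.ounit_nonzero by auto
  moreover have "?A * ?B \<noteq> top" using cb by (auto simp: top_unique)
  ultimately have fin: "?A \<noteq> top" "?B \<noteq> top" by (auto simp: ennreal_mult_eq_top_iff)
  define a where "a = enn2real ?A"
  define b where "b = enn2real ?B"
  have ab: "?A = ennreal a" "?B = ennreal b" "0 \<le> a" "0 \<le> b" using fin by (auto simp: a_def b_def top.not_eq_extremum)
  have "ennreal (a * b) \<le> ennreal (1 + \<gamma>)" using cb unfolding ab(1,2) ennreal_mult[OF ab(3,4)] .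
  then have abc: "a * b \<le> 1 + \<gamma>" using \<gamma> by (subst (asm) ennreal_le_iff) auto
  obtain m \<phi> where \<phi>: "ucp X m \<phi>" "\<forall>x\<in>mats N ?E. mnorm X N x \<le> (1 + \<gamma>) * mnorm (matalg m) N (amp \<phi> x)"
    using near_isometry[OF X B(1,2) \<gamma>(1), of N] by (elim exE conjE)
  interpret M: operator_system "matalg m" by (rule ucpD(4)[OF \<phi>(1)])
  show ?thesis
  proof (intro exI[of _ m] exI[of _ \<phi>] conjI allI ballI \<phi>(1))
    fix n x assume x: "x \<in> mats n ?E"
    have xm: "x \<in> mats n (carr X)" using x B(2) by (auto simp: mats_def)
    have \<alpha>x: "amp \<alpha> x \<in> mats n (\<alpha> ` ?E)" by (rule amp_mats[where f = \<alpha>, OF x subset_refl \<alpha>0])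
    have "mnorm (matalg N) n (amp \<alpha> x) \<le> a * (1 + \<gamma>) * mnorm (matalg m) n (amp \<phi> x)"
      by (rule smith[OF X E B(2) \<alpha>(1) \<phi>(1) N ab(3) _ bspec[OF \<phi>(2)] _ x])
        (use \<gamma> cb_normD[OF X N.operator_system_axioms E B(2) \<alpha>(1) eq_refl[OF ab(1)] ab(3)] in auto)
    then have "b * mnorm (matalg N) n (amp \<alpha> x) \<le> b * (a * (1 + \<gamma>) * mnorm (matalg m) n (amp \<phi> x))"
      by (rule mult_left_mono[OF _ ab(4)])
    moreover have "mnorm X n (amp ?\<beta> (amp \<alpha> x)) \<le> b * mnorm (matalg N) n (amp \<alpha> x)"
      by (rule cb_normD[OF N.operator_system_axioms X \<alpha>E \<alpha>Ec \<beta> eq_refl[OF ab(2)] ab(4) \<alpha>x])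
    moreover have "amp ?\<beta> (amp \<alpha> x) = x" by (rule amp_cancel[where U = ?\<beta> and T = \<alpha>, OF x inv X.subspace_0[OF E]])
    ultimately have "mnorm X n x \<le> (a * b) * (1 + \<gamma>) * mnorm (matalg m) n (amp \<phi> x)" by (simp add: mult_ac)
    also have "\<dots> \<le> (1 + \<gamma>) * (1 + \<gamma>) * mnorm (matalg m) n (amp \<phi> x)"
      using abc \<gamma> by (intro mult_right_mono M.mnorm_nonneg cp_map_mats[OF X ucpD(2)[OF \<phi>(1)] xm]) auto
    also have "\<dots> \<le> (1 + \<delta>) * mnorm (matalg m) n (amp \<phi> x)"
      by (rule mult_right_mono[OF g2]) (intro M.mnorm_nonneg cp_map_mats[OF X ucpD(2)[OF \<phi>(1)] xm])
    finally show "mnorm X n x \<le> (1 + \<delta>) * mnorm (matalg m) n (amp \<phi> x)" .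
  qed
qed

section \<open>States and Lip-norms\<close>

lemma statesD:
  assumes "\<sigma> \<in> states X"
  shows "\<sigma> \<in> extensional (carr X)" "\<sigma> (ounit X) = 1"
    "x \<in> carr X \<Longrightarrow> y \<in> carr X \<Longrightarrow> \<sigma> (x + y) = \<sigma> x + \<sigma> y"
    "x \<in> carr X \<Longrightarrow> \<sigma> (scl X c x) = c * \<sigma> x"
    "z \<in> pos X 1 \<Longrightarrow> \<sigma> (z 0 0) \<in> \<real>\<^sub>\<ge>\<^sub>0"
  using assms by (auto simp: states_def linear_into_def)

lemma saD: "x \<in> sa X \<Longrightarrow> x \<in> carr X" "x \<in> sa X \<Longrightarrow> adj X x = x"
  by (auto simp: sa_def)

context operator_system
begin

lemma sa_0: "0 \<in> sa X" by (simp add: sa_def carr_0 adj_0)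
lemma sa_add: "x \<in> sa X \<Longrightarrow> y \<in> sa X \<Longrightarrow> x + y \<in> sa X" by (simp add: sa_def carr_add adj_add)
lemma sa_diff: "x \<in> sa X \<Longrightarrow> y \<in> sa X \<Longrightarrow> x - y \<in> sa X" by (simp add: sa_def carr_diff adj_diff)
lemma sa_scl: "x \<in> sa X \<Longrightarrow> scl X (complex_of_real r) x \<in> sa X" by (simp add: sa_def carr_scl adj_scl)
lemma sa_neg: "x \<in> sa X \<Longrightarrow> - x \<in> sa X" by (simp add: sa_def carr_neg adj_neg)
lemma sa_ounit: "ounit X \<in> sa X" by (simp add: sa_def ounit_closed adj_ounit)
lemmas sa_intros = sa_0 sa_add sa_diff sa_scl sa_neg sa_ounit

lemma elt_hmats: "x \<in> sa X \<Longrightarrow> elt 0 0 x \<in> hmats X 1"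
  by (auto simp: sa_def hmats_def mats_def madj_def elt_def fun_eq_iff)

lemma elt_scl: "elt i j (scl X c a) = mscl X c (elt i j a)"
  by (auto simp: elt_def mscl_def fun_eq_iff)

lemma munit_1: "munit X 1 = elt 0 0 (ounit X)"
  by (auto simp: munit_def elt_def fun_eq_iff)

lemma sa_norm_le_iff:
  assumes "x \<in> sa X" "0 \<le> r"
  shows "opsys_norm X x \<le> r \<longleftrightarrow> elt 0 0 (scl X (complex_of_real r) (ounit X) + x) \<in> pos X 1 \<and>
    elt 0 0 (scl X (complex_of_real r) (ounit X) - x) \<in> pos X 1"
proof -
  have "elt 0 0 (a - b) = elt 0 0 a - elt 0 0 b" for a b :: 'a by (auto simp: elt_def fun_eq_iff)
  then show ?thesis
    unfolding opsys_norm_elt hermitian_mnorm_le_iff[OF elt_hmats[OF assms(1)] assms(2)] munit_1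
    by (simp add: elt_simps elt_scl)
qed

lemma elt_state: "elt 0 0 x \<in> pos X 1 \<Longrightarrow> \<sigma> \<in> states X \<Longrightarrow> \<sigma> x \<in> \<real>\<^sub>\<ge>\<^sub>0"
  using statesD(5)[of \<sigma> X "elt 0 0 x"] by (simp add: elt_def)

lemma state_0: "\<sigma> \<in> states X \<Longrightarrow> \<sigma> 0 = 0"
  using statesD(4)[of \<sigma> X 0 0] carr_0 by simp

lemma state_neg: "\<sigma> \<in> states X \<Longrightarrow> x \<in> carr X \<Longrightarrow> \<sigma> (- x) = - \<sigma> x"
  using statesD(4)[of \<sigma> X x "- 1"] by simp

lemma state_diff: "\<sigma> \<in> states X \<Longrightarrow> x \<in> carr X \<Longrightarrow> y \<in> carr X \<Longrightarrow> \<sigma> (x - y) = \<sigma> x - \<sigma> y"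
  using statesD(3)[of \<sigma> X x "- y"] state_neg[of \<sigma> y] carr_neg[of y] by simp

lemma state_sa:
  assumes \<sigma>: "\<sigma> \<in> states X" and x: "x \<in> sa X"
  shows "Im (\<sigma> x) = 0" "\<bar>Re (\<sigma> x)\<bar> \<le> opsys_norm X x" "cmod (\<sigma> x) \<le> opsys_norm X x"
proof -
  have xc: "x \<in> carr X" using x by (rule saD)
  define r where "r = opsys_norm X x"
  have r: "0 \<le> r" unfolding r_def by (rule opsys_norm_nonneg[OF xc])
  have c: "scl X (complex_of_real r) (ounit X) \<in> carr X" by (intro carr_intros)
  have "\<sigma> (scl X (complex_of_real r) (ounit X) + x) \<in> \<real>\<^sub>\<ge>\<^sub>0" "\<sigma> (scl X (complex_of_real r) (ounit X) - x) \<in> \<real>\<^sub>\<ge>\<^sub>0"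
    using sa_norm_le_iff[OF x r] elt_state[OF _ \<sigma>] by (auto simp: r_def)
  then have 1: "complex_of_real r + \<sigma> x \<in> \<real>\<^sub>\<ge>\<^sub>0" "complex_of_real r - \<sigma> x \<in> \<real>\<^sub>\<ge>\<^sub>0"
    using \<sigma> by (simp_all add: statesD(2-4)[OF \<sigma>] state_diff c xc ounit_closed)
  then show i: "Im (\<sigma> x) = 0" and "\<bar>Re (\<sigma> x)\<bar> \<le> opsys_norm X x"
    by (auto simp: complex_nonneg_Reals_iff r_def)
  then show "cmod (\<sigma> x) \<le> opsys_norm X x" by (simp add: cmod_eq_Re)
qed

lemma state_of_ucp:
  assumes f: "ucp X 1 f"
  shows "restrict (\<lambda>x. f x 0 0) (carr X) \<in> states X"
proof -
  note lin = cp_map_linear[OF ucpD(2)[OF f]]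
  have "f (z 0 0) 0 0 \<in> \<real>\<^sub>\<ge>\<^sub>0" if z: "z \<in> pos X 1" for z
    using cp_map_sesq[OF ucpD(2)[OF f] z, of "\<lambda>_ _. 1"] by (simp add: sesq_def amp_def)
  then show ?thesis using mats_entry[OF pos_mats[of _ 1]]
    by (auto simp: states_def linear_into_def carr_add carr_scl lin(2,3) ounit_closed ucpD(3)[OF f])
qed

lemma states_nonempty: "states X \<noteq> {}"
proof -
  have "mscl X (complex_of_real (- 1)) (munit X 1) \<notin> pos X 1" using munit_pos_iff[of 1 "- 1"] by auto
  then have "\<exists>f. ucp X 1 f" using separating_ucp[OF operator_system_axioms hmats_mscl[OF hmats_munit]] by blast
  then show ?thesis using state_of_ucp by blast
qed

text \<open>Separation at level 1 produces maps into 1 x 1 matrices, which are states; so states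
  detect positivity of single self-adjoint elements and thereby their norm.\<close>

lemma sa_norm_le_states:
  assumes x: "x \<in> sa X" and r: "0 \<le> r" and s: "\<And>\<sigma>. \<sigma> \<in> states X \<Longrightarrow> cmod (\<sigma> x) \<le> r"
  shows "opsys_norm X x \<le> r"
proof -
  have key: "elt 0 0 (scl X (complex_of_real r) (ounit X) + y) \<in> pos X 1" if y: "y \<in> sa X"
    and ys: "\<And>\<sigma>. \<sigma> \<in> states X \<Longrightarrow> cmod (\<sigma> y) \<le> r" for y
  proof (rule ccontr)
    let ?z = "elt 0 0 (scl X (complex_of_real r) (ounit X) + y)"
    assume n: "?z \<notin> pos X 1"
    have zh: "?z \<in> hmats X 1" using y by (intro elt_hmats sa_intros)
    obtain f where f: "ucp X 1 f" "amp f ?z \<notin> pos (matalg 1) 1"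
      using separating_ucp[OF operator_system_axioms zh n] by blast
    define \<sigma> where "\<sigma> = restrict (\<lambda>x. f x 0 0) (carr X)"
    have \<sigma>: "\<sigma> \<in> states X" unfolding \<sigma>_def by (rule state_of_ucp[OF f(1)])
    have yc: "y \<in> carr X" "scl X (complex_of_real r) (ounit X) \<in> carr X" using y saD by (auto intro: carr_intros)
    have zc: "scl X (complex_of_real r) (ounit X) + y \<in> carr X" using yc by (rule carr_add[rotated])
    have "\<sigma> (scl X (complex_of_real r) (ounit X) + y) = complex_of_real r + \<sigma> y"
      by (simp add: statesD(2-4)[OF \<sigma>] yc ounit_closed)
    moreover have "\<bar>Re (\<sigma> y)\<bar> \<le> r" using ys[OF \<sigma>] abs_Re_le_cmod[of "\<sigma> y"] by linarith
    ultimately have nn: "f (scl X (complex_of_real r) (ounit X) + y) 0 0 \<in> \<real>\<^sub>\<ge>\<^sub>0"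
      using state_sa(1)[OF \<sigma> y] zc by (simp add: \<sigma>_def complex_nonneg_Reals_iff)
    have "f 0 = 0" by (rule cp_map_0[OF operator_system_axioms ucpD(2)[OF f(1)]])
    then have e: "amp f ?z = elt 0 0 (f (scl X (complex_of_real r) (ounit X) + y))" by (rule amp_elt)
    have "sesq 1 1 (amp f ?z) \<xi> \<xi> = cnj (\<xi> 0 0) * \<xi> 0 0 * f (scl X (complex_of_real r) (ounit X) + y) 0 0" for \<xi>
      unfolding e by (simp add: sesq_def elt_def mult_ac)
    moreover have "cnj w * w \<in> \<real>\<^sub>\<ge>\<^sub>0" for w :: complex by (simp add: complex_nonneg_Reals_iff)
    ultimately have "sesq 1 1 (amp f ?z) \<xi> \<xi> \<in> \<real>\<^sub>\<ge>\<^sub>0" for \<xi> using nn by (simp only:) (rule nonneg_Reals_mult_I)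
    moreover have "amp f ?z \<in> mats 1 (mats 1 UNIV)"
      using cp_map_mats[OF operator_system_axioms ucpD(2)[OF f(1)] hmats_mats[OF zh]] by simp
    ultimately show False using f(2) by (simp add: matalg_pos)
  qed
  have "cmod (\<sigma> (- x)) \<le> r" if "\<sigma> \<in> states X" for \<sigma> using s[OF that] state_neg[OF that saD(1)[OF x]] by simp
  then have "elt 0 0 (scl X (complex_of_real r) (ounit X) + - x) \<in> pos X 1" by (intro key sa_neg x)
  moreover have "elt 0 0 (scl X (complex_of_real r) (ounit X) + x) \<in> pos X 1" by (intro key s x)
  ultimately show ?thesis using sa_norm_le_iff[OF x r] by simp
qed

section \<open>Weak* compactness of the state space\<close>

lemma real_imag_parts:
  assumes x: "x \<in> carr X"
  obtains u v where "u \<in> sa X" "v \<in> sa X" "x = u + scl X \<i> v"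
proof (rule that)
  let ?a = "adj X x"
  note c = x adj_closed[OF x]
  show "scl X (1/2) (x + ?a) \<in> sa X"
    using c by (simp add: sa_def carr_intros adj_scl adj_add adj_adj add.commute)
  show "scl X (-\<i>/2) (x - ?a) \<in> sa X"
    using c by (simp add: sa_def carr_intros adj_scl adj_diff adj_adj scale_right_diff_distrib)
  have "scl X \<i> (scl X (-\<i>/2) (x - ?a)) = scl X (1/2) (x - ?a)" by simp
  then have "scl X (1/2) (x + ?a) + scl X \<i> (scl X (-\<i>/2) (x - ?a)) = scl X (1/2) x + scl X (1/2) x"
    by (simp add: scale_right_distrib scale_right_diff_distrib)
  also have "\<dots> = scl X (1/2 + 1/2) x" by (simp only: scale_left_distrib)
  finally show "x = scl X (1/2) (x + ?a) + scl X \<i> (scl X (-\<i>/2) (x - ?a))" by simp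
qed

text \<open>By Tychonoff, as the states are a closed subset of a product of discs. The radius at a
  general element comes from its real and imaginary parts, since states are bounded by the norm on
  self-adjoint elements.\<close>

lemma compact_weak_star: "compact_space (weak_star X)"
proof -
  let ?T = "product_topology (\<lambda>_. euclidean :: complex topology) (carr X)"
  have "\<exists>M. \<forall>\<sigma>\<in>states X. cmod (\<sigma> x) \<le> M" if x: "x \<in> carr X" for x
  proof -
    obtain u v where uv: "u \<in> sa X" "v \<in> sa X" "x = u + scl X \<i> v" using real_imag_parts[OF x] .
    have "cmod (\<sigma> x) \<le> opsys_norm X u + opsys_norm X v" if \<sigma>: "\<sigma> \<in> states X" for \<sigma>
    proof -
      have "\<sigma> x = \<sigma> u + \<i> * \<sigma> v" unfolding uv(3)
        using statesD(3)[OF \<sigma> saD(1)[OF uv(1)] carr_scl[OF saD(1)[OF uv(2)], of \<i>]] statesD(4)[OF \<sigma> saD(1)[OF uv(2)], of \<i>]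
        by (simp only:)
      then have "cmod (\<sigma> x) \<le> cmod (\<sigma> u) + cmod (\<sigma> v)" using norm_triangle_ineq[of "\<sigma> u" "\<i> * \<sigma> v"] by (simp add: norm_mult)
      then show ?thesis using state_sa(3)[OF \<sigma> uv(1)] state_sa(3)[OF \<sigma> uv(2)] by linarith
    qed
    then show ?thesis by blast
  qed
  then obtain M where M: "\<And>x \<sigma>. x \<in> carr X \<Longrightarrow> \<sigma> \<in> states X \<Longrightarrow> cmod (\<sigma> x) \<le> M x" by metis
  let ?K = "\<Pi>\<^sub>E x\<in>carr X. cball (0::complex) (M x)"
  have K: "compactin ?T ?K" by (simp add: compactin_PiE)
  have proj: "continuous_map ?T euclidean (\<lambda>\<sigma>. \<sigma> x)" if "x \<in> carr X" for x
    using continuous_map_product_projection[of x "carr X" "\<lambda>_. euclidean"] that by simp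
  have cl: "closedin ?T {\<sigma> \<in> topspace ?T. F \<sigma> \<in> C}" if "continuous_map ?T euclidean F" "closed C" for F :: "_ \<Rightarrow> complex" and C
    by (rule closedin_continuous_map_preimage[OF that(1)]) (use that(2) in simp)
  define A where "A x y = {\<sigma> \<in> topspace ?T. \<sigma> (x + y) - (\<sigma> x + \<sigma> y) \<in> {0}}" for x y
  define B where "B c x = {\<sigma> \<in> topspace ?T. \<sigma> (scl X c x) - c * \<sigma> x \<in> {0}}" for c x
  define U where "U = {\<sigma> \<in> topspace ?T. \<sigma> (ounit X) \<in> {1}}"
  define Z where "Z z = {\<sigma> \<in> topspace ?T. \<sigma> (z 0 0) \<in> \<real>\<^sub>\<ge>\<^sub>0}" for z :: "nat \<Rightarrow> nat \<Rightarrow> 'a"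
  \<comment> \<open>Each defining condition of a state is closed. The whole space is a member so
    that the family is nonempty and the intersection also records extensionality.\<close>
  define \<C> where "\<C> = {S. S = topspace ?T \<or> (\<exists>x\<in>carr X. \<exists>y\<in>carr X. S = A x y) \<or>
    (\<exists>c. \<exists>x\<in>carr X. S = B c x) \<or> S = U \<or> (\<exists>z\<in>pos X 1. S = Z z)}"
  have "closedin ?T S" if S: "S \<in> \<C>" for S
  proof -
    have mult: "continuous_map ?T euclidean (\<lambda>\<sigma>. c * \<sigma> x)" if "x \<in> carr X" for c x
      using continuous_map_compose[OF proj[OF that], of euclidean "\<lambda>w. c * w"]
      by (simp add: o_def continuous_on_mult_left)
    have 1: "closedin ?T (A x y)" if "x \<in> carr X" "y \<in> carr X" for x y
      unfolding A_def using that by (intro cl continuous_map_diff continuous_map_add proj carr_add) auto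
    have 2: "closedin ?T (B c x)" if "x \<in> carr X" for c x
      unfolding B_def using that by (intro cl continuous_map_diff mult proj carr_scl) auto
    have 3: "closedin ?T U" unfolding U_def by (intro cl proj ounit_closed) auto
    have 4: "closedin ?T (Z z)" if "z \<in> pos X 1" for z
      unfolding Z_def using mats_entry[OF pos_mats[OF that]] by (intro cl proj closed_nonneg_Reals_complex) auto
    have 0: "closedin ?T (topspace ?T)" by (rule closedin_topspace)
    show ?thesis using S 0 1 2 3 4 unfolding \<C>_def by blast
  qed
  then have "closedin ?T (\<Inter>\<C>)" by (intro closedin_Inter) (auto simp: \<C>_def)
  moreover have "states X = \<Inter>\<C>"
  proof (intro equalityI subsetI InterI)
    have top: "\<sigma> \<in> topspace ?T \<longleftrightarrow> \<sigma> \<in> extensional (carr X)" for \<sigma> by (simp add: PiE_def)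
    show "\<sigma> \<in> S" if \<sigma>: "\<sigma> \<in> states X" and S: "S \<in> \<C>" for \<sigma> S
    proof -
      have 0: "\<sigma> \<in> topspace ?T" using top statesD(1)[OF \<sigma>] by blast
      have "\<sigma> \<in> A x y" if "x \<in> carr X" "y \<in> carr X" for x y using 0 statesD(3)[OF \<sigma> that] by (simp add: A_def)
      moreover have "\<sigma> \<in> B c x" if "x \<in> carr X" for c x using 0 statesD(4)[OF \<sigma> that] by (simp add: B_def)
      moreover have "\<sigma> \<in> U" using 0 statesD(2)[OF \<sigma>] by (simp add: U_def)
      moreover have "\<sigma> \<in> Z z" if "z \<in> pos X 1" for z using 0 statesD(5)[OF \<sigma> that] by (simp add: Z_def)
      ultimately show ?thesis using S 0 unfolding \<C>_def by blast
    qed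
    fix \<sigma> assume \<sigma>: "\<sigma> \<in> \<Inter>\<C>"
    show "\<sigma> \<in> states X" unfolding states_def linear_into_def mem_Collect_eq
    proof (intro conjI ballI allI)
      have mem: "\<sigma> \<in> S" if "S \<in> \<C>" for S using \<sigma> that by blast
      show "\<sigma> \<in> extensional (carr X)" using mem[of "topspace ?T"] unfolding top[symmetric] by (simp add: \<C>_def)
      show "\<sigma> (x + y) = \<sigma> x + \<sigma> y" if "x \<in> carr X" "y \<in> carr X" for x y
      proof -
        have "\<sigma> \<in> A x y" using that by (intro mem) (auto simp: \<C>_def)
        then show ?thesis by (simp add: A_def)
      qed
      show "\<sigma> (scl X c x) = c * \<sigma> x" if "x \<in> carr X" for c x
      proof -
        have "\<sigma> \<in> B c x" using that by (intro mem) (auto simp: \<C>_def)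
        then show ?thesis by (simp add: B_def)
      qed
      show "\<sigma> (ounit X) = 1"
      proof -
        have "\<sigma> \<in> U" by (intro mem) (auto simp: \<C>_def)
        then show ?thesis by (simp add: U_def)
      qed
      show "\<sigma> (z 0 0) \<in> \<real>\<^sub>\<ge>\<^sub>0" if "z \<in> pos X 1" for z
      proof -
        have "\<sigma> \<in> Z z" using that by (intro mem) (auto simp: \<C>_def)
        then show ?thesis by (simp add: Z_def)
      qed
    qed auto
  qed
  ultimately have "closedin ?T (states X)" by simp
  moreover have "states X \<subseteq> ?K" using M statesD(1) by (auto simp: PiE_def)
  ultimately have "compactin ?T (states X)" by (rule closed_compactin[OF K, rotated])
  then show ?thesis unfolding weak_star_def by (rule compact_space_subtopology)
qed

end

section \<open>Lip-balls: total boundedness modulo scalars and density\<close>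

locale lip_normed_system = operator_system X for X :: "'a::ab_group_add opsys" +
  fixes L :: "'a \<Rightarrow> ennreal"
  assumes lip_norm: "lip_norm X L"
begin

lemma L_add: "a \<in> sa X \<Longrightarrow> b \<in> sa X \<Longrightarrow> L (a + b) \<le> L a + L b"
  using lip_norm by (simp add: lip_norm_def)
lemma L_scl: "a \<in> sa X \<Longrightarrow> L (scl X (complex_of_real r) a) = ennreal \<bar>r\<bar> * L a"
  using lip_norm by (simp add: lip_norm_def)
lemma L_unit: "L (scl X (complex_of_real r) (ounit X)) = 0"
  using lip_norm by (simp add: lip_norm_def)

sublocale S: Metric_space "states X" "\<lambda>\<sigma> \<omega>. enn2real (lip_rho X L \<sigma> \<omega>)"
  using lip_norm by (simp add: lip_norm_def)

lemma S_topology: "S.mtopology = weak_star X"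
  using lip_norm by (simp add: lip_norm_def)

lemma lip_ballD: "a \<in> lip_ball X L \<Longrightarrow> a \<in> sa X" "a \<in> lip_ball X L \<Longrightarrow> L a \<le> 1"
  by (auto simp: lip_ball_def)

lemma lip_rho_bound:
  assumes "\<sigma> \<in> states X" "\<omega> \<in> states X" "a \<in> lip_ball X L"
  shows "cmod (\<sigma> a - \<omega> a) \<le> enn2real (lip_rho X L \<sigma> \<omega>)"
proof -
  have "ennreal (cmod (\<sigma> a - \<omega> a)) \<le> lip_rho X L \<sigma> \<omega>"
    unfolding lip_rho_def by (rule SUP_upper[OF assms(3)])
  moreover have "lip_rho X L \<sigma> \<omega> < top" using lip_norm assms by (simp add: lip_norm_def)
  ultimately have "enn2real (ennreal (cmod (\<sigma> a - \<omega> a))) \<le> enn2real (lip_rho X L \<sigma> \<omega>)" by (rule enn2real_mono)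
  then show ?thesis by simp
qed

text \<open>The metric induces the compact weak* topology, so the states have a finite net K.
  Elements of the Lip-ball are 1-Lipschitz functions on the states, hence determined up to small
  errors by their values on K, and relative to a base state these values are bounded.\<close>

lemma lip_net:
  assumes \<epsilon>: "0 < \<epsilon>"
  shows "\<exists>F. finite F \<and> F \<subseteq> lip_ball X L \<and>
    (\<forall>a\<in>lip_ball X L. \<exists>b\<in>F. \<exists>s::real. opsys_norm X (a - (b + scl X (complex_of_real s) (ounit X))) \<le> \<epsilon>)"
proof -
  have "compactin S.mtopology (states X)"
    using compact_weak_star S.topspace_mtopology unfolding S_topology compact_space_def by simp
  then have "S.mtotally_bounded (states X)" by (rule S.compactin_imp_mtotally_bounded)
  then have "\<exists>K. finite K \<and> K \<subseteq> states X \<and> states X \<subseteq> (\<Union>x\<in>K. S.mball x (\<epsilon> / 3))"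
    using \<epsilon> unfolding S.mtotally_bounded_def by simp
  then obtain K where K: "finite K" "K \<subseteq> states X" "states X \<subseteq> (\<Union>x\<in>K. S.mball x (\<epsilon> / 3))" by blast
  \<comment> \<open>Subtracting the value at a base state removes scalars, on which the Lip-norm
    gives no control.\<close>
  obtain \<sigma>0 where \<sigma>0: "\<sigma>0 \<in> states X" using states_nonempty by blast
  let ?d = "\<lambda>\<sigma> \<omega>. enn2real (lip_rho X L \<sigma> \<omega>)"
  have bd: "cmod (\<sigma> a - \<sigma>0 a) \<le> (\<Sum>\<sigma>\<in>K. ?d \<sigma> \<sigma>0)" if a: "a \<in> lip_ball X L" and \<sigma>: "\<sigma> \<in> K" for a \<sigma>
  proof -
    have "cmod (\<sigma> a - \<sigma>0 a) \<le> ?d \<sigma> \<sigma>0" using \<sigma> K(2) by (intro lip_rho_bound \<sigma>0 a) auto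
    also have "\<dots> \<le> (\<Sum>\<sigma>\<in>K. ?d \<sigma> \<sigma>0)" using \<sigma> K(1) by (intro member_le_sum) auto
    finally show ?thesis .
  qed
  have \<epsilon>3: "0 < \<epsilon> / 3" using \<epsilon> by simp
  have "\<exists>F. finite F \<and> F \<subseteq> lip_ball X L \<and>
    (\<forall>a\<in>lip_ball X L. \<exists>b\<in>F. \<forall>\<sigma>\<in>K. cmod ((\<sigma> a - \<sigma>0 a) - (\<sigma> b - \<sigma>0 b)) \<le> \<epsilon> / 3)"
    by (rule finite_net[where I = K and T = "lip_ball X L" and c = "\<lambda>a \<sigma>. \<sigma> a - \<sigma>0 a"
          and M = "\<Sum>\<sigma>\<in>K. ?d \<sigma> \<sigma>0", OF K(1) _ \<epsilon>3]) (rule bd)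
  then obtain F where F: "finite F" "F \<subseteq> lip_ball X L"
    "\<forall>a\<in>lip_ball X L. \<exists>b\<in>F. \<forall>\<sigma>\<in>K. cmod ((\<sigma> a - \<sigma>0 a) - (\<sigma> b - \<sigma>0 b)) \<le> \<epsilon> / 3"
    by (elim exE conjE)
  show ?thesis
  proof (intro exI[of _ F] conjI F(1,2) ballI)
    fix a assume a: "a \<in> lip_ball X L"
    then obtain b where b: "b \<in> F" "\<forall>\<sigma>\<in>K. cmod ((\<sigma> a - \<sigma>0 a) - (\<sigma> b - \<sigma>0 b)) \<le> \<epsilon> / 3" using F(3) by blast
    have b': "b \<in> lip_ball X L" using b(1) F(2) by blast
    note sa = lip_ballD(1)[OF a] lip_ballD(1)[OF b']
    note c = saD(1)[OF sa(1)] saD(1)[OF sa(2)]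
    define s where "s = Re (\<sigma>0 a - \<sigma>0 b)"
    have s: "\<sigma>0 a - \<sigma>0 b = complex_of_real s"
      using state_sa(1)[OF \<sigma>0 sa(1)] state_sa(1)[OF \<sigma>0 sa(2)] by (simp add: s_def complex_eq_iff)
    have "opsys_norm X (a - (b + scl X (complex_of_real s) (ounit X))) \<le> \<epsilon>"
    proof (rule sa_norm_le_states)
      show "a - (b + scl X (complex_of_real s) (ounit X)) \<in> sa X" using sa by (intro sa_intros)
      show "0 \<le> \<epsilon>" using \<epsilon> by simp
      fix \<tau> assume \<tau>: "\<tau> \<in> states X"
      obtain \<sigma> where \<sigma>: "\<sigma> \<in> K" "\<tau> \<in> S.mball \<sigma> (\<epsilon> / 3)" using \<tau> K(3) by blast
      then have \<sigma>s: "\<sigma> \<in> states X" and d: "?d \<sigma> \<tau> < \<epsilon> / 3" by (auto simp: S.in_mball)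
      have 1: "cmod (\<sigma> a - \<tau> a) \<le> \<epsilon> / 3" "cmod (\<sigma> b - \<tau> b) \<le> \<epsilon> / 3"
        using lip_rho_bound[OF \<sigma>s \<tau> a] lip_rho_bound[OF \<sigma>s \<tau> b'] d by linarith+
      have "\<tau> (a - (b + scl X (complex_of_real s) (ounit X))) = \<tau> a - (\<tau> b + complex_of_real s)"
        using state_diff[OF \<tau> c(1) carr_add[OF c(2) carr_scl[OF ounit_closed]]]
          statesD(3)[OF \<tau> c(2) carr_scl[OF ounit_closed]] statesD(4)[OF \<tau> ounit_closed] statesD(2)[OF \<tau>] by simp
      \<comment> \<open>One third of \<epsilon> for the values at the net state \<sigma>, and one
        third for each of the moves between \<sigma> and \<tau> at a and at b.\<close>
      also have "\<dots> = ((\<sigma> a - \<sigma>0 a) - (\<sigma> b - \<sigma>0 b)) - (\<sigma> a - \<tau> a) + (\<sigma> b - \<tau> b)"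
        unfolding s[symmetric] by simp
      also have "cmod \<dots> \<le> cmod ((\<sigma> a - \<sigma>0 a) - (\<sigma> b - \<sigma>0 b)) + cmod (\<sigma> a - \<tau> a) + cmod (\<sigma> b - \<tau> b)"
        by (meson add_mono norm_triangle_ineq norm_triangle_ineq4 order_trans order_refl)
      also have "\<dots> \<le> \<epsilon>" using 1 b(2) \<sigma>(1) by force
      finally show "cmod (\<tau> (a - (b + scl X (complex_of_real s) (ounit X)))) \<le> \<epsilon>" .
    qed
    then show "\<exists>b\<in>F. \<exists>s::real. opsys_norm X (a - (b + scl X (complex_of_real s) (ounit X))) \<le> \<epsilon>"
      using b(1) by blast
  qed
qed

text \<open>A net of mesh 1 is finite, so the sum of the norms of its points bounds each of
  them.\<close>

lemma lip_radius:
  "\<exists>R>0. \<forall>a\<in>lip_ball X L. \<exists>s::real. opsys_norm X (a - scl X (complex_of_real s) (ounit X)) \<le> R"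
proof -
  obtain F where F: "finite F" "F \<subseteq> lip_ball X L"
    "\<forall>a\<in>lip_ball X L. \<exists>b\<in>F. \<exists>s::real. opsys_norm X (a - (b + scl X (complex_of_real s) (ounit X))) \<le> 1"
    using lip_net[of 1] by auto
  have Fc: "b \<in> carr X" if "b \<in> F" for b using that F(2) by (intro saD(1) lip_ballD(1)) blast
  have nn: "0 \<le> opsys_norm X b" if "b \<in> F" for b using Fc[OF that] by (rule opsys_norm_nonneg)
  show ?thesis
  proof (rule exI[of _ "1 + (\<Sum>b\<in>F. opsys_norm X b)"], intro conjI ballI)
    show "0 < 1 + (\<Sum>b\<in>F. opsys_norm X b)" using nn by (intro add_pos_nonneg sum_nonneg) auto
    fix a assume a: "a \<in> lip_ball X L"
    then obtain b s where b: "b \<in> F" "opsys_norm X (a - (b + scl X (complex_of_real s) (ounit X))) \<le> 1" using F(3) by blast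
    have ac: "a \<in> carr X" by (rule saD(1)[OF lip_ballD(1)[OF a]])
    have sc: "scl X (complex_of_real s) (ounit X) \<in> carr X" by (intro carr_intros)
    have "a - scl X (complex_of_real s) (ounit X) = (a - (b + scl X (complex_of_real s) (ounit X))) + b" by simp
    then have "opsys_norm X (a - scl X (complex_of_real s) (ounit X)) \<le>
        opsys_norm X (a - (b + scl X (complex_of_real s) (ounit X))) + opsys_norm X b"
      using opsys_norm_triangle[OF carr_diff[OF ac carr_add[OF Fc[OF b(1)] sc]] Fc[OF b(1)]] by simp
    also have "\<dots> \<le> 1 + (\<Sum>b\<in>F. opsys_norm X b)"
      using b F(1) nn by (intro add_mono member_le_sum) auto
    finally show "\<exists>s::real. opsys_norm X (a - scl X (complex_of_real s) (ounit X)) \<le> 1 + (\<Sum>b\<in>F. opsys_norm X b)" by blast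
  qed
qed

lemma lip_ball_eq_states:
  assumes \<sigma>: "\<sigma> \<in> states X" and \<omega>: "\<omega> \<in> states X" and e: "\<And>a. a \<in> lip_ball X L \<Longrightarrow> \<sigma> a = \<omega> a"
  shows "\<sigma> = \<omega>"
proof -
  have "lip_rho X L \<sigma> \<omega> \<le> 0" unfolding lip_rho_def using e by (intro SUP_least) simp
  then have "enn2real (lip_rho X L \<sigma> \<omega>) = 0" by simp
  then show ?thesis using S.zero[OF \<sigma> \<omega>] by simp
qed

text \<open>If \<open>a\<close> were not in the closure of the domain \<open>D\<close> of \<open>L\<close>, two different states would agree
  on \<open>D\<close>. The pair of states is a single functional on \<open>X \<times> X\<close> that vanishes on the pairs
  \<open>(d, - d)\<close>.\<close>

lemma lip_domain_dense:
  assumes a: "a \<in> sa X" and \<epsilon>: "0 < \<epsilon>"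
  shows "\<exists>b\<in>sa X. L b < top \<and> opsys_norm X (a - b) \<le> \<epsilon>"
proof (rule ccontr)
  assume neg: "\<not> ?thesis"
  define D where "D = {b \<in> sa X. L b < top}"
  let ?u = "\<lambda>t::real. scl X (complex_of_real t) (ounit X)"
  let ?P = "\<lambda>x. elt 0 0 x \<in> rpos X 1"
  have uc: "?u t \<in> carr X" for t by (intro carr_intros)
  have usa: "?u t \<in> sa X" for t by (intro sa_intros)
  have Dsa: "d \<in> sa X" if "d \<in> D" for d using that by (simp add: D_def)
  have Dc: "d \<in> carr X" if "d \<in> D" for d by (rule saD(1)[OF Dsa[OF that]])
  have Dadd: "d + e \<in> D" if "d \<in> D" "e \<in> D" for d e
  proof -
    have de: "d \<in> sa X" "e \<in> sa X" "L d \<noteq> top" "L e \<noteq> top" using that by (auto simp: D_def)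
    then have "L d + L e < top" by (simp add: less_top[symmetric])
    with L_add[OF de(1,2)] have "L (d + e) < top" by (rule order.strict_trans1)
    then show ?thesis using sa_add[OF de(1,2)] by (simp add: D_def)
  qed
  have Dscl: "scl X (complex_of_real r) d \<in> D" if "d \<in> D" for r d
  proof -
    have d: "d \<in> sa X" "L d < top" using that by (simp_all add: D_def)
    have "ennreal \<bar>r\<bar> * L d < top" using d(2) by (simp add: ennreal_mult_less_top)
    then show ?thesis using sa_scl[OF d(1), of r] L_scl[OF d(1), of r] by (simp add: D_def)
  qed
  have Du: "?u t \<in> D" for t by (simp add: D_def usa L_unit)
  have D0: "0 \<in> D" using Du[of 0] by simp
  have Dneg: "- d \<in> D" if "d \<in> D" for d using Dscl[OF that, of "- 1"] by simp
  have far: "\<epsilon> < opsys_norm X (a - d)" if "d \<in> D" for d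
  proof -
    have "\<not> opsys_norm X (a - d) \<le> \<epsilon>" using neg that unfolding D_def by blast
    then show ?thesis by simp
  qed
  have Padd: "?P (x + y)" if "?P x" "?P y" for x y using rpos_add[OF that] by (simp add: elt_simps)
  have Pscl: "?P (scl X (complex_of_real r) x)" if "?P x" "0 \<le> r" for x r
    using rpos_mscl[OF that] by (simp add: elt_scl)
  have P0: "?P 0" using pos_rpos[OF pos_0, of 1] by (simp add: elt_simps)
  have Pu: "0 \<le> t" if "?P (?u t)" for t using rpos_munit_iff[of 1 t] that unfolding munit_1 elt_scl by simp
  have Pou: "\<exists>t. ?P (?u t - x)" if x: "x \<in> carr X" for x
  proof -
    obtain t where "mscl X (complex_of_real t) (munit X 1) - elt 0 0 x \<in> rpos X 1"
      using rpos_order_unit[of "elt 0 0 x" 1] mats_elt[of 0 1 0 x] x by auto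
    moreover have "mscl X (complex_of_real t) (munit X 1) - elt 0 0 x = elt 0 0 (?u t - x)"
      by (auto simp: mscl_def munit_def elt_def fun_eq_iff)
    ultimately show ?thesis by auto
  qed
  define sc where "sc r p = (scl X (complex_of_real r) (fst p), scl X (complex_of_real r) (snd p))" for r and p :: "'a \<times> 'a"
  let ?W = "carr X \<times> carr X"
  interpret R: vector_space sc
    by unfold_locales (auto simp: sc_def scale_right_distrib scale_left_distrib)
  have W: "R.subspace ?W"
    by (rule R.subspaceI) (auto simp: sc_def zero_prod_def carr_intros)
  \<comment> \<open>The infimum of the admissible t is invariant under adding pairs (d, - d), so a
    linear functional below it vanishes on them; t1 and t2 are order unit bounds for the two
    coordinates.\<close>
  define G where "G p t \<longleftrightarrow> (\<exists>d\<in>D. \<exists>t1 t2. t = t1 + t2 \<and> ?P (?u t1 - (fst p + d)) \<and> ?P (?u t2 - (snd p - d)))" for p t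
  have usplit: "?u (s + t) = ?u s + ?u t" for s t by (simp add: scale_left_distrib)
  have Gdom: "\<exists>t. G p t" if pW: "p \<in> ?W" for p
  proof -
    obtain t1 t2 where "?P (?u t1 - fst p)" "?P (?u t2 - snd p)" using Pou[of "fst p"] Pou[of "snd p"] pW by (auto simp: mem_Times_iff)
    then show ?thesis unfolding G_def using D0 by (intro exI[of _ "t1 + t2"] bexI[of _ 0] exI[of _ t1] exI[of _ t2]) auto
  qed
  have Gadd: "G (p + q) (s + t)" if Gpq: "G p s" "G q t" for p q s t
  proof -
    obtain d s1 s2 where d: "d \<in> D" "s = s1 + s2" "?P (?u s1 - (fst p + d))" "?P (?u s2 - (snd p - d))"
      using Gpq(1) unfolding G_def by blast
    obtain e t1 t2 where e: "e \<in> D" "t = t1 + t2" "?P (?u t1 - (fst q + e))" "?P (?u t2 - (snd q - e))"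
      using Gpq(2) unfolding G_def by blast
    have "?P (?u (s1 + t1) - (fst (p + q) + (d + e)))"
      using Padd[OF d(3) e(3)] unfolding usplit by (simp add: algebra_simps)
    moreover have "?P (?u (s2 + t2) - (snd (p + q) - (d + e)))"
      using Padd[OF d(4) e(4)] unfolding usplit by (simp add: algebra_simps)
    ultimately show ?thesis unfolding G_def using Dadd[OF d(1) e(1)] d(2) e(2)
      by (intro bexI[of _ "d + e"] exI[of _ "s1 + t1"] exI[of _ "s2 + t2"]) auto
  qed
  have Gscl: "G (sc c p) (c * t)" if cG: "0 < c" "G p t" for p c t
  proof -
    obtain d s1 s2 where d: "d \<in> D" "t = s1 + s2" "?P (?u s1 - (fst p + d))" "?P (?u s2 - (snd p - d))"
      using cG(2) unfolding G_def by blast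
    have us: "?u (c * s) = scl X (complex_of_real c) (?u s)" for s by simp
    have "?P (?u (c * s1) - (fst (sc c p) + scl X (complex_of_real c) d))"
      using Pscl[OF d(3), of c] cG(1) unfolding us sc_def by (simp only: fst_conv scale_right_distrib scale_right_diff_distrib)
    moreover have "?P (?u (c * s2) - (snd (sc c p) - scl X (complex_of_real c) d))"
      using Pscl[OF d(4), of c] cG(1) unfolding us sc_def by (simp only: snd_conv scale_right_distrib scale_right_diff_distrib)
    ultimately show ?thesis unfolding G_def using Dscl[OF d(1), of c] d(2)
      by (intro bexI[of _ "scl X (complex_of_real c) d"] exI[of _ "c * s1"] exI[of _ "c * s2"]) (auto simp: distrib_left)
  qed
  have G0: "0 \<le> t" if Gt: "G 0 t" for t
  proof -
    obtain d s1 s2 where d: "d \<in> D" "t = s1 + s2" "?P (?u s1 - (fst (0 :: 'a \<times> 'a) + d))" "?P (?u s2 - (snd (0 :: 'a \<times> 'a) - d))"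
      using Gt unfolding G_def by blast
    have "?u s1 - (fst (0 :: 'a \<times> 'a) + d) + (?u s2 - (snd (0 :: 'a \<times> 'a) - d)) = ?u t" unfolding d(2) usplit by simp
    then show ?thesis using Padd[OF d(3,4)] Pu by simp
  qed
  have aW: "(a, - a) \<in> ?W" using saD(1)[OF a] by (auto intro: carr_neg)
  have "\<exists>S. (\<forall>x\<in>?W. \<forall>y\<in>?W. S (x + y) = S x + S y) \<and> (\<forall>c. \<forall>x\<in>?W. S (sc c x) = c * S x) \<and>
    (\<forall>x\<in>?W. \<forall>t. G x t \<longrightarrow> S x \<le> t) \<and> (\<forall>t. (\<forall>s. G (a, - a) s \<longrightarrow> t \<le> s) \<longrightarrow> t \<le> S (a, - a))"
    proof (rule hahn_banach_cone[OF R.vector_space_axioms W])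
    show "\<exists>t. G p t" if "p \<in> ?W" for p by (rule Gdom[OF that])
    show "G (p + q) (s + t)" if "G p s" "G q t" for p q s t by (rule Gadd[OF that])
    show "G (sc c p) (c * t)" if "0 < c" "G p t" for p c t by (rule Gscl[OF that])
    show "0 \<le> t" if "G 0 t" for t by (rule G0[OF that])
    show "(a, - a) \<in> ?W" by (rule aW)
  qed
  then obtain S where S: "\<forall>x\<in>?W. \<forall>y\<in>?W. S (x + y) = S x + (S y :: real)" "\<forall>c. \<forall>x\<in>?W. S (sc c x) = c * S x"
    "\<forall>x\<in>?W. \<forall>t. G x t \<longrightarrow> S x \<le> t" "\<forall>t. (\<forall>s. G (a, - a) s \<longrightarrow> t \<le> s) \<longrightarrow> t \<le> S (a, - a)"
    by (elim exE conjE)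
  have "2 * \<epsilon> \<le> S (a, - a)"
  proof (rule S(4)[rule_format])
    fix s assume "G (a, - a) s"
    then obtain d s1 s2 where d: "d \<in> D" "s = s1 + s2" "?P (?u s1 - (a + d))" "?P (?u s2 - (- a - d))"
      unfolding G_def by auto
    \<comment> \<open>The two order inequalities confine a + d between the scalars - s2 and s1. With
      ?c the midpoint and ?h half the width, a is within ?h of the element ?c 1 - d of D, and the
      assumed distance from D gives \<epsilon> < ?h = s / 2.\<close>
    let ?c = "(s1 - s2) / 2" and ?h = "(s1 + s2) / 2"
    have s: "0 \<le> s" using Pu[of s] Padd[OF d(3,4)] unfolding d(2) usplit by simp
    have sa: "a - (?u ?c - d) \<in> sa X" "?u s1 - (a + d) \<in> sa X" "?u s2 - (- a - d) \<in> sa X"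
      by (intro sa_diff sa_add sa_neg usa a Dsa[OF d(1)])+
    have u: "?u ?h + ?u ?c = ?u s1" "?u ?h - ?u ?c = ?u s2"
      unfolding scale_left_distrib[symmetric] scale_left_diff_distrib[symmetric]
        of_real_add[symmetric] of_real_diff[symmetric] by (simp_all add: field_simps)
    have e1: "?u ?h + (a - (?u ?c - d)) = ?u s2 - (- a - d)" unfolding u(2)[symmetric] by (simp add: algebra_simps)
    have e2: "?u ?h - (a - (?u ?c - d)) = ?u s1 - (a + d)" unfolding u(1)[symmetric] by (simp add: algebra_simps)
    have "opsys_norm X (a - (?u ?c - d)) \<le> ?h"
      unfolding sa_norm_le_iff[OF sa(1), of ?h, OF s[unfolded d(2), THEN divide_nonneg_pos, OF zero_less_numeral]] e1 e2
      using d(3,4) rpos_hmats[OF elt_hmats[OF sa(2)]] rpos_hmats[OF elt_hmats[OF sa(3)]] by simp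
    moreover have "?u ?c - d \<in> D" using Dadd[OF Du Dneg[OF d(1)], of ?c] by simp
    ultimately show "2 * \<epsilon> \<le> s" using far[of "?u ?c - d"] d(2) by simp
  qed
  then have Sa: "0 < S (a, - a)" using \<epsilon> by simp
  have SD: "S (d, - d) = 0" if "d \<in> D" for d
  proof -
    have 1: "S (d, - d) \<le> 0" if d: "d \<in> D" for d
    proof -
      have "G (d, - d) 0" unfolding G_def using P0 Dneg[OF d]
        by (intro bexI[of _ "- d"] exI[of _ 0]) auto
      then show ?thesis using S(3) Dc[OF d] carr_neg by blast
    qed
    have "S (sc (- 1) (d, - d)) = - 1 * S (d, - d)" using S(2) Dc[OF that] carr_neg by blast
    then show ?thesis using 1[OF that] 1[OF Dneg[OF that]] by (simp add: sc_def)
  qed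
  \<comment> \<open>A positive normalized real functional becomes a state by being read as a
    functional of 1 x 1 matrices, to which \<open>complexify\<close> applies.\<close>
  have st: "restrict (\<lambda>x. complex_of_real (s x) - \<i> * complex_of_real (s (scl X \<i> x))) (carr X) \<in> states X"
    "x \<in> sa X \<Longrightarrow> complex_of_real (s x) - \<i> * complex_of_real (s (scl X \<i> x)) = complex_of_real (s x)"
    if s: "\<And>x y. x \<in> carr X \<Longrightarrow> y \<in> carr X \<Longrightarrow> s (x + y) = s x + (s y :: real)"
      "\<And>r x. x \<in> carr X \<Longrightarrow> s (scl X (complex_of_real r) x) = r * s x"
      "\<And>x. x \<in> carr X \<Longrightarrow> ?P x \<Longrightarrow> 0 \<le> s x" "s (ounit X) = 1" for s x
  proof -
    define R where "R z = s (z 0 0)" for z :: "nat \<Rightarrow> nat \<Rightarrow> 'a"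
    define T where "T = (\<lambda>z. complex_of_real (R z) - \<i> * complex_of_real (R (mscl X \<i> z)))"
    have e: "z = elt 0 0 (z 0 0)" if "z \<in> mats 1 (carr X)" for z using that by (auto simp: mats_def elt_def fun_eq_iff)
    have p: "0 \<le> R z" if z: "z \<in> rpos X 1" for z
    proof -
      have "?P (z 0 0)" using z e[OF rpos_mats[OF z]] by simp
      then show ?thesis unfolding R_def by (rule s(3)[OF mats_entry[OF rpos_mats[OF z]]])
    qed
    have ad: "R (y + z) = R y + R z" if "y \<in> mats 1 (carr X)" "z \<in> mats 1 (carr X)" for y z
      using s(1)[OF mats_entry[OF that(1), of 0 0] mats_entry[OF that(2), of 0 0]] by (simp add: R_def)
    have sm: "R (mscl X (complex_of_real r) z) = r * R z" if "z \<in> mats 1 (carr X)" for r z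
      using s(2)[OF mats_entry[OF that, of 0 0], of r] by (simp add: mscl_def R_def)
    have T1: "T (x + y) = T x + T y" if "x \<in> mats 1 (carr X)" "y \<in> mats 1 (carr X)" for x y
      unfolding T_def by (rule complexify(1)[of 1 R]) (fact ad sm p that)+
    have T2: "T (mscl X c x) = c * T x" if "x \<in> mats 1 (carr X)" for x c
      unfolding T_def by (rule complexify(2)[of 1 R]) (fact ad sm p that)+
    have T3: "T x = complex_of_real (R x)" if "x \<in> hmats X 1" for x
      unfolding T_def by (rule complexify(3)[of 1 R]) (fact ad sm p that)+
    have T4: "T x \<in> \<real>\<^sub>\<ge>\<^sub>0" if "x \<in> pos X 1" for x
      unfolding T_def by (rule complexify(4)[of 1 R]) (fact ad sm p that)+
    have Te: "T (elt 0 0 x) = complex_of_real (s x) - \<i> * complex_of_real (s (scl X \<i> x))" for x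
      by (simp add: T_def R_def elt_def mscl_def)
    have em: "elt 0 0 x \<in> mats 1 (carr X)" if "x \<in> carr X" for x using that by (intro mats_elt) auto
    show sa: "complex_of_real (s x) - \<i> * complex_of_real (s (scl X \<i> x)) = complex_of_real (s x)" if "x \<in> sa X" for x
      using T3[OF elt_hmats[OF that]] unfolding Te by (simp add: elt_def R_def)
    let ?f = "\<lambda>x. T (elt 0 0 x)"
    have "restrict ?f (carr X) \<in> states X"
      unfolding states_def mem_Collect_eq linear_into_def
    proof (intro conjI ballI allI)
      show "restrict ?f (carr X) (x + y) = restrict ?f (carr X) x + restrict ?f (carr X) y" if "x \<in> carr X" "y \<in> carr X" for x y
        using that T1[OF em[OF that(1)] em[OF that(2)]] by (simp add: carr_add elt_simps)
      show "restrict ?f (carr X) (scl X c x) = c * restrict ?f (carr X) x" if "x \<in> carr X" for c x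
        using that T2[OF em[OF that], of c] by (simp add: carr_scl elt_scl)
      show "restrict ?f (carr X) (ounit X) = 1" using sa[OF sa_ounit] s(4) unfolding Te by (simp add: ounit_closed)
      show "restrict ?f (carr X) (z 0 0) \<in> \<real>\<^sub>\<ge>\<^sub>0" if z: "z \<in> pos X 1" for z
      proof -
        have "T (elt 0 0 (z 0 0)) \<in> \<real>\<^sub>\<ge>\<^sub>0" using T4[OF z] e[OF pos_mats[OF z]] by simp
        then show ?thesis using mats_entry[OF pos_mats[OF z], of 0 0] by simp
      qed
    qed auto
    then show "restrict (\<lambda>x. complex_of_real (s x) - \<i> * complex_of_real (s (scl X \<i> x))) (carr X) \<in> states X"
      unfolding Te .
  qed
  have z0: "(0::'a) \<in> carr X" by (rule carr_0)
  have S0: "S (0, 0) = 0" using S(2)[rule_format, of "(0, 0)" 0] z0 by (simp add: sc_def)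
  have Sadd: "S (x + x', y + y') = S (x, y) + S (x', y')" if "x \<in> carr X" "y \<in> carr X" "x' \<in> carr X" "y' \<in> carr X" for x y x' y'
    using S(1)[rule_format, of "(x, y)" "(x', y')"] that by simp
  have Sscl: "S (scl X (complex_of_real r) x, scl X (complex_of_real r) y) = r * S (x, y)" if "x \<in> carr X" "y \<in> carr X" for r x y
    using S(2)[rule_format, of "(x, y)" r] that by (simp add: sc_def)
  have Sle: "S (x, y) \<le> t1 + t2" if "x \<in> carr X" "y \<in> carr X" "?P (?u t1 - x)" "?P (?u t2 - y)" for x y t1 t2
  proof -
    have "G (x, y) (t1 + t2)" unfolding G_def
      by (rule bexI[OF _ D0], rule exI[of _ t1], rule exI[of _ t2]) (use that in simp)
    moreover have "(x, y) \<in> ?W" using that by simp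
    ultimately show ?thesis using S(3) by blast
  qed
  have un: "?u (- 1) - - ounit X = 0" "?u 0 - 0 = 0" "?u 1 - ounit X = 0" by simp_all
  have oc: "ounit X \<in> carr X" "- ounit X \<in> carr X" by (intro carr_intros)+
  have Sneg: "S (- x, - y) = - S (x, y)" if "x \<in> carr X" "y \<in> carr X" for x y
    using Sscl[OF that, of "- 1"] by simp
  \<comment> \<open>S is at most 1 at the unit and at most - 1 at its negative, separately in each
    coordinate; so each coordinate functional is normalized.\<close>
  have st1: "S (ounit X, 0) = 1"
    using Sle[OF oc(1) z0, of 1 0] Sle[OF oc(2) z0, of "- 1" 0] Sneg[OF oc(1) z0] P0 unfolding un by simp
  have st2: "S (0, ounit X) = 1"
    using Sle[OF z0 oc(1), of 0 1] Sle[OF z0 oc(2), of 0 "- 1"] Sneg[OF z0 oc(1)] P0 unfolding un by simp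
  let ?s1 = "\<lambda>x. S (x, 0)" and ?s2 = "\<lambda>x. S (0, x)"
  have lin1: "?s1 (x + y) = ?s1 x + ?s1 y" if "x \<in> carr X" "y \<in> carr X" for x y using Sadd[OF that(1) z0 that(2) z0] by simp
  have lin2: "?s2 (x + y) = ?s2 x + ?s2 y" if "x \<in> carr X" "y \<in> carr X" for x y using Sadd[OF z0 that(1) z0 that(2)] by simp
  have scl1: "?s1 (scl X (complex_of_real r) x) = r * ?s1 x" if "x \<in> carr X" for r x using Sscl[OF that z0, of r] by simp
  have scl2: "?s2 (scl X (complex_of_real r) x) = r * ?s2 x" if "x \<in> carr X" for r x using Sscl[OF z0 that, of r] by simp
  have pos1: "0 \<le> ?s1 x" if "x \<in> carr X" "?P x" for x
    using Sle[OF carr_neg[OF that(1)] z0, of 0 0] Sneg[OF that(1) z0] that(2) P0 by simp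
  have pos2: "0 \<le> ?s2 x" if "x \<in> carr X" "?P x" for x
    using Sle[OF z0 carr_neg[OF that(1)], of 0 0] Sneg[OF z0 that(1)] that(2) P0 by simp
  define \<sigma> where "\<sigma> = restrict (\<lambda>x. complex_of_real (?s1 x) - \<i> * complex_of_real (?s1 (scl X \<i> x))) (carr X)"
  define \<omega> where "\<omega> = restrict (\<lambda>x. complex_of_real (?s2 x) - \<i> * complex_of_real (?s2 (scl X \<i> x))) (carr X)"
  have \<sigma>: "\<sigma> \<in> states X" unfolding \<sigma>_def by (rule st(1)[of ?s1]) (fact lin1 scl1 pos1 st1)+
  have \<omega>: "\<omega> \<in> states X" unfolding \<omega>_def by (rule st(1)[of ?s2]) (fact lin2 scl2 pos2 st2)+
  have \<sigma>v: "\<sigma> x = complex_of_real (?s1 x)" if x: "x \<in> sa X" for x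
  proof -
    have "complex_of_real (?s1 x) - \<i> * complex_of_real (?s1 (scl X \<i> x)) = complex_of_real (?s1 x)"
      by (rule st(2)[of ?s1]) (fact lin1 scl1 pos1 st1 x)+
    then show ?thesis using saD(1)[OF x] by (simp add: \<sigma>_def)
  qed
  have \<omega>v: "\<omega> x = complex_of_real (?s2 x)" if x: "x \<in> sa X" for x
  proof -
    have "complex_of_real (?s2 x) - \<i> * complex_of_real (?s2 (scl X \<i> x)) = complex_of_real (?s2 x)"
      by (rule st(2)[of ?s2]) (fact lin2 scl2 pos2 st2 x)+
    then show ?thesis using saD(1)[OF x] by (simp add: \<omega>_def)
  qed
  have diff: "S (x, - x) = ?s1 x - ?s2 x" if x: "x \<in> carr X" for x
    using Sadd[OF x z0 z0 carr_neg[OF x]] Sneg[OF z0 x] by simp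
  have "\<sigma> = \<omega>"
  proof (rule lip_ball_eq_states[OF \<sigma> \<omega>])
    fix b assume b: "b \<in> lip_ball X L"
    have bsa: "b \<in> sa X" "L b < top" using lip_ballD[OF b] by (auto intro: order.strict_trans1)
    then have "b \<in> D" by (simp add: D_def)
    then show "\<sigma> b = \<omega> b" using SD[of b] diff[OF saD(1)[OF bsa(1)]] \<sigma>v[OF bsa(1)] \<omega>v[OF bsa(1)] by simp
  qed
  then show False using Sa diff[OF saD(1)[OF a]] \<sigma>v[OF a] \<omega>v[OF a] by simp
qed

end

section \<open>Exactness of limits of matricial systems\<close>

lemma mnorm_subsys:
  assumes V: "operator_system V" "operator_subsystem (subsys V S) V" and x: "x \<in> mats n S"
  shows "mnorm (subsys V S) n x = mnorm V n x"
proof -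
  interpret Y: operator_system "subsys V S" by (rule operator_system_subsystem[OF V])
  have S: "carr (subsys V S) = S" "adj (subsys V S) = adj V" "ounit (subsys V S) = ounit V" "scl (subsys V S) = scl V"
    by (simp_all add: subsys_def)
  have "norm_block (subsys V S) n r x = norm_block V n r x" for r
    by (simp add: norm_block_def S fun_eq_iff)
  moreover have "norm_block (subsys V S) n r x \<in> mats (2 * n) S" for r
    using norm_block_mats[OF Y.operator_system_axioms, of x n r] x by (simp add: S)
  ultimately show ?thesis unfolding mnorm_def by (simp add: subsys_def)
qed

text \<open>The real and imaginary parts are approximated in the domain of the Lip-norm and then
  scaled into the Lip-ball, the only place where a bound on the distance gives information.\<close>

lemma (in lip_normed_system) lip_approx:
  assumes b: "b \<in> carr X" and \<eta>: "0 < \<eta>"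
  shows "\<exists>t s a a'. 0 < t \<and> 0 < s \<and> a \<in> lip_ball X L \<and> a' \<in> lip_ball X L \<and>
    opsys_norm X (b - (scl X (complex_of_real t) a + scl X (\<i> * complex_of_real s) a')) \<le> \<eta>"
proof -
  have ball: "\<exists>t a. 0 < t \<and> a \<in> lip_ball X L \<and> opsys_norm X (u - scl X (complex_of_real t) a) \<le> \<eta> / 2"
    if u: "u \<in> sa X" for u
  proof -
    have "0 < \<eta> / 2" using \<eta> by simp
    then obtain p where p: "p \<in> sa X" "L p < top" "opsys_norm X (u - p) \<le> \<eta> / 2"
      using lip_domain_dense[OF u] by blast
    \<comment> \<open>The summand 1 keeps the scaling positive when \<open>L p\<close> is 0.\<close>
    define t where "t = 1 + enn2real (L p)"
    have t: "0 < t" by (simp add: t_def add_pos_nonneg)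
    have Lp: "L p = ennreal (enn2real (L p))" using p(2) by simp
    have "L (scl X (complex_of_real (1 / t)) p) = ennreal \<bar>1 / t\<bar> * L p" by (rule L_scl[OF p(1)])
    also have "\<dots> = ennreal (1 / t * enn2real (L p))"
      using t by (subst Lp) (simp add: ennreal_mult'[symmetric])
    also have "\<dots> \<le> ennreal 1" using t by (intro ennreal_leI) (simp add: t_def)
    finally have "scl X (complex_of_real (1 / t)) p \<in> lip_ball X L"
      using sa_scl[OF p(1), of "1 / t"] by (simp add: lip_ball_def)
    moreover have "scl X (complex_of_real t) (scl X (complex_of_real (1 / t)) p) = p" using t by simp
    ultimately show ?thesis using t p(3) by metis
  qed
  obtain u v where uv: "u \<in> sa X" "v \<in> sa X" "b = u + scl X \<i> v" using real_imag_parts[OF b] .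
  obtain t a where ta: "0 < t" "a \<in> lip_ball X L" "opsys_norm X (u - scl X (complex_of_real t) a) \<le> \<eta> / 2"
    using ball[OF uv(1)] by blast
  obtain s a' where sa: "0 < s" "a' \<in> lip_ball X L" "opsys_norm X (v - scl X (complex_of_real s) a') \<le> \<eta> / 2"
    using ball[OF uv(2)] by blast
  have c: "u - scl X (complex_of_real t) a \<in> carr X" "v - scl X (complex_of_real s) a' \<in> carr X"
    by (intro carr_diff carr_scl saD(1)[OF uv(1)] saD(1)[OF uv(2)] saD(1)[OF lip_ballD(1)[OF ta(2)]] saD(1)[OF lip_ballD(1)[OF sa(2)]])+
  have "b - (scl X (complex_of_real t) a + scl X (\<i> * complex_of_real s) a') =
    (u - scl X (complex_of_real t) a) + scl X \<i> (v - scl X (complex_of_real s) a')"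
    unfolding uv(3) by (simp add: scale_right_diff_distrib algebra_simps)
  then have "opsys_norm X (b - (scl X (complex_of_real t) a + scl X (\<i> * complex_of_real s) a')) \<le>
    opsys_norm X (u - scl X (complex_of_real t) a) + opsys_norm X (scl X \<i> (v - scl X (complex_of_real s) a'))"
    using opsys_norm_triangle[OF c(1) carr_scl[OF c(2)], of \<i>] by (simp only:)
  also have "\<dots> \<le> \<eta>" using ta(3) sa(3) opsys_norm_scl[OF c(2), of \<i>] by simp
  finally show ?thesis using ta(1,2) sa(1,2) by blast
qed

text \<open>Neither the infimum over the systems V nor the infimum inside the Hausdorff distance
  need be attained; the gap between \<epsilon> and \<delta> pays for both.\<close>

lemma dist_opD:
  fixes X :: "'a::ab_group_add opsys" and Y :: "'b::ab_group_add opsys"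
  assumes "dist_op X L Y M \<le> ennreal \<epsilon>" "0 < \<delta>" "\<epsilon> < \<delta>"
  shows "\<exists>(V :: ('a \<times> 'b) opsys) h k. operator_system V \<and> unital_complete_order_embedding X V h \<and>
    unital_complete_order_embedding Y V k \<and>
    (\<forall>a\<in>lip_ball X L. \<exists>y\<in>lip_ball Y M. opsys_norm V (h a - k y) < \<delta>)"
proof -
  have "ennreal \<epsilon> < ennreal \<delta>" using assms(2,3) by (simp add: ennreal_less_iff ennreal_lessI)
  then have "dist_op X L Y M < ennreal \<delta>" using assms(1) by (rule order.strict_trans1[rotated])
  then obtain V :: "('a \<times> 'b) opsys" and h k where V: "operator_system V"
    "unital_complete_order_embedding X V h" "unital_complete_order_embedding Y V k"
    and d: "hausdorff V (h ` lip_ball X L) (k ` lip_ball Y M) < ennreal \<delta>"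
    unfolding dist_op_def Inf_less_iff by blast
  have "\<exists>y\<in>lip_ball Y M. opsys_norm V (h a - k y) < \<delta>" if a: "a \<in> lip_ball X L" for a
  proof -
    have "(INF b\<in>k ` lip_ball Y M. ennreal (opsys_norm V (h a - b))) \<le>
       (SUP a\<in>h ` lip_ball X L. INF b\<in>k ` lip_ball Y M. ennreal (opsys_norm V (a - b)))"
      using a by (intro SUP_upper imageI)
    also have "\<dots> \<le> hausdorff V (h ` lip_ball X L) (k ` lip_ball Y M)" by (simp add: hausdorff_def)
    finally have "(INF b\<in>k ` lip_ball Y M. ennreal (opsys_norm V (h a - b))) < ennreal \<delta>"
      using d by (rule order.strict_trans1)
    then obtain b where b: "b \<in> k ` lip_ball Y M" "ennreal (opsys_norm V (h a - b)) < ennreal \<delta>"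
      unfolding INF_less_iff by blast
    then obtain y where y: "y \<in> lip_ball Y M" "b = k y" by blast
    have "opsys_norm V (h a - k y) < \<delta>"
    proof (rule ccontr)
      assume "\<not> ?thesis"
      then have "ennreal \<delta> \<le> ennreal (opsys_norm V (h a - k y))" by (intro ennreal_leI) simp
      then show False using b(2) y(2) by simp
    qed
    then show ?thesis using y(1) by blast
  qed
  then show ?thesis using V by blast
qed

section \<open>Perturbation into subsystems of matrix algebras\<close>

text \<open>The map \<alpha> sends each basis vector to its nearby element. The difference of h and
  k \<alpha> is a sum of d rank-one maps, each completely bounded by K \<eta>, so at every level it
  is at most \<Gamma>. Since h and k preserve all matrix norms, \<alpha> distorts them by factors
  between 1 - \<Gamma> and 1 + \<Gamma>.\<close>

lemma near_embedding:
  fixes c :: "'a::ab_group_add \<Rightarrow> nat \<Rightarrow> complex"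
  assumes X: "operator_system X" and V: "operator_system V" and n: "1 \<le> n"
    and h: "unital_complete_order_embedding X V h" and Y: "operator_subsystem Y (matalg n)"
    and k: "unital_complete_order_embedding Y V k"
    and E: "module.subspace (scl X) E" "E \<subseteq> carr X" and K: "0 < K" and \<eta>: "0 < \<eta>"
    and bE: "\<And>i. i < d \<Longrightarrow> b i \<in> E"
    and rep: "\<And>e. e \<in> E \<Longrightarrow> e = (\<Sum>i<d. scl X (c e i) (b i))"
    and cK: "\<And>e i. e \<in> E \<Longrightarrow> i < d \<Longrightarrow> cmod (c e i) \<le> K * opsys_norm X e"
    and cadd: "\<And>e e' i. e \<in> E \<Longrightarrow> e' \<in> E \<Longrightarrow> i < d \<Longrightarrow> c (e + e') i = c e i + c e' i"
    and cscl: "\<And>t e i. e \<in> E \<Longrightarrow> i < d \<Longrightarrow> c (scl X t e) i = t * c e i"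
    and w: "\<And>i. i < d \<Longrightarrow> w i \<in> carr Y" and hw: "\<And>i. i < d \<Longrightarrow> opsys_norm V (h (b i) - k (w i)) \<le> \<eta>"
    and small: "real d * (K * \<eta>) \<le> \<Gamma>" "\<Gamma> < 1"
  shows "\<exists>\<alpha>. linear_into (scl X) E (scl (matalg n)) (carr (matalg n)) \<alpha> \<and> inj_on \<alpha> E \<and>
        cb_norm X E (matalg n) \<alpha> * cb_norm (matalg n) (\<alpha> ` E) X (inv_into E \<alpha>) \<le> ennreal ((1 + \<Gamma>) / (1 - \<Gamma>))"
proof -
  interpret X: operator_system X by fact
  interpret V: operator_system V by fact
  interpret M: operator_system "matalg n" by (rule operator_system_matalg[OF n])
  have Ys: "operator_system Y" by (rule operator_system_subsystem[OF M.operator_system_axioms Y])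
  interpret Y: operator_system Y by (rule Ys)
  obtain S where S: "S \<subseteq> carr (matalg n)" "Y = subsys (matalg n) S" using Y by (auto simp: operator_subsystem_def)
  have Yc: "carr Y = S" "scl Y = scl (matalg n)" by (simp_all add: S(2) subsys_def)
  have E0: "0 \<in> E" by (rule X.subspace_0[OF E(1)])
  have \<Gamma>: "0 \<le> \<Gamma>" using small(1) K \<eta> by (meson mult_nonneg_nonneg less_imp_le of_nat_0_le_iff order_trans)
  define \<alpha> where "\<alpha> e = (\<Sum>i<d. scl Y (c e i) (w i))" for e
  have \<alpha>Y: "\<alpha> e \<in> carr Y" for e unfolding \<alpha>_def by (intro Y.carr_sum Y.carr_scl w) auto
  have \<alpha>add: "\<alpha> (e + e') = \<alpha> e + \<alpha> e'" if "e \<in> E" "e' \<in> E" for e e'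
  proof -
    have "\<alpha> (e + e') = (\<Sum>i<d. scl Y (c e i) (w i) + scl Y (c e' i) (w i))"
      unfolding \<alpha>_def by (rule sum.cong[OF refl]) (simp only: cadd[OF that] lessThan_iff Y.scale_left_distrib)
    then show ?thesis by (simp only: \<alpha>_def sum.distrib)
  qed
  have \<alpha>scl: "\<alpha> (scl X t e) = scl Y t (\<alpha> e)" if "e \<in> E" for t e
  proof -
    have "\<alpha> (scl X t e) = (\<Sum>i<d. scl Y t (scl Y (c e i) (w i)))"
      unfolding \<alpha>_def by (rule sum.cong[OF refl]) (simp only: cscl[OF that] lessThan_iff Y.scale_scale)
    then show ?thesis by (simp only: \<alpha>_def Y.scale_sum_right)
  qed
  have \<alpha>lin: "linear_into (scl X) E (scl (matalg n)) (carr (matalg n)) \<alpha>"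
    unfolding linear_into_def Yc(2)[symmetric]
    using \<alpha>Y S(1) by (intro conjI ballI allI \<alpha>add \<alpha>scl) (auto simp: Yc(1))
  have \<alpha>0: "\<alpha> 0 = 0" by (rule linear_into_0[OF \<alpha>lin E0])
  have hc: "h e \<in> carr V" if "e \<in> carr X" for e by (rule cp_map_linear(1)[OF embedding_linear(1)[OF h] that])
  have kc: "k y \<in> carr V" if "y \<in> carr Y" for y by (rule cp_map_linear(1)[OF embedding_linear(1)[OF k] that])
  have hlin: "linear_into (scl X) (carr X) (scl V) (carr V) h" using embedding_linear(1)[OF h] by (simp add: cp_map_def)
  have klin: "linear_into (scl Y) (carr Y) (scl V) (carr V) k" using embedding_linear(1)[OF k] by (simp add: cp_map_def)
  have VX: "vector_space (scl X)" by unfold_locales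
  have VY: "vector_space (scl Y)" by unfold_locales
  define v where "v i = h (b i) - k (w i)" for i
  have vc: "v i \<in> carr V" if "i < d" for i
    unfolding v_def using E(2) bE[OF that] w[OF that] by (intro V.carr_diff hc kc) auto
  have bc: "b i \<in> carr X" if "i < d" for i using bE[OF that] E(2) by blast
  have diff: "h e - k (\<alpha> e) = (\<Sum>i<d. scl V (c e i) (v i))" if e: "e \<in> E" for e
  proof -
    have "h e = h (\<Sum>i<d. scl X (c e i) (b i))" by (rule arg_cong[OF rep[OF e]])
    also have "\<dots> = (\<Sum>i<d. h (scl X (c e i) (b i)))"
      by (rule linear_into_sum[OF hlin VX X.subspace_carr]) (intro X.carr_scl bc, simp)
    also have "\<dots> = (\<Sum>i<d. scl V (c e i) (h (b i)))"
      by (rule sum.cong[OF refl]) (simp only: lessThan_iff cp_map_linear(3)[OF embedding_linear(1)[OF h] bc])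
    finally have 1: "h e = (\<Sum>i<d. scl V (c e i) (h (b i)))" .
    have "k (\<alpha> e) = (\<Sum>i<d. k (scl Y (c e i) (w i)))"
      unfolding \<alpha>_def by (rule linear_into_sum[OF klin VY Y.subspace_carr]) (intro Y.carr_scl w, simp)
    also have "\<dots> = (\<Sum>i<d. scl V (c e i) (k (w i)))"
      by (rule sum.cong[OF refl]) (simp only: lessThan_iff cp_map_linear(3)[OF embedding_linear(1)[OF k] w])
    finally have 2: "k (\<alpha> e) = (\<Sum>i<d. scl V (c e i) (k (w i)))" .
    show ?thesis unfolding 1 2 v_def V.scale_right_diff_distrib sum_subtractf ..
  qed
  have est: "mnorm (matalg n) N (amp \<alpha> x) \<le> (1 + \<Gamma>) * mnorm X N x"
    "(1 - \<Gamma>) * mnorm X N x \<le> mnorm (matalg n) N (amp \<alpha> x)" if x: "x \<in> mats N E" for N x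
  proof -
    have xm: "x \<in> mats N (carr X)" using x E(2) by (auto simp: mats_def)
    have xE: "x i j \<in> E" for i j using x E0 by (cases "i < N \<and> j < N") (auto simp: mats_def)
    have \<alpha>x: "amp \<alpha> x \<in> mats N (carr Y)" by (rule amp_mats[where f = \<alpha>, OF x _ \<alpha>0]) (use \<alpha>Y in auto)
    have hx: "amp h x \<in> mats N (carr V)" by (rule cp_map_mats[OF X embedding_linear(1)[OF h] xm])
    have kx: "amp k (amp \<alpha> x) \<in> mats N (carr V)" by (rule cp_map_mats[OF Ys embedding_linear(1)[OF k] \<alpha>x])
    let ?D = "\<lambda>i. amp (\<lambda>e. scl V (c e i) (v i)) x"
    have c0: "c 0 i = 0" if "i < d" for i using cscl[OF E0 that, of 0] by simp
    have Dm: "?D i \<in> mats N (carr V)" if "i < d" for i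
      by (rule amp_mats[where f = "\<lambda>e. scl V (c e i) (v i)", OF x]) (use vc[OF that] V.carr_scl c0[OF that] in auto)
    have "amp h x - amp k (amp \<alpha> x) = (\<Sum>i<d. ?D i)"
    proof (intro ext)
      fix p q
      have "(\<Sum>i<d. ?D i) p q = (\<Sum>i<d. scl V (c (x p q) i) (v i))" unfolding sum_fun_apply2 amp_def ..
      then show "(amp h x - amp k (amp \<alpha> x)) p q = (\<Sum>i<d. ?D i) p q"
        using diff[OF xE, of p q] by (simp add: amp_def)
    qed
    then have "mnorm V N (amp h x - amp k (amp \<alpha> x)) = mnorm V N (\<Sum>i<d. ?D i)" by (simp only:)
    also have "\<dots> \<le> (\<Sum>i<d. mnorm V N (?D i))" by (rule V.mnorm_sum_le) (use Dm in auto)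
    also have "\<dots> \<le> (\<Sum>i<d. K * \<eta> * mnorm X N x)"
    proof (rule sum_mono)
      fix i assume "i \<in> {..<d}"
      then have i: "i < d" by simp
      show "mnorm V N (?D i) \<le> K * \<eta> * mnorm X N x"
        by (rule rank_one_bound[OF X E cadd[OF _ _ i] cscl[OF _ i] _ cK[OF _ i] x V vc[OF i] \<eta>])
          (use K hw[OF i] in \<open>auto simp: v_def\<close>)
    qed
    also have "\<dots> = real d * (K * \<eta>) * mnorm X N x" by simp
    also have "\<dots> \<le> \<Gamma> * mnorm X N x" by (rule mult_right_mono[OF small(1) X.mnorm_nonneg[OF xm]])
    finally have D: "mnorm V N (amp h x - amp k (amp \<alpha> x)) \<le> \<Gamma> * mnorm X N x" .
    have e1: "mnorm V N (amp h x) = mnorm X N x" by (rule embedding_mnorm[OF X V h xm])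
    have "mnorm V N (amp k (amp \<alpha> x)) = mnorm Y N (amp \<alpha> x)" by (rule embedding_mnorm[OF Ys V k \<alpha>x])
    also have "\<dots> = mnorm (matalg n) N (amp \<alpha> x)"
      unfolding S(2) by (rule mnorm_subsys[OF M.operator_system_axioms Y[unfolded S(2)]]) (use \<alpha>x in \<open>simp add: Yc(1)\<close>)
    finally have e2: "mnorm V N (amp k (amp \<alpha> x)) = mnorm (matalg n) N (amp \<alpha> x)" .
    have "mnorm V N (amp h x - (amp h x - amp k (amp \<alpha> x))) \<le> mnorm V N (amp h x) + mnorm V N (amp h x - amp k (amp \<alpha> x))"
      by (rule V.mnorm_diff[OF hx V.mats_diff[OF hx kx]])
    then show "mnorm (matalg n) N (amp \<alpha> x) \<le> (1 + \<Gamma>) * mnorm X N x"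
      using D e1 e2 by (simp add: algebra_simps)
    have "mnorm V N ((amp h x - amp k (amp \<alpha> x)) + amp k (amp \<alpha> x)) \<le>
      mnorm V N (amp h x - amp k (amp \<alpha> x)) + mnorm V N (amp k (amp \<alpha> x))"
      by (rule V.mnorm_triangle[OF V.mats_diff[OF hx kx] kx])
    then show "(1 - \<Gamma>) * mnorm X N x \<le> mnorm (matalg n) N (amp \<alpha> x)"
      using D e1 e2 by (simp add: algebra_simps)
  qed
  have inj: "inj_on \<alpha> E"
  proof (rule inj_onI)
    fix x y assume xy: "x \<in> E" "y \<in> E" "\<alpha> x = \<alpha> y"
    have d: "x - y \<in> E" using xy X.subspace_diff[OF E(1)] by blast
    have "\<alpha> (x - y) = 0" using \<alpha>add[OF d xy(2)] xy(3) by simp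
    then have "amp \<alpha> (elt 0 0 (x - y)) = 0" by (simp add: amp_elt \<alpha>0 elt_simps)
    moreover have "elt 0 0 (x - y) \<in> mats 1 E" using d E0 by (auto simp: elt_def mats_def)
    ultimately have "(1 - \<Gamma>) * opsys_norm X (x - y) \<le> 0"
      using est(2)[of "elt 0 0 (x - y)" 1] M.mnorm_0[of 1] unfolding opsys_norm_elt by simp
    then have "opsys_norm X (x - y) \<le> 0" using small(2) by (simp add: mult_le_0_iff)
    then have "opsys_norm X (x - y) = 0" using X.opsys_norm_nonneg[of "x - y"] d E(2) by fastforce
    then show "x = y" using X.opsys_norm_eq_0D[of "x - y"] d E(2) by auto
  qed
  have A: "cb_norm X E (matalg n) \<alpha> \<le> ennreal (1 + \<Gamma>)" using \<Gamma> by (intro cb_normI est(1)) auto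
  have B: "cb_norm (matalg n) (\<alpha> ` E) X (inv_into E \<alpha>) \<le> ennreal (1 / (1 - \<Gamma>))"
  proof (rule cb_normI)
    show "0 \<le> 1 / (1 - \<Gamma>)" using small(2) by simp
    fix N z assume z: "z \<in> mats N (\<alpha> ` E)"
    have inv: "inv_into E \<alpha> (\<alpha> e) = e" if "e \<in> E" for e by (rule inv_into_f_f[OF inj that])
    have inv0: "inv_into E \<alpha> 0 = 0" using inv[OF E0] \<alpha>0 by simp
    let ?x = "amp (inv_into E \<alpha>) z"
    have x: "?x \<in> mats N E" by (rule amp_mats[where f = "inv_into E \<alpha>", OF z _ inv0]) (auto simp: inv)
    have "amp \<alpha> ?x = z"
      by (rule amp_cancel[where U = \<alpha> and T = "inv_into E \<alpha>", OF z]) (use inv \<alpha>0 E0 in \<open>auto intro: image_eqI[of _ \<alpha> 0]\<close>)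
    then have "(1 - \<Gamma>) * mnorm X N ?x \<le> mnorm (matalg n) N z" using est(2)[OF x] by (simp only:)
    then show "mnorm X N ?x \<le> 1 / (1 - \<Gamma>) * mnorm (matalg n) N z" using small(2) by (simp add: field_simps)
  qed
  have "cb_norm X E (matalg n) \<alpha> * cb_norm (matalg n) (\<alpha> ` E) X (inv_into E \<alpha>) \<le> ennreal (1 + \<Gamma>) * ennreal (1 / (1 - \<Gamma>))"
    by (rule mult_mono[OF A B]) auto
  also have "\<dots> = ennreal ((1 + \<Gamma>) * (1 / (1 - \<Gamma>)))" using \<Gamma> small(2) by (intro ennreal_mult[symmetric]) auto
  also have "(1 + \<Gamma>) * (1 / (1 - \<Gamma>)) = (1 + \<Gamma>) / (1 - \<Gamma>)" by simp
  finally show ?thesis using \<alpha>lin inj by blast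
qed

theorem one_exact_of_approx:
  fixes X :: "'a::ab_group_add opsys"
  assumes XL: "lip_normed X L"
    and approx: "\<And>\<epsilon>::real. \<epsilon> > 0 \<Longrightarrow> \<exists>n\<ge>1. \<exists>Y L'. operator_subsystem Y (matalg n) \<and>
      lip_normed Y L' \<and> dist_op X L Y L' \<le> ennreal \<epsilon>"
  shows "one_exact X"
  unfolding one_exact_def
proof (intro allI impI, elim conjE exE)
  have X: "operator_system X" using XL by (simp add: lip_normed_def)
  interpret lip_normed_system X L
    using XL by (simp add: lip_normed_def lip_normed_system_def lip_normed_system_axioms_def)
  fix E B and c :: real
  assume E: "subspace E" "E \<subseteq> carr X" and c: "1 < c" and B: "finite B" "span B = E"
  have Bc: "span B \<subseteq> carr X" using E(2) B(2) by simp
  obtain K d b cc where K: "0 < K" and b': "\<forall>i<d. b i \<in> span B"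
    and rep': "\<forall>e\<in>span B. e = (\<Sum>i<d. scl X (cc e i) (b i))"
    and cK': "\<forall>e\<in>span B. \<forall>i<d. cmod (cc e i) \<le> K * opsys_norm X e"
    and ca': "\<forall>e\<in>span B. \<forall>e'\<in>span B. \<forall>i<d. cc (e + e') i = cc e i + cc e' i"
    and cs': "\<forall>t. \<forall>e\<in>span B. \<forall>i<d. cc (scl X t e) i = t * cc e (i::nat)"
    using fd_coords[OF B(1) Bc] by (elim exE conjE)
  \<comment> \<open>The solution of \<open>(1 + \<Gamma>) / (1 - \<Gamma>) = c\<close>, the
    distortion that \<open>near_embedding\<close> produces.\<close>
  define \<Gamma> where "\<Gamma> = (c - 1) / (c + 1)"
  have \<Gamma>: "0 < \<Gamma>" "\<Gamma> < 1" using c by (simp_all add: \<Gamma>_def)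
  have \<Gamma>c: "(1 + \<Gamma>) / (1 - \<Gamma>) = c"
  proof -
    have "1 + \<Gamma> = 2 * c / (c + 1)" "1 - \<Gamma> = 2 / (c + 1)" using c by (simp_all add: \<Gamma>_def field_simps)
    then show ?thesis using c by simp
  qed
  \<comment> \<open>Makes d K \<eta> at most \<Gamma>; the + 1 covers the case d = 0.\<close>
  define \<eta> where "\<eta> = \<Gamma> / (real d * K + 1)"
  have den: "0 < real d * K + 1" using K by (intro add_nonneg_pos mult_nonneg_nonneg) auto
  have \<eta>: "0 < \<eta>" using \<Gamma> den by (simp add: \<eta>_def)
  have small: "real d * (K * \<eta>) \<le> \<Gamma>"
  proof -
    have "real d * (K * \<eta>) \<le> (real d * K + 1) * \<eta>" using \<eta> by (simp add: algebra_simps)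
    also have "\<dots> = \<Gamma>" using den by (simp add: \<eta>_def)
    finally show ?thesis .
  qed
  have bc: "b i \<in> carr X" if "i < d" for i using b' that E(2) B(2) by blast
  have "0 < \<eta> / 2" using \<eta> by simp
  note ap = lip_approx[OF bc this]
  have "\<exists>t s a a'. \<forall>i<d. 0 < t i \<and> 0 < s i \<and> a i \<in> lip_ball X L \<and> a' i \<in> lip_ball X L \<and>
    opsys_norm X (b i - (scl X (complex_of_real (t i)) (a i) + scl X (\<i> * complex_of_real (s i)) (a' i))) \<le> \<eta> / 2"
    using ap by metis
  then obtain t s a a' where a: "\<forall>i<d. 0 < t i \<and> 0 < s i \<and> a i \<in> lip_ball X L \<and> a' i \<in> lip_ball X L \<and>
    opsys_norm X (b i - (scl X (complex_of_real (t i)) (a i) + scl X (\<i> * complex_of_real (s i)) (a' i))) \<le> \<eta> / 2"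
    by (elim exE)
  \<comment> \<open>T bounds all the scalings from the Lip-ball to the basis, so \<epsilon> can be
    fixed only after these are known. Half of \<eta> is spent on approximating the basis and half on
    T times the distance 2 \<epsilon> in \<open>V\<close>.\<close>
  define T where "T = 1 + (\<Sum>i<d. t i + s i)"
  have T: "0 < T" "\<And>i. i < d \<Longrightarrow> t i + s i \<le> T"
  proof -
    have nn: "0 \<le> t i + s i" if "i < d" for i using a that by (simp add: less_imp_le)
    show "0 < T" unfolding T_def using nn by (intro add_pos_nonneg sum_nonneg) auto
    fix i assume "i < d"
    then have "t i + s i \<le> (\<Sum>i<d. t i + s i)" using nn by (intro member_le_sum) auto
    then show "t i + s i \<le> T" by (simp add: T_def)
  qed
  define \<epsilon> where "\<epsilon> = \<eta> / (4 * T)"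
  have \<epsilon>: "0 < \<epsilon>" using \<eta> T(1) by (simp add: \<epsilon>_def)
  obtain n Y L' where n: "1 \<le> n" and Y: "operator_subsystem Y (matalg n)" and YL: "lip_normed Y L'"
    and dist: "dist_op X L Y L' \<le> ennreal \<epsilon>" using approx[OF \<epsilon>] by (elim exE conjE)
  have Ys: "operator_system Y" using YL by (simp add: lip_normed_def)
  interpret Y: operator_system Y by (rule Ys)
  \<comment> \<open>The factor 2 creates the strict gap that \<open>dist_opD\<close>
    requires.\<close>
  have "\<exists>(V :: ('a \<times> (nat \<Rightarrow> nat \<Rightarrow> complex)) opsys) h k. operator_system V \<and> unital_complete_order_embedding X V h \<and>
    unital_complete_order_embedding Y V k \<and>
    (\<forall>a\<in>lip_ball X L. \<exists>y\<in>lip_ball Y L'. opsys_norm V (h a - k y) < 2 * \<epsilon>)"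
    by (rule dist_opD[OF dist]) (use \<epsilon> in auto)
  then obtain V :: "('a \<times> (nat \<Rightarrow> nat \<Rightarrow> complex)) opsys" and h k where V: "operator_system V"
    and h: "unital_complete_order_embedding X V h" and k: "unital_complete_order_embedding Y V k"
    and hk: "\<forall>a\<in>lip_ball X L. \<exists>y\<in>lip_ball Y L'. opsys_norm V (h a - k y) < 2 * \<epsilon>"
    by (elim exE conjE)
  interpret V: operator_system V by (rule V)
  note hl = cp_map_linear[OF embedding_linear(1)[OF h]] and kl = cp_map_linear[OF embedding_linear(1)[OF k]]
  have "\<exists>w. w \<in> carr Y \<and> opsys_norm V (h (b i) - k w) \<le> \<eta>" if i: "i < d" for i
  proof -
    have ai: "a i \<in> lip_ball X L" "a' i \<in> lip_ball X L" "0 < t i" "0 < s i"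
      "opsys_norm X (b i - (scl X (complex_of_real (t i)) (a i) + scl X (\<i> * complex_of_real (s i)) (a' i))) \<le> \<eta> / 2"
      using a i by auto
    obtain y where y: "y \<in> lip_ball Y L'" "opsys_norm V (h (a i) - k y) < 2 * \<epsilon>" using hk ai(1) by blast
    obtain y' where y': "y' \<in> lip_ball Y L'" "opsys_norm V (h (a' i) - k y') < 2 * \<epsilon>" using hk ai(2) by blast
    have ac: "a i \<in> carr X" "a' i \<in> carr X"
      by (rule saD(1)[OF lip_ballD(1)[OF ai(1)]], rule saD(1)[OF lip_ballD(1)[OF ai(2)]])
    have yc: "y \<in> carr Y" "y' \<in> carr Y" using y(1) y'(1) by (auto simp: lip_ball_def sa_def)
    let ?t = "complex_of_real (t i)" and ?s = "\<i> * complex_of_real (s i)"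
    let ?w = "scl Y ?t y + scl Y ?s y'" and ?p = "scl X ?t (a i) + scl X ?s (a' i)"
    have wc: "?w \<in> carr Y" by (intro Y.carr_add Y.carr_scl yc)
    have pc: "?p \<in> carr X" by (intro carr_add carr_scl ac)
    have kw: "k ?w = scl V ?t (k y) + scl V ?s (k y')"
      using kl(2)[OF Y.carr_scl[OF yc(1)] Y.carr_scl[OF yc(2)]] kl(3)[OF yc(1)] kl(3)[OF yc(2)] by simp
    have hp: "h ?p = scl V ?t (h (a i)) + scl V ?s (h (a' i))"
      using hl(2)[OF carr_scl[OF ac(1)] carr_scl[OF ac(2)]] hl(3)[OF ac(1)] hl(3)[OF ac(2)] by simp
    have hd: "h (b i - ?p) = h (b i) - h ?p"
      using hl(2)[OF carr_diff[OF bc[OF i] pc] pc] by (simp add: algebra_simps)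
    have vc: "h (a i) - k y \<in> carr V" "h (a' i) - k y' \<in> carr V" by (intro V.carr_diff hl(1) kl(1) ac yc)+
    have "h (b i) - k ?w = h (b i - ?p) + (scl V ?t (h (a i) - k y) + scl V ?s (h (a' i) - k y'))"
      unfolding hd hp kw V.scale_right_diff_distrib by (simp add: algebra_simps)
    then have "opsys_norm V (h (b i) - k ?w) \<le> opsys_norm V (h (b i - ?p)) +
      (opsys_norm V (scl V ?t (h (a i) - k y)) + opsys_norm V (scl V ?s (h (a' i) - k y')))"
      using V.opsys_norm_triangle[OF hl(1)[OF carr_diff[OF bc[OF i] pc]] V.carr_add[OF V.carr_scl[OF vc(1), of ?t] V.carr_scl[OF vc(2), of ?s]]]
        V.opsys_norm_triangle[OF V.carr_scl[OF vc(1), of ?t] V.carr_scl[OF vc(2), of ?s]] by simp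
    also have "opsys_norm V (h (b i - ?p)) = opsys_norm X (b i - ?p)"
      using h carr_diff[OF bc[OF i] pc] by (simp add: unital_complete_order_embedding_def)
    also have "opsys_norm V (scl V ?t (h (a i) - k y)) = t i * opsys_norm V (h (a i) - k y)"
      using V.opsys_norm_scl[OF vc(1), of ?t] ai(3) by simp
    also have "opsys_norm V (scl V ?s (h (a' i) - k y')) = s i * opsys_norm V (h (a' i) - k y')"
      using V.opsys_norm_scl[OF vc(2), of ?s] ai(4) by (simp add: norm_mult)
    finally have "opsys_norm V (h (b i) - k ?w) \<le>
      opsys_norm X (b i - ?p) + (t i * opsys_norm V (h (a i) - k y) + s i * opsys_norm V (h (a' i) - k y'))" .
    also have "\<dots> \<le> \<eta> / 2 + (t i * (2 * \<epsilon>) + s i * (2 * \<epsilon>))"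
      using ai(3-5) y(2) y'(2) by (intro add_mono mult_left_mono) auto
    also have "t i * (2 * \<epsilon>) + s i * (2 * \<epsilon>) = (t i + s i) * (2 * \<epsilon>)" by (simp add: algebra_simps)
    also have "\<eta> / 2 + (t i + s i) * (2 * \<epsilon>) \<le> \<eta> / 2 + T * (2 * \<epsilon>)"
      using T(2)[OF i] \<epsilon> by (intro add_left_mono mult_right_mono) auto
    also have "T * (2 * \<epsilon>) = \<eta> / 2" using T(1) by (simp add: \<epsilon>_def)
    also have "\<eta> / 2 + \<eta> / 2 = \<eta>" by simp
    finally have "opsys_norm V (h (b i) - k ?w) \<le> \<eta>" .
    then show ?thesis using wc by blast
  qed
  then have "\<exists>w. \<forall>i<d. w i \<in> carr Y \<and> opsys_norm V (h (b i) - k (w i)) \<le> \<eta>" by metis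
  then obtain w where w: "\<forall>i<d. w i \<in> carr Y \<and> opsys_norm V (h (b i) - k (w i)) \<le> \<eta>" by (elim exE)
  have "\<exists>\<alpha>. linear_into (scl X) E (scl (matalg n)) (carr (matalg n)) \<alpha> \<and> inj_on \<alpha> E \<and>
        cb_norm X E (matalg n) \<alpha> * cb_norm (matalg n) (\<alpha> ` E) X (inv_into E \<alpha>) \<le> ennreal ((1 + \<Gamma>) / (1 - \<Gamma>))"
  proof (rule near_embedding[OF X V n h Y k E K \<eta> _ _ _ _ _ _ _ small \<Gamma>(2), where b = b and c = cc and w = w])
    show "e = (\<Sum>i<d. scl X (cc e i) (b i))" if "e \<in> E" for e using rep' that unfolding B(2) by (rule bspec)
  qed (use b' cK' ca' cs' w B(2) in auto)
  then show "\<exists>n\<ge>1. \<exists>\<alpha>. linear_into (scl X) E (scl (matalg n)) (carr (matalg n)) \<alpha> \<and> inj_on \<alpha> E \<and>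
        cb_norm X E (matalg n) \<alpha> * cb_norm (matalg n) (\<alpha> ` E) X (inv_into E \<alpha>) \<le> ennreal c"
    unfolding \<Gamma>c using n by blast
qed

section \<open>Approximate factorization of completely positive maps\<close>

text \<open>\<open>P \<otimes> 1\<close> for a scalar matrix \<open>P\<close>.\<close>

definition scm :: "'a::ab_group_add opsys \<Rightarrow> nat \<Rightarrow> (nat \<Rightarrow> nat \<Rightarrow> complex) \<Rightarrow> nat \<Rightarrow> nat \<Rightarrow> 'a" where
  "scm X k P = (\<lambda>i j. if i < k \<and> j < k then scl X (P i j) (ounit X) else 0)"

context operator_system
begin

lemma mats_scm: "scm X k P \<in> mats k (carr X)"
  by (auto simp: scm_def mats_def intro: carr_intros)

lemma scm_add: "scm X k (\<lambda>i j. P i j + Q i j) = scm X k P + scm X k Q"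
  by (auto simp: scm_def fun_eq_iff scale_left_distrib)

lemma scm_mscl: "scm X k (\<lambda>i j. c * P i j) = mscl X c (scm X k P)"
  by (auto simp: scm_def mscl_def fun_eq_iff)

lemma scm_munit: "scm X k (\<lambda>i j. if i = j then r else 0) = mscl X r (munit X k)"
  by (auto simp: scm_def mscl_def munit_def fun_eq_iff)

lemma hmats_scm:
  assumes P: "\<And>i j. P j i = cnj (P i j)"
  shows "scm X k P \<in> hmats X k"
proof -
  have "adj X (scl X (P j i) (ounit X)) = scl X (P i j) (ounit X)" for i j
    unfolding adj_scl[OF ounit_closed] adj_ounit by (rule arg_cong[where f = "\<lambda>c. scl X c (ounit X)"]) (rule P[symmetric])
  then have "madj X k (scm X k P) = scm X k P" by (auto simp: scm_def madj_def fun_eq_iff)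
  then show ?thesis using mats_scm by (simp add: hmats_def)
qed

lemma ucp_amp_scm:
  assumes \<phi>: "ucp X m \<phi>"
  shows "amp \<phi> (scm X k P) = scm (matalg m) k P"
proof (intro ext)
  fix i j
  have "\<phi> (scl X c (ounit X)) = scl (matalg m) c (ounit (matalg m))" for c
    using cp_map_linear(3)[OF ucpD(2)[OF \<phi>] ounit_closed] ucpD(3)[OF \<phi>] by (simp only:)
  moreover have "\<phi> 0 = 0" by (rule cp_map_0[OF operator_system_axioms ucpD(2)[OF \<phi>]])
  ultimately have "amp \<phi> (scm X k P) i j = scm (matalg m) k P i j"
    unfolding amp_def scm_def by presburger
  then show "amp \<phi> (scm X k P) i j p q = scm (matalg m) k P i j p q" for p q by (simp only:)
qed

end

lemma sesq_scm: "sesq k m (scm (matalg m) k P) \<xi> \<xi> = (\<Sum>p<m. \<Sum>i<k. \<Sum>j<k. cnj (\<xi> i p) * P i j * \<xi> j p)"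
proof -
  have "sesq k m (scm (matalg m) k P) \<xi> \<xi> = (\<Sum>i<k. \<Sum>j<k. \<Sum>p<m. \<Sum>q<m. if q = p then cnj (\<xi> i p) * P i j * \<xi> j p else 0)"
    unfolding sesq_def by (intro sum.cong refl) (auto simp: scm_def)
  also have "\<dots> = (\<Sum>i<k. \<Sum>j<k. \<Sum>p<m. cnj (\<xi> i p) * P i j * \<xi> j p)" by simp
  also have "\<dots> = (\<Sum>p<m. \<Sum>i<k. \<Sum>j<k. cnj (\<xi> i p) * P i j * \<xi> j p)" by (rule sum_rotate)
  finally show ?thesis .
qed

text \<open>By compression with a Cholesky factor of \<open>P + \<epsilon>\<close>, the normalized bound \<open>0 \<le> \<phi>(e) \<le> 1\<close>
  suffices to treat \<open>0 \<le> \<phi>(e) \<le> P \<otimes> 1\<close>.\<close>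

lemma almost_positive:
  assumes X: "operator_system X" and \<phi>: "ucp X m \<phi>" and E: "module.subspace (scl X) E" "E \<subseteq> carr X"
    and \<delta>: "0 \<le> \<delta>" and u: "ucp X k f"
    and P: "\<And>i j. P j i = cnj (P i j)"
    and ap: "\<And>e. e \<in> mats k E \<Longrightarrow> e \<in> hmats X k \<Longrightarrow> amp \<phi> e \<in> pos (matalg m) k \<Longrightarrow>
      munit (matalg m) k - amp \<phi> e \<in> pos (matalg m) k \<Longrightarrow> mscl X (complex_of_real \<delta>) (munit X k) + e \<in> pos X k"
    and e: "e \<in> mats k E" "e \<in> hmats X k" "amp \<phi> e \<in> pos (matalg m) k" "scm (matalg m) k P - amp \<phi> e \<in> pos (matalg m) k"
  shows "- \<delta> * Re (\<Sum>i<k. P i i) \<le> Re (\<Sum>i<k. \<Sum>j<k. f (e i j) i j)"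
proof -
  interpret X: operator_system X by fact
  interpret M: operator_system "matalg m" by (rule ucpD(4)[OF \<phi>])
  have m: "1 \<le> m" by (rule ucpD(1)[OF \<phi>])
  note em = X.hmats_mats[OF e(2)]
  have flin: "linear_into (scl X) (carr X) (scl (matalg m)) (carr (matalg m)) \<phi>" using ucpD(2)[OF \<phi>] by (simp add: cp_map_def)
  have flin': "linear_into (scl X) (carr X) (scl (matalg k)) (carr (matalg k)) f" using ucpD(2)[OF u] by (simp add: cp_map_def)
  have Ppos: "0 \<le> Re (\<Sum>i<k. \<Sum>j<k. cnj (z i) * P i j * z j)" for z
  proof -
    have "scm (matalg m) k P \<in> pos (matalg m) k" using M.pos_add[OF e(4,3)] by simp
    then have "sesq k m (scm (matalg m) k P) (\<lambda>i p. if p = 0 then z i else 0) (\<lambda>i p. if p = 0 then z i else 0) \<in> \<real>\<^sub>\<ge>\<^sub>0"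
      by (simp add: matalg_pos)
    also have "sesq k m (scm (matalg m) k P) (\<lambda>i p. if p = 0 then z i else 0) (\<lambda>i p. if p = 0 then z i else 0) =
      (\<Sum>p<m. if p = 0 then \<Sum>i<k. \<Sum>j<k. cnj (z i) * P i j * z j else 0)"
      unfolding sesq_scm by (rule sum.cong[OF refl]) simp
    also have "\<dots> = (\<Sum>i<k. \<Sum>j<k. cnj (z i) * P i j * z j)" using m by simp
    finally show ?thesis by (simp add: complex_nonneg_Reals_iff)
  qed
  have cs: "cnj z * z = complex_of_real ((cmod z)\<^sup>2)" for z by (simp only: complex_norm_square mult.commute)
  have "- \<delta> * Re (\<Sum>i<k. P i i) \<le> Re (\<Sum>i<k. \<Sum>j<k. f (e i j) i j) + \<epsilon>0" if \<epsilon>0: "0 < \<epsilon>0" for \<epsilon>0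
  proof -
    define \<epsilon> where "\<epsilon> = \<epsilon>0 / (\<delta> * real k + 1)"
    have den: "0 < \<delta> * real k + 1" using \<delta> by (intro add_nonneg_pos mult_nonneg_nonneg) auto
    have \<epsilon>: "0 < \<epsilon>" using \<epsilon>0 den by (simp add: \<epsilon>_def)
    have \<epsilon>\<delta>: "\<delta> * (\<epsilon> * real k) \<le> \<epsilon>0"
    proof -
      have "\<delta> * (\<epsilon> * real k) \<le> \<epsilon> * (\<delta> * real k + 1)" using \<epsilon> by (simp add: algebra_simps)
      also have "\<dots> = \<epsilon>0" using den by (simp add: \<epsilon>_def)
      finally show ?thesis .
    qed
    \<comment> \<open>P is only positive semidefinite; adding \<epsilon> on the diagonal gives an
      invertible Cholesky factor T.\<close>
    define Q where "Q i j = P i j + (if i = j then complex_of_real \<epsilon> else 0)" for i j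
    have Qform: "(\<Sum>i<k. \<Sum>j<k. cnj (z i) * Q i j * w j) = (\<Sum>i<k. \<Sum>j<k. cnj (z i) * P i j * w j) + complex_of_real \<epsilon> * (\<Sum>i<k. cnj (z i) * w i)" for z w
    proof -
      have "(\<Sum>i<k. \<Sum>j<k. cnj (z i) * Q i j * w j) = (\<Sum>i<k. \<Sum>j<k. cnj (z i) * P i j * w j) +
        (\<Sum>i<k. \<Sum>j<k. if j = i then complex_of_real \<epsilon> * (cnj (z i) * w i) else 0)"
        unfolding sum.distrib[symmetric] by (intro sum.cong refl) (simp add: Q_def algebra_simps)
      then show ?thesis by (simp add: sum_distrib_left)
    qed
    have "\<exists>T D. (\<forall>i<k. \<forall>j<k. Q i j = (\<Sum>l<k. cnj (T l i) * T l j)) \<and>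
      (\<forall>i<k. \<forall>j<k. (\<Sum>l<k. D i l * T l j) = (if i = j then 1 else 0)) \<and>
      (\<forall>i<k. \<forall>j<k. (\<Sum>l<k. T i l * D l j) = (if i = j then 1 else 0))"
    proof (rule cholesky)
      show "Q j i = cnj (Q i j)" for i j using P[of i j] by (simp add: Q_def)
      show "0 < Re (\<Sum>i<k. \<Sum>j<k. cnj (z i) * Q i j * z j)" if z: "\<exists>i<k. z i \<noteq> 0" for z
      proof -
        have "0 < (\<Sum>i<k. (cmod (z i))\<^sup>2)" using z by (auto intro!: sum_pos2)
        moreover have "(\<Sum>i<k. cnj (z i) * z i) = complex_of_real (\<Sum>i<k. (cmod (z i))\<^sup>2)"
          unfolding of_real_sum by (rule sum.cong[OF refl], rule cs)
        ultimately have "0 < Re (complex_of_real \<epsilon> * (\<Sum>i<k. cnj (z i) * z i))" using \<epsilon> by simp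
        then show ?thesis unfolding Qform using Ppos[of z] by simp
      qed
    qed
    then obtain T D where T: "\<forall>i<k. \<forall>j<k. Q i j = (\<Sum>l<k. cnj (T l i) * T l j)"
      and DT: "\<forall>i<k. \<forall>j<k. (\<Sum>l<k. D i l * T l j) = (if i = j then 1 else 0)"
      and TD: "\<forall>i<k. \<forall>j<k. (\<Sum>l<k. T i l * D l j) = (if i = j then 1 else 0)" by (elim exE conjE)
    let ?e = "bicomp X k k D D e"
    have cb: "bicomp Z k k A A y = compress Z k k A y" for Z :: "'z::ab_group_add opsys" and A y
      by (simp add: bicomp_def compress_def)
    have e1: "?e \<in> mats k E" by (rule mats_bicomp[OF X E(1) e(1)])
    have e1m: "?e \<in> mats k (carr X)" using e1 E(2) by (auto simp: mats_def)
    have e2: "?e \<in> hmats X k"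
    proof -
      have "adj X (?e i j) = ?e j i" if "i < k" "j < k" for i j
      proof -
        have me: "madj X k e = e" using e(2) by (simp add: hmats_def)
        have "adj X (e p q) = e q p" if "p < k" "q < k" for p q
          using fun_cong[OF fun_cong[OF me, of q], of p] that by (simp add: madj_def)
        moreover have ec: "e p q \<in> carr X" for p q by (rule X.mats_entry[OF em])
        ultimately have "adj X (?e i j) = (\<Sum>p<k. \<Sum>q<k. scl X (D p i * cnj (D q j)) (e q p))"
          using that by (simp add: bicomp_def X.adj_sum X.carr_sum X.carr_scl X.adj_scl)
        also have "\<dots> = (\<Sum>q<k. \<Sum>p<k. scl X (D p i * cnj (D q j)) (e q p))" by (rule sum.swap)
        finally show ?thesis using that by (simp add: bicomp_def mult.commute)
      qed
      then have "madj X k ?e = ?e" by (auto simp: madj_def fun_eq_iff) (auto simp: bicomp_def)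
      then show ?thesis using e1m by (simp add: hmats_def)
    qed
    have \<phi>e: "amp \<phi> ?e = bicomp (matalg m) k k D D (amp \<phi> e)" by (rule amp_bicomp[OF X flin em])
    have e3: "amp \<phi> ?e \<in> pos (matalg m) k" unfolding \<phi>e unfolding cb by (rule M.pos_compress[OF e(3)])
    \<comment> \<open>In the coordinates \<zeta> = D \<xi> the unit form becomes the form of Q,
      which exceeds that of P by a nonnegative term.\<close>
    have e4: "munit (matalg m) k - amp \<phi> ?e \<in> pos (matalg m) k"
      unfolding matalg_pos mem_Collect_eq
    proof (intro conjI allI)
      show "munit (matalg m) k - amp \<phi> ?e \<in> mats k (mats m UNIV)"
        using M.mats_diff[OF M.mats_munit M.pos_mats[OF e3]] by simp
      fix \<xi> :: "nat \<Rightarrow> nat \<Rightarrow> complex"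
      define \<zeta> where "\<zeta> = (\<lambda>i p. \<Sum>a<k. D i a * \<xi> a p)"
      have T\<zeta>: "(\<Sum>a<k. T i a * \<zeta> a p) = \<xi> i p" if i: "i < k" for i p
      proof -
        have "(\<Sum>a<k. T i a * \<zeta> a p) = (\<Sum>b<k. (\<Sum>a<k. T i a * D a b) * \<xi> b p)"
          unfolding \<zeta>_def sum_distrib_left sum_distrib_right by (subst sum.swap) (simp add: mult_ac)
        also have "\<dots> = (\<Sum>b<k. if b = i then \<xi> b p else 0)" by (rule sum.cong[OF refl]) (use TD i in auto)
        finally show ?thesis using i by simp
      qed
      have row: "(\<Sum>i<k. \<Sum>j<k. cnj (\<zeta> i p) * Q i j * \<zeta> j p) = (\<Sum>i<k. cnj (\<xi> i p) * \<xi> i p)" for p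
      proof -
        have "(\<Sum>i<k. \<Sum>j<k. cnj (\<zeta> i p) * Q i j * \<zeta> j p) =
          (\<Sum>i<k. \<Sum>j<k. \<Sum>l<k. cnj (T l i * \<zeta> i p) * (T l j * \<zeta> j p))"
        proof (rule sum.cong[OF refl], rule sum.cong[OF refl])
          fix i j assume "i \<in> {..<k}" "j \<in> {..<k}"
          then have QT: "Q i j = (\<Sum>l<k. cnj (T l i) * T l j)" using T by simp
          have "cnj a * (\<Sum>l<k. cnj (T l i) * T l j) * b = (\<Sum>l<k. cnj (T l i * a) * (T l j * b))" for a b
            by (simp add: sum_distrib_left sum_distrib_right mult_ac)
          then show "cnj (\<zeta> i p) * Q i j * \<zeta> j p = (\<Sum>l<k. cnj (T l i * \<zeta> i p) * (T l j * \<zeta> j p))"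
            unfolding QT .
        qed
        also have "\<dots> = (\<Sum>l<k. cnj (\<Sum>i<k. T l i * \<zeta> i p) * (\<Sum>j<k. T l j * \<zeta> j p))"
          unfolding cnj_sum sum_product by (rule sum_rotate)
        also have "\<dots> = (\<Sum>l<k. cnj (\<xi> l p) * \<xi> l p)" by (rule sum.cong[OF refl]) (simp only: T\<zeta> lessThan_iff)
        finally show ?thesis .
      qed
      have s\<phi>: "sesq k m (amp \<phi> ?e) \<xi> \<xi> = sesq k m (amp \<phi> e) \<zeta> \<zeta>"
        unfolding \<zeta>_def by (rule sesq_bicomp[OF X flin X.subspace_carr em])
      have "sesq k m (scm (matalg m) k P - amp \<phi> e) \<zeta> \<zeta> \<in> \<real>\<^sub>\<ge>\<^sub>0" using e(4) by (simp add: matalg_pos)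
      moreover have "complex_of_real (\<epsilon> * (\<Sum>p<m. \<Sum>i<k. (cmod (\<zeta> i p))\<^sup>2)) \<in> \<real>\<^sub>\<ge>\<^sub>0"
        unfolding complex_nonneg_Reals_iff Re_complex_of_real Im_complex_of_real
        using \<epsilon> by (intro conjI refl mult_nonneg_nonneg sum_nonneg) auto
      ultimately have n: "sesq k m (scm (matalg m) k P - amp \<phi> e) \<zeta> \<zeta> +
        complex_of_real (\<epsilon> * (\<Sum>p<m. \<Sum>i<k. (cmod (\<zeta> i p))\<^sup>2)) \<in> \<real>\<^sub>\<ge>\<^sub>0" by (rule nonneg_Reals_add_I)
      have "sesq k m (munit (matalg m) k) \<xi> \<xi> = (\<Sum>p<m. \<Sum>i<k. cnj (\<xi> i p) * \<xi> i p)"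
        unfolding sesq_unit sqn_def of_real_sum by (subst sum.swap) (simp only: cs)
      also have "\<dots> = (\<Sum>p<m. \<Sum>i<k. \<Sum>j<k. cnj (\<zeta> i p) * Q i j * \<zeta> j p)" unfolding row ..
      also have "\<dots> = sesq k m (scm (matalg m) k P) \<zeta> \<zeta> + complex_of_real (\<epsilon> * (\<Sum>p<m. \<Sum>i<k. (cmod (\<zeta> i p))\<^sup>2))"
        unfolding Qform sesq_scm sum.distrib cs of_real_mult of_real_sum sum_distrib_left ..
      finally have "sesq k m (munit (matalg m) k - amp \<phi> ?e) \<xi> \<xi> = sesq k m (scm (matalg m) k P - amp \<phi> e) \<zeta> \<zeta> +
        complex_of_real (\<epsilon> * (\<Sum>p<m. \<Sum>i<k. (cmod (\<zeta> i p))\<^sup>2))"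
        unfolding diff_conv_add_uminus[of "munit (matalg m) k"] diff_conv_add_uminus[of "scm (matalg m) k P"] sesq_add_mat sesq_minus_mat s\<phi>
        by simp
      then show "sesq k m (munit (matalg m) k - amp \<phi> ?e) \<xi> \<xi> \<in> \<real>\<^sub>\<ge>\<^sub>0" using n by (simp only:)
    qed
    have pos: "mscl X (complex_of_real \<delta>) (munit X k) + ?e \<in> pos X k" by (rule ap[OF e1 e2 e3 e4])
    \<comment> \<open>Testing at T undoes the compression by D, so the form yields the trace pairing
      of f with e, and the square norm of T is the trace of Q, that is, the trace of P plus
      \<epsilon> k.\<close>
    let ?T = "\<lambda>i a. T i a"
    have "sesq k k (amp f (mscl X (complex_of_real \<delta>) (munit X k) + ?e)) ?T ?T \<in> \<real>\<^sub>\<ge>\<^sub>0"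
      by (rule cp_map_sesq[OF ucpD(2)[OF u] pos])
    then have n1: "complex_of_real (\<delta> * sqn k k ?T) + sesq k k (amp f ?e) ?T ?T \<in> \<real>\<^sub>\<ge>\<^sub>0"
      unfolding X.ucp_amp_add[OF u X.mats_mscl[OF X.mats_munit] e1m] X.ucp_amp_mscl[OF u X.mats_munit] X.ucp_amp_munit[OF u]
        sesq_add_mat sesq_scl sesq_unit by simp
    have n2: "sesq k k (amp f ?e) ?T ?T = (\<Sum>i<k. \<Sum>j<k. f (e i j) i j)"
    proof -
      have "sesq k k (amp f ?e) ?T ?T = sesq k k (amp f e) (\<lambda>i p. \<Sum>a<k. D i a * T a p) (\<lambda>i p. \<Sum>a<k. D i a * T a p)"
        by (rule sesq_bicomp[OF X flin' X.subspace_carr em])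
      also have "\<dots> = sesq k k (amp f e) (\<lambda>i p. if i = p then 1 else 0) (\<lambda>i p. if i = p then 1 else 0)"
        by (rule sesq_cong) (simp add: DT)
      also have "\<dots> = (\<Sum>i<k. \<Sum>j<k. f (e i j) i j)" unfolding sesq_unit_vectors amp_def ..
      finally show ?thesis .
    qed
    have "complex_of_real (sqn k k ?T) = (\<Sum>i<k. P i i) + complex_of_real (\<epsilon> * real k)"
    proof -
      have "complex_of_real (sqn k k ?T) = (\<Sum>i<k. \<Sum>l<k. cnj (T l i) * T l i)"
        unfolding sqn_def of_real_sum by (subst sum.swap) (simp only: cs)
      also have "\<dots> = (\<Sum>i<k. Q i i)" using T by simp
      finally show ?thesis by (simp add: Q_def sum.distrib)
    qed
    from arg_cong[OF this, of Re] have n3: "sqn k k ?T = Re (\<Sum>i<k. P i i) + \<epsilon> * real k"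
      by (simp only: Re_complex_of_real plus_complex.simps)
    have "0 \<le> Re (complex_of_real (\<delta> * sqn k k ?T) + sesq k k (amp f ?e) ?T ?T)"
      using n1 by (simp only: complex_nonneg_Reals_iff)
    then have "0 \<le> \<delta> * Re (\<Sum>i<k. P i i) + \<delta> * (\<epsilon> * real k) + Re (\<Sum>i<k. \<Sum>j<k. f (e i j) i j)"
      unfolding n2 n3 plus_complex.simps Re_complex_of_real distrib_left .
    then show ?thesis using \<epsilon>\<delta> unfolding mult_minus_left by linarith
  qed
  then show ?thesis by (rule field_le_epsilon)
qed

lemma (in operator_system) mats_subspace:
  assumes E: "subspace E"
  shows "x \<in> mats k E \<Longrightarrow> y \<in> mats k E \<Longrightarrow> x + y \<in> mats k E" "x \<in> mats k E \<Longrightarrow> mscl X c x \<in> mats k E"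
    "0 \<in> mats k E" "ounit X \<in> E \<Longrightarrow> scm X k P \<in> mats k E" "a \<in> E \<Longrightarrow> i < k \<Longrightarrow> j < k \<Longrightarrow> elt i j a \<in> mats k E"
  by (auto simp: mats_def mscl_def scm_def elt_def intro: subspace_add[OF E] subspace_scale[OF E] subspace_0[OF E])

lemma amp_hmats:
  assumes X: "operator_system X" and Y: "operator_system Y" and f: "cp_map X Y f" and x: "x \<in> hmats X n"
  shows "amp f x \<in> hmats Y n"
proof -
  interpret X: operator_system X by fact
  have xm: "x \<in> mats n (carr X)" and ma: "madj X n x = x" using x by (auto simp: hmats_def)
  have ad: "adj Y (f (x j i)) = f (x i j)" if "i < n" "j < n" for i j
    using cp_map_adj[OF X Y f X.mats_entry[OF xm], of j i] fun_cong[OF fun_cong[OF ma, of i], of j] that by (simp add: madj_def)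
  have m: "amp f x \<in> mats n (carr Y)" by (rule cp_map_mats[OF X f xm])
  have "madj Y n (amp f x) i j = amp f x i j" for i j
  proof (cases "i < n \<and> j < n")
    case True
    then show ?thesis using ad by (simp add: madj_def amp_def)
  next
    case False
    then have "amp f x i j = 0" using m by (auto simp: mats_def)
    then show ?thesis using False by (auto simp: madj_def)
  qed
  then have "madj Y n (amp f x) = amp f x" by (intro ext) (simp only:)
  then show ?thesis using m by (simp add: hmats_def)
qed

lemma ucp_opsys_norm_le:
  assumes X: "operator_system X" and f: "ucp X k f" and x: "x \<in> carr X"
  shows "opsys_norm (matalg k) (f x) \<le> opsys_norm X x"
proof -
  have m: "elt 0 0 x \<in> mats 1 (carr X)" by (rule operator_system.mats_elt[OF X _ _ x]) simp_all
  show ?thesis using ucp_mnorm_le[OF X f m] unfolding amp_elt[of f, OF cp_map_0[OF X ucpD(2)[OF f]]] opsys_norm_elt .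
qed

section \<open>The trace pairing and factorization by Hahn-Banach\<close>

text \<open>The functional on k x k matrices that corresponds to f; passing to it inverts
  \<open>choi\<close>.\<close>

definition tr_form :: "nat \<Rightarrow> ('a \<Rightarrow> nat \<Rightarrow> nat \<Rightarrow> complex) \<Rightarrow> (nat \<Rightarrow> nat \<Rightarrow> 'a) \<Rightarrow> complex" where
  "tr_form k f z = (\<Sum>i<k. \<Sum>j<k. f (z i j) i j)"

context operator_system
begin

lemma tr_form_simps:
  assumes f: "ucp X k f"
  shows "x \<in> mats k (carr X) \<Longrightarrow> y \<in> mats k (carr X) \<Longrightarrow> tr_form k f (x + y) = tr_form k f x + tr_form k f y"
    "x \<in> mats k (carr X) \<Longrightarrow> tr_form k f (mscl X c x) = c * tr_form k f x"
    "a \<in> carr X \<Longrightarrow> i < k \<Longrightarrow> j < k \<Longrightarrow> tr_form k f (elt i j a) = f a i j"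
    "tr_form k f (scm X k P) = (\<Sum>i<k. P i i)"
    "x \<in> hmats X k \<Longrightarrow> Im (tr_form k f x) = 0"
proof -
  note lin = cp_map_linear[OF ucpD(2)[OF f]]
  have f0: "f 0 = 0" by (rule cp_map_0[OF operator_system_axioms ucpD(2)[OF f]])
  show "tr_form k f (x + y) = tr_form k f x + tr_form k f y" if x: "x \<in> mats k (carr X)" and y: "y \<in> mats k (carr X)"
  proof -
    have "f ((x + y) i j) i j = f (x i j) i j + f (y i j) i j" for i j
      using lin(2)[OF mats_entry[OF x] mats_entry[OF y], of i j i j] by (simp only: plus_fun_apply)
    then show ?thesis unfolding tr_form_def by (simp only: sum.distrib)
  qed
  show "tr_form k f (mscl X c x) = c * tr_form k f x" if x: "x \<in> mats k (carr X)"
  proof -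
    have "f (mscl X c x i j) i j = c * f (x i j) i j" for i j
      unfolding mscl_def lin(3)[OF mats_entry[OF x]] matalg_sel ..
    then show ?thesis unfolding tr_form_def by (simp only: sum_distrib_left)
  qed
  show "tr_form k f (elt i j a) = f a i j" if ij: "i < k" "j < k"
  proof -
    have "f (elt i j a p q) p q = (if q = j then if p = i then f a p q else 0 else 0)" for p q
      by (simp add: elt_def f0)
    then have "tr_form k f (elt i j a) = (\<Sum>p<k. \<Sum>q<k. if q = j then if p = i then f a p q else 0 else 0)"
      unfolding tr_form_def by (simp only:)
    also have "\<dots> = f a i j" using ij by simp
    finally show ?thesis .
  qed
  show "tr_form k f (scm X k P) = (\<Sum>i<k. P i i)"
  proof -
    have s: "f (scl X c (ounit X)) i j = (if j = i then if i < k then c else 0 else 0)" for c i j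
      unfolding lin(3)[OF ounit_closed] ucpD(3)[OF f] by simp
    have "f (scm X k P i j) i j = (if j = i then P i j else 0)" if "i < k" "j < k" for i j
      using that s by (simp add: scm_def)
    then have "tr_form k f (scm X k P) = (\<Sum>i<k. \<Sum>j<k. if j = i then P i j else 0)"
      unfolding tr_form_def by (intro sum.cong refl) simp
    then show ?thesis by simp
  qed
  show "Im (tr_form k f x) = 0" if x: "x \<in> hmats X k"
  proof -
    let ?u = "\<lambda>i p. if i = p then 1 else (0::complex)"
    have t: "tr_form k f x = sesq k k (amp f x) ?u ?u" unfolding sesq_unit_vectors tr_form_def amp_def ..
    have "sesq k k (amp f x) ?u ?u = cnj (sesq k k (amp f x) ?u ?u)" by (rule ucp_amp_hermitian[OF f x])
    from arg_cong[OF this, of Im] have "Im (sesq k k (amp f x) ?u ?u) = - Im (sesq k k (amp f x) ?u ?u)"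
      unfolding cnj.simps(2) .
    then show ?thesis unfolding t by linarith
  qed
qed

text \<open>Each matrix unit is a complex combination of two hermitian matrices.\<close>

lemma linear_elt:
  assumes add: "\<And>x y. x \<in> mats k (carr X) \<Longrightarrow> y \<in> mats k (carr X) \<Longrightarrow> T (x + y) = T x + (T y :: complex)"
    and scale: "\<And>c x. x \<in> mats k (carr X) \<Longrightarrow> T (mscl X c x) = c * T x"
    and x: "x \<in> mats k (carr X)" and y: "y \<in> mats k (carr X)"
  shows "T x = (T (x + y) - \<i> * T (mscl X \<i> x + mscl X (- \<i>) y)) / 2"
proof -
  have d: "T (mscl X \<i> x + mscl X (- \<i>) y) = \<i> * (T x - T y)"
    unfolding add[OF mats_mscl[OF x] mats_mscl[OF y]] scale[OF x] scale[OF y] by (simp add: right_diff_distrib)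
  have i: "\<i> * (\<i> * z) = - z" for z by (simp add: mult.assoc[symmetric])
  show ?thesis unfolding add[OF x y] d i by simp
qed

lemma elt_pair_hmats:
  assumes e: "e \<in> sa X" and ij: "i < k" "j < k"
  shows "elt i j e + elt j i e \<in> hmats X k" "mscl X \<i> (elt i j e) + mscl X (- \<i>) (elt j i e) \<in> hmats X k"
proof -
  note ec = saD(1)[OF e]
  have m: "elt i j e \<in> mats k (carr X)" "elt j i e \<in> mats k (carr X)" using ij by (auto intro: mats_elt ec)
  have a: "madj X k (elt p q e) = elt q p e" if "p < k" "q < k" for p q
    using that saD(2)[OF e] adj_0 by (auto simp: madj_def elt_def fun_eq_iff)
  show "elt i j e + elt j i e \<in> hmats X k"
    unfolding hmats_def mem_Collect_eq madj_add[OF m] a[OF ij] a[OF ij(2,1)]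
    by (intro conjI mats_add m) (simp only: add.commute)
  show "mscl X \<i> (elt i j e) + mscl X (- \<i>) (elt j i e) \<in> hmats X k"
    unfolding hmats_def mem_Collect_eq madj_add[OF mats_mscl[OF m(1)] mats_mscl[OF m(2)]] madj_mscl[OF m(1)] madj_mscl[OF m(2)] a[OF ij] a[OF ij(2,1)]
      complex_cnj_minus complex_cnj_i minus_minus
    by (intro conjI mats_add mats_mscl m) (simp only: add.commute)
qed

end

text \<open>The Hahn--Banach functional on pairs of matrices has components \<open>(1 + \<delta>) g\<close> and \<open>\<delta> h\<close>, as functionals.\<close>

lemma factor_pair:
  assumes X: "operator_system X" and \<phi>: "ucp X m \<phi>" and E: "module.subspace (scl X) E" "E \<subseteq> carr X" "ounit X \<in> E"
    and \<delta>: "0 < \<delta>" and f: "ucp X k f"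
    and ap: "\<And>e. e \<in> mats k E \<Longrightarrow> e \<in> hmats X k \<Longrightarrow> amp \<phi> e \<in> pos (matalg m) k \<Longrightarrow>
      munit (matalg m) k - amp \<phi> e \<in> pos (matalg m) k \<Longrightarrow> mscl X (complex_of_real \<delta>) (munit X k) + e \<in> pos X k"
  shows "\<exists>g h. ucp (matalg m) k g \<and> ucp (matalg m) k h \<and> (\<forall>e\<in>E \<inter> sa X. \<forall>i j.
    f e i j = complex_of_real (1 + \<delta>) * g (\<phi> e) i j - complex_of_real \<delta> * h (\<phi> e) i j)"
proof -
  interpret X: operator_system X by fact
  define M where "M = matalg m"
  interpret M: operator_system M unfolding M_def by (rule ucpD(4)[OF \<phi>])
  have \<phi>M: "cp_map X M \<phi>" "\<phi> (ounit X) = ounit M" unfolding M_def by (rule ucpD(2)[OF \<phi>], rule ucpD(3)[OF \<phi>])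
  note lin = cp_map_linear[OF \<phi>M(1)]
  have k: "1 \<le> k" by (rule ucpD(1)[OF f])
  have mE: "z \<in> mats k (carr X)" if "z \<in> mats k E" for z using that E(2) by (auto simp: mats_def)
  note Es = X.mats_subspace[OF E(1)]
  have aadd: "amp \<phi> (x + y) = amp \<phi> x + amp \<phi> y" if "x \<in> mats k (carr X)" "y \<in> mats k (carr X)" for x y
    by (rule X.ucp_amp_add[OF \<phi> that])
  have ascl: "amp \<phi> (mscl X c x) = mscl M c (amp \<phi> x)" if x: "x \<in> mats k (carr X)" for c x
    unfolding amp_def mscl_def lin(3)[OF X.mats_entry[OF x]] ..
  have ascm: "amp \<phi> (scm X k P) = scm M k P" for P unfolding M_def by (rule X.ucp_amp_scm[OF \<phi>])
  have ah: "amp \<phi> x \<in> hmats M k" if "x \<in> hmats X k" for x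
    by (rule amp_hmats[OF X M.operator_system_axioms \<phi>M(1) that])
  have am: "amp \<phi> x \<in> mats k (carr M)" if "x \<in> mats k (carr X)" for x by (rule cp_map_mats[OF X \<phi>M(1) that])
  note tr = X.tr_form_simps[OF f]
  have scm0: "scm Z k (\<lambda>i j. 0) = 0" if "operator_system Z" for Z :: "'z::ab_group_add opsys"
    using operator_system.scm_mscl[OF that, of k 0 "\<lambda>i j. 0"] operator_system.mscl_simps(7)[OF that] by simp
  have a0: "amp \<phi> 0 = 0" using ascm[of "\<lambda>i j. 0"] scm0[OF X] scm0[OF M.operator_system_axioms] by simp
  have t0: "tr_form k f 0 = 0" using tr(4)[of "\<lambda>i j. 0"] scm0[OF X] by simp
  \<comment> \<open>The pair w is dominated by the pair of \<phi> e and P - \<phi> e, and t is the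
    value that the functional should take on the latter. At w = 0 the requirement t \<ge> 0 is
    exactly \<open>almost_positive\<close>.\<close>
  define G where "G w t \<longleftrightarrow> (\<exists>e P. e \<in> mats k E \<and> e \<in> hmats X k \<and> (\<forall>i j. P j i = cnj (P i j)) \<and>
    t = Re (tr_form k f e) + \<delta> * Re (\<Sum>i<k. P i i) \<and>
    amp \<phi> e - fst w \<in> rpos M k \<and> (scm M k P - amp \<phi> e) - snd w \<in> rpos M k)" for w t
  define W where "W = mats k (carr M) \<times> mats k (carr M)"
  define sc where "sc r w = (mscl M (complex_of_real r) (fst w), mscl M (complex_of_real r) (snd w))" for r w
  have GI: "G w (Re (tr_form k f e) + \<delta> * Re (\<Sum>i<k. P i i))"
    if "e \<in> mats k E" "e \<in> hmats X k" "\<And>i j. P j i = cnj (P i j)" "amp \<phi> e - fst w \<in> rpos M k"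
      "(scm M k P - amp \<phi> e) - snd w \<in> rpos M k" for e P w
    unfolding G_def by (rule exI[of _ e], rule exI[of _ P], intro conjI allI refl) (fact that)+
  have r0: "0 \<in> rpos M k" by (rule M.pos_rpos[OF M.pos_0])
  have "\<exists>S. (\<forall>x\<in>W. \<forall>y\<in>W. S (x + y) = S x + S y) \<and> (\<forall>c. \<forall>x\<in>W. S (sc c x) = c * S x) \<and>
    (\<forall>x\<in>W. \<forall>t. G x t \<longrightarrow> S x \<le> t) \<and> (\<forall>t. (\<forall>s. G 0 s \<longrightarrow> t \<le> s) \<longrightarrow> t \<le> S 0)"
  proof (rule hahn_banach_cone)
    show V: "vector_space sc"
      by unfold_locales (simp_all add: sc_def M.mscl_simps prod_eq_iff)
    interpret V: vector_space sc by (rule V)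
    show "V.subspace W"
      by (rule V.subspaceI) (auto simp: W_def sc_def zero_prod_def intro: M.mats_intros)
    show "\<exists>t. G w t" if w: "w \<in> W" for w
    proof -
      have wm: "fst w \<in> mats k (carr M)" "snd w \<in> mats k (carr M)" using w by (auto simp: W_def)
      obtain s where s: "mscl M (complex_of_real s) (munit M k) - fst w \<in> rpos M k" using M.rpos_order_unit[OF wm(1)] by blast
      obtain s' where s': "mscl M (complex_of_real s') (munit M k) - snd w \<in> rpos M k" using M.rpos_order_unit[OF wm(2)] by blast
      \<comment> \<open>Scalar witnesses: e = s 1 dominates the first component, and P = s + s'
        leaves s' for the second. This e is admissible because the unit lies in
        \<open>E\<close>.\<close>
      let ?D = "\<lambda>r i j. if i = j then complex_of_real r else 0"
      have D: "?D r j i = cnj (?D r i j)" for i j :: nat and r :: real by simp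
      have "(scm M k (?D (s + s')) - amp \<phi> (scm X k (?D s))) = mscl M (complex_of_real s') (munit M k)"
        unfolding ascm M.scm_munit of_real_add M.mscl_simps(1) by simp
      then have "G w (Re (tr_form k f (scm X k (?D s))) + \<delta> * Re (\<Sum>i<k. ?D (s + s') i i))"
        using s s' by (intro GI Es(4) E(3) X.hmats_scm) (auto simp: ascm M.scm_munit)
      then show ?thesis by blast
    qed
    show "G (x + y) (s + t)" if "x \<in> W" "y \<in> W" and Gx: "G x s" and Gy: "G y t" for x y s t
    proof -
      obtain e P where e: "e \<in> mats k E" "e \<in> hmats X k" "\<forall>i j. P j i = cnj (P i j)"
        "s = Re (tr_form k f e) + \<delta> * Re (\<Sum>i<k. P i i)" "amp \<phi> e - fst x \<in> rpos M k" "(scm M k P - amp \<phi> e) - snd x \<in> rpos M k"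
        using Gx unfolding G_def by (elim exE conjE)
      obtain e' P' where e': "e' \<in> mats k E" "e' \<in> hmats X k" "\<forall>i j. P' j i = cnj (P' i j)"
        "t = Re (tr_form k f e') + \<delta> * Re (\<Sum>i<k. P' i i)" "amp \<phi> e' - fst y \<in> rpos M k" "(scm M k P' - amp \<phi> e') - snd y \<in> rpos M k"
        using Gy unfolding G_def by (elim exE conjE)
      have "G (x + y) (Re (tr_form k f (e + e')) + \<delta> * Re (\<Sum>i<k. P i i + P' i i))"
      proof (rule GI[of "e + e'" "\<lambda>i j. P i j + P' i j" "x + y"])
        show "e + e' \<in> mats k E" "e + e' \<in> hmats X k" by (rule Es(1)[OF e(1) e'(1)], rule X.hmats_add[OF e(2) e'(2)])
        show "P j i + P' j i = cnj (P i j + P' i j)" for i j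
          unfolding complex_cnj_add using e(3) e'(3) by metis
        show "amp \<phi> (e + e') - fst (x + y) \<in> rpos M k"
          unfolding aadd[OF mE[OF e(1)] mE[OF e'(1)]] fst_add add_diff_add by (rule M.rpos_add[OF e(5) e'(5)])
        show "scm M k (\<lambda>i j. P i j + P' i j) - amp \<phi> (e + e') - snd (x + y) \<in> rpos M k"
          unfolding aadd[OF mE[OF e(1)] mE[OF e'(1)]] M.scm_add snd_add add_diff_add by (rule M.rpos_add[OF e(6) e'(6)])
      qed
      moreover have "Re (tr_form k f (e + e')) + \<delta> * Re (\<Sum>i<k. P i i + P' i i) = s + t"
        unfolding tr(1)[OF mE[OF e(1)] mE[OF e'(1)]] e(4) e'(4) sum.distrib plus_complex.simps by (simp only: distrib_left ac_simps)
      ultimately show ?thesis by (simp only:)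
    qed
    show "G (sc c x) (c * t)" if "x \<in> W" and c: "0 < c" and Gx: "G x t" for x c t
    proof -
      obtain e P where e: "e \<in> mats k E" "e \<in> hmats X k" "\<forall>i j. P j i = cnj (P i j)"
        "t = Re (tr_form k f e) + \<delta> * Re (\<Sum>i<k. P i i)" "amp \<phi> e - fst x \<in> rpos M k" "(scm M k P - amp \<phi> e) - snd x \<in> rpos M k"
        using Gx unfolding G_def by (elim exE conjE)
      let ?c = "complex_of_real c"
      have c0: "0 \<le> c" using c by simp
      have "G (sc c x) (Re (tr_form k f (mscl X ?c e)) + \<delta> * Re (\<Sum>i<k. ?c * P i i))"
      proof (rule GI[of "mscl X ?c e" "\<lambda>i j. ?c * P i j" "sc c x"])
        show "mscl X ?c e \<in> mats k E" "mscl X ?c e \<in> hmats X k" by (rule Es(2)[OF e(1)], rule X.hmats_mscl[OF e(2)])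
        show "?c * P j i = cnj (?c * P i j)" for i j
          unfolding complex_cnj_mult complex_cnj_complex_of_real using e(3) by metis
        show "amp \<phi> (mscl X ?c e) - fst (sc c x) \<in> rpos M k"
          unfolding ascl[OF mE[OF e(1)]] sc_def fst_conv M.mscl_simps(3)[symmetric] by (rule M.rpos_mscl[OF e(5) c0])
        show "scm M k (\<lambda>i j. ?c * P i j) - amp \<phi> (mscl X ?c e) - snd (sc c x) \<in> rpos M k"
          unfolding ascl[OF mE[OF e(1)]] M.scm_mscl sc_def snd_conv M.mscl_simps(3)[symmetric] by (rule M.rpos_mscl[OF e(6) c0])
      qed
      moreover have "Re (tr_form k f (mscl X ?c e)) + \<delta> * Re (\<Sum>i<k. ?c * P i i) = c * t"
        unfolding tr(2)[OF mE[OF e(1)]] e(4) sum_distrib_left[symmetric] by (simp add: distrib_left)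
      ultimately show ?thesis by (simp only:)
    qed
    show "0 \<le> t" if G0: "G 0 t" for t
    proof -
      obtain e P where e: "e \<in> mats k E" "e \<in> hmats X k" "\<forall>i j. P j i = cnj (P i j)"
        "t = Re (tr_form k f e) + \<delta> * Re (\<Sum>i<k. P i i)" "amp \<phi> e \<in> rpos M k" "scm M k P - amp \<phi> e \<in> rpos M k"
        using G0 unfolding G_def fst_zero snd_zero diff_0_right by (elim exE conjE)
      have P: "P j i = cnj (P i j)" for i j using e(3) by blast
      have p1: "amp \<phi> e \<in> pos (matalg m) k" using e(5) M.rpos_hmats[OF ah[OF e(2)]] unfolding M_def by blast
      have p2: "scm (matalg m) k P - amp \<phi> e \<in> pos (matalg m) k"
        using e(6) M.rpos_hmats[OF M.hmats_diff[OF M.hmats_scm[of P, OF P] ah[OF e(2)]]] unfolding M_def by blast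
      have "- \<delta> * Re (\<Sum>i<k. P i i) \<le> Re (tr_form k f e)"
        unfolding tr_form_def by (rule almost_positive[OF X \<phi> E(1,2) less_imp_le[OF \<delta>] f P ap e(1,2) p1 p2])
      then show ?thesis unfolding e(4) by simp
    qed
    show "0 \<in> W" by (auto simp: W_def zero_prod_def intro: M.mats_0)
  qed
  then obtain S where Sadd: "\<forall>x\<in>W. \<forall>y\<in>W. S (x + y) = S x + S y" and Ssc: "\<forall>c. \<forall>x\<in>W. S (sc c x) = c * S x"
    and SG: "\<forall>x\<in>W. \<forall>t. G x t \<longrightarrow> S x \<le> t" by (elim exE conjE)
  have Sneg: "S (- a, - b) = - S (a, b)" if "(a, b) \<in> W" for a b
  proof -
    have "sc (- 1) (a, b) = (- a, - b)" by (simp add: sc_def M.mscl_simps)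
    then show ?thesis using Ssc that by (metis mult_minus1)
  qed
  define s1 where "s1 a = S (a, 0)" for a
  define s2 where "s2 b = S (0, b)" for b
  have W1: "(a, b) \<in> W" if "a \<in> mats k (carr M)" "b \<in> mats k (carr M)" for a b using that by (simp add: W_def)
  have S12: "S (a, b) = s1 a + s2 b" if "a \<in> mats k (carr M)" "b \<in> mats k (carr M)" for a b
  proof -
    have "(a, b) = (a, 0) + (0, b)" by simp
    then show ?thesis using Sadd W1[OF that(1) M.mats_0] W1[OF M.mats_0 that(2)] unfolding s1_def s2_def by metis
  qed
  have s1add: "s1 (x + y) = s1 x + s1 y" and s2add: "s2 (x + y) = s2 x + s2 y"
    if "x \<in> mats k (carr M)" "y \<in> mats k (carr M)" for x y
    using Sadd[THEN bspec, OF W1[OF that(1) M.mats_0], THEN bspec, OF W1[OF that(2) M.mats_0]]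
      Sadd[THEN bspec, OF W1[OF M.mats_0 that(1)], THEN bspec, OF W1[OF M.mats_0 that(2)]]
    unfolding s1_def s2_def by (simp_all only: add_Pair add_0_left)
  have s1sc: "s1 (mscl M (complex_of_real r) x) = r * s1 x" and s2sc: "s2 (mscl M (complex_of_real r) x) = r * s2 x"
    if "x \<in> mats k (carr M)" for r x
    using Ssc[THEN spec, of r, THEN bspec, OF W1[OF that M.mats_0]] Ssc[THEN spec, of r, THEN bspec, OF W1[OF M.mats_0 that]]
    unfolding s1_def s2_def sc_def fst_conv snd_conv M.mscl_simps(8) by simp_all
  have z0: "0 \<in> mats k E" "0 \<in> hmats X k" by (rule Es(3), rule X.hmats_0)
  \<comment> \<open>For a in \<open>rpos\<close> the choice e = 0, P = 0 already dominates the pair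
    (- a, 0), so S is at most 0 there.\<close>
  have s1pos: "0 \<le> s1 a" if a: "a \<in> rpos M k" for a
  proof -
    have aW: "(a, 0) \<in> W" by (rule W1[OF M.rpos_mats[OF a] M.mats_0])
    have G: "G (- a, - 0) (Re (tr_form k f 0) + \<delta> * Re (\<Sum>i<k. (\<lambda>i j. 0) i i))"
    proof (rule GI[OF z0])
      show "amp \<phi> 0 - fst (- a, - 0) \<in> rpos M k" "scm M k (\<lambda>i j. 0) - amp \<phi> 0 - snd (- a, - 0) \<in> rpos M k"
        using a r0 by (simp_all only: a0 scm0[OF M.operator_system_axioms] fst_conv snd_conv minus_zero diff_self diff_zero diff_minus_eq_add add_0_left)
    qed simp
    have "S (- a, - 0) \<le> Re (tr_form k f 0) + \<delta> * Re (\<Sum>i<k. (\<lambda>i j. 0) i i)"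
      by (rule SG[THEN bspec, OF W1[OF M.mats_neg[OF M.rpos_mats[OF a]] M.mats_neg[OF M.mats_0]], THEN spec, THEN mp, OF G])
    then have "S (- a, - 0) \<le> 0" by (simp only: t0 sum.neutral_const mult_zero_right zero_complex.simps add_0_left)
    then show ?thesis unfolding Sneg[OF aW] s1_def by simp
  qed
  have s2pos: "0 \<le> s2 a" if a: "a \<in> rpos M k" for a
  proof -
    have aW: "(0, a) \<in> W" by (rule W1[OF M.mats_0 M.rpos_mats[OF a]])
    have G: "G (- 0, - a) (Re (tr_form k f 0) + \<delta> * Re (\<Sum>i<k. (\<lambda>i j. 0) i i))"
    proof (rule GI[OF z0])
      show "amp \<phi> 0 - fst (- 0, - a) \<in> rpos M k" "scm M k (\<lambda>i j. 0) - amp \<phi> 0 - snd (- 0, - a) \<in> rpos M k"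
        using a r0 by (simp_all only: a0 scm0[OF M.operator_system_axioms] fst_conv snd_conv minus_zero diff_self diff_zero diff_minus_eq_add add_0_left)
    qed simp
    have "S (- 0, - a) \<le> Re (tr_form k f 0) + \<delta> * Re (\<Sum>i<k. (\<lambda>i j. 0) i i)"
      by (rule SG[THEN bspec, OF W1[OF M.mats_neg[OF M.mats_0] M.mats_neg[OF M.rpos_mats[OF a]]], THEN spec, THEN mp, OF G])
    then have "S (- 0, - a) \<le> 0" by (simp only: t0 sum.neutral_const mult_zero_right zero_complex.simps add_0_left)
    then show ?thesis unfolding Sneg[OF aW] s2_def by simp
  qed
  have key_le: "s1 (amp \<phi> e) + s2 (scm M k P - amp \<phi> e) \<le> Re (tr_form k f e) + \<delta> * Re (\<Sum>i<k. P i i)"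
    if e: "e \<in> mats k E" "e \<in> hmats X k" and P: "\<And>i j. P j i = cnj (P i j)" for e P
  proof -
    have m: "amp \<phi> e \<in> mats k (carr M)" "scm M k P - amp \<phi> e \<in> mats k (carr M)"
      by (intro M.mats_diff am mE e M.mats_scm)+
    have "G (amp \<phi> e, scm M k P - amp \<phi> e) (Re (tr_form k f e) + \<delta> * Re (\<Sum>i<k. P i i))"
      using r0 by (intro GI e P) simp_all
    then show ?thesis using SG W1[OF m] unfolding S12[OF m, symmetric] by blast
  qed
  have s1neg: "s1 (- x) = - s1 x" and s2neg: "s2 (- x) = - s2 x" if "x \<in> mats k (carr M)" for x
    using s1sc[OF that, of "- 1"] s2sc[OF that, of "- 1"] by (simp_all add: M.mscl_simps)
  \<comment> \<open>Both sides are real linear in e and P, so the inequality at - e and - P is the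
    reverse one.\<close>
  have key: "s1 (amp \<phi> e) + s2 (scm M k P - amp \<phi> e) = Re (tr_form k f e) + \<delta> * Re (\<Sum>i<k. P i i)"
    if e: "e \<in> mats k E" "e \<in> hmats X k" and P: "\<And>i j. P j i = cnj (P i j)" for e P
  proof (rule antisym[OF key_le[OF e P]])
    have m: "amp \<phi> e \<in> mats k (carr M)" "scm M k P - amp \<phi> e \<in> mats k (carr M)"
      by (intro M.mats_diff am mE e M.mats_scm)+
    let ?n = "complex_of_real (- 1)"
    have ne: "amp \<phi> (mscl X ?n e) = - amp \<phi> e" unfolding ascl[OF mE[OF e(1)]] by (simp add: M.mscl_simps)
    have np: "scm M k (\<lambda>i j. ?n * P i j) = - scm M k P" unfolding M.scm_mscl by (simp add: M.mscl_simps)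
    have "s1 (amp \<phi> (mscl X ?n e)) + s2 (scm M k (\<lambda>i j. ?n * P i j) - amp \<phi> (mscl X ?n e)) \<le>
      Re (tr_form k f (mscl X ?n e)) + \<delta> * Re (\<Sum>i<k. ?n * P i i)"
    proof (rule key_le)
      show "mscl X ?n e \<in> mats k E" "mscl X ?n e \<in> hmats X k" by (rule Es(2)[OF e(1)], rule X.hmats_mscl[OF e(2)])
      show "?n * P j i = cnj (?n * P i j)" for i j
        unfolding complex_cnj_mult complex_cnj_complex_of_real by (rule arg_cong[OF P])
    qed
    moreover have "- scm M k P - - amp \<phi> e = - (scm M k P - amp \<phi> e)" by simp
    moreover have "Re (tr_form k f (mscl X ?n e)) = - Re (tr_form k f e)" unfolding tr(2)[OF mE[OF e(1)]] by simp
    moreover have "Re (\<Sum>i<k. ?n * P i i) = - Re (\<Sum>i<k. P i i)" unfolding sum_distrib_left[symmetric] by simp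
    ultimately have "- s1 (amp \<phi> e) - s2 (scm M k P - amp \<phi> e) \<le> - Re (tr_form k f e) - \<delta> * Re (\<Sum>i<k. P i i)"
      unfolding ne np by (simp only: s1neg[OF m(1)] s2neg[OF m(2)] mult_minus_right)
    then show "Re (tr_form k f e) + \<delta> * Re (\<Sum>i<k. P i i) \<le> s1 (amp \<phi> e) + s2 (scm M k P - amp \<phi> e)" by linarith
  qed
  have s0: "s1 0 = 0" "s2 0 = 0" using s1add[OF M.mats_0 M.mats_0] s2add[OF M.mats_0 M.mats_0] by simp_all
  \<comment> \<open>P = 0 and e = 0 separate what the equation says: the difference of the two
    functionals on \<phi> e represents f, and the second functional is \<delta> times the trace on
    scalar matrices.\<close>
  have key1: "s1 (amp \<phi> e) - s2 (amp \<phi> e) = Re (tr_form k f e)" if e: "e \<in> mats k E" "e \<in> hmats X k" for e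
    using key[OF e, of "\<lambda>i j. 0"] s2neg[OF am[OF mE[OF e(1)]]] by (simp add: scm0[OF M.operator_system_axioms])
  have key2: "s2 (scm M k P) = \<delta> * Re (\<Sum>i<k. P i i)" if P: "\<And>i j. P j i = cnj (P i j)" for P
    using key[OF z0, of P, OF P] by (simp only: a0 s0 t0 diff_0_right) simp
  define T1 where "T1 = (\<lambda>z. complex_of_real (s1 z) - \<i> * complex_of_real (s1 (mscl M \<i> z)))"
  define T2 where "T2 = (\<lambda>z. complex_of_real (s2 z) - \<i> * complex_of_real (s2 (mscl M \<i> z)))"
  note sa1 = s1add s1sc s1pos
  have T1: "x \<in> mats k (carr M) \<Longrightarrow> y \<in> mats k (carr M) \<Longrightarrow> T1 (x + y) = T1 x + T1 y"
    "x \<in> mats k (carr M) \<Longrightarrow> T1 (mscl M c x) = c * T1 x" "x \<in> hmats M k \<Longrightarrow> T1 x = complex_of_real (s1 x)"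
    "x \<in> pos M k \<Longrightarrow> T1 x \<in> \<real>\<^sub>\<ge>\<^sub>0" for x y c
  proof -
    show "T1 (x + y) = T1 x + T1 y" if "x \<in> mats k (carr M)" "y \<in> mats k (carr M)"
      unfolding T1_def by (rule M.complexify(1)[of k s1]) (fact sa1 that)+
    show "T1 (mscl M c x) = c * T1 x" if "x \<in> mats k (carr M)"
      unfolding T1_def by (rule M.complexify(2)[of k s1]) (fact sa1 that)+
    show "T1 x = complex_of_real (s1 x)" if "x \<in> hmats M k"
      unfolding T1_def by (rule M.complexify(3)[of k s1]) (fact sa1 that)+
    show "T1 x \<in> \<real>\<^sub>\<ge>\<^sub>0" if "x \<in> pos M k"
      unfolding T1_def by (rule M.complexify(4)[of k s1]) (fact sa1 that)+
  qed
  note sa2 = s2add s2sc s2pos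
  have T2: "x \<in> mats k (carr M) \<Longrightarrow> y \<in> mats k (carr M) \<Longrightarrow> T2 (x + y) = T2 x + T2 y"
    "x \<in> mats k (carr M) \<Longrightarrow> T2 (mscl M c x) = c * T2 x" "x \<in> hmats M k \<Longrightarrow> T2 x = complex_of_real (s2 x)"
    "x \<in> pos M k \<Longrightarrow> T2 x \<in> \<real>\<^sub>\<ge>\<^sub>0" for x y c
  proof -
    show "T2 (x + y) = T2 x + T2 y" if "x \<in> mats k (carr M)" "y \<in> mats k (carr M)"
      unfolding T2_def by (rule M.complexify(1)[of k s2]) (fact sa2 that)+
    show "T2 (mscl M c x) = c * T2 x" if "x \<in> mats k (carr M)"
      unfolding T2_def by (rule M.complexify(2)[of k s2]) (fact sa2 that)+
    show "T2 x = complex_of_real (s2 x)" if "x \<in> hmats M k"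
      unfolding T2_def by (rule M.complexify(3)[of k s2]) (fact sa2 that)+
    show "T2 x \<in> \<real>\<^sub>\<ge>\<^sub>0" if "x \<in> pos M k"
      unfolding T2_def by (rule M.complexify(4)[of k s2]) (fact sa2 that)+
  qed
  \<comment> \<open>The vanishing of Q is known for hermitian matrices over \<open>E\<close> only;
    \<open>linear_elt\<close> carries it over to matrix units with self-adjoint entry.\<close>
  define Q where "Q z = T1 (amp \<phi> z) - T2 (amp \<phi> z) - tr_form k f z" for z
  have Q0: "Q z = 0" if z: "z \<in> mats k E" "z \<in> hmats X k" for z
    unfolding Q_def T1(3)[OF ah[OF z(2)]] T2(3)[OF ah[OF z(2)]] of_real_diff[symmetric] key1[OF z]
    using tr(5)[OF z(2)] by (simp add: complex_eq_iff)
  have Qadd: "Q (x + y) = Q x + Q y" if "x \<in> mats k (carr X)" "y \<in> mats k (carr X)" for x y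
    unfolding Q_def aadd[OF that] T1(1)[OF am[OF that(1)] am[OF that(2)]] T2(1)[OF am[OF that(1)] am[OF that(2)]] tr(1)[OF that] by simp
  have Qscl: "Q (mscl X c x) = c * Q x" if "x \<in> mats k (carr X)" for c x
    unfolding Q_def ascl[OF that] T1(2)[OF am[OF that]] T2(2)[OF am[OF that]] tr(2)[OF that] by (simp only: right_diff_distrib)
  have diff: "T1 (elt i j (\<phi> e)) - T2 (elt i j (\<phi> e)) = f e i j" if e: "e \<in> E" "e \<in> sa X" and ij: "i < k" "j < k" for e i j
  proof -
    have m: "elt i j e \<in> mats k E" "elt j i e \<in> mats k E" by (rule Es(5)[OF e(1) ij], rule Es(5)[OF e(1) ij(2,1)])
    have "Q (elt i j e) = (Q (elt i j e + elt j i e) - \<i> * Q (mscl X \<i> (elt i j e) + mscl X (- \<i>) (elt j i e))) / 2"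
      by (rule X.linear_elt[OF Qadd Qscl mE[OF m(1)] mE[OF m(2)]])
    also have "\<dots> = 0"
      using Q0[OF Es(1)[OF m] X.elt_pair_hmats(1)[OF e(2) ij]]
        Q0[OF Es(1)[OF Es(2)[OF m(1)] Es(2)[OF m(2)]] X.elt_pair_hmats(2)[OF e(2) ij]] by simp
    finally have "T1 (elt i j (\<phi> e)) - T2 (elt i j (\<phi> e)) - tr_form k f (elt i j e) = 0"
      unfolding Q_def amp_elt[of \<phi>, OF cp_map_0[OF X \<phi>M(1)]] .
    then show ?thesis unfolding tr(3)[OF saD(1)[OF e(2)] ij] by simp
  qed
  \<comment> \<open>The second functional is \<delta> times the trace on scalar matrices, so its
    Choi map takes the value \<delta> at the unit. The equation for f at the unit then gives 1 +
    \<delta> for the first one, and division by these numbers makes both maps unital.\<close>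
  have T2u: "T2 (elt i j (ounit M)) = (if i = j then complex_of_real \<delta> else 0)" if ij: "i < k" "j < k" for i j
  proof -
    have m: "elt i j (ounit M) \<in> mats k (carr M)" "elt j i (ounit M) \<in> mats k (carr M)"
      using ij by (auto intro: M.mats_elt M.ounit_closed)
    let ?P = "\<lambda>p q. (if p = i \<and> q = j then 1 else 0) + (if p = j \<and> q = i then 1 else (0::complex))"
    let ?R = "\<lambda>p q. (if p = i \<and> q = j then \<i> else 0) + (if p = j \<and> q = i then - \<i> else (0::complex))"
    have sI: "scl M (if b then c else 0) x = (if b then scl M c x else 0)"
      and sI': "scl M c (if b then x else 0) = (if b then scl M c x else 0)" for b c x by simp_all
    have eP: "elt i j (ounit M) + elt j i (ounit M) = scm M k ?P"
    proof (rule ext, rule ext)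
      fix p q
      show "(elt i j (ounit M) + elt j i (ounit M)) p q = scm M k ?P p q"
      proof (cases "p < k \<and> q < k")
        case True
        show ?thesis unfolding scm_def if_P[OF True] elt_def mscl_def plus_fun_apply M.scale_left_distrib sI sI' M.scale_one ..
      next
        case False
        have n: "\<not> (p = i \<and> q = j)" "\<not> (p = j \<and> q = i)" using False ij by auto
        show ?thesis unfolding scm_def if_not_P[OF False] elt_def mscl_def plus_fun_apply if_not_P[OF n(1)] if_not_P[OF n(2)] M.scale_zero_right
          by (simp add: fun_eq_iff)
      qed
    qed
    have eR: "mscl M \<i> (elt i j (ounit M)) + mscl M (- \<i>) (elt j i (ounit M)) = scm M k ?R"
    proof (rule ext, rule ext)
      fix p q
      show "(mscl M \<i> (elt i j (ounit M)) + mscl M (- \<i>) (elt j i (ounit M))) p q = scm M k ?R p q"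
      proof (cases "p < k \<and> q < k")
        case True
        show ?thesis unfolding scm_def if_P[OF True] elt_def mscl_def plus_fun_apply M.scale_left_distrib sI sI' M.scale_one ..
      next
        case False
        have n: "\<not> (p = i \<and> q = j)" "\<not> (p = j \<and> q = i)" using False ij by auto
        show ?thesis unfolding scm_def if_not_P[OF False] elt_def mscl_def plus_fun_apply if_not_P[OF n(1)] if_not_P[OF n(2)] M.scale_zero_right
          by (simp add: fun_eq_iff)
      qed
    qed
    have hc: "cnj (if b then c else 0) = (if b then cnj c else 0)" for b c by simp
    have hP: "?P q p = cnj (?P p q)" and hR: "?R q p = cnj (?R p q)" for p q
    proof -
      have cj: "(q = i \<and> p = j) = (p = j \<and> q = i)" "(q = j \<and> p = i) = (p = i \<and> q = j)" by blast+
      show "?P q p = cnj (?P p q)" unfolding complex_cnj_add hc complex_cnj_one cj by (rule add.commute)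
      show "?R q p = cnj (?R p q)" unfolding complex_cnj_add hc complex_cnj_minus complex_cnj_i minus_minus cj by (rule add.commute)
    qed
    have d: "(if p = i \<and> p = j then c else 0) = (if p = i then if i = j then c else 0 else 0)"
      "(if p = j \<and> p = i then c else 0) = (if p = i then if i = j then c else 0 else (0::complex))" for p c by auto
    have tP: "(\<Sum>p<k. ?P p p) = (if i = j then 2 else 0)" unfolding sum.distrib d using ij by simp
    have tR: "(\<Sum>p<k. ?R p p) = 0" unfolding sum.distrib d using ij by simp
    have "T2 (elt i j (ounit M)) = (T2 (elt i j (ounit M) + elt j i (ounit M)) -
        \<i> * T2 (mscl M \<i> (elt i j (ounit M)) + mscl M (- \<i>) (elt j i (ounit M)))) / 2"
      by (rule M.linear_elt[OF T2(1,2) m])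
    also have "\<dots> = (complex_of_real (\<delta> * Re (if i = j then 2 else 0)) - \<i> * complex_of_real (\<delta> * Re 0)) / 2"
      unfolding eP eR T2(3)[OF M.hmats_scm[of ?P, OF hP]] T2(3)[OF M.hmats_scm[of ?R, OF hR]] key2[of ?P, OF hP] key2[of ?R, OF hR] tP tR ..
    also have "\<dots> = (if i = j then complex_of_real \<delta> else 0)" by simp
    finally show ?thesis .
  qed
  have T1u: "T1 (elt i j (ounit M)) = (if i = j then complex_of_real (1 + \<delta>) else 0)" if ij: "i < k" "j < k" for i j
  proof -
    have "T1 (elt i j (ounit M)) - T2 (elt i j (ounit M)) = ounit (matalg k) i j"
      using diff[OF E(3) X.sa_ounit ij] unfolding \<phi>M(2) ucpD(3)[OF f] .
    then have "T1 (elt i j (ounit M)) = ounit (matalg k) i j + (if i = j then complex_of_real \<delta> else 0)"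
      unfolding T2u[OF ij] diff_eq_eq .
    then show ?thesis using ij by simp
  qed
  have scaled: "ucp M k (choi k (\<lambda>z. complex_of_real (inverse c) * T z))"
    if c: "0 < c" and T: "\<And>x y. x \<in> mats k (carr M) \<Longrightarrow> y \<in> mats k (carr M) \<Longrightarrow> T (x + y) = T x + T y"
      "\<And>c x. x \<in> mats k (carr M) \<Longrightarrow> T (mscl M c x) = c * T x" "\<And>x. x \<in> pos M k \<Longrightarrow> T x \<in> \<real>\<^sub>\<ge>\<^sub>0"
      and Tu: "\<And>i j. i < k \<Longrightarrow> j < k \<Longrightarrow> T (elt i j (ounit M)) = (if i = j then complex_of_real c else 0)" for c T
    unfolding ucp_def
  proof (intro conjI k)
    show "cp_map M (matalg k) (choi k (\<lambda>z. complex_of_real (inverse c) * T z))"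
    proof (rule M.choi_cp)
      show "complex_of_real (inverse c) * T (x + y) = complex_of_real (inverse c) * T x + complex_of_real (inverse c) * T y"
        if "x \<in> mats k (carr M)" "y \<in> mats k (carr M)" for x y unfolding T(1)[OF that] by (rule distrib_left)
      show "complex_of_real (inverse c) * T (mscl M b x) = b * (complex_of_real (inverse c) * T x)"
        if "x \<in> mats k (carr M)" for b x unfolding T(2)[OF that] by (rule mult.left_commute)
      show "complex_of_real (inverse c) * T x \<in> \<real>\<^sub>\<ge>\<^sub>0" if "x \<in> pos M k" for x
        by (rule nonneg_Reals_mult_I[OF _ T(3)[OF that]]) (use c in simp)
    qed
    have "choi k (\<lambda>z. complex_of_real (inverse c) * T z) (ounit M) i j = ounit (matalg k) i j" for i j
      using c Tu by (auto simp: choi_def)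
    then show "choi k (\<lambda>z. complex_of_real (inverse c) * T z) (ounit M) = ounit (matalg k)" by (intro ext)
  qed
  define g where "g = choi k (\<lambda>z. complex_of_real (inverse (1 + \<delta>)) * T1 z)"
  define h where "h = choi k (\<lambda>z. complex_of_real (inverse \<delta>) * T2 z)"
  have d1: "0 < 1 + \<delta>" using \<delta> by simp
  have g: "ucp M k g" unfolding g_def by (rule scaled[OF d1 T1(1,2,4) T1u])
  have h: "ucp M k h" unfolding h_def by (rule scaled[OF \<delta> T2(1,2,4) T2u])
  have "f e i j = complex_of_real (1 + \<delta>) * g (\<phi> e) i j - complex_of_real \<delta> * h (\<phi> e) i j"
    if e: "e \<in> E" "e \<in> sa X" for e i j
  proof (cases "i < k \<and> j < k")
    case True
    have c: "complex_of_real c * (complex_of_real (inverse c) * z) = z" if "0 < c" for c z using that by simp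
    show ?thesis unfolding g_def h_def choi_def using True diff[OF e] by (simp only: c[OF d1] c[OF \<delta>] if_True simp_thms)
  next
    case False
    have "f e i j = 0" using cp_map_linear(1)[OF ucpD(2)[OF f] saD(1)[OF e(2)]] False by (auto simp: mats_def)
    then show ?thesis using False unfolding g_def h_def choi_def by auto
  qed
  then show ?thesis using g h unfolding M_def by blast
qed

text \<open>The order hypothesis of \<open>factor_pair\<close> is a norm bound in disguise: if 0
  \<le> \<phi> e \<le> 1, then 1 - 2 e has an image of norm at most 1, hence itself norm at most 1 +
  2 \<delta>, and so e \<ge> - \<delta>. The resulting maps satisfy f - g \<phi> = \<delta> (g
  \<phi> - h \<phi>), which has the stated bound by contractivity.\<close>

theorem approx_factor:
  assumes X: "operator_system X" and \<phi>: "ucp X m \<phi>" and E: "module.subspace (scl X) E" "E \<subseteq> carr X" "ounit X \<in> E"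
    and \<delta>: "0 < \<delta>" and f: "ucp X k f"
    and nb: "\<forall>n. \<forall>x\<in>mats n E. mnorm X n x \<le> (1 + 2 * \<delta>) * mnorm (matalg m) n (amp \<phi> x)"
  shows "\<exists>g. ucp (matalg m) k g \<and> (\<forall>e\<in>E \<inter> sa X. opsys_norm (matalg k) (f e - g (\<phi> e)) \<le> 2 * \<delta> * opsys_norm X e)"
proof -
  interpret X: operator_system X by fact
  define M where "M = matalg m"
  interpret M: operator_system M unfolding M_def by (rule ucpD(4)[OF \<phi>])
  interpret K: operator_system "matalg k" by (rule ucpD(4)[OF f])
  have "\<exists>g h. ucp (matalg m) k g \<and> ucp (matalg m) k h \<and> (\<forall>e\<in>E \<inter> sa X. \<forall>i j.
    f e i j = complex_of_real (1 + \<delta>) * g (\<phi> e) i j - complex_of_real \<delta> * h (\<phi> e) i j)"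
  proof (rule factor_pair[OF X \<phi> E \<delta> f])
    fix e assume e: "e \<in> mats k E" "e \<in> hmats X k" "amp \<phi> e \<in> pos (matalg m) k" "munit (matalg m) k - amp \<phi> e \<in> pos (matalg m) k"
    have em: "e \<in> mats k (carr X)" by (rule X.hmats_mats[OF e(2)])
    define z where "z = scm X k (\<lambda>i j. if i = j then 1 else 0) + mscl X (complex_of_real (- 2)) e"
    have zu: "z = munit X k + mscl X (complex_of_real (- 2)) e" unfolding z_def X.scm_munit X.mscl_simps(6) ..
    have zE: "z \<in> mats k E" unfolding z_def
      by (intro X.mats_subspace(1)[OF E(1)] X.mats_subspace(2)[OF E(1)] X.mats_subspace(4)[OF E(1,3)] e(1))
    have zh: "z \<in> hmats X k" unfolding zu by (intro X.hmats_add X.hmats_munit X.hmats_mscl e(2))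
    have lin: "linear_into (scl X) (carr X) (scl M) (carr M) \<phi>" using ucpD(2)[OF \<phi>] unfolding M_def cp_map_def by blast
    have az: "amp \<phi> z = munit M k + mscl M (complex_of_real (- 2)) (amp \<phi> e)"
      unfolding zu X.ucp_amp_add[OF \<phi> X.mats_munit X.mats_mscl[OF em]] amp_mscl_linear[OF lin em X.carr_0]
        X.ucp_amp_munit[OF \<phi>] M_def ..
    have azh: "amp \<phi> z \<in> hmats M k"
      by (rule amp_hmats[OF X M.operator_system_axioms _ zh]) (use ucpD(2)[OF \<phi>] in \<open>simp only: M_def\<close>)
    have p: "amp \<phi> e \<in> pos M k" "munit M k - amp \<phi> e \<in> pos M k" using e(3,4) unfolding M_def by blast+
    have "mscl M (complex_of_real 1) (munit M k) + amp \<phi> z = mscl M (complex_of_real 2) (munit M k - amp \<phi> e)"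
      unfolding az using M.mscl_simps(1)[of 1 1 "munit M k"] by (simp add: M.mscl_simps)
    moreover have "mscl M (complex_of_real 1) (munit M k) - amp \<phi> z = mscl M (complex_of_real 2) (amp \<phi> e)"
      unfolding az by (simp add: M.mscl_simps)
    ultimately have "mnorm M k (amp \<phi> z) \<le> 1"
      using M.hermitian_mnorm_le_iff[OF azh, of 1] M.pos_mscl[OF p(1), of 2] M.pos_mscl[OF p(2), of 2] by simp
    then have "(1 + 2 * \<delta>) * mnorm M k (amp \<phi> z) \<le> (1 + 2 * \<delta>) * 1" using \<delta> by (intro mult_left_mono) auto
    then have "mnorm X k z \<le> 1 + 2 * \<delta>" using nb zE unfolding M_def by fastforce
    then have "mscl X (complex_of_real (1 + 2 * \<delta>)) (munit X k) - z \<in> pos X k"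
      using X.hermitian_mnorm_le_iff[OF zh, of "1 + 2 * \<delta>"] \<delta> by simp
    from X.pos_mscl[OF this, of "1/2"]
    have "mscl X (complex_of_real (1/2)) (mscl X (complex_of_real (1 + 2 * \<delta>)) (munit X k) - z) \<in> pos X k" by simp
    also have "mscl X (complex_of_real (1/2)) (mscl X (complex_of_real (1 + 2 * \<delta>)) (munit X k) - z) =
      mscl X (complex_of_real \<delta>) (munit X k) + e"
      unfolding zu of_real_add of_real_1 X.mscl_simps(1,6) by (simp add: X.mscl_simps)
    finally show "mscl X (complex_of_real \<delta>) (munit X k) + e \<in> pos X k" .
  qed
  then obtain g h where gh: "ucp M k g" "ucp M k h" "\<forall>e\<in>E \<inter> sa X. \<forall>i j.
    f e i j = complex_of_real (1 + \<delta>) * g (\<phi> e) i j - complex_of_real \<delta> * h (\<phi> e) i j" unfolding M_def by (elim exE conjE)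
  have "opsys_norm (matalg k) (f e - g (\<phi> e)) \<le> 2 * \<delta> * opsys_norm X e" if e: "e \<in> E \<inter> sa X" for e
  proof -
    have ec: "e \<in> carr X" using e E(2) by blast
    have \<phi>e: "\<phi> e \<in> carr M" using cp_map_linear(1)[OF ucpD(2)[OF \<phi>] ec] unfolding M_def .
    note gc = cp_map_linear(1)[OF ucpD(2)[OF gh(1)] \<phi>e] and hc = cp_map_linear(1)[OF ucpD(2)[OF gh(2)] \<phi>e]
    have "f e - g (\<phi> e) = scl (matalg k) (complex_of_real \<delta>) (g (\<phi> e) - h (\<phi> e))"
      using gh(3) e by (intro ext) (simp add: algebra_simps)
    then have "opsys_norm (matalg k) (f e - g (\<phi> e)) = \<delta> * opsys_norm (matalg k) (g (\<phi> e) - h (\<phi> e))"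
      using K.opsys_norm_scl[OF K.carr_diff[OF gc hc], of "complex_of_real \<delta>"] \<delta> by (simp only: norm_of_real abs_of_pos)
    also have "\<dots> \<le> \<delta> * (opsys_norm X e + opsys_norm X e)"
    proof (intro mult_left_mono order_trans[OF K.opsys_norm_diff[OF gc hc]] add_mono less_imp_le[OF \<delta>])
      have \<phi>n: "opsys_norm M (\<phi> e) \<le> opsys_norm X e" unfolding M_def by (rule ucp_opsys_norm_le[OF X \<phi> ec])
      show "opsys_norm (matalg k) (g (\<phi> e)) \<le> opsys_norm X e" "opsys_norm (matalg k) (h (\<phi> e)) \<le> opsys_norm X e"
        using ucp_opsys_norm_le[OF M.operator_system_axioms gh(1) \<phi>e] ucp_opsys_norm_le[OF M.operator_system_axioms gh(2) \<phi>e] \<phi>n by linarith+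
    qed
    finally show ?thesis by simp
  qed
  then show ?thesis using gh(1) unfolding M_def by blast
qed

section \<open>Products of matrix algebras\<close>

text \<open>Needed for the bounded elements of a product to be closed under the involution.\<close>

lemma (in operator_system) opsys_norm_adj:
  assumes x: "x \<in> carr X"
  shows "opsys_norm X (adj X x) \<le> opsys_norm X x"
proof -
  have m: "elt 0 0 x \<in> mats 1 (carr X)" "elt 0 0 (adj X x) \<in> mats 1 (carr X)"
    by (intro mats_elt adj_closed x; simp)+
  have "mnorm X 1 (elt 0 0 (adj X x)) \<le> mnorm X 1 (elt 0 0 x)"
  proof (rule mnorm_leI[OF m(2) mnorm_nonneg[OF m(1)]])
    fix k f and \<xi> \<eta> :: "nat \<Rightarrow> nat \<Rightarrow> complex" assume f: "ucp X k f"
    have "amp f (elt 0 0 (adj X x)) = (\<lambda>i j p q. cnj (amp f (elt 0 0 x) j i q p))"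
      using cp_map_adj[OF operator_system_axioms ucpD(4)[OF f] ucpD(2)[OF f] x] cp_map_0[OF operator_system_axioms ucpD(2)[OF f]]
      by (auto simp: amp_def elt_def fun_eq_iff)
    then have s: "sesq 1 k (amp f (elt 0 0 (adj X x))) \<xi> \<eta> = cnj (sesq 1 k (amp f (elt 0 0 x)) \<eta> \<xi>)" by (simp only: sesq_adj)
    show "2 * cmod (sesq 1 k (amp f (elt 0 0 (adj X x))) \<xi> \<eta>) \<le> mnorm X 1 (elt 0 0 x) * (sqn 1 k \<xi> + sqn 1 k \<eta>)"
      using mnormD[OF m(1) f order_refl, of \<eta> \<xi>] unfolding s complex_mod_cnj by (simp only: add.commute)
  qed
  then show ?thesis unfolding opsys_norm_elt .
qed

text \<open>The \<open>\<ell>\<^sup>\<infinity>\<close>-product of the matrix algebras of sizes \<open>d i\<close>, \<open>i \<in> I\<close>.\<close>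

definition prod_carr :: "'i set \<Rightarrow> ('i \<Rightarrow> nat) \<Rightarrow> ('i \<Rightarrow> nat \<Rightarrow> nat \<Rightarrow> complex) set" where
  "prod_carr I d = {v. (\<forall>i. if i \<in> I then v i \<in> carr (matalg (d i)) else v i = 0) \<and>
     (\<exists>r. \<forall>i\<in>I. opsys_norm (matalg (d i)) (v i) \<le> r)}"

definition prod_sys :: "'i set \<Rightarrow> ('i \<Rightarrow> nat) \<Rightarrow> ('i \<Rightarrow> nat \<Rightarrow> nat \<Rightarrow> complex) opsys" where
  "prod_sys I d = \<lparr>
     carr = prod_carr I d,
     scl = (\<lambda>c v i p q. c * v i p q),
     adj = (\<lambda>v i p q. cnj (v i q p)),
     ounit = (\<lambda>i. if i \<in> I then ounit (matalg (d i)) else 0),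
     pos = (\<lambda>n. {x \<in> mats n (prod_carr I d). \<forall>i\<in>I. amp (\<lambda>v. v i) x \<in> pos (matalg (d i)) n}) \<rparr>"

lemma prod_sys_sel:
  "carr (prod_sys I d) = prod_carr I d" "scl (prod_sys I d) = (\<lambda>c v i p q. c * v i p q)"
  "adj (prod_sys I d) = (\<lambda>v i p q. cnj (v i q p))"
  "ounit (prod_sys I d) = (\<lambda>i. if i \<in> I then ounit (matalg (d i)) else 0)"
  "pos (prod_sys I d) n = {x \<in> mats n (prod_carr I d). \<forall>i\<in>I. amp (\<lambda>v. v i) x \<in> pos (matalg (d i)) n}"
  by (simp_all add: prod_sys_def)

lemma sum_fun_apply: "(\<Sum>a\<in>A. f a) p = (\<Sum>a\<in>A. f a p)"
  by (induction A rule: infinite_finite_induct) auto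

context
  fixes I :: "'i set" and d :: "'i \<Rightarrow> nat"
  assumes ne: "I \<noteq> {}" and d: "\<And>i. i \<in> I \<Longrightarrow> 1 \<le> d i"
begin

private abbreviation "V \<equiv> prod_sys I d"
private abbreviation "M i \<equiv> matalg (d i)"
private abbreviation comp :: "'i \<Rightarrow> (nat \<Rightarrow> nat \<Rightarrow> 'i \<Rightarrow> nat \<Rightarrow> nat \<Rightarrow> complex) \<Rightarrow> nat \<Rightarrow> nat \<Rightarrow> nat \<Rightarrow> nat \<Rightarrow> complex"
  where "comp i x \<equiv> amp (\<lambda>v. v i) x"

private lemma Mo: "i \<in> I \<Longrightarrow> operator_system (M i)"
  by (rule operator_system_matalg[OF d])

private lemma carrD:
  "v \<in> prod_carr I d \<Longrightarrow> i \<in> I \<Longrightarrow> v i \<in> carr (M i)" "v \<in> prod_carr I d \<Longrightarrow> i \<notin> I \<Longrightarrow> v i = 0"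
  "v \<in> prod_carr I d \<Longrightarrow> \<exists>r. \<forall>i\<in>I. opsys_norm (M i) (v i) \<le> r"
  unfolding prod_carr_def mem_Collect_eq by presburger+

private lemma carrI:
  "(\<And>i. i \<in> I \<Longrightarrow> v i \<in> carr (M i)) \<Longrightarrow> (\<And>i. i \<notin> I \<Longrightarrow> v i = 0) \<Longrightarrow>
    (\<And>i. i \<in> I \<Longrightarrow> opsys_norm (M i) (v i) \<le> r) \<Longrightarrow> v \<in> prod_carr I d"
  unfolding prod_carr_def by auto

private lemma carr_closed:
  shows "0 \<in> prod_carr I d"
    and "v \<in> prod_carr I d \<Longrightarrow> w \<in> prod_carr I d \<Longrightarrow> v + w \<in> prod_carr I d"
    and "v \<in> prod_carr I d \<Longrightarrow> scl V c v \<in> prod_carr I d"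
    and "v \<in> prod_carr I d \<Longrightarrow> adj V v \<in> prod_carr I d"
    and "ounit V \<in> prod_carr I d"
proof -
  show "0 \<in> prod_carr I d"
  proof (rule carrI[where r = 0])
    fix i assume "i \<in> I"
    then interpret M: operator_system "M i" by (rule Mo)
    show "0 i \<in> carr (M i)" "opsys_norm (M i) (0 i) \<le> 0" using M.carr_0 by (simp_all only: zero_fun_apply M.opsys_norm_0)
  qed simp
  show "v + w \<in> prod_carr I d" if v: "v \<in> prod_carr I d" and w: "w \<in> prod_carr I d"
  proof -
    obtain r s where r: "\<forall>i\<in>I. opsys_norm (M i) (v i) \<le> r" and s: "\<forall>i\<in>I. opsys_norm (M i) (w i) \<le> s"
      using carrD(3)[OF v] carrD(3)[OF w] by blast
    show ?thesis
    proof (rule carrI[where r = "r + s"])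
      fix i assume i: "i \<in> I"
      then interpret M: operator_system "M i" by (rule Mo)
      note m = carrD(1)[OF v i] carrD(1)[OF w i]
      have e: "(v + w) i = v i + w i" by (rule plus_fun_apply)
      show "(v + w) i \<in> carr (M i)" unfolding e by (rule M.carr_add[OF m])
      show "opsys_norm (M i) ((v + w) i) \<le> r + s" unfolding e
        using M.opsys_norm_triangle[OF m] bspec[OF r i] bspec[OF s i] by linarith
    qed (simp add: carrD(2)[OF v] carrD(2)[OF w])
  qed
  show "scl V c v \<in> prod_carr I d" if v: "v \<in> prod_carr I d"
  proof -
    obtain r where r: "\<forall>i\<in>I. opsys_norm (M i) (v i) \<le> r" using carrD(3)[OF v] by blast
    have e: "scl V c v i = scl (M i) c (v i)" for i by (simp add: prod_sys_sel)
    show ?thesis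
    proof (rule carrI[where r = "cmod c * r"])
      fix i assume i: "i \<in> I"
      then interpret M: operator_system "M i" by (rule Mo)
      note m = carrD(1)[OF v i]
      show "scl V c v i \<in> carr (M i)" unfolding e by (rule M.carr_scl[OF m])
      show "opsys_norm (M i) (scl V c v i) \<le> cmod c * r" unfolding e M.opsys_norm_scl[OF m]
        by (intro mult_left_mono bspec[OF r i]) simp
    qed (simp add: e carrD(2)[OF v] zero_fun_def)
  qed
  show "adj V v \<in> prod_carr I d" if v: "v \<in> prod_carr I d"
  proof -
    obtain r where r: "\<forall>i\<in>I. opsys_norm (M i) (v i) \<le> r" using carrD(3)[OF v] by blast
    have e: "adj V v i = adj (M i) (v i)" for i by (simp add: prod_sys_sel)
    show ?thesis
    proof (rule carrI[where r = r])
      fix i assume i: "i \<in> I"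
      then interpret M: operator_system "M i" by (rule Mo)
      note m = carrD(1)[OF v i]
      show "adj V v i \<in> carr (M i)" unfolding e by (rule M.adj_closed[OF m])
      show "opsys_norm (M i) (adj V v i) \<le> r" unfolding e
        using M.opsys_norm_adj[OF m] bspec[OF r i] by linarith
    qed (simp add: e carrD(2)[OF v] zero_fun_def)
  qed
  have e: "ounit V i = ounit (M i)" if "i \<in> I" for i using that by (simp add: prod_sys_sel)
  show "ounit V \<in> prod_carr I d"
  proof (rule carrI[where r = 1])
    fix i assume i: "i \<in> I"
    then interpret M: operator_system "M i" by (rule Mo)
    show "ounit V i \<in> carr (M i)" unfolding e[OF i] by (rule M.ounit_closed)
    have "elt 0 0 (scl (M i) (complex_of_real 1) (ounit (M i)) + ounit (M i)) \<in> pos (M i) 1"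
      "elt 0 0 (scl (M i) (complex_of_real 1) (ounit (M i)) - ounit (M i)) \<in> pos (M i) 1"
      using M.pos_munit[of 2 1] M.pos_0[of 1] M.mscl_simps(1)[of 1 1 "munit (M i) 1"]
      unfolding M.munit_1 M.scale_one of_real_1 diff_self elt_simps M.mscl_simps(6) of_real_numeral one_add_one by simp_all
    then show "opsys_norm (M i) (ounit V i) \<le> 1" unfolding e[OF i]
      using M.sa_norm_le_iff[OF M.sa_ounit, of 1] by (simp only: zero_le_one)
  qed (simp add: prod_sys_sel)
qed

private lemma comp_simps:
  "comp i (x + y) = comp i x + comp i y" "comp i (- x) = - comp i x"
  "comp i (mscl V c x) = mscl (M i) c (comp i x)"
  "comp i (madj V n x) = madj (M i) n (comp i x)"
  "comp i (compress V n m A x) = compress (M i) n m A (comp i x)"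
  "i \<in> I \<Longrightarrow> comp i (munit V n) = munit (M i) n"
proof -
  show "comp i (x + y) = comp i x + comp i y" "comp i (- x) = - comp i x" by (simp_all add: amp_def fun_eq_iff)
  show "comp i (mscl V c x) = mscl (M i) c (comp i x)" by (simp add: amp_def mscl_def fun_eq_iff prod_sys_sel)
  show "comp i (madj V n x) = madj (M i) n (comp i x)" by (simp add: amp_def madj_def fun_eq_iff prod_sys_sel)
  show "comp i (compress V n m A x) = compress (M i) n m A (comp i x)"
    by (auto simp: amp_def compress_def fun_eq_iff prod_sys_sel sum_fun_apply)
  show "comp i (munit V n) = munit (M i) n" if "i \<in> I" using that by (auto simp: amp_def munit_def fun_eq_iff prod_sys_sel)
qed

private lemma comp_mats: "i \<in> I \<Longrightarrow> x \<in> mats n (prod_carr I d) \<Longrightarrow> comp i x \<in> mats n (carr (M i))"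
  unfolding mats_def mem_Collect_eq amp_def using carrD(1) by fastforce

private lemma comp_eqI:
  assumes x: "x \<in> mats n (prod_carr I d)" "y \<in> mats n (prod_carr I d)" and e: "\<And>i. i \<in> I \<Longrightarrow> comp i x = comp i y"
  shows "x = y"
proof (intro ext)
  fix a b i p q
  have c: "x a b \<in> prod_carr I d" "y a b \<in> prod_carr I d"
    using x carr_closed(1) unfolding mats_def mem_Collect_eq by metis+
  show "x a b i p q = y a b i p q"
  proof (cases "i \<in> I")
    case True
    from fun_cong[OF fun_cong[OF e[OF True], of a], of b] show ?thesis by (simp add: amp_def)
  qed (simp add: carrD(2)[OF c(1)] carrD(2)[OF c(2)])
qed

private lemma mats_closed:
  "x \<in> mats n (prod_carr I d) \<Longrightarrow> y \<in> mats n (prod_carr I d) \<Longrightarrow> x + y \<in> mats n (prod_carr I d)"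
  "x \<in> mats n (prod_carr I d) \<Longrightarrow> mscl V c x \<in> mats n (prod_carr I d)"
  "x \<in> mats n (prod_carr I d) \<Longrightarrow> madj V n x \<in> mats n (prod_carr I d)"
  "munit V n \<in> mats n (prod_carr I d)"
proof -
  have 0: "scl V c 0 = 0" for c by (simp add: prod_sys_sel(2) fun_eq_iff)
  show "x \<in> mats n (prod_carr I d) \<Longrightarrow> y \<in> mats n (prod_carr I d) \<Longrightarrow> x + y \<in> mats n (prod_carr I d)"
    using carr_closed(2) by (simp add: mats_def)
  show "x \<in> mats n (prod_carr I d) \<Longrightarrow> mscl V c x \<in> mats n (prod_carr I d)"
    using carr_closed(3) 0 by (simp add: mats_def mscl_def)
  show "x \<in> mats n (prod_carr I d) \<Longrightarrow> madj V n x \<in> mats n (prod_carr I d)"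
    using carr_closed(4) by (simp add: mats_def madj_def)
  show "munit V n \<in> mats n (prod_carr I d)"
    using carr_closed(1,5) by (simp add: mats_def munit_def)
qed

private lemma hmats_comp: "x \<in> hmats V n \<longleftrightarrow> x \<in> mats n (prod_carr I d) \<and> (\<forall>i\<in>I. comp i x \<in> hmats (M i) n)"
proof
  assume "x \<in> hmats V n"
  then have x: "x \<in> mats n (prod_carr I d)" "madj V n x = x" by (auto simp: hmats_def prod_sys_sel(1))
  have "comp i x \<in> hmats (M i) n" if i: "i \<in> I" for i
    using comp_mats[OF i x(1)] arg_cong[OF x(2), of "comp i"] unfolding comp_simps hmats_def by simp
  then show "x \<in> mats n (prod_carr I d) \<and> (\<forall>i\<in>I. comp i x \<in> hmats (M i) n)" using x(1) by blast
next
  assume x: "x \<in> mats n (prod_carr I d) \<and> (\<forall>i\<in>I. comp i x \<in> hmats (M i) n)"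
  have "madj V n x = x"
  proof (rule comp_eqI[OF mats_closed(3)[OF conjunct1[OF x]] conjunct1[OF x]])
    fix i assume "i \<in> I"
    then have "comp i x \<in> hmats (M i) n" using x by blast
    then show "comp i (madj V n x) = comp i x" unfolding comp_simps hmats_def by blast
  qed
  then show "x \<in> hmats V n" using x by (simp add: hmats_def prod_sys_sel(1))
qed

lemma operator_system_prod_sys: "operator_system V"
proof -
  interpret vector_space "scl V" by unfold_locales (auto simp: prod_sys_sel(2) fun_eq_iff algebra_simps)
  have pos: "x \<in> pos V n \<longleftrightarrow> x \<in> mats n (prod_carr I d) \<and> (\<forall>i\<in>I. comp i x \<in> pos (M i) n)" for x n
    by (simp add: prod_sys_sel(5))
  have car: "carr V = prod_carr I d" by (rule prod_sys_sel(1))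
  show ?thesis
  proof unfold_locales
    show sub: "subspace (carr V)" unfolding car by (rule subspaceI) (fact carr_closed)+
    show "adj V x \<in> carr V" if "x \<in> carr V" for x using carr_closed(4) that unfolding car .
    show "adj V (adj V x) = x" for x by (simp add: prod_sys_sel)
    show "adj V (x + y) = adj V x + adj V y" for x y by (simp add: prod_sys_sel fun_eq_iff)
    show "adj V (scl V c x) = scl V (cnj c) (adj V x)" for c x by (simp add: prod_sys_sel fun_eq_iff)
    show "ounit V \<in> carr V" unfolding car by (rule carr_closed)
    show "ounit V \<noteq> 0"
    proof
      assume "ounit V = 0"
      obtain i where i: "i \<in> I" using ne by blast
      then interpret M: operator_system "M i" by (rule Mo)
      have "ounit (M i) = 0" using fun_cong[OF \<open>ounit V = 0\<close>, of i] i unfolding prod_sys_sel(4) by (simp only: if_True zero_fun_apply)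
      then show False using M.ounit_nonzero by blast
    qed
    show "adj V (ounit V) = ounit V" by (auto simp: prod_sys_sel fun_eq_iff)
    show "pos V n \<subseteq> hmats V n" for n
    proof
      fix x assume x: "x \<in> pos V n"
      then have "comp i x \<in> hmats (M i) n" if "i \<in> I" for i
        using subsetD[OF operator_system.pos_hmats[OF Mo[OF that]]] that unfolding pos by blast
      then show "x \<in> hmats V n" using x unfolding hmats_comp pos by blast
    qed
    show "a + b \<in> pos V n" if "a \<in> pos V n" "b \<in> pos V n" for a b n
      using that operator_system.pos_add[OF Mo] mats_closed(1) unfolding pos comp_simps by blast
    show "mscl V (complex_of_real r) a \<in> pos V n" if "a \<in> pos V n" "0 \<le> r" for a n r
      using that operator_system.pos_mscl[OF Mo] mats_closed(2) unfolding pos comp_simps by blast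
    show "a = 0" if a: "a \<in> pos V n" "- a \<in> pos V n" for a n
    proof (rule comp_eqI[of _ n])
      show "a \<in> mats n (prod_carr I d)" using a(1) unfolding pos by blast
      show "0 \<in> mats n (prod_carr I d)" using carr_closed(1) by (auto simp: mats_def)
      fix i assume i: "i \<in> I"
      have "comp i a = 0" using a i operator_system.pos_proper[OF Mo[OF i]] unfolding pos comp_simps by blast
      then show "comp i a = comp i 0" by (simp add: amp_def zero_fun_def)
    qed
    show "compress V n m A a \<in> pos V m" if a: "a \<in> pos V n" for a n m A
    proof -
      have am: "a \<in> mats n (carr V)" using a unfolding pos car by blast
      have ac: "a p q \<in> carr V" for p q
        using am subspace_0[OF sub] unfolding mats_def mem_Collect_eq by metis
      have "compress V n m A a \<in> mats m (carr V)"
        unfolding mats_def compress_def by (auto intro!: subspace_sum[OF sub] subspace_scale[OF sub] ac)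
      then show ?thesis using a operator_system.pos_compress[OF Mo] unfolding pos comp_simps car by blast
    qed
    show "\<exists>r>0. mscl V (complex_of_real r) (munit V n) + a \<in> pos V n" if a: "a \<in> hmats V n" for a n
    proof -
      have am: "a \<in> mats n (prod_carr I d)" and ah: "\<And>i. i \<in> I \<Longrightarrow> comp i a \<in> hmats (M i) n"
        using a unfolding hmats_comp by blast+
      have ac: "a p q \<in> prod_carr I d" for p q
        using am carr_closed(1) unfolding mats_def mem_Collect_eq by metis
      have "\<forall>p. \<forall>q. \<exists>r. \<forall>i\<in>I. opsys_norm (M i) (a p q i) \<le> r" using carrD(3)[OF ac] by blast
      then obtain \<rho> where \<rho>: "\<forall>p q. \<forall>i\<in>I. opsys_norm (M i) (a p q i) \<le> \<rho> p q" by metis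
      \<comment> \<open>The entries of a are bounded uniformly in the component, so one radius
        serves all components at once.\<close>
      define R where "R = 1 + (\<Sum>p<n. \<Sum>q<n. \<bar>\<rho> p q\<bar>)"
      have R: "0 < R" unfolding R_def by (intro add_pos_nonneg sum_nonneg) auto
      have "comp i (mscl V (complex_of_real R) (munit V n) + a) \<in> pos (M i) n" if i: "i \<in> I" for i
      proof -
        interpret M: operator_system "M i" by (rule Mo[OF i])
        have "mnorm (M i) n (comp i a) \<le> (\<Sum>p<n. \<Sum>q<n. opsys_norm (M i) (comp i a p q))"
          by (rule M.mnorm_le_sum_entries[OF comp_mats[OF i am]])
        also have "\<dots> \<le> (\<Sum>p<n. \<Sum>q<n. \<bar>\<rho> p q\<bar>)"
          unfolding amp_def by (intro sum_mono order_trans[OF _ abs_ge_self]) (use \<rho> i in blast)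
        also have "\<dots> \<le> R" unfolding R_def by linarith
        finally have "mscl (M i) (complex_of_real R) (munit (M i) n) + comp i a \<in> pos (M i) n"
          using M.hermitian_mnorm_le_iff[OF ah[OF i], of R] R by (simp only: less_imp_le)
        then show ?thesis unfolding comp_simps(1,3) comp_simps(6)[OF i] .
      qed
      then show ?thesis using R mats_closed(1)[OF mats_closed(2)[OF mats_closed(4)] am] unfolding pos by blast
    qed
    show "a \<in> pos V n" if a: "a \<in> hmats V n" and r: "\<And>r. r > 0 \<Longrightarrow> mscl V (complex_of_real r) (munit V n) + a \<in> pos V n" for a n
      unfolding pos
    proof (intro conjI ballI)
      show "a \<in> mats n (prod_carr I d)" using a unfolding hmats_comp by blast
      fix i assume i: "i \<in> I"
      show "comp i a \<in> pos (M i) n"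
      proof (rule operator_system.archimedean[OF Mo[OF i]])
        show "comp i a \<in> hmats (M i) n" using a i unfolding hmats_comp by blast
        fix r :: real assume "r > 0"
        then have "comp i (mscl V (complex_of_real r) (munit V n) + a) \<in> pos (M i) n" using that(2) i unfolding pos by blast
        then show "mscl (M i) (complex_of_real r) (munit (M i) n) + comp i a \<in> pos (M i) n"
          unfolding comp_simps(1,3) comp_simps(6)[OF i] .
      qed
    qed
  qed
qed

lemma ucp_prod_sys_component:
  assumes i: "i \<in> I" shows "ucp V (d i) (\<lambda>v. v i)"
  unfolding ucp_def
proof (intro conjI)
  show "1 \<le> d i" by (rule d[OF i])
  have "linear_into (scl V) (carr V) (scl (M i)) (carr (M i)) (\<lambda>v. v i)"
    unfolding linear_into_def prod_sys_sel(1,2) using carrD(1)[OF _ i] by auto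
  then show "cp_map V (M i) (\<lambda>v. v i)"
    unfolding cp_map_def using i by (simp add: prod_sys_sel(5) del: matalg_sel)
  show "ounit V i = ounit (M i)" using i by (simp add: prod_sys_sel)
qed

lemma prod_sys_norm_le:
  assumes v: "v \<in> carr V" and r: "0 \<le> r" and b: "\<And>i. i \<in> I \<Longrightarrow> opsys_norm (M i) (v i) \<le> r"
  shows "opsys_norm V v \<le> r"
proof -
  interpret V: operator_system V by (rule operator_system_prod_sys)
  have m: "elt 0 0 v \<in> mats 1 (carr V)" by (rule V.mats_elt[OF _ _ v]) simp_all
  have "norm_block V 1 r (elt 0 0 v) \<in> pos V (2 * 1)"
    unfolding prod_sys_sel(5) mem_Collect_eq
  proof (intro conjI ballI)
    show "norm_block V 1 r (elt 0 0 v) \<in> mats (2 * 1) (prod_carr I d)"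
      using norm_block_mats[OF V.operator_system_axioms m] unfolding prod_sys_sel(1) .
    fix i assume i: "i \<in> I"
    interpret M: operator_system "M i" by (rule Mo[OF i])
    note u = ucp_prod_sys_component[OF i]
    have vi: "v i \<in> carr (M i)" using carrD(1)[OF _ i] v unfolding prod_sys_sel(1) by blast
    have mi: "elt 0 0 (v i) \<in> mats 1 (carr (M i))" by (rule M.mats_elt[OF _ _ vi]) simp_all
    have "amp (\<lambda>v. v i) (norm_block V 1 r (elt 0 0 v)) = norm_block (M i) 1 r (amp (\<lambda>v. v i) (elt 0 0 v))"
      by (rule amp_norm_block[OF V.operator_system_axioms M.operator_system_axioms ucpD(2,3)[OF u] m])
    also have "amp (\<lambda>v. v i) (elt 0 0 v) = elt 0 0 (v i)" by (rule amp_elt) (rule zero_fun_apply)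
    finally show "amp (\<lambda>v. v i) (norm_block V 1 r (elt 0 0 v)) \<in> pos (M i) (2 * 1)"
      using M.mnorm_norm_block(2)[OF mi r] b[OF i] unfolding opsys_norm_elt by (simp only:)
  qed
  then show ?thesis using V.mnorm_norm_block(2)[OF m r] unfolding opsys_norm_elt by blast
qed

text \<open>Unital completely positive maps are contractive, so the values of the family at x form a
  bounded element of the product; positivity in the product is componentwise, so a family that
  jointly detects positivity embeds \<open>X\<close>.\<close>

lemma embedding_prod_sys:
  assumes X: "operator_system X" and F: "\<And>i. i \<in> I \<Longrightarrow> ucp X (d i) (F i)"
    and sep: "\<And>n x. x \<in> hmats X n \<Longrightarrow> (\<And>i. i \<in> I \<Longrightarrow> amp (F i) x \<in> pos (M i) n) \<Longrightarrow> x \<in> pos X n"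
  shows "unital_complete_order_embedding X V (\<lambda>x i. if i \<in> I then F i x else 0)"
proof (rule embeddingI[OF X operator_system_prod_sys])
  interpret X: operator_system X by fact
  let ?h = "\<lambda>x i. if i \<in> I then F i x else 0"
  note lin = cp_map_linear[OF ucpD(2)[OF F]]
  have F0: "F i 0 = 0" if i: "i \<in> I" for i by (rule cp_map_0[OF X ucpD(2)[OF F[OF i]]])
  have hc: "?h x \<in> prod_carr I d" if x: "x \<in> carr X" for x
  proof (rule carrI[where r = "opsys_norm X x"])
    fix i assume i: "i \<in> I"
    show "?h x i \<in> carr (M i)" using lin(1)[OF i x] i by (simp only: if_True)
    have e: "elt 0 0 x \<in> mats 1 (carr X)" by (rule X.mats_elt[OF _ _ x]) simp_all
    have "mnorm (M i) 1 (amp (F i) (elt 0 0 x)) \<le> mnorm X 1 (elt 0 0 x)" by (rule ucp_mnorm_le[OF X F[OF i] e])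
    then have "opsys_norm (M i) (F i x) \<le> opsys_norm X x" unfolding amp_elt[of "F i", OF F0[OF i]] opsys_norm_elt .
    then show "opsys_norm (M i) (?h x i) \<le> opsys_norm X x" using i by (simp only: if_True)
  qed (simp only: if_False)
  have hi: "amp (\<lambda>v. v i) (amp ?h x) = amp (F i) x" if "i \<in> I" for i x using that by (simp add: amp_def)
  have h0: "?h 0 = 0"
  proof
    show "?h 0 i = 0 i" for i using F0[of i] by (cases "i \<in> I") (simp_all only: if_True if_False zero_fun_apply)
  qed
  have hm: "amp ?h x \<in> mats n (prod_carr I d)" if x: "x \<in> mats n (carr X)" for x n
    using x hc h0 unfolding mats_def mem_Collect_eq amp_def by presburger
  show "cp_map X V ?h"
    unfolding cp_map_def linear_into_def prod_sys_sel(1,5)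
  proof (intro conjI ballI allI)
    show "?h ` carr X \<subseteq> prod_carr I d" using hc by (rule image_subsetI)
    show "?h (x + y) = ?h x + ?h y" if "x \<in> carr X" "y \<in> carr X" for x y
      using lin(2)[OF _ that] by (intro ext) simp
    show "?h (scl X c x) = scl V c (?h x)" if "x \<in> carr X" for c x
      using lin(3)[OF _ that] by (intro ext) (simp add: prod_sys_sel)
    fix n z assume z: "z \<in> pos X n"
    have "amp ?h z \<in> mats n (prod_carr I d)" by (rule hm[OF X.pos_mats[OF z]])
    moreover have "amp (\<lambda>v. v i) (amp ?h z) \<in> pos (M i) n" if i: "i \<in> I" for i
      unfolding hi[OF i] by (rule lin(4)[OF i z])
    ultimately show "amp ?h z \<in> {x \<in> mats n (prod_carr I d). \<forall>i\<in>I. comp i x \<in> pos (M i) n}" by blast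
  qed
  show "?h (ounit X) = ounit V" using ucpD(3)[OF F] by (simp add: prod_sys_sel(4) fun_eq_iff del: matalg_sel)
  fix n x assume x: "x \<in> hmats X n" and p: "amp ?h x \<in> pos V n"
  show "x \<in> pos X n"
  proof (rule sep[OF x])
    fix i assume i: "i \<in> I"
    have "comp i (amp ?h x) \<in> pos (M i) n" using p i unfolding prod_sys_sel(5) by blast
    then show "amp (F i) x \<in> pos (M i) n" unfolding hi[OF i] .
  qed
qed

end

section \<open>Transfer of Lip-norms\<close>

lemma ennreal_less_add: "x < top \<Longrightarrow> 0 < e \<Longrightarrow> x < x + ennreal e"
  by (cases x) (auto simp: ennreal_less_iff simp flip: ennreal_plus)

definition lip_push :: "'a::ab_group_add opsys \<Rightarrow> ('a \<Rightarrow> ennreal) \<Rightarrow> 'b::ab_group_add opsys \<Rightarrow> ('a \<Rightarrow> 'b) \<Rightarrow> real \<Rightarrow> 'b \<Rightarrow> ennreal" where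
  "lip_push X L Y \<phi> \<epsilon> y = (INF x\<in>sa X. L x + ennreal (opsys_norm Y (y - \<phi> x) / \<epsilon>))"

text \<open>The bounded coordinates with respect to a finite family u encode that \<open>Y\<close>
  is finite-dimensional; they let finitely many evaluations control the metric on its
  states.\<close>

locale lip_transfer = lip_normed_system X L + Y: operator_system Y
  for X :: "'a::ab_group_add opsys" and L and Y :: "'b::ab_group_add opsys" +
  fixes \<phi> :: "'a \<Rightarrow> 'b" and \<epsilon> :: real and A :: "'c set" and u :: "'c \<Rightarrow> 'b" and coord :: "'b \<Rightarrow> 'c \<Rightarrow> complex"
  assumes \<phi>: "cp_map X Y \<phi>" "\<phi> (ounit X) = ounit Y"
    and \<phi>_contr: "\<And>x. x \<in> carr X \<Longrightarrow> opsys_norm Y (\<phi> x) \<le> opsys_norm X x"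
    and \<epsilon>: "0 < \<epsilon>"
    and A: "finite A" "\<And>a. a \<in> A \<Longrightarrow> u a \<in> carr Y"
    and coord: "\<And>y. y \<in> carr Y \<Longrightarrow> y = (\<Sum>a\<in>A. scl Y (coord y a) (u a))"
      "\<And>y a. y \<in> carr Y \<Longrightarrow> a \<in> A \<Longrightarrow> cmod (coord y a) \<le> opsys_norm Y y"
begin

abbreviation "P \<equiv> lip_push X L Y \<phi> \<epsilon>"

lemma \<phi>_simps:
  "x \<in> carr X \<Longrightarrow> \<phi> x \<in> carr Y"
  "x \<in> carr X \<Longrightarrow> y \<in> carr X \<Longrightarrow> \<phi> (x + y) = \<phi> x + \<phi> y"
  "x \<in> carr X \<Longrightarrow> \<phi> (scl X c x) = scl Y c (\<phi> x)"
  "x \<in> carr X \<Longrightarrow> y \<in> carr X \<Longrightarrow> \<phi> (x - y) = \<phi> x - \<phi> y"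
  "x \<in> sa X \<Longrightarrow> \<phi> x \<in> sa Y" "\<phi> 0 = 0"
proof -
  note lin = cp_map_linear[OF \<phi>(1)]
  show "x \<in> carr X \<Longrightarrow> \<phi> x \<in> carr Y" for x by (rule lin(1))
  show "x \<in> carr X \<Longrightarrow> y \<in> carr X \<Longrightarrow> \<phi> (x + y) = \<phi> x + \<phi> y" for x y by (rule lin(2))
  show "x \<in> carr X \<Longrightarrow> \<phi> (scl X c x) = scl Y c (\<phi> x)" for x c by (rule lin(3))
  show "\<phi> 0 = 0" by (rule cp_map_0[OF operator_system_axioms \<phi>(1)])
  show "\<phi> (x - y) = \<phi> x - \<phi> y" if x: "x \<in> carr X" and y: "y \<in> carr X" for x y
  proof -
    have "\<phi> ((x - y) + y) = \<phi> (x - y) + \<phi> y" by (rule lin(2)[OF carr_diff[OF x y] y])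
    then show ?thesis by (simp add: eq_diff_eq)
  qed
  show "\<phi> x \<in> sa Y" if x: "x \<in> sa X" for x
    using lin(1)[OF saD(1)[OF x]] cp_map_adj[OF operator_system_axioms Y.operator_system_axioms \<phi>(1) saD(1)[OF x]] saD(2)[OF x]
    by (simp add: sa_def)
qed

lemma P_le: "x \<in> sa X \<Longrightarrow> P y \<le> L x + ennreal (opsys_norm Y (y - \<phi> x) / \<epsilon>)"
  unfolding lip_push_def by (rule INF_lower)

lemma P_less: "P y < t \<Longrightarrow> \<exists>x\<in>sa X. L x + ennreal (opsys_norm Y (y - \<phi> x) / \<epsilon>) < t"
  unfolding lip_push_def INF_less_iff .

lemma P_add:
  assumes a: "a \<in> sa Y" and b: "b \<in> sa Y" shows "P (a + b) \<le> P a + P b"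
proof (rule ennreal_le_epsilon)
  fix e :: real assume "P a + P b < top" and e: "0 < e"
  then have "P a < top" "P b < top" using ennreal_add_eq_top[of "P a" "P b"] by (auto simp: less_top)
  then have l: "P a < P a + ennreal (e / 2)" "P b < P b + ennreal (e / 2)" using e by (auto intro: ennreal_less_add)
  obtain x where x: "x \<in> sa X" "L x + ennreal (opsys_norm Y (a - \<phi> x) / \<epsilon>) < P a + ennreal (e / 2)" using P_less[OF l(1)] by blast
  obtain z where z: "z \<in> sa X" "L z + ennreal (opsys_norm Y (b - \<phi> z) / \<epsilon>) < P b + ennreal (e / 2)" using P_less[OF l(2)] by blast
  note xc = saD(1)[OF x(1)] and zc = saD(1)[OF z(1)]
  have m: "a - \<phi> x \<in> carr Y" "b - \<phi> z \<in> carr Y"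
    by (intro Y.carr_diff \<phi>_simps(1) xc zc saD(1)[OF a] saD(1)[OF b])+
  have s: "a + b - \<phi> (x + z) = (a - \<phi> x) + (b - \<phi> z)" unfolding \<phi>_simps(2)[OF xc zc] by simp
  have "opsys_norm Y (a + b - \<phi> (x + z)) / \<epsilon> \<le> opsys_norm Y (a - \<phi> x) / \<epsilon> + opsys_norm Y (b - \<phi> z) / \<epsilon>"
    unfolding add_divide_distrib[symmetric] s by (rule divide_right_mono[OF Y.opsys_norm_triangle[OF m] less_imp_le[OF \<epsilon>]])
  then have n: "ennreal (opsys_norm Y (a + b - \<phi> (x + z)) / \<epsilon>) \<le>
    ennreal (opsys_norm Y (a - \<phi> x) / \<epsilon>) + ennreal (opsys_norm Y (b - \<phi> z) / \<epsilon>)"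
    unfolding ennreal_plus[OF divide_nonneg_pos[OF Y.opsys_norm_nonneg[OF m(1)] \<epsilon>] divide_nonneg_pos[OF Y.opsys_norm_nonneg[OF m(2)] \<epsilon>], symmetric]
    by (rule ennreal_leI)
  have "P (a + b) \<le> L (x + z) + ennreal (opsys_norm Y (a + b - \<phi> (x + z)) / \<epsilon>)" by (rule P_le[OF sa_add[OF x(1) z(1)]])
  also have "\<dots> \<le> (L x + L z) + (ennreal (opsys_norm Y (a - \<phi> x) / \<epsilon>) + ennreal (opsys_norm Y (b - \<phi> z) / \<epsilon>))"
    by (intro add_mono n L_add x(1) z(1))
  also have "\<dots> = (L x + ennreal (opsys_norm Y (a - \<phi> x) / \<epsilon>)) + (L z + ennreal (opsys_norm Y (b - \<phi> z) / \<epsilon>))"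
    by (simp only: ac_simps)
  also have "\<dots> \<le> (P a + ennreal (e / 2)) + (P b + ennreal (e / 2))" using x(2) z(2) by (intro add_mono less_imp_le)
  also have "\<dots> = P a + P b + (ennreal (e / 2) + ennreal (e / 2))" by (simp only: ac_simps)
  also have "ennreal (e / 2) + ennreal (e / 2) = ennreal e" using e by (subst ennreal_plus[symmetric]) auto
  finally show "P (a + b) \<le> P a + P b + ennreal e" .
qed

text \<open>The scalar factor stands on the left so that the bound can be checked at each x under
  the infimum; r and 1 / r together then give homogeneity.\<close>

lemma P_scl_le:
  assumes y: "y \<in> sa Y" and r: "r \<noteq> 0"
  shows "ennreal \<bar>1 / r\<bar> * P (scl Y (complex_of_real r) y) \<le> P y"
  unfolding lip_push_def[of X L Y \<phi> \<epsilon> y]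
proof (rule INF_greatest)
  fix x assume x: "x \<in> sa X"
  note xc = saD(1)[OF x]
  let ?Z = "L x + ennreal (opsys_norm Y (y - \<phi> x) / \<epsilon>)"
  have "scl Y (complex_of_real r) y - \<phi> (scl X (complex_of_real r) x) = scl Y (complex_of_real r) (y - \<phi> x)"
    unfolding \<phi>_simps(3)[OF xc] Y.scale_right_diff_distrib ..
  then have n: "opsys_norm Y (scl Y (complex_of_real r) y - \<phi> (scl X (complex_of_real r) x)) / \<epsilon> = \<bar>r\<bar> * (opsys_norm Y (y - \<phi> x) / \<epsilon>)"
    using Y.opsys_norm_scl[OF Y.carr_diff[OF saD(1)[OF y] \<phi>_simps(1)[OF xc]], of "complex_of_real r"] by simp
  have "P (scl Y (complex_of_real r) y) \<le> L (scl X (complex_of_real r) x) +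
      ennreal (opsys_norm Y (scl Y (complex_of_real r) y - \<phi> (scl X (complex_of_real r) x)) / \<epsilon>)"
    by (rule P_le[OF sa_scl[OF x]])
  also have "\<dots> = ennreal \<bar>r\<bar> * ?Z"
    unfolding n L_scl[OF x] distrib_left ennreal_mult'[OF abs_ge_zero] ..
  finally have "ennreal \<bar>1 / r\<bar> * P (scl Y (complex_of_real r) y) \<le> ennreal \<bar>1 / r\<bar> * (ennreal \<bar>r\<bar> * ?Z)"
    by (rule mult_left_mono) simp
  also have "\<dots> = ennreal (\<bar>1 / r\<bar> * \<bar>r\<bar>) * ?Z" unfolding ennreal_mult'[OF abs_ge_zero] by (simp only: mult.assoc)
  also have "\<dots> = ?Z" using r by simp
  finally show "ennreal \<bar>1 / r\<bar> * P (scl Y (complex_of_real r) y) \<le> ?Z" .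
qed

lemma P_unit: "P (scl Y (complex_of_real r) (ounit Y)) = 0"
proof -
  have "\<phi> (scl X (complex_of_real r) (ounit X)) = scl Y (complex_of_real r) (ounit Y)"
    unfolding \<phi>_simps(3)[OF ounit_closed] \<phi>(2) ..
  then show ?thesis using P_le[OF sa_scl[OF sa_ounit], of "scl Y (complex_of_real r) (ounit Y)" r] L_unit by simp
qed

lemma P_scl:
  assumes y: "y \<in> sa Y" shows "P (scl Y (complex_of_real r) y) = ennreal \<bar>r\<bar> * P y"
proof (cases "r = 0")
  case True
  then show ?thesis using P_unit[of 0] by simp
next
  case r: False
  have i: "ennreal \<bar>r\<bar> * (ennreal \<bar>1 / r\<bar> * z) = z" for z
    using r by (simp add: mult.assoc[symmetric] ennreal_mult'[symmetric])
  show ?thesis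
  proof (rule antisym)
    have "ennreal \<bar>r\<bar> * (ennreal \<bar>1 / r\<bar> * P (scl Y (complex_of_real r) y)) \<le> ennreal \<bar>r\<bar> * P y"
      by (rule mult_left_mono[OF P_scl_le[OF y r]]) simp
    then show "P (scl Y (complex_of_real r) y) \<le> ennreal \<bar>r\<bar> * P y" unfolding i .
    have "ennreal \<bar>1 / (1 / r)\<bar> * P (scl Y (complex_of_real (1 / r)) (scl Y (complex_of_real r) y)) \<le> P (scl Y (complex_of_real r) y)"
      by (rule P_scl_le[OF Y.sa_scl[OF y]]) (use r in simp)
    then show "ennreal \<bar>r\<bar> * P y \<le> P (scl Y (complex_of_real r) y)" using r by simp
  qed
qed

lemma P_norm_le: "P y \<le> ennreal (opsys_norm Y y / \<epsilon>)"
  using P_le[OF sa_0, of y] L_unit[of 0] by (simp add: \<phi>_simps(6))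

text \<open>The infimum in \<open>P y \<le> 1\<close> need not be attained. Any t > 1 leaves room
  for a witness x, and division by t returns x to the Lip-ball.\<close>

lemma P_ball_approx:
  assumes y: "y \<in> lip_ball Y P" and t: "1 < t"
  shows "\<exists>x\<in>lip_ball X L. opsys_norm Y (scl Y (complex_of_real (1 / t)) y - \<phi> x) \<le> \<epsilon>"
proof -
  have "P y \<le> 1" using y by (simp add: lip_ball_def)
  also have "1 < ennreal t" using t ennreal_less_iff[of 1 t] by simp
  finally obtain x where x: "x \<in> sa X" "L x + ennreal (opsys_norm Y (y - \<phi> x) / \<epsilon>) < ennreal t" using P_less by blast
  note xc = saD(1)[OF x(1)]
  have yc: "y \<in> carr Y" using y by (auto simp: lip_ball_def sa_def)
  have "L x \<le> ennreal t"
    by (rule order_trans[OF add_increasing2[OF zero_le order_refl] less_imp_le[OF x(2)]])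
  then have "ennreal \<bar>1 / t\<bar> * L x \<le> ennreal \<bar>1 / t\<bar> * ennreal t" by (rule mult_left_mono) simp
  also have "\<dots> = 1" using t by (simp add: ennreal_mult'[symmetric])
  finally have b: "scl X (complex_of_real (1 / t)) x \<in> lip_ball X L"
    using sa_scl[OF x(1), of "1 / t"] L_scl[OF x(1), of "1 / t"] by (simp add: lip_ball_def)
  have "ennreal (opsys_norm Y (y - \<phi> x) / \<epsilon>) \<le> ennreal t"
    by (rule order_trans[OF add_increasing[OF zero_le order_refl] less_imp_le[OF x(2)]])
  then have n: "opsys_norm Y (y - \<phi> x) \<le> t * \<epsilon>" using t \<epsilon> by (simp add: divide_le_eq)
  have "scl Y (complex_of_real (1 / t)) y - \<phi> (scl X (complex_of_real (1 / t)) x) = scl Y (complex_of_real (1 / t)) (y - \<phi> x)"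
    unfolding \<phi>_simps(3)[OF xc] Y.scale_right_diff_distrib ..
  then have "opsys_norm Y (scl Y (complex_of_real (1 / t)) y - \<phi> (scl X (complex_of_real (1 / t)) x)) = 1 / t * opsys_norm Y (y - \<phi> x)"
    using Y.opsys_norm_scl[OF Y.carr_diff[OF yc \<phi>_simps(1)[OF xc]], of "complex_of_real (1 / t)"] t by (simp del: of_real_divide)
  also have "\<dots> \<le> 1 / t * (t * \<epsilon>)" using t by (intro mult_left_mono n) simp
  also have "\<dots> = \<epsilon>" using t by simp
  finally show ?thesis using b by blast
qed

text \<open>Take t = 2 in \<open>P_ball_approx\<close>: half of y is within \<epsilon> of the image
  of an element of the Lip-ball, which is itself within R of a scalar.\<close>

lemma P_radius:
  "\<exists>C>0. \<forall>y\<in>lip_ball Y P. \<exists>s::real. opsys_norm Y (y - scl Y (complex_of_real s) (ounit Y)) \<le> C"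
proof -
  obtain R where R: "0 < R" "\<forall>a\<in>lip_ball X L. \<exists>s::real. opsys_norm X (a - scl X (complex_of_real s) (ounit X)) \<le> R"
    using lip_radius by blast
  have "\<exists>s::real. opsys_norm Y (y - scl Y (complex_of_real s) (ounit Y)) \<le> 2 * (\<epsilon> + R)" if y: "y \<in> lip_ball Y P" for y
  proof -
    obtain x where x: "x \<in> lip_ball X L" "opsys_norm Y (scl Y (complex_of_real (1 / 2)) y - \<phi> x) \<le> \<epsilon>"
      using P_ball_approx[OF y, of 2] by auto
    obtain s :: real where s: "opsys_norm X (x - scl X (complex_of_real s) (ounit X)) \<le> R" using R(2) x(1) by blast
    have yc: "y \<in> carr Y" using y by (auto simp: lip_ball_def sa_def)
    note xc = saD(1)[OF lip_ballD(1)[OF x(1)]]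
    have sc: "scl X (complex_of_real s) (ounit X) \<in> carr X" by (intro carr_intros)
    let ?a = "scl Y (complex_of_real (1 / 2)) y - \<phi> x" and ?b = "\<phi> (x - scl X (complex_of_real s) (ounit X))"
    have m: "?a \<in> carr Y" "?b \<in> carr Y" by (intro Y.carr_diff Y.carr_scl \<phi>_simps(1) carr_diff xc yc sc)+
    have b: "?b = \<phi> x - scl Y (complex_of_real s) (ounit Y)"
      unfolding \<phi>_simps(4)[OF xc sc] \<phi>_simps(3)[OF ounit_closed] \<phi>(2) ..
    have "y - scl Y (complex_of_real (2 * s)) (ounit Y) = scl Y 2 (?a + ?b)"
      unfolding b by (simp add: Y.scale_right_diff_distrib)
    then have "opsys_norm Y (y - scl Y (complex_of_real (2 * s)) (ounit Y)) = 2 * opsys_norm Y (?a + ?b)"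
      using Y.opsys_norm_scl[OF Y.carr_add[OF m], of 2] by (simp only: norm_numeral)
    also have "\<dots> \<le> 2 * (\<epsilon> + R)"
      by (intro mult_left_mono order_trans[OF Y.opsys_norm_triangle[OF m]] add_mono x(2)
          order_trans[OF \<phi>_contr[OF carr_diff[OF xc sc]] s]) simp
    finally show ?thesis by blast
  qed
  moreover have "0 < 2 * (\<epsilon> + R)" using \<epsilon> R(1) by simp
  ultimately show ?thesis by blast
qed

section \<open>The induced metric on the state space\<close>

lemma state_shift:
  assumes \<sigma>: "\<sigma> \<in> states Y" and \<omega>: "\<omega> \<in> states Y" and y: "y \<in> carr Y"
  shows "\<sigma> y - \<omega> y = \<sigma> (y - scl Y c (ounit Y)) - \<omega> (y - scl Y c (ounit Y))"
  using Y.state_diff[OF \<sigma> y Y.carr_scl[OF Y.ounit_closed]] Y.state_diff[OF \<omega> y Y.carr_scl[OF Y.ounit_closed]]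
    statesD(2,4)[OF \<sigma>] statesD(2,4)[OF \<omega>] Y.ounit_closed by simp

text \<open>Differences of states do not see scalars, so y may be centred, and centred elements of
  the Lip-ball have coordinates at most C. Finitely many evaluations thus dominate the metric, which
  gives both finiteness and weak* continuity.\<close>

lemma rho_coord:
  "\<exists>C>0. \<forall>\<sigma>\<in>states Y. \<forall>\<omega>\<in>states Y. lip_rho Y P \<sigma> \<omega> \<le> ennreal (C * (\<Sum>a\<in>A. cmod (\<sigma> (u a) - \<omega> (u a))))"
proof -
  obtain C where C: "0 < C" "\<forall>y\<in>lip_ball Y P. \<exists>s::real. opsys_norm Y (y - scl Y (complex_of_real s) (ounit Y)) \<le> C"
    using P_radius by blast
  have "cmod (\<sigma> y - \<omega> y) \<le> C * (\<Sum>a\<in>A. cmod (\<sigma> (u a) - \<omega> (u a)))"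
    if \<sigma>: "\<sigma> \<in> states Y" and \<omega>: "\<omega> \<in> states Y" and y: "y \<in> lip_ball Y P" for \<sigma> \<omega> y
  proof -
    obtain s :: real where s: "opsys_norm Y (y - scl Y (complex_of_real s) (ounit Y)) \<le> C" using C(2) y by blast
    have yc: "y \<in> carr Y" using y by (auto simp: lip_ball_def sa_def)
    define z where "z = y - scl Y (complex_of_real s) (ounit Y)"
    have z: "z \<in> carr Y" unfolding z_def by (intro Y.carr_diff Y.carr_scl Y.ounit_closed yc)
    have st: "\<tau> z = (\<Sum>a\<in>A. coord z a * \<tau> (u a))" if \<tau>: "\<tau> \<in> states Y" for \<tau>
    proof -
      have sm: "\<tau> (\<Sum>a\<in>B. scl Y (coord z a) (u a)) = (\<Sum>a\<in>B. coord z a * \<tau> (u a))" if "B \<subseteq> A" for B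
        using finite_subset[OF that A(1)] that
      proof (induction B rule: finite_induct)
        case empty
        show ?case using Y.state_0[OF \<tau>] by simp
      next
        case (insert b B)
        have "\<tau> (scl Y (coord z b) (u b) + (\<Sum>a\<in>B. scl Y (coord z a) (u a))) =
            coord z b * \<tau> (u b) + \<tau> (\<Sum>a\<in>B. scl Y (coord z a) (u a))"
          using insert(4) A(2) statesD(4)[OF \<tau>, of "u b"]
          by (subst statesD(3)[OF \<tau>]) (auto intro!: Y.carr_scl Y.carr_sum)
        then show ?case using insert by simp
      qed
      show ?thesis by (subst coord(1)[OF z]) (rule sm[OF subset_refl])
    qed
    have "\<sigma> y - \<omega> y = \<sigma> z - \<omega> z" unfolding z_def by (rule state_shift[OF \<sigma> \<omega> yc])
    also have "\<dots> = (\<Sum>a\<in>A. coord z a * (\<sigma> (u a) - \<omega> (u a)))"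
      unfolding st[OF \<sigma>] st[OF \<omega>] by (simp only: right_diff_distrib sum_subtractf)
    finally have "cmod (\<sigma> y - \<omega> y) \<le> (\<Sum>a\<in>A. cmod (coord z a * (\<sigma> (u a) - \<omega> (u a))))"
      by (simp only: norm_sum)
    also have "\<dots> \<le> (\<Sum>a\<in>A. C * cmod (\<sigma> (u a) - \<omega> (u a)))"
      unfolding norm_mult using coord(2)[OF z] s by (intro sum_mono mult_right_mono) (auto simp: z_def intro: order_trans)
    finally show ?thesis by (simp only: sum_distrib_left)
  qed
  then show ?thesis using C(1) unfolding lip_rho_def
    by (intro exI[of _ C] conjI ballI SUP_least ennreal_leI) blast+
qed

lemma rho_finite: "\<sigma> \<in> states Y \<Longrightarrow> \<omega> \<in> states Y \<Longrightarrow> lip_rho Y P \<sigma> \<omega> < top"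
  using rho_coord ennreal_less_top order.strict_trans1 by blast

lemma rho_bound:
  assumes "\<sigma> \<in> states Y" "\<omega> \<in> states Y" "y \<in> lip_ball Y P"
  shows "cmod (\<sigma> y - \<omega> y) \<le> enn2real (lip_rho Y P \<sigma> \<omega>)"
proof -
  have "ennreal (cmod (\<sigma> y - \<omega> y)) \<le> lip_rho Y P \<sigma> \<omega>"
    unfolding lip_rho_def by (rule SUP_upper[OF assms(3)])
  then have "enn2real (ennreal (cmod (\<sigma> y - \<omega> y))) \<le> enn2real (lip_rho Y P \<sigma> \<omega>)"
    by (rule enn2real_mono[OF _ rho_finite[OF assms(1,2)]])
  then show ?thesis by simp
qed

text \<open>\<open>P\<close> is at most the norm divided by \<epsilon>, so every self-adjoint
  element has a positive multiple in the Lip-ball.\<close>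

lemma rho_separates:
  assumes \<sigma>: "\<sigma> \<in> states Y" and \<omega>: "\<omega> \<in> states Y" and 0: "enn2real (lip_rho Y P \<sigma> \<omega>) = 0"
  shows "\<sigma> = \<omega>"
proof
  fix z
  have sa: "\<sigma> y = \<omega> y" if y: "y \<in> sa Y" for y
  proof -
    note yc = saD(1)[OF y]
    define r where "r = \<epsilon> / (opsys_norm Y y + 1)"
    have n: "0 \<le> opsys_norm Y y" by (rule Y.opsys_norm_nonneg[OF yc])
    have r: "0 < r" unfolding r_def using \<epsilon> n by simp
    have "opsys_norm Y (scl Y (complex_of_real r) y) / \<epsilon> = opsys_norm Y y / (opsys_norm Y y + 1)"
      unfolding Y.opsys_norm_scl[OF yc] norm_of_real using r \<epsilon> n by (simp add: r_def)
    also have "\<dots> \<le> 1" using n by simp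
    finally have "ennreal (opsys_norm Y (scl Y (complex_of_real r) y) / \<epsilon>) \<le> ennreal 1" by (rule ennreal_leI)
    then have "scl Y (complex_of_real r) y \<in> lip_ball Y P"
      using P_norm_le[of "scl Y (complex_of_real r) y"] Y.sa_scl[OF y, of r] by (auto simp: lip_ball_def intro: order_trans)
    from rho_bound[OF \<sigma> \<omega> this] have "\<sigma> (scl Y (complex_of_real r) y) = \<omega> (scl Y (complex_of_real r) y)" unfolding 0 by simp
    then show ?thesis unfolding statesD(4)[OF \<sigma> yc] statesD(4)[OF \<omega> yc] using r by simp
  qed
  show "\<sigma> z = \<omega> z"
  proof (cases "z \<in> carr Y")
    case True
    obtain v w where vw: "v \<in> sa Y" "w \<in> sa Y" "z = v + scl Y \<i> w" using Y.real_imag_parts[OF True] .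
    note c = saD(1)[OF vw(1)] saD(1)[OF vw(2)]
    show ?thesis
      unfolding vw(3) statesD(3)[OF \<sigma> c(1) Y.carr_scl[OF c(2)]] statesD(3)[OF \<omega> c(1) Y.carr_scl[OF c(2)]]
        statesD(4)[OF \<sigma> c(2)] statesD(4)[OF \<omega> c(2)] sa[OF vw(1)] sa[OF vw(2)] ..
  next
    case False
    then show ?thesis using statesD(1)[OF \<sigma>] statesD(1)[OF \<omega>] by (simp add: extensional_def)
  qed
qed

lemma metric: "Metric_space (states Y) (\<lambda>\<sigma> \<omega>. enn2real (lip_rho Y P \<sigma> \<omega>))"
proof
  show "0 \<le> enn2real (lip_rho Y P \<sigma> \<omega>)" for \<sigma> \<omega> by (rule enn2real_nonneg)
  show "enn2real (lip_rho Y P \<sigma> \<omega>) = enn2real (lip_rho Y P \<omega> \<sigma>)" for \<sigma> \<omega>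
    by (simp only: lip_rho_def norm_minus_commute)
  show "enn2real (lip_rho Y P \<sigma> \<omega>) = 0 \<longleftrightarrow> \<sigma> = \<omega>" if "\<sigma> \<in> states Y" "\<omega> \<in> states Y" for \<sigma> \<omega>
  proof
    assume "\<sigma> = \<omega>"
    then have "lip_rho Y P \<sigma> \<omega> \<le> 0" unfolding lip_rho_def by (intro SUP_least) simp
    then show "enn2real (lip_rho Y P \<sigma> \<omega>) = 0" by simp
  qed (rule rho_separates[OF that])
  show "enn2real (lip_rho Y P \<sigma> \<tau>) \<le> enn2real (lip_rho Y P \<sigma> \<omega>) + enn2real (lip_rho Y P \<omega> \<tau>)"
    if \<sigma>: "\<sigma> \<in> states Y" and \<omega>: "\<omega> \<in> states Y" and \<tau>: "\<tau> \<in> states Y" for \<sigma> \<omega> \<tau>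
  proof -
    have "lip_rho Y P \<sigma> \<tau> \<le> ennreal (enn2real (lip_rho Y P \<sigma> \<omega>) + enn2real (lip_rho Y P \<omega> \<tau>))"
      unfolding lip_rho_def[of Y P \<sigma> \<tau>]
    proof (intro SUP_least ennreal_leI)
      fix y assume y: "y \<in> lip_ball Y P"
      have "cmod (\<sigma> y - \<tau> y) \<le> cmod (\<sigma> y - \<omega> y) + cmod (\<omega> y - \<tau> y)"
        using norm_triangle_ineq[of "\<sigma> y - \<omega> y" "\<omega> y - \<tau> y"] by simp
      then show "cmod (\<sigma> y - \<tau> y) \<le> enn2real (lip_rho Y P \<sigma> \<omega>) + enn2real (lip_rho Y P \<omega> \<tau>)"
        using rho_bound[OF \<sigma> \<omega> y] rho_bound[OF \<omega> \<tau> y] by linarith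
    qed
    then have "enn2real (lip_rho Y P \<sigma> \<tau>) \<le> enn2real (ennreal (enn2real (lip_rho Y P \<sigma> \<omega>) + enn2real (lip_rho Y P \<omega> \<tau>)))"
      by (rule enn2real_mono) simp
    then show ?thesis by (simp only: enn2real_ennreal[OF add_nonneg_nonneg[OF enn2real_nonneg enn2real_nonneg]])
  qed
qed

sublocale T: Metric_space "states Y" "\<lambda>\<sigma> \<omega>. enn2real (lip_rho Y P \<sigma> \<omega>)" by (rule metric)

text \<open>It suffices that the identity is continuous from the compact weak* topology.\<close>

lemma topology: "T.mtopology = weak_star Y"
proof -
  have ts: "topspace (weak_star Y) = states Y"
    using statesD(1)[of _ Y] by (auto simp: weak_star_def PiE_def)
  have "continuous_map (weak_star Y) T.mtopology id"
    unfolding T.continuous_map_to_metric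
  proof (intro ballI allI impI)
    fix \<sigma> and e :: real assume "\<sigma> \<in> topspace (weak_star Y)" and e: "0 < e"
    then have \<sigma>: "\<sigma> \<in> states Y" unfolding ts by simp
    obtain C where C: "0 < C" "\<forall>\<sigma>\<in>states Y. \<forall>\<omega>\<in>states Y. lip_rho Y P \<sigma> \<omega> \<le> ennreal (C * (\<Sum>a\<in>A. cmod (\<sigma> (u a) - \<omega> (u a))))"
      using rho_coord by blast
    define D where "D \<omega> = (\<Sum>a\<in>A. cmod (\<sigma> (u a) - \<omega> (u a)))" for \<omega>
    have proj: "continuous_map (weak_star Y) euclidean (\<lambda>\<omega>. \<omega> x)" if "x \<in> carr Y" for x
      unfolding weak_star_def using continuous_map_product_projection[of x "carr Y" "\<lambda>_. euclidean"] that
      by (intro continuous_map_from_subtopology) simp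
    have cD: "continuous_map (weak_star Y) euclidean D"
      unfolding D_def by (intro continuous_map_sum A(1) continuous_map_norm continuous_map_diff proj A(2)) simp_all
    define U where "U = {\<omega> \<in> topspace (weak_star Y). D \<omega> \<in> {..<e / C}}"
    have "openin (weak_star Y) U" unfolding U_def by (rule openin_continuous_map_preimage[OF cD]) simp
    moreover have "\<sigma> \<in> U" using \<sigma> e C(1) by (simp add: U_def ts D_def)
    moreover have "id \<omega> \<in> T.mball (id \<sigma>) e" if \<omega>: "\<omega> \<in> U" for \<omega>
    proof -
      have \<omega>s: "\<omega> \<in> states Y" and d: "D \<omega> < e / C" using \<omega> by (auto simp: U_def ts)
      have "lip_rho Y P \<sigma> \<omega> \<le> ennreal (C * D \<omega>)" using C(2) \<sigma> \<omega>s by (simp add: D_def)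
      then have "enn2real (lip_rho Y P \<sigma> \<omega>) \<le> enn2real (ennreal (C * D \<omega>))" by (rule enn2real_mono) simp
      also have "\<dots> = C * D \<omega>" using C(1) by (simp add: D_def sum_nonneg)
      also have "\<dots> < e" using d C(1) by (simp add: less_divide_eq mult.commute)
      finally show ?thesis using \<sigma> \<omega>s by (simp add: T.in_mball)
    qed
    ultimately show "\<exists>U. openin (weak_star Y) U \<and> \<sigma> \<in> U \<and> (\<forall>y\<in>U. id y \<in> T.mball (id \<sigma>) e)" by blast
  qed
  then have "homeomorphic_map (weak_star Y) T.mtopology id"
    by (rule continuous_imp_homeomorphic_map[OF _ Y.compact_weak_star T.Hausdorff_space_mtopology]) (simp_all add: ts)
  then show ?thesis unfolding homeomorphic_map_id .
qed

theorem lip_norm_push: "lip_norm Y P"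
  unfolding lip_norm_def
  using P_add P_scl P_unit rho_finite metric topology by (auto simp: infinity_ennreal_def)

text \<open>From \<open>X\<close> to \<open>Y\<close> nothing beyond \<gamma> is lost, as
  \<open>P (\<phi> x) \<le> L x\<close>. In the other direction the witness in the infimum that
  defines \<open>P\<close> costs one \<epsilon>, and rescaling y so that this witness lies in the
  Lip-ball costs another.\<close>

theorem hausdorff_push:
  assumes V: "operator_system V" and h: "unital_complete_order_embedding X V h" and k: "unital_complete_order_embedding Y V k"
    and \<gamma>: "\<And>x. x \<in> lip_ball X L \<Longrightarrow> opsys_norm V (h x - k (\<phi> x)) \<le> \<gamma>" "0 \<le> \<gamma>"
  shows "hausdorff V (h ` lip_ball X L) (k ` lip_ball Y P) \<le> ennreal (\<gamma> + 2 * \<epsilon>)"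
  unfolding hausdorff_def
proof (intro max.boundedI SUP_least)
  interpret V: operator_system V by fact
  note hl = cp_map_linear[OF embedding_linear(1)[OF h]] and kl = cp_map_linear[OF embedding_linear(1)[OF k]]
  fix w assume "w \<in> h ` lip_ball X L"
  then obtain x where x: "x \<in> lip_ball X L" "w = h x" by blast
  have "P (\<phi> x) \<le> L x" using P_le[OF lip_ballD(1)[OF x(1)], of "\<phi> x"] by simp
  then have "\<phi> x \<in> lip_ball Y P" using lip_ballD[OF x(1)] \<phi>_simps(5) by (auto simp: lip_ball_def)
  then have "k (\<phi> x) \<in> k ` lip_ball Y P" by blast
  moreover have "ennreal (opsys_norm V (w - k (\<phi> x))) \<le> ennreal (\<gamma> + 2 * \<epsilon>)"
    unfolding x(2) using \<gamma>(1)[OF x(1)] \<epsilon> by (intro ennreal_leI) linarith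
  ultimately show "(INF b\<in>k ` lip_ball Y P. ennreal (opsys_norm V (w - b))) \<le> ennreal (\<gamma> + 2 * \<epsilon>)" by (rule INF_lower2)
next
  interpret V: operator_system V by fact
  note hl = cp_map_linear[OF embedding_linear(1)[OF h]] and kl = cp_map_linear[OF embedding_linear(1)[OF k]]
  fix w assume "w \<in> k ` lip_ball Y P"
  then obtain y where y: "y \<in> lip_ball Y P" "w = k y" by blast
  have yc: "y \<in> carr Y" using y by (auto simp: lip_ball_def sa_def)
  define N where "N = opsys_norm Y y"
  have N: "0 \<le> N" unfolding N_def by (rule Y.opsys_norm_nonneg[OF yc])
  \<comment> \<open>So close to 1 that y and y / t differ by at most \<epsilon> in norm.\<close>
  define t where "t = 1 + \<epsilon> / (N + 1)"
  have t: "1 < t" using \<epsilon> N by (simp add: t_def)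
  obtain x where x: "x \<in> lip_ball X L" "opsys_norm Y (scl Y (complex_of_real (1 / t)) y - \<phi> x) \<le> \<epsilon>"
    using P_ball_approx[OF y(1) t] by blast
  note xc = saD(1)[OF lip_ballD(1)[OF x(1)]]
  let ?y = "scl Y (complex_of_real (1 / t)) y"
  have m: "y - ?y \<in> carr Y" "?y - \<phi> x \<in> carr Y" by (intro Y.carr_diff Y.carr_scl \<phi>_simps(1) xc yc)+
  have "y - ?y = scl Y (complex_of_real (1 - 1 / t)) y" unfolding of_real_diff Y.scale_left_diff_distrib by simp
  moreover have "(1 - 1 / t) * N \<le> \<epsilon>"
  proof -
    have "1 - 1 / t = (t - 1) / t" using t by (simp add: field_simps)
    also have "\<dots> \<le> (t - 1) / 1" using t by (intro divide_left_mono) auto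
    finally have "1 - 1 / t \<le> t - 1" by simp
    then have "(1 - 1 / t) * N \<le> (t - 1) * (N + 1)" using t N by (intro mult_mono) auto
    also have "\<dots> = \<epsilon>" using N by (simp add: t_def)
    finally show ?thesis .
  qed
  moreover have "0 \<le> 1 - 1 / t" using t by simp
  ultimately have "opsys_norm Y (y - ?y) \<le> \<epsilon>"
    using Y.opsys_norm_scl[OF yc, of "complex_of_real (1 - 1 / t)"] by (simp add: N_def del: of_real_diff of_real_divide)
  moreover have "y - \<phi> x = (y - ?y) + (?y - \<phi> x)" by simp
  then have "opsys_norm Y (y - \<phi> x) \<le> opsys_norm Y (y - ?y) + opsys_norm Y (?y - \<phi> x)"
    using Y.opsys_norm_triangle[OF m] by (simp only:)
  ultimately have n: "opsys_norm Y (y - \<phi> x) \<le> 2 * \<epsilon>" using x(2) by linarith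
  have px: "\<phi> x \<in> carr Y" by (rule \<phi>_simps(1)[OF xc])
  have d: "y - \<phi> x \<in> carr Y" by (rule Y.carr_diff[OF yc px])
  have "k y = k ((y - \<phi> x) + \<phi> x)" by simp
  also have "\<dots> = k (y - \<phi> x) + k (\<phi> x)" by (rule kl(2)[OF d px])
  finally have ky: "h x - k y = (h x - k (\<phi> x)) - k (y - \<phi> x)" by simp
  have "opsys_norm V (h x - k y) \<le> opsys_norm V (h x - k (\<phi> x)) + opsys_norm V (k (y - \<phi> x))"
    unfolding ky by (rule V.opsys_norm_diff[OF V.carr_diff[OF hl(1)[OF xc] kl(1)[OF px]] kl(1)[OF d]])
  also have "opsys_norm V (k (y - \<phi> x)) = opsys_norm Y (y - \<phi> x)"
    using k d by (simp add: unital_complete_order_embedding_def)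
  finally have "ennreal (opsys_norm V (h x - w)) \<le> ennreal (\<gamma> + 2 * \<epsilon>)"
    unfolding y(2) using \<gamma>(1)[OF x(1)] n by (intro ennreal_leI) linarith
  moreover have "h x \<in> h ` lip_ball X L" using x(1) by blast
  ultimately show "(INF a\<in>h ` lip_ball X L. ennreal (opsys_norm V (a - w))) \<le> ennreal (\<gamma> + 2 * \<epsilon>)" by (intro INF_lower2)
qed

end

section \<open>Approximation by matrix algebras\<close>

lemma matalg_entry_le:
  assumes m: "1 \<le> m" and y: "y \<in> carr (matalg m)" and pq: "p < m" "q < m"
  shows "cmod (y p q) \<le> opsys_norm (matalg m) y"
proof -
  interpret M: operator_system "matalg m" by (rule operator_system_matalg[OF m])
  have e: "elt 0 0 y \<in> mats 1 (carr (matalg m))" by (rule M.mats_elt[OF _ _ y]) simp_all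
  then have e': "elt 0 0 y \<in> mats 1 (mats m UNIV)" by simp
  let ?d = "\<lambda>r i p'. if i = 0 then if p' = r then 1 else 0 else (0::complex)"
  have "bnd 1 m (elt 0 0 y) (mnorm (matalg m) 1 (elt 0 0 y))"
    using mnorm_matalg_le_iff[OF m e' M.mnorm_nonneg[OF e]] by blast
  then have "2 * cmod (sesq 1 m (elt 0 0 y) (?d p) (?d q)) \<le> opsys_norm (matalg m) y * (sqn 1 m (?d p) + sqn 1 m (?d q))"
    unfolding bnd_def opsys_norm_elt by blast
  moreover have "sesq 1 m (elt 0 0 y) (?d p) (?d q) = elt 0 0 y 0 0 p q"
    by (rule sesq_delta) (use pq in simp_all)
  moreover have "sqn 1 m (?d r) = 1" if r: "r < m" for r
  proof -
    have "sqn 1 m (?d r) = (\<Sum>i<(1::nat). \<Sum>p'<m. if p' = r then if i = 0 then 1 else 0 else 0)"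
      unfolding sqn_def by (intro sum.cong refl) auto
    then show ?thesis using r by simp
  qed
  ultimately show ?thesis using pq by (simp add: elt_def)
qed

text \<open>Applied to a matrix algebra, this is the implication from (iii) to (ii).\<close>

lemma operator_subsystem_refl:
  assumes "operator_system X" shows "operator_subsystem X X"
proof -
  interpret operator_system X by fact
  have "(\<lambda>n. pos X n \<inter> mats n (carr X)) = pos X" using pos_mats by (intro ext) blast
  then have "X = subsys X (carr X)" unfolding subsys_def by (intro opsys.equality) simp_all
  then show ?thesis unfolding operator_subsystem_def
    using subspace_carr ounit_closed adj_closed by (intro exI[of _ "carr X"]) simp
qed

lemma ucp_id: "1 \<le> m \<Longrightarrow> ucp (matalg m) m (\<lambda>x. x)"
  unfolding ucp_def cp_map_def linear_into_def amp_def by (intro conjI) auto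

theorem approx_of_one_exact:
  fixes X :: "'a::ab_group_add opsys"
  assumes XL: "lip_normed X L" and ex: "one_exact X" and \<epsilon>: "0 < \<epsilon>"
  shows "\<exists>n\<ge>1. \<exists>L'. lip_normed (matalg n) L' \<and> dist_op X L (matalg n) L' \<le> ennreal \<epsilon>"
proof -
  have X: "operator_system X" using XL by (simp add: lip_normed_def)
  interpret lip_normed_system X L
    by (rule lip_normed_system.intro[OF X lip_normed_system_axioms.intro]) (use XL in \<open>simp add: lip_normed_def\<close>)
  obtain R where R: "0 < R" "\<forall>a\<in>lip_ball X L. \<exists>s::real. opsys_norm X (a - scl X (complex_of_real s) (ounit X)) \<le> R"
    using lip_radius by blast
  obtain F where F: "finite F" "F \<subseteq> lip_ball X L"
    "\<forall>a\<in>lip_ball X L. \<exists>b\<in>F. \<exists>s::real. opsys_norm X (a - (b + scl X (complex_of_real s) (ounit X))) \<le> \<epsilon> / 8"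
    using lip_net[of "\<epsilon> / 8"] \<epsilon> by auto
  \<comment> \<open>Factorization errors are 2 \<delta> times the norm, and centred net points have
    norm at most R; the product is \<epsilon> / 4.\<close>
  define \<delta> where "\<delta> = \<epsilon> / (8 * R)"
  have \<delta>: "0 < \<delta>" "2 * \<delta> * R = \<epsilon> / 4" using \<epsilon> R(1) by (simp_all add: \<delta>_def)
  define E where "E = span (insert (ounit X) F)"
  have Fc: "F \<subseteq> carr X" using F(2) by (auto simp: lip_ball_def sa_def)
  have E: "subspace E" "E \<subseteq> carr X" "ounit X \<in> E" "F \<subseteq> E"
  proof -
    show "subspace E" unfolding E_def by (rule subspace_span)
    show "E \<subseteq> carr X" unfolding E_def by (rule span_minimal[OF _ subspace_carr]) (use Fc ounit_closed in blast)
    show "ounit X \<in> E" "F \<subseteq> E" unfolding E_def using span_superset by blast+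
  qed
  obtain m \<phi> where \<phi>: "ucp X m \<phi>" and nb: "\<forall>n. \<forall>x\<in>mats n E. mnorm X n x \<le> (1 + 2 * \<delta>) * mnorm (matalg m) n (amp \<phi> x)"
    using one_exact_ucp[OF X ex, of "insert (ounit X) F" "2 * \<delta>"] F(1) E(2,3) \<delta>(1) unfolding E_def by auto
  have m: "1 \<le> m" by (rule ucpD(1)[OF \<phi>])
  have Mo: "operator_system (matalg m)" by (rule ucpD(4)[OF \<phi>])
  interpret M: operator_system "matalg m" by (rule Mo)
  \<comment> \<open>All unital completely positive f with all their approximate factors g. By
    \<open>approx_factor\<close> every f occurs, so the first components together detect positivity
    in \<open>X\<close>.\<close>
  define I where "I = {(k, f, g). ucp X k f \<and> ucp (matalg m) k g \<and>
    (\<forall>e\<in>E \<inter> sa X. opsys_norm (matalg k) (f e - g (\<phi> e)) \<le> 2 * \<delta> * opsys_norm X e)}"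
  define d where "d i = fst i" for i :: "nat \<times> ('a \<Rightarrow> nat \<Rightarrow> nat \<Rightarrow> complex) \<times> ((nat \<Rightarrow> nat \<Rightarrow> complex) \<Rightarrow> nat \<Rightarrow> nat \<Rightarrow> complex)"
  define ff where "ff i = fst (snd i)" for i :: "nat \<times> ('a \<Rightarrow> nat \<Rightarrow> nat \<Rightarrow> complex) \<times> ((nat \<Rightarrow> nat \<Rightarrow> complex) \<Rightarrow> nat \<Rightarrow> nat \<Rightarrow> complex)"
  define gg where "gg i = snd (snd i)" for i :: "nat \<times> ('a \<Rightarrow> nat \<Rightarrow> nat \<Rightarrow> complex) \<times> ((nat \<Rightarrow> nat \<Rightarrow> complex) \<Rightarrow> nat \<Rightarrow> nat \<Rightarrow> complex)"
  have ID: "ucp X (d i) (ff i)" "ucp (matalg m) (d i) (gg i)"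
    "\<And>e. e \<in> E \<Longrightarrow> e \<in> sa X \<Longrightarrow> opsys_norm (matalg (d i)) (ff i e - gg i (\<phi> e)) \<le> 2 * \<delta> * opsys_norm X e" if "i \<in> I" for i
    using that unfolding I_def d_def ff_def gg_def by (auto simp: case_prod_unfold)
  \<comment> \<open>The pair of \<phi> and the identity: its second component alone makes k a
    complete order embedding of the matrix algebra.\<close>
  define i0 where "i0 = (m, \<phi>, \<lambda>x :: nat \<Rightarrow> nat \<Rightarrow> complex. x)"
  have i0: "i0 \<in> I"
  proof -
    have "0 \<le> 2 * \<delta> * opsys_norm X e" if "e \<in> E \<inter> sa X" for e
      using \<delta>(1) opsys_norm_nonneg[of e] E(2) that by (intro mult_nonneg_nonneg) auto
    then have "opsys_norm (matalg m) (\<phi> e - \<phi> e) \<le> 2 * \<delta> * opsys_norm X e" if "e \<in> E \<inter> sa X" for e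
      unfolding diff_self M.opsys_norm_0 using that by blast
    then show ?thesis unfolding i0_def I_def mem_Collect_eq prod.case using \<phi> ucp_id[OF m] by blast
  qed
  then have ne: "I \<noteq> {}" by blast
  have d: "1 \<le> d i" if "i \<in> I" for i by (rule ucpD(1)[OF ID(1)[OF that]])
  define V where "V = prod_sys I d"
  have Vo: "operator_system V" unfolding V_def by (rule operator_system_prod_sys[OF ne d])
  interpret V: operator_system V by (rule Vo)
  define h where "h = (\<lambda>x i. if i \<in> I then ff i x else 0)"
  define k where "k = (\<lambda>x i. if i \<in> I then gg i x else 0)"
  have h: "unital_complete_order_embedding X V h"
    unfolding V_def h_def
  proof (rule embedding_prod_sys[OF ne d X ID(1)])
    fix n x assume x: "x \<in> hmats X n" and p: "\<And>i. i \<in> I \<Longrightarrow> amp (ff i) x \<in> pos (matalg (d i)) n"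
    show "x \<in> pos X n"
    proof (rule ccontr)
      assume "x \<notin> pos X n"
      then obtain f where f: "ucp X n f" "amp f x \<notin> pos (matalg n) n" using separating_ucp[OF X x] by blast
      obtain g where "ucp (matalg m) n g" "\<forall>e\<in>E \<inter> sa X. opsys_norm (matalg n) (f e - g (\<phi> e)) \<le> 2 * \<delta> * opsys_norm X e"
        using approx_factor[OF X \<phi> E(1-3) \<delta>(1) f(1) nb] by blast
      then have "(n, f, g) \<in> I" using f(1) unfolding I_def by blast
      then show False using p[of "(n, f, g)"] f(2) by (simp add: d_def ff_def)
    qed
  qed
  have k: "unital_complete_order_embedding (matalg m) V k"
    unfolding V_def k_def
  proof (rule embedding_prod_sys[OF ne d Mo ID(2)])
    fix n x assume "x \<in> hmats (matalg m) n" and p: "\<And>i. i \<in> I \<Longrightarrow> amp (gg i) x \<in> pos (matalg (d i)) n"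
    show "x \<in> pos (matalg m) n" using p[OF i0] by (simp add: i0_def d_def gg_def amp_def)
  qed
  have near: "opsys_norm V (h x - k (\<phi> x)) \<le> \<epsilon> / 2" if x: "x \<in> lip_ball X L" for x
  proof -
    note xc = saD(1)[OF lip_ballD(1)[OF x]]
    obtain b and s :: real where b: "b \<in> F" "opsys_norm X (x - (b + scl X (complex_of_real s) (ounit X))) \<le> \<epsilon> / 8" using F(3) x by blast
    have b': "b \<in> lip_ball X L" using b(1) F(2) by blast
    obtain s' :: real where s': "opsys_norm X (b - scl X (complex_of_real s') (ounit X)) \<le> R" using R(2) b' by blast
    \<comment> \<open>x is split into the net error q, the centred net point c in \<open>E\<close>
      and a scalar. The scalar cancels because all maps are unital; q costs \<epsilon> / 8 on each
      side by contractivity, and c costs \<epsilon> / 4 by the factorization bound.\<close>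
    define c where "c = b - scl X (complex_of_real s') (ounit X)"
    define q where "q = x - (b + scl X (complex_of_real s) (ounit X))"
    define t where "t = complex_of_real (s + s')"
    have cE: "c \<in> E" unfolding c_def using b(1) E(3,4) by (intro subspace_diff[OF E(1)] subspace_scale[OF E(1)]) blast+
    have csa: "c \<in> sa X" unfolding c_def by (intro sa_diff sa_scl sa_ounit lip_ballD(1)[OF b'])
    note cc = saD(1)[OF csa]
    have qc: "q \<in> carr X" unfolding q_def
      by (intro carr_diff carr_add carr_scl ounit_closed xc saD(1)[OF lip_ballD(1)[OF b']])
    have uc: "scl X t (ounit X) \<in> carr X" by (intro carr_scl ounit_closed)
    have xq: "x = (q + c) + scl X t (ounit X)" by (simp add: q_def c_def t_def scale_left_distrib)
    show ?thesis unfolding V_def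
    proof (rule prod_sys_norm_le[OF ne d])
      show "h x - k (\<phi> x) \<in> carr (prod_sys I d)" unfolding V_def[symmetric]
        by (rule V.carr_diff[OF cp_map_linear(1)[OF embedding_linear(1)[OF h] xc]
              cp_map_linear(1)[OF embedding_linear(1)[OF k] cp_map_linear(1)[OF ucpD(2)[OF \<phi>] xc]]])
      show "0 \<le> \<epsilon> / 2" using \<epsilon> by simp
      fix i assume i: "i \<in> I"
      interpret K: operator_system "matalg (d i)" by (rule ucpD(4)[OF ID(1)[OF i]])
      note fl = cp_map_linear[OF ucpD(2)[OF ID(1)[OF i]]] and gl = cp_map_linear[OF ucpD(2)[OF ID(2)[OF i]]]
        and pl = cp_map_linear[OF ucpD(2)[OF \<phi>]]
      have fx: "ff i x = (ff i q + ff i c) + scl (matalg (d i)) t (ounit (matalg (d i)))"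
        unfolding xq fl(2)[OF carr_add[OF qc cc] uc] fl(2)[OF qc cc] fl(3)[OF ounit_closed] ucpD(3)[OF ID(1)[OF i]] ..
      have gx: "gg i (\<phi> x) = (gg i (\<phi> q) + gg i (\<phi> c)) + scl (matalg (d i)) t (ounit (matalg (d i)))"
        unfolding xq pl(2)[OF carr_add[OF qc cc] uc] pl(2)[OF qc cc] pl(3)[OF ounit_closed] ucpD(3)[OF \<phi>]
          gl(2)[OF M.carr_add[OF pl(1)[OF qc] pl(1)[OF cc]] M.carr_scl[OF M.ounit_closed]] gl(2)[OF pl(1)[OF qc] pl(1)[OF cc]]
          gl(3)[OF M.ounit_closed] ucpD(3)[OF ID(2)[OF i]] ..
      have hk: "(h x - k (\<phi> x)) i = (ff i q - gg i (\<phi> q)) + (ff i c - gg i (\<phi> c))"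
      proof -
        have "(h x - k (\<phi> x)) i = ff i x - gg i (\<phi> x)"
          unfolding minus_apply h_def k_def using i by (simp only: if_True)
        also have "\<dots> = (ff i q - gg i (\<phi> q)) + (ff i c - gg i (\<phi> c))"
          unfolding fx gx add_diff_cancel_right by (rule add_diff_add)
        finally show ?thesis .
      qed
      have n1: "opsys_norm (matalg (d i)) (ff i q - gg i (\<phi> q)) \<le> \<epsilon> / 8 + \<epsilon> / 8"
      proof (rule order_trans[OF K.opsys_norm_diff[OF fl(1)[OF qc] gl(1)[OF pl(1)[OF qc]]]], rule add_mono)
        have "opsys_norm X q \<le> \<epsilon> / 8" unfolding q_def by (rule b(2))
        then show "opsys_norm (matalg (d i)) (ff i q) \<le> \<epsilon> / 8" "opsys_norm (matalg (d i)) (gg i (\<phi> q)) \<le> \<epsilon> / 8"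
          using ucp_opsys_norm_le[OF X ID(1)[OF i] qc] ucp_opsys_norm_le[OF Mo ID(2)[OF i] pl(1)[OF qc]]
            ucp_opsys_norm_le[OF X \<phi> qc] by linarith+
      qed
      have n2: "opsys_norm (matalg (d i)) (ff i c - gg i (\<phi> c)) \<le> \<epsilon> / 4"
      proof -
        have "2 * \<delta> * opsys_norm X c \<le> 2 * \<delta> * R" using \<delta>(1) s' unfolding c_def by (intro mult_left_mono) auto
        then show ?thesis using ID(3)[OF i cE csa] unfolding \<delta>(2) by linarith
      qed
      show "opsys_norm (matalg (d i)) ((h x - k (\<phi> x)) i) \<le> \<epsilon> / 2"
        unfolding hk using K.opsys_norm_triangle[OF K.carr_diff[OF fl(1)[OF qc] gl(1)[OF pl(1)[OF qc]]]
            K.carr_diff[OF fl(1)[OF cc] gl(1)[OF pl(1)[OF cc]]]] n1 n2 by linarith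
    qed
  qed
  define A where "A = {..<m} \<times> {..<m}"
  define u :: "nat \<times> nat \<Rightarrow> nat \<Rightarrow> nat \<Rightarrow> complex" where "u a = elt (fst a) (snd a) 1" for a
  define co :: "(nat \<Rightarrow> nat \<Rightarrow> complex) \<Rightarrow> nat \<times> nat \<Rightarrow> complex" where "co y a = y (fst a) (snd a)" for y a
  \<comment> \<open>The matrix units with the entries as coordinates. The parameter \<epsilon> / 4
    makes the cost 2 (\<epsilon> / 4) of the transfer equal to the half of \<epsilon> left over by
    the distance of x and \<phi> x.\<close>
  interpret T: lip_transfer X L "matalg m" \<phi> "\<epsilon> / 4" A u co
  proof
    show "cp_map X (matalg m) \<phi>" "\<phi> (ounit X) = ounit (matalg m)" by (rule ucpD(2)[OF \<phi>], rule ucpD(3)[OF \<phi>])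
    show "opsys_norm (matalg m) (\<phi> x) \<le> opsys_norm X x" if "x \<in> carr X" for x by (rule ucp_opsys_norm_le[OF X \<phi> that])
    show "0 < \<epsilon> / 4" using \<epsilon> by simp
    show "finite A" by (simp add: A_def)
    show "u a \<in> carr (matalg m)" if "a \<in> A" for a using that by (auto simp: u_def A_def elt_def mats_def)
    show "cmod (co y a) \<le> opsys_norm (matalg m) y" if "y \<in> carr (matalg m)" "a \<in> A" for y a
      unfolding co_def by (rule matalg_entry_le[OF m that(1)]) (use that(2) in \<open>auto simp: A_def\<close>)
    show "y = (\<Sum>a\<in>A. scl (matalg m) (co y a) (u a))" if y: "y \<in> carr (matalg m)" for y
    proof -
      have "scl (matalg m) c (elt p q 1) = elt p q c" for p q and c :: complex by (auto simp: elt_def fun_eq_iff)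
      then have "(\<Sum>a\<in>A. scl (matalg m) (co y a) (u a)) = (\<Sum>a\<in>A. elt (fst a) (snd a) (y (fst a) (snd a)))"
        unfolding co_def u_def by (simp only:)
      also have "\<dots> = (\<Sum>p<m. \<Sum>q<m. elt p q (y p q))" unfolding A_def sum.cartesian_product case_prod_unfold ..
      also have "\<dots> = y" using mats_elt_sum[of y m UNIV] y by simp
      finally show ?thesis by simp
    qed
  qed
  have "dist_op X L (matalg m) T.P \<le> hausdorff V (h ` lip_ball X L) (k ` lip_ball (matalg m) T.P)"
    by (rule dist_op_le[OF X Mo Vo h k])
  also have "\<dots> \<le> ennreal (\<epsilon> / 2 + 2 * (\<epsilon> / 4))"
    by (rule T.hausdorff_push[OF Vo h k near]) (use \<epsilon> in simp_all)
  also have "\<epsilon> / 2 + 2 * (\<epsilon> / 4) = \<epsilon>" by simp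
  finally have "dist_op X L (matalg m) T.P \<le> ennreal \<epsilon>" .
  moreover have "lip_normed (matalg m) T.P" unfolding lip_normed_def using Mo T.lip_norm_push by blast
  ultimately show ?thesis using m by blast
qed

theorem theorem5p3:
  fixes X :: "'a::ab_group_add opsys" and L :: "'a \<Rightarrow> ennreal"
  assumes "lip_normed X L"
  shows "(one_exact X \<longleftrightarrow>
           (\<forall>\<epsilon>::real. \<epsilon> > 0 \<longrightarrow> (\<exists>n\<ge>1. \<exists>Y L'. operator_subsystem Y (matalg n) \<and>
              lip_normed Y L' \<and> dist_op X L Y L' \<le> ennreal \<epsilon>))) \<and>
         (one_exact X \<longleftrightarrow>
           (\<forall>\<epsilon>::real. \<epsilon> > 0 \<longrightarrow> (\<exists>n\<ge>1. \<exists>L'.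
              lip_normed (matalg n) L' \<and> dist_op X L (matalg n) L' \<le> ennreal \<epsilon>)))"
proof -
  let ?ii = "\<forall>\<epsilon>::real. \<epsilon> > 0 \<longrightarrow> (\<exists>n\<ge>1. \<exists>Y L'. operator_subsystem Y (matalg n) \<and>
    lip_normed Y L' \<and> dist_op X L Y L' \<le> ennreal \<epsilon>)"
  let ?iii = "\<forall>\<epsilon>::real. \<epsilon> > 0 \<longrightarrow> (\<exists>n\<ge>1. \<exists>L'. lip_normed (matalg n) L' \<and> dist_op X L (matalg n) L' \<le> ennreal \<epsilon>)"
  have 1: "?iii" if "one_exact X" using approx_of_one_exact[OF assms that] by blast
  have 2: "?ii" if "?iii" using that operator_subsystem_refl[OF operator_system_matalg] by blast
  have 3: "one_exact X" if ii: "?ii" by (rule one_exact_of_approx[OF assms]) (use ii in blast)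
  show ?thesis using 1 2 3 by blast
qed

end
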